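(* Let $\lambda\in\mathbb C\setminus\{0\}$ and let $F(\lambda;\hbar)=\sum_{g\ge0}\hbar^{2g-2}F_g(\lambda)$ be the free energy of the Weber curve $y^2-\frac{x^2}{4}+\lambda=0$. Then, as formal series in $\hbar$, $$F(\lambda+\hbar;\hbar)-2F(\lambda;\hbar)+F(\lambda-\hbar;\hbar)=\frac{\partial^2F_0}{\partial\lambda^2}\;\big(=\log\lambda\big).$$
   Context: $F(\lambda\pm\hbar;\hbar)$ denotes the formal Laurent series in $\hbar$ obtained by Taylor expansion in the shift, $\sum_{n\ge0}\frac{(\pm\hbar)^n}{n!}\partial_\lambda^nF(\lambda;\hbar)$. Branches of $\sqrt\lambda$ and $\log\lambda$ are fixed. The Weber curve is parametrized by $x(z)=\sqrt\lambda\,(z+1/z)$, $y(z)=\frac{\sqrt\lambda}{2}(z-1/z)$, $z\in\mathbb P^1$. The ramification points of $x$ are $R=\{1,-1\}$ and the conjugate map is $\overline z=1/z$. The correlation functions $W_{g,n}(z_1,\dots,z_n)$ ($g\ge0,n\ge1$; $W_{g,n}\equiv0$ for $g<0$) are the meromorphic multidifferentials defined by $W_{0,1}(z_0)=y(z_0)dx(z_0)$, $W_{0,2}(z_0,z_1)=B(z_0,z_1)=\frac{dz_0dz_1}{(z_0-z_1)^2}$ and, for $2g+n\ge2$, $$W_{g,n+1}(z_0,\dots,z_n)=\sum_{r\in R}\operatorname{Res}_{z=r}K(z_0,z)\Big[W_{g-1,n+2}(z,\overline z,z_1,\dots,z_n)+\sum{}'\,W_{g_1,|I_1|+1}(z,z_{I_1})W_{g_2,|I_2|+1}(\overline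 z,z_{I_2})\Big],$$ $K(z_0,z)=\frac{1}{2(y(z)-y(\overline z))dx(z)}\int_{\zeta=\overline z}^{\zeta=z}B(z_0,\zeta)$, where the sum is over $g_1+g_2=g$, $I_1\sqcup I_2=\{1,\dots,n\}$ and the prime means that terms with $(g_i,I_i)=(0,\emptyset)$ are excluded. The free energies are $F_g(\lambda)=\frac{1}{2-2g}\sum_{r\in R}\operatorname{Res}_{z=r}\Phi(z)W_{g,1}(z)$ for $g\ge2$, with $\Phi$ a primitive of $y(z)dx(z)$, and (from the Eynard–Orantin definitions) $F_0(\lambda)=-\frac34\lambda^2+\frac12\lambda^2\log\lambda$, $F_1(\lambda)=-\frac1{12}\log\lambda$. *)

theory Defs
  imports "HOL-Complex_Analysis.Complex_Analysis"
begin

text \<open>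
  Multidifferentials on the Weber curve are represented by their coefficients with respect to the
  affine coordinate \<open>z\<close>: a value \<open>f [z\<^sub>1, \<dots>, z\<^sub>n]\<close> stands for
  \<open>f(z\<^sub>1,\<dots>,z\<^sub>n) dz\<^sub>1 \<cdots> dz\<^sub>n\<close>. The parameter \<open>s\<close> is the chosen value of the square root of
  \<open>\<lambda>\<close>.
\<close>

definition weber_x :: "complex \<Rightarrow> complex \<Rightarrow> complex" where
  "weber_x s z = s * (z + 1 / z)"

definition weber_y :: "complex \<Rightarrow> complex \<Rightarrow> complex" where
  "weber_y s z = s / 2 * (z - 1 / z)"

definition weber_conj :: "complex \<Rightarrow> complex" where
  "weber_conj z = 1 / z"

definition weber_ramification :: "complex set" where
  "weber_ramification = {1, -1}"

definition weber_ydx :: "complex \<Rightarrow> complex \<Rightarrow> complex" where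
  "weber_ydx s z = weber_y s z * deriv (weber_x s) z"

definition bidiff :: "complex \<Rightarrow> complex \<Rightarrow> complex" where
  "bidiff z0 z1 = 1 / (z0 - z1)^2"

text \<open>
  The coefficient of \<open>dz\<^sub>0 / dz\<close>. Only \<open>z\<close> close to a ramification point different from \<open>z\<^sub>0\<close> matters,
  so the segment from \<open>1/z\<close> to \<open>z\<close> avoids the (residue-free) pole of the integrand.
\<close>

definition weber_kernel :: "complex \<Rightarrow> complex \<Rightarrow> complex \<Rightarrow> complex" where
  "weber_kernel s z0 z =
     1 / (2 * (weber_y s z - weber_y s (weber_conj z)) * deriv (weber_x s) z)
     * contour_integral (linepath (weber_conj z) z) (\<lambda>\<zeta>. bidiff z0 \<zeta>)"

lemma residue_fundef_cong [fundef_cong]: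
  "r = r' \<Longrightarrow> (\<And>z. f z = g z) \<Longrightarrow> residue f r = residue g r'"
  by presburger

text \<open>
  \<open>weber_W s g [z\<^sub>1, \<dots>, z\<^sub>n]\<close> is the coefficient of \<open>W\<^bsub>g,n\<^esub>(z\<^sub>1,\<dots>,z\<^sub>n)\<close>; the value for the empty list
  is a dummy. The bracket of the recursion contains one argument \<open>z\<close> and one argument \<open>1/z\<close>;
  the factor \<open>deriv weber_conj z\<close> comes from pulling back the differential in the latter. The
  index \<open>I\<close> is the set \<open>I\<^sub>1\<close>, as a set of positions in \<open>zs\<close>, and \<open>I\<^sub>2\<close> is its complement.
\<close>

function weber_W :: "complex \<Rightarrow> nat \<Rightarrow> complex list \<Rightarrow> complex" where
  "weber_W s g [] = 0"
| "weber_W s g (z0 # zs) =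
    (if g = 0 \<and> length zs = 0 then weber_ydx s z0
     else if g = 0 \<and> length zs = 1 then bidiff z0 (zs ! 0)
     else \<Sum>r\<in>weber_ramification. residue (\<lambda>z.
       weber_kernel s z0 z * deriv weber_conj z *
         ((if g = 0 then 0 else weber_W s (g - 1) (z # weber_conj z # zs)) +
          (\<Sum>g1\<in>{0..g}. \<Sum>I\<in>Pow {0..<length zs}.
             if (g1 = 0 \<and> I = {}) \<or> (g - g1 = 0 \<and> {0..<length zs} - I = {}) then 0
             else weber_W s g1 (z # nths zs I)
                * weber_W s (g - g1) (weber_conj z # nths zs ({0..<length zs} - I))))) r)"
  by pat_completeness auto
termination
proof (relation "Wellfounded.measure (\<lambda>(s, g, zs). 2 * g + length zs)", goal_cases)
  case 1
  then show ?case by simp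
next
  case (2 s g z0 zs r z)
  then show ?case by simp
next
  case (3 s g z0 zs r z g1 I)
  have le: "g1 \<le> g" and I: "I \<subseteq> {0..<length zs}" using 3 by auto
  have "{i. i < length zs \<and> i \<in> I} = I" using I by auto
  then have len: "length (nths zs I) = card I" by (simp add: length_nths)
  have c: "card I \<le> length zs" using card_mono[OF _ I] by simp
  have "g1 < g \<or> card I < length zs"
  proof (cases "g1 < g")
    case False
    with 3 have "I \<noteq> {0..<length zs}" by auto
    with I have "I \<subset> {0..<length zs}" by auto
    from psubset_card_mono[OF _ this] show ?thesis by simp
  qed simp
  with le c have "2 * g1 + length (z # nths zs I) < 2 * g + length (z0 # zs)"
    unfolding list.size len by linarith
  then show ?case by simp
next
  case (4 s g z0 zs r z g1 I)
  have le: "g1 \<le> g" and I: "I \<subseteq> {0..<length zs}" using 4 by auto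
  have fin: "finite I" using I finite_subset by blast
  have "{i. i < length zs \<and> i \<in> {0..<length zs} - I} = {0..<length zs} - I" by auto
  then have len: "length (nths zs ({0..<length zs} - I)) = length zs - card I"
    using card_Diff_subset[OF fin I] by (simp add: length_nths)
  have c: "card I \<le> length zs" using card_mono[OF _ I] by simp
  have "g1 > 0 \<or> I \<noteq> {}" using 4(6) by (metis gr0I)
  then have "g1 > 0 \<or> card I > 0" using fin by (simp add: card_gt_0_iff)
  with le c have "2 * (g - g1) + length (weber_conj z # nths zs ({0..<length zs} - I))
      < 2 * g + length (z0 # zs)"
    unfolding list.size len by linarith
  then show ?case by simp
qed

text \<open>
  On \<open>\<complex> - {0}\<close> a primitive of \<open>y dx\<close> is multivalued; only its germs at the ramification points
  enter the free energies.
\<close>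

definition weber_primitive :: "complex \<Rightarrow> (complex \<Rightarrow> complex) \<Rightarrow> bool" where
  "weber_primitive s \<Phi> \<longleftrightarrow>
     (\<forall>r\<in>weber_ramification. \<forall>\<^sub>F z in nhds r. (\<Phi> has_field_derivative weber_ydx s z) (at z))"

definition sqrt_branch :: "complex set \<Rightarrow> (complex \<Rightarrow> complex) \<Rightarrow> bool" where
  "sqrt_branch U s \<longleftrightarrow> continuous_on U s \<and> (\<forall>\<mu>\<in>U. (s \<mu>)^2 = \<mu>)"

definition log_branch :: "complex set \<Rightarrow> (complex \<Rightarrow> complex) \<Rightarrow> bool" where
  "log_branch U l \<longleftrightarrow> continuous_on U l \<and> (\<forall>\<mu>\<in>U. exp (l \<mu>) = \<mu>)"

text \<open>
  The free energies, for the branches \<open>s\<close> and \<open>l\<close> of the square root and the logarithm, and a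
  primitive \<open>\<Phi> \<mu>\<close> of \<open>y dx\<close> on the curve with parameter \<open>\<mu>\<close>.
\<close>

definition weber_F ::
  "(complex \<Rightarrow> complex) \<Rightarrow> (complex \<Rightarrow> complex) \<Rightarrow> (complex \<Rightarrow> complex \<Rightarrow> complex)
     \<Rightarrow> nat \<Rightarrow> complex \<Rightarrow> complex" where
  "weber_F s l \<Phi> g \<mu> =
     (if g = 0 then - (3 / 4) * \<mu>^2 + 1 / 2 * \<mu>^2 * l \<mu>
      else if g = 1 then - (1 / 12) * l \<mu>
      else 1 / (2 - 2 * of_nat g) *
        (\<Sum>r\<in>weber_ramification. residue (\<lambda>z. \<Phi> \<mu> z * weber_W (s \<mu>) g [z]) r))"

text \<open>
  Formal Laurent series in \<open>\<hbar>\<close> are elements of \<open>complex fls\<close>, with \<open>\<hbar>\<close> being \<open>fls_X\<close>. Infinite sums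
  of such series converge in the topology of \<open>fls\<close>, i.e. each coefficient is eventually constant.
\<close>

definition weber_free_energy ::
  "(complex \<Rightarrow> complex) \<Rightarrow> (complex \<Rightarrow> complex) \<Rightarrow> (complex \<Rightarrow> complex \<Rightarrow> complex)
     \<Rightarrow> complex \<Rightarrow> complex fls" where
  "weber_free_energy s l \<Phi> \<mu> =
     (\<Sum>g. fls_X_intpow (2 * int g - 2) * fls_const (weber_F s l \<Phi> g \<mu>))"

definition fls_param_deriv :: "(complex \<Rightarrow> complex fls) \<Rightarrow> complex \<Rightarrow> complex fls" where
  "fls_param_deriv F \<mu> = Abs_fls (\<lambda>k. deriv (\<lambda>\<nu>. fls_nth (F \<nu>) k) \<mu>)"

text \<open>\<open>fls_param_shift \<epsilon> F \<mu>\<close> is \<open>F(\<mu> + \<epsilon>\<hbar>; \<hbar>)\<close>, Taylor expanded in the shift.\<close>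

definition fls_param_shift ::
  "complex \<Rightarrow> (complex \<Rightarrow> complex fls) \<Rightarrow> complex \<Rightarrow> complex fls" where
  "fls_param_shift \<epsilon> F \<mu> =
     (\<Sum>n. (fls_const \<epsilon> * fls_X)^n * fls_const (1 / fact n) * (fls_param_deriv ^^ n) F \<mu>)"

end

theory Submission
  imports Defs
begin

text \<open>
  The differentials of the Weber curve are rational functions of x and of D = x^2 - 4 (after
  rescaling to \<open>\<lambda> = 1\<close>): up to the factor dz/z in every variable, each
  stable \<open>W\<^bsub>g,n\<^esub>\<close> is a finite combination of products of the
  functions \<open>x\<^sup>\<epsilon> / D\<^sup>m\<close> with \<open>\<epsilon> \<in> {0,
  1}\<close>. So the topological recursion is a recursion for arrays of coefficients
  (\<open>tr_coeff\<close>), and \<open>weber_W_eq_contract\<close> identifies the two; the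
  dependence on \<open>\<lambda>\<close> is a power of \<open>s\<^sup>2\<close>.

  The same arrays can be contracted with the Taylor coefficients of the basis functions at
  \<open>x = \<infinity>\<close> instead of their values at points. The resulting numbers
  (\<open>cumulant\<close>) satisfy the loop equations of the Gaussian matrix model
  (\<open>omega_rec\<close>, \<open>cumulant_Suc\<close>): they are the genus g parts of the
  cumulants of traces of powers. In terms of joint moments (\<open>joint_moment\<close>) the
  loop equations are linear, and the Virasoro commutation relations show that these moments are
  symmetric in their arguments. Evaluating symmetric weighted sums of two- and three-point
  moments in two ways eliminates everything except the one-point moments, and leaves the
  three-term recursion of Harer and Zagier.

  That recursion is solved in closed form (\<open>even_moment_eq\<close>): the moment of degree
  2n is the central binomial coefficient times a polynomial in n, made of a falling factorial
  and of coefficients of powers of w coth w. On the geometric side, integration by parts shows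
  that the residue of \<open>\<Phi>\<close> against a basis function is \<open>\<lambda>\<close>
  times the derivative at n = 0 of the polynomial which that basis function contributes to the
  moment. Hence \<open>(2 - 2g) F\<^sub>g\<close> is, up to a power of \<open>\<lambda>\<close>,
  the derivative at n = 0 of the moment polynomial, and the closed form gives \<open>F\<^sub>g =
  - (2g-3)! 4\<^bsup>-g\<^esup> \<kappa>\<^sub>g \<lambda>\<^bsup>2-2g\<^esup>\<close>, for
  \<open>g \<ge> 2\<close>, where \<open>\<kappa>\<^sub>g\<close> is the coefficient of
  \<open>w\<^bsup>2g\<^esup>\<close> in \<open>(w / sinh w)\<^sup>2\<close>.

  For these values the second difference is a convolution: the coefficient of
  \<open>\<hbar>\<^bsup>2M\<^esup>\<close> collects the derivatives of order 2j of
  \<open>F\<^bsub>M+1-j\<^esub>\<close>, all of which, for \<open>M \<ge> 1\<close>, are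
  multiples of \<open>\<lambda>\<^bsup>-2M\<^esup>\<close>, and their sum is a multiple of the
  coefficient of \<open>w\<^bsup>2M+2\<^esup>\<close> in \<open>(2 sinh\<^sup>2 w) (w / sinh
  w)\<^sup>2 = 2 w\<^sup>2\<close>. This vanishes for \<open>M \<ge> 1\<close>, while \<open>M =
  0\<close> gives the second derivative of \<open>F\<^sub>0\<close>.
\<close>

section \<open>Sums over splittings of a list and multilinear contractions\<close>

text \<open>
  Sums over the ways to distribute the entries of a list, as positions, to two complementary
  sublists, and over the ways to single out one entry. Lists instead of index sets keep the
  recursion over marked points structural.
\<close>

primrec split_sum :: "('a list \<Rightarrow> 'a list \<Rightarrow> 'b::comm_monoid_add) \<Rightarrow> 'a list \<Rightarrow> 'b" where
  "split_sum f [] = f [] []"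
| "split_sum f (x # xs) = split_sum (\<lambda>u v. f (x # u) v) xs + split_sum (\<lambda>u v. f u (x # v)) xs"

primrec pick_sum :: "('a \<Rightarrow> 'a list \<Rightarrow> 'b::comm_monoid_add) \<Rightarrow> 'a list \<Rightarrow> 'b" where
  "pick_sum f [] = 0"
| "pick_sum f (x # xs) = f x xs + pick_sum (\<lambda>y ys. f y (x # ys)) xs"

text \<open>
  The parts of a splitting are controlled through their multisets; this is what the termination
  proofs below need.
\<close>

lemma split_sum_cong_mset:
  "(\<And>u v. mset u + mset v = mset xs \<Longrightarrow> f u v = g u v) \<Longrightarrow> split_sum f xs = split_sum g xs"
proof (induction xs arbitrary: f g)
  case (Cons x xs)
  have "split_sum (\<lambda>u v. f (x # u) v) xs = split_sum (\<lambda>u v. g (x # u) v) xs"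
    by (rule Cons.IH) (simp add: Cons.prems)
  moreover have "split_sum (\<lambda>u v. f u (x # v)) xs = split_sum (\<lambda>u v. g u (x # v)) xs"
    by (rule Cons.IH) (simp add: Cons.prems)
  ultimately show ?case by simp
qed simp

lemma split_sum_cong [fundef_cong]:
  assumes "xs = xs'" "\<And>u v. mset u + mset v = mset xs' \<Longrightarrow> f u v = g u v"
  shows "split_sum f xs = split_sum g xs'"
  using split_sum_cong_mset[of xs' f g] assms by simp

lemma pick_sum_cong_mset:
  "(\<And>y ys. mset (y # ys) = mset xs \<Longrightarrow> f y ys = g y ys) \<Longrightarrow> pick_sum f xs = pick_sum g xs"
proof (induction xs arbitrary: f g)
  case (Cons x xs)
  have "pick_sum (\<lambda>y ys. f y (x # ys)) xs = pick_sum (\<lambda>y ys. g y (x # ys)) xs"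
    by (rule Cons.IH) (simp add: Cons.prems add_mset_commute)
  then show ?case by (simp add: Cons.prems)
qed simp

lemma pick_sum_cong [fundef_cong]:
  assumes "xs = xs'" "\<And>y ys. mset (y # ys) = mset xs' \<Longrightarrow> f y ys = g y ys"
  shows "pick_sum f xs = pick_sum g xs'"
  using pick_sum_cong_mset[of xs' f g] assms by simp

lemma mset_split_bounds:
  assumes "mset u + mset v = mset xs"
  shows "length u + length v = length xs" "set u \<subseteq> set xs" "set v \<subseteq> set xs"
proof -
  have "size (mset u + mset v) = size (mset xs)" using assms by simp
  then show "length u + length v = length xs" by simp
  have "set_mset (mset u + mset v) = set_mset (mset xs)" using assms by simp
  then show "set u \<subseteq> set xs" "set v \<subseteq> set xs" by auto
qed

lemma mset_pick_bounds:
  assumes "mset (y # ys) = mset xs"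
  shows "length xs = Suc (length ys)" "y \<in> set xs" "set ys \<subseteq> set xs"
proof -
  show "length xs = Suc (length ys)" using assms by (metis length_Cons size_mset)
  have "set xs = set (y # ys)" using assms by (metis set_mset_mset)
  then show "y \<in> set xs" "set ys \<subseteq> set xs" by auto
qed

lemma sum_list_pick: "mset (y # ys) = mset xs \<Longrightarrow> sum_list xs = y + sum_list ys"
  for y :: "'a::comm_monoid_add"
  by (metis sum_list.Cons sum_mset_sum_list)

lemma split_sum_add:
  "split_sum (\<lambda>u v. f u v + g u v) xs = split_sum f xs + split_sum g xs"
  by (induction xs arbitrary: f g) (simp_all add: add_ac)

lemma pick_sum_add:
  "pick_sum (\<lambda>u v. f u v + g u v) xs = pick_sum f xs + pick_sum g xs"
  by (induction xs arbitrary: f g) (simp_all add: add_ac)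

lemma split_sum_0 [simp]: "split_sum (\<lambda>u v. 0) xs = 0"
  by (induction xs) simp_all

lemma pick_sum_0 [simp]: "pick_sum (\<lambda>u v. 0) xs = 0"
  by (induction xs) simp_all

lemma split_sum_sum: "split_sum (\<lambda>u v. \<Sum>i\<in>A. f i u v) xs = (\<Sum>i\<in>A. split_sum (f i) xs)"
  by (induction xs arbitrary: f) (simp_all add: sum.distrib)

lemma pick_sum_sum: "pick_sum (\<lambda>u v. \<Sum>i\<in>A. f i u v) xs = (\<Sum>i\<in>A. pick_sum (f i) xs)"
  by (induction xs arbitrary: f) (simp_all add: sum.distrib)

lemma split_sum_cmult:
  "split_sum (\<lambda>u v. (c::'a::semiring_0) * f u v) xs = c * split_sum f xs"
  by (induction xs arbitrary: f) (simp_all add: algebra_simps)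

lemma pick_sum_cmult:
  "pick_sum (\<lambda>u v. (c::'a::semiring_0) * f u v) xs = c * pick_sum f xs"
  by (induction xs arbitrary: f) (simp_all add: algebra_simps)

lemma split_sum_cmult_right:
  "split_sum (\<lambda>u v. f u v * (c::'a::semiring_0)) xs = split_sum f xs * c"
  by (induction xs arbitrary: f) (simp_all add: algebra_simps)

lemma split_sum_commute: "split_sum f xs = split_sum (\<lambda>u v. f v u) xs"
proof (induction xs arbitrary: f)
  case (Cons x xs)
  show ?case
    using Cons.IH[of "\<lambda>u v. f (x # u) v"] Cons.IH[of "\<lambda>u v. f u (x # v)"]
    by (simp add: add.commute)
qed simp

text \<open>Both sides sum over the splittings into three parts.\<close>

lemma split_sum_assoc:
  "split_sum (\<lambda>u v. split_sum (\<lambda>u1 u2. f u1 u2 v) u) xs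
     = split_sum (\<lambda>u w. split_sum (\<lambda>v1 v2. f u v1 v2) w) xs"
  by (induction xs arbitrary: f) (simp_all add: split_sum_add add_ac)

lemma split_sum_pick_left:
  "split_sum (\<lambda>u v. pick_sum (\<lambda>y ys. f y ys v) u) xs
     = pick_sum (\<lambda>y ys. split_sum (\<lambda>u v. f y u v) ys) xs"
proof (induction xs arbitrary: f)
  case (Cons x xs)
  have "split_sum (\<lambda>u v. pick_sum (\<lambda>y ys. f y ys v) u) (x # xs)
      = split_sum (\<lambda>u v. f x u v) xs
        + split_sum (\<lambda>u v. pick_sum (\<lambda>y ys. f y (x # ys) v) u) xs
        + split_sum (\<lambda>u v. pick_sum (\<lambda>y ys. f y ys (x # v)) u) xs"
    by (simp add: split_sum_add)
  then show ?case
    using Cons.IH[of "\<lambda>y ys v. f y (x # ys) v"] Cons.IH[of "\<lambda>y ys v. f y ys (x # v)"]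
    by (simp add: pick_sum_add add_ac)
qed simp

lemma split_sum_Nil_left:
  "split_sum (\<lambda>u v. if u = [] then f v else 0) xs = f xs"
  by (induction xs arbitrary: f) simp_all

lemma split_sum_singleton_left:
  "split_sum (\<lambda>u v. if length u = 1 then f (hd u) v else 0) xs = pick_sum f xs"
proof (induction xs arbitrary: f)
  case (Cons x xs)
  have "split_sum (\<lambda>u v. if length (x # u) = 1 then f (hd (x # u)) v else 0) xs
      = split_sum (\<lambda>u v. if u = [] then f x v else 0) xs"
    by (rule split_sum_cong) auto
  also have "\<dots> = f x xs" by (rule split_sum_Nil_left)
  finally show ?case using Cons.IH[of "\<lambda>y ys. f y (x # ys)"] by simp
qed simp

text \<open>
  The recursion for the correlation functions sums over subsets of positions. Induction over the
  list: a subset of the positions of \<open>x # xs\<close> either contains 0 or not, and is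
  otherwise a shifted subset of the positions of xs.
\<close>

lemma sum_Pow_nths:
  "(\<Sum>I\<in>Pow {0..<length xs}. f (nths xs I) (nths xs ({0..<length xs} - I))) = split_sum f xs"
proof (induction xs arbitrary: f)
  case (Cons x xs)
  let ?n = "length xs"
  have range: "{0..<length (x # xs)} = insert 0 (Suc ` {0..<?n})"
    by (simp add: atLeast0_lessThan_Suc_eq_insert_0 del: image_Suc_atLeastLessThan)
  have PowS: "Pow (Suc ` {0..<?n}) = (\<lambda>I. Suc ` I) ` Pow {0..<?n}"
    by (simp add: image_Pow_surj del: image_Suc_atLeastLessThan)
  have inj: "inj_on (\<lambda>I. Suc ` I) (Pow {0..<?n})" by (auto simp: inj_on_def inj_image_eq_iff)
  have inj': "inj_on (insert 0) ((\<lambda>I. Suc ` I) ` Pow {0..<?n})"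
    by (auto simp: inj_on_def)
  have pre: "{j. Suc j \<in> Suc ` I} = I" "{j. Suc j \<in> insert 0 (Suc ` I)} = I" for I by auto
  have pre': "{j. Suc j \<in> insert 0 (Suc ` {0..<?n}) - Suc ` I} = {0..<?n} - I"
    "{j. Suc j \<in> insert 0 (Suc ` {0..<?n}) - insert 0 (Suc ` I)} = {0..<?n} - I" for I by auto
  let ?h = "\<lambda>I. f (nths (x # xs) I) (nths (x # xs) (insert 0 (Suc ` {0..<?n}) - I))"
  have "sum ?h (Pow (insert 0 (Suc ` {0..<?n})))
      = sum ?h (Pow (Suc ` {0..<?n})) + sum ?h (insert 0 ` Pow (Suc ` {0..<?n}))"
    unfolding Pow_insert by (rule sum.union_disjoint) auto
  also have "sum ?h (Pow (Suc ` {0..<?n}))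
      = (\<Sum>I\<in>Pow {0..<?n}. f (nths xs I) (x # nths xs ({0..<?n} - I)))"
    unfolding PowS sum.reindex[OF inj] o_def nths_Cons pre pre' by (simp cong: if_cong)
  also have "sum ?h (insert 0 ` Pow (Suc ` {0..<?n}))
      = (\<Sum>I\<in>Pow {0..<?n}. f (x # nths xs I) (nths xs ({0..<?n} - I)))"
    unfolding PowS sum.reindex[OF inj'] sum.reindex[OF inj] o_def nths_Cons pre pre' by simp
  finally show ?case
    unfolding range using Cons.IH[of "\<lambda>u v. f (x # u) v"] Cons.IH[of "\<lambda>u v. f u (x # v)"]
    by (simp add: add_ac)
qed simp

text \<open>
  A tensor c of finite rank, with indices below K, evaluated at the vectors \<open>M p\<close>.
  Values of the correlation functions at points and their moments at infinity are contractions
  of one and the same tensor with different vectors.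
\<close>

primrec contract :: "('p \<Rightarrow> nat \<Rightarrow> 'c::comm_ring_1) \<Rightarrow> nat \<Rightarrow> (nat list \<Rightarrow> 'c) \<Rightarrow> 'p list \<Rightarrow> 'c" where
  "contract M K c [] = c []"
| "contract M K c (p # ps) = (\<Sum>k<K. M p k * contract M K (\<lambda>ks. c (k # ks)) ps)"

lemma contract_cong:
  "(\<And>ks. length ks = length ps \<Longrightarrow> set ks \<subseteq> {..<K} \<Longrightarrow> c ks = d ks) \<Longrightarrow>
     contract M K c ps = contract M K d ps"
proof (induction ps arbitrary: c d)
  case (Cons p ps)
  have "contract M K (\<lambda>ks. c (k # ks)) ps = contract M K (\<lambda>ks. d (k # ks)) ps" if "k < K" for k
    by (rule Cons.IH, rule Cons.prems) (use that in auto)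
  then show ?case by simp
qed simp

lemma contract_0: "(\<And>ks. length ks = length ps \<Longrightarrow> c ks = 0) \<Longrightarrow> contract M K c ps = 0"
  by (induction ps arbitrary: c) simp_all

lemma contract_add:
  "contract M K (\<lambda>ks. c ks + d ks) ps = contract M K c ps + contract M K d ps"
  by (induction ps arbitrary: c d) (simp_all add: sum.distrib algebra_simps)

lemma contract_cmult: "contract M K (\<lambda>ks. a * c ks) ps = a * contract M K c ps"
  by (induction ps arbitrary: c) (simp_all add: sum_distrib_left mult.left_commute)

lemma contract_sum:
  "contract M K (\<lambda>ks. \<Sum>i\<in>A. c i ks) ps = (\<Sum>i\<in>A. contract M K (c i) ps)"
proof (induction ps arbitrary: c)
  case (Cons p ps)
  then show ?case by (simp add: sum_distrib_left) (rule sum.swap)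
qed simp

text \<open>
  The tensors used here have finite support, so the cutoff K can be raised at will.
\<close>

lemma contract_mono:
  assumes "K \<le> K'" "\<And>ks. length ks = length ps \<Longrightarrow> \<not> set ks \<subseteq> {..<K} \<Longrightarrow> c ks = 0"
  shows "contract M K' c ps = contract M K c ps"
  using assms(2)
proof (induction ps arbitrary: c)
  case (Cons p ps)
  have "(\<Sum>k<K'. M p k * contract M K' (\<lambda>ks. c (k # ks)) ps)
      = (\<Sum>k<K. M p k * contract M K' (\<lambda>ks. c (k # ks)) ps)"
  proof (rule sum.mono_neutral_right)
    have "contract M K' (\<lambda>ks. c (i # ks)) ps = 0" if "\<not> i < K" for i
      by (rule contract_0, rule Cons.prems) (use that in auto)
    then show "\<forall>i\<in>{..<K'} - {..<K}. M p i * contract M K' (\<lambda>ks. c (i # ks)) ps = 0"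
      by simp
  qed (use assms(1) in auto)
  also have "\<dots> = (\<Sum>k<K. M p k * contract M K (\<lambda>ks. c (k # ks)) ps)"
  proof (rule sum.cong[OF refl])
    fix k assume "k \<in> {..<K}"
    then have "contract M K' (\<lambda>ks. c (k # ks)) ps = contract M K (\<lambda>ks. c (k # ks)) ps"
      by (intro Cons.IH Cons.prems) auto
    then show "M p k * contract M K' (\<lambda>ks. c (k # ks)) ps
        = M p k * contract M K (\<lambda>ks. c (k # ks)) ps" by simp
  qed
  finally show ?case by simp
qed simp

lemma contract_split:
  "contract M K (split_sum (\<lambda>u v. c u * d v)) ps
     = split_sum (\<lambda>u v. contract M K c u * contract M K d v) ps"
proof (induction ps arbitrary: c d)
  case (Cons p ps)
  have "contract M K (split_sum (\<lambda>u v. c u * d v)) (p # ps)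
      = (\<Sum>k<K. M p k * (contract M K (split_sum (\<lambda>u v. c (k # u) * d v)) ps
          + contract M K (split_sum (\<lambda>u v. c u * d (k # v))) ps))"
    by (simp add: contract_add)
  also have "\<dots> = (\<Sum>k<K. split_sum (\<lambda>u v. M p k * contract M K (\<lambda>ks. c (k # ks)) u
            * contract M K d v) ps)
        + (\<Sum>k<K. split_sum (\<lambda>u v. contract M K c u
            * (M p k * contract M K (\<lambda>ks. d (k # ks)) v)) ps)"
  proof -
    have 1: "M p k * contract M K (split_sum (\<lambda>u v. c (k # u) * d v)) ps
        = split_sum (\<lambda>u v. M p k * contract M K (\<lambda>ks. c (k # ks)) u * contract M K d v) ps" for k
      unfolding Cons.IH split_sum_cmult[symmetric] by (simp add: mult.assoc)
    have 2: "M p k * contract M K (split_sum (\<lambda>u v. c u * d (k # v))) ps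
        = split_sum (\<lambda>u v. contract M K c u * (M p k * contract M K (\<lambda>ks. d (k # ks)) v)) ps" for k
      unfolding Cons.IH split_sum_cmult[symmetric] by (simp add: mult.left_commute)
    show ?thesis by (simp only: distrib_left sum.distrib 1 2)
  qed
  also have "\<dots> = split_sum (\<lambda>u v. contract M K c u * contract M K d v) (p # ps)"
    by (simp add: split_sum_sum[symmetric] sum_distrib_left[symmetric] sum_distrib_right[symmetric])
  finally show ?case .
qed simp

lemma contract_pick:
  "contract M K (pick_sum (\<lambda>j ks. b j * c ks)) ps
     = pick_sum (\<lambda>p qs. (\<Sum>j<K. M p j * b j) * contract M K c qs) ps"
proof (induction ps arbitrary: c)
  case (Cons p ps)
  have "contract M K (pick_sum (\<lambda>j ks. b j * c ks)) (p # ps)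
      = (\<Sum>k<K. M p k * (b k * contract M K c ps
          + contract M K (pick_sum (\<lambda>j ks. b j * c (k # ks))) ps))"
    by (simp add: contract_add contract_cmult)
  also have "\<dots> = (\<Sum>k<K. M p k * b k) * contract M K c ps
        + (\<Sum>k<K. pick_sum (\<lambda>q qs. (\<Sum>j<K. M q j * b j)
            * (M p k * contract M K (\<lambda>ks. c (k # ks)) qs)) ps)"
  proof -
    have "M p k * contract M K (pick_sum (\<lambda>j ks. b j * c (k # ks))) ps
        = pick_sum (\<lambda>q qs. (\<Sum>j<K. M q j * b j)
            * (M p k * contract M K (\<lambda>ks. c (k # ks)) qs)) ps" for k
      unfolding Cons.IH pick_sum_cmult[symmetric] by (simp add: mult.left_commute)
    then show ?thesis by (simp only: distrib_left sum.distrib sum_distrib_right mult.assoc)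
  qed
  also have "\<dots> = pick_sum (\<lambda>p qs. (\<Sum>j<K. M p j * b j) * contract M K c qs) (p # ps)"
    by (simp add: pick_sum_sum[symmetric] sum_distrib_left[symmetric])
  finally show ?case .
qed simp

lemma contract_prod:
  "contract M K (\<lambda>ks. \<Prod>k\<leftarrow>ks. f k) ps = (\<Prod>p\<leftarrow>ps. \<Sum>k<K. M p k * f k)"
  by (induction ps) (simp_all add: contract_cmult sum_distrib_right mult.assoc)

section \<open>Structure constants of the basis of rational functions\<close>

text \<open>
  With \<open>w\<^sub>k = x\<^bsup>k mod 2\<^esup> / D\<^bsup>k div 2 + 1\<^esup>\<close> and
  \<open>D = x\<^sup>2 - 4\<close>, these are the coefficients of \<open>- w\<^sub>k w\<^sub>l /
  D\<close> in the basis \<open>w\<close>.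
\<close>

definition quad_coeff :: "nat \<Rightarrow> nat \<Rightarrow> nat \<Rightarrow> int" where
  "quad_coeff k0 k l =
     (if odd k \<and> odd l then - of_bool (k0 = k + l) - 4 * of_bool (k0 = k + l + 2)
      else - of_bool (k0 = k + l + 4))"

text \<open>
  The coefficients of the divided difference \<open>(w\<^sub>n(y) - w\<^sub>n(x)) / (y -
  x)\<close> in the products \<open>w\<^sub>i(x) w\<^sub>j(y)\<close>.
\<close>

definition dd_coeff :: "nat \<Rightarrow> nat \<Rightarrow> nat \<Rightarrow> int" where
  "dd_coeff n i j =
     (if even n \<or> odd i \<and> odd j then - of_bool (i + j = n + 1)
      else if even i \<and> even j then - 4 * of_bool (i + j + 1 = n) - of_bool (i + j + 3 = n)
      else 0)"

text \<open>
  On the basis \<open>w\<close> this is the operator \<open>f \<mapsto> - D f - x f\<close>,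
  that is \<open>- \<surd>D d/dx (\<surd>D f)\<close>. It is written out as an operator on
  sequences because it is also applied to sequences of power series.
\<close>

definition theta :: "(nat \<Rightarrow> 'a::comm_ring_1) \<Rightarrow> nat \<Rightarrow> 'a" where
  "theta f i = (if even i then of_nat (i + 1) * f (i + 1)
     else of_nat (i - 1) * f (i - 3) + 4 * of_nat i * f (i - 1))"

definition theta_coeff :: "nat \<Rightarrow> nat \<Rightarrow> int" where
  "theta_coeff i j = theta (\<lambda>k. of_bool (k = j)) i"

definition lin_coeff :: "nat \<Rightarrow> nat \<Rightarrow> nat \<Rightarrow> int" where
  "lin_coeff k0 j k = (\<Sum>i\<le>k+3. dd_coeff (k + 2) k0 i * theta_coeff i j)"

text \<open>
  The two structural maps for an arbitrary sequence in place of the basis functions, so that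
  they also apply to expansions at infinity.
\<close>

definition quad_form :: "(nat \<Rightarrow> 'a::comm_ring_1) \<Rightarrow> nat \<Rightarrow> nat \<Rightarrow> 'a" where
  "quad_form e k l = (if odd k \<and> odd l then - e (k + l) - 4 * e (k + l + 2) else - e (k + l + 4))"

definition dd_form :: "nat \<Rightarrow> (nat \<Rightarrow> 'a::comm_ring_1) \<Rightarrow> (nat \<Rightarrow> 'a) \<Rightarrow> 'a" where
  "dd_form n e f = (\<Sum>i\<le>n+1. \<Sum>j\<le>n+1. of_int (dd_coeff n i j) * (e i * f j))"

text \<open>
  Multiplication by x in the basis \<open>w\<close>. The boundary term \<open>x w\<^sub>1 = 1 +
  4 w\<^sub>0\<close> leaves the span of the basis; the parameter u stands for the constant 1.
\<close>

definition xmul :: "'a::comm_ring_1 \<Rightarrow> (nat \<Rightarrow> 'a) \<Rightarrow> nat \<Rightarrow> 'a" where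
  "xmul u e i = (if even i then e (i + 1) else (if i = 1 then u else e (i - 3)) + 4 * e (i - 1))"

lemma sum_even_odd: "(\<Sum>i\<le>2*p+1. h i) = (\<Sum>a\<le>p. h (2*a) + h (2*a+1))" for p :: nat
  by (induction p) (simp_all add: add_ac)

lemma dd_form_even:
  "dd_form (2*p) e f = - (\<Sum>a\<le>p. e (2*a) * f (2*(p-a)+1) + e (2*a+1) * f (2*(p-a)))"
proof -
  have "dd_form (2*p) e f = (\<Sum>i\<le>2*p+1. - (e i * f (2*p+1-i)))"
    unfolding dd_form_def
  proof (rule sum.cong[OF refl])
    fix i assume i: "i \<in> {..2*p+1}"
    have "(\<Sum>j\<le>2*p+1. of_int (dd_coeff (2*p) i j) * (e i * f j))
        = (\<Sum>j\<le>2*p+1. if j = 2*p+1-i then - (e i * f j) else 0)"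
      using i by (intro sum.cong) (auto simp: dd_coeff_def)
    then show "(\<Sum>j\<le>2*p+1. of_int (dd_coeff (2*p) i j) * (e i * f j)) = - (e i * f (2*p+1-i))"
      by (simp del: sum.atMost_Suc)
  qed
  also have "\<dots> = (\<Sum>a\<le>p. - (e (2*a) * f (2*(p-a)+1)) - e (2*a+1) * f (2*(p-a)))"
    unfolding sum_even_odd
  proof (rule sum.cong[OF refl])
    fix a assume "a \<in> {..p}"
    then have "2*p+1-2*a = 2*(p-a)+1" "2*p+1-(2*a+1) = 2*(p-a)" by auto
    then show "- (e (2*a) * f (2*p+1-2*a)) + - (e (2*a+1) * f (2*p+1-(2*a+1)))
      = - (e (2*a) * f (2*(p-a)+1)) - e (2*a+1) * f (2*(p-a))" by simp
  qed
  finally show ?thesis by (simp add: sum_negf[symmetric] sum_subtractf sum.distrib)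
qed

lemma dd_form_odd:
  "dd_form (2*p+1) e f = - (\<Sum>a\<le>p. e (2*a+1) * f (2*(p-a)+1) + 4 * (e (2*a) * f (2*(p-a))))
     - (\<Sum>a<p. e (2*a) * f (2*(p-Suc a)))"
proof -
  have inner: "(\<Sum>j\<le>2*p+2. of_int (dd_coeff (2*p+1) i j) * (e i * f j))
      = (if odd i then - (e i * f (2*p+2-i)) else
          - 4 * (if i \<le> 2*p then e i * f (2*p-i) else 0)
          - (if i + 2 \<le> 2*p then e i * f (2*p-2-i) else 0))" if "i \<le> 2*p+2" for i
  proof (cases "odd i")
    case True
    have "(\<Sum>j\<le>2*p+2. of_int (dd_coeff (2*p+1) i j) * (e i * f j))
        = (\<Sum>j\<le>2*p+2. if j = 2*p+2-i then - (e i * f j) else 0)"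
      using that True by (intro sum.cong) (auto simp: dd_coeff_def)
    then show ?thesis using True by (simp del: sum.atMost_Suc)
  next
    case False
    have "(\<Sum>j\<le>2*p+2. of_int (dd_coeff (2*p+1) i j) * (e i * f j))
        = (\<Sum>j\<le>2*p+2. (if j = 2*p-i then (if i \<le> 2*p then -4 * (e i * f j) else 0) else 0)
            + (if j = 2*p-2-i then (if i+2 \<le> 2*p then - (e i * f j) else 0) else 0))"
      using that False by (intro sum.cong refl) (auto simp: dd_coeff_def; presburger)
    then show ?thesis using False by (auto simp add: sum.distrib simp del: sum.atMost_Suc)
  qed
  have "dd_form (2*p+1) e f = (\<Sum>i\<le>2*p+2. if odd i then - (e i * f (2*p+2-i)) else
          - 4 * (if i \<le> 2*p then e i * f (2*p-i) else 0)
          - (if i + 2 \<le> 2*p then e i * f (2*p-2-i) else 0))"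
    unfolding dd_form_def using inner by (intro sum.cong) (simp_all add: add.commute)
  also have "\<dots> = (\<Sum>i\<le>2*p+1. if odd i then - (e i * f (2*p+2-i)) else
          - 4 * (if i \<le> 2*p then e i * f (2*p-i) else 0)
          - (if i + 2 \<le> 2*p then e i * f (2*p-2-i) else 0))" by simp
  also have "\<dots> = (\<Sum>a\<le>p. (- (e (2*a+1) * f (2*(p-a)+1)) - 4 * (e (2*a) * f (2*(p-a))))
      - (if a < p then e (2*a) * f (2*(p-Suc a)) else 0))"
    unfolding sum_even_odd
  proof (rule sum.cong[OF refl])
    fix a assume "a \<in> {..p}"
    moreover have "2*p+2-(2*a+1) = 2*(p-a)+1" "2*p-2*a = 2*(p-a)" "2*p-2-2*a = 2*(p-Suc a)"
      if "a \<le> p" using that by auto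
    ultimately show "(if odd (2*a) then - (e (2*a) * f (2*p+2-2*a)) else
          - 4 * (if 2*a \<le> 2*p then e (2*a) * f (2*p-2*a) else 0)
          - (if 2*a + 2 \<le> 2*p then e (2*a) * f (2*p-2-2*a) else 0)) +
        (if odd (2*a+1) then - (e (2*a+1) * f (2*p+2-(2*a+1))) else
          - 4 * (if 2*a+1 \<le> 2*p then e (2*a+1) * f (2*p-(2*a+1)) else 0)
          - (if 2*a+1 + 2 \<le> 2*p then e (2*a+1) * f (2*p-2-(2*a+1)) else 0))
        = (- (e (2*a+1) * f (2*(p-a)+1)) - 4 * (e (2*a) * f (2*(p-a))))
          - (if a < p then e (2*a) * f (2*(p-Suc a)) else 0)" by simp
  qed
  also have "\<dots> = - (\<Sum>a\<le>p. e (2*a+1) * f (2*(p-a)+1) + 4 * (e (2*a) * f (2*(p-a))))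
     - (\<Sum>a\<le>p. if a < p then e (2*a) * f (2*(p-Suc a)) else 0)"
    by (simp add: sum_subtractf sum_negf sum.distrib)
  also have "(\<Sum>a\<le>p. if a < p then e (2*a) * f (2*(p-Suc a)) else 0)
      = (\<Sum>a<p. e (2*a) * f (2*(p-Suc a)))"
    by (intro sum.mono_neutral_cong_right) auto
  finally show ?thesis .
qed

lemma xmul_even: "xmul u e (2*a) = e (2*a+1)"
  and xmul_odd: "xmul u e (2*a+1) = (if a = 0 then u else e (2*(a-1))) + 4 * e (2*a)"
proof -
  show "xmul u e (2*a) = e (2*a+1)" by (simp add: xmul_def)
  have "a \<noteq> 0 \<Longrightarrow> 2*a+1-3 = 2*(a-1)" by simp
  then show "xmul u e (2*a+1) = (if a = 0 then u else e (2*(a-1))) + 4 * e (2*a)"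
    by (auto simp: xmul_def)
qed

lemma sum_unshift_left:
  "(\<Sum>a\<le>p. (if a = 0 then u else E (a-1)) * F (p-a)) = u * F p + (\<Sum>a<p. E a * F (p-Suc a))"
  for p :: nat and E F :: "nat \<Rightarrow> 'a::comm_ring_1"
proof (cases p)
  case (Suc q)
  have "(\<Sum>a\<le>Suc q. (if a = 0 then u else E (a-1)) * F (Suc q-a))
     = u * F (Suc q) + (\<Sum>a\<le>q. E a * F (q - a))" by (subst sum.atMost_Suc_shift) simp
  then show ?thesis unfolding Suc by (simp add: lessThan_Suc_atMost)
qed simp

lemma sum_unshift_right:
  "(\<Sum>a\<le>p. E a * (if p - a = 0 then u else F (p-a-1))) = E p * u + (\<Sum>a<p. E a * F (p-Suc a))"
  for p :: nat and E F :: "nat \<Rightarrow> 'a::comm_ring_1"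
proof (cases p)
  case (Suc q)
  have "(\<Sum>a\<le>Suc q. E a * (if Suc q - a = 0 then u else F (Suc q-a-1)))
     = E (Suc q) * u + (\<Sum>a\<le>q. E a * (if Suc q - a = 0 then u else F (Suc q-a-1)))"
    by (simp add: add.commute)
  also have "(\<Sum>a\<le>q. E a * (if Suc q - a = 0 then u else F (Suc q-a-1))) = (\<Sum>a\<le>q. E a * F (q - a))"
    by (intro sum.cong) auto
  finally show ?thesis unfolding Suc by (simp add: lessThan_Suc_atMost)
qed simp

text \<open>
  The divided difference is characterised by being multiplied by \<open>y - x\<close> to the
  difference. This identity holds for arbitrary sequences, with the two boundary terms as
  parameters.
\<close>

lemma dd_form_xmul:
  fixes e f :: "nat \<Rightarrow> 'a::comm_ring_1"
  shows "dd_form n e (xmul u1 f) - dd_form n (xmul u0 e) f = u0 * f n - u1 * e n"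
proof (cases "even n")
  case True
  then obtain p where n: "n = 2 * p" by blast
  have "dd_form n e (xmul u1 f) - dd_form n (xmul u0 e) f
      = (\<Sum>a\<le>p. ((if a = 0 then u0 else e (2*(a-1))) + 4 * e (2*a)) * f (2*(p-a))
          - e (2*a) * ((if p - a = 0 then u1 else f (2*(p-a-1))) + 4 * f (2*(p-a))))"
    unfolding n dd_form_even xmul_even xmul_odd
    by (simp only: sum_subtractf sum.distrib minus_add_distrib ring_distribs) (simp add: algebra_simps)
  also have "\<dots> = (\<Sum>a\<le>p. (if a = 0 then u0 else e (2*(a-1))) * f (2*(p-a)))
        - (\<Sum>a\<le>p. e (2*a) * (if p - a = 0 then u1 else f (2*(p-a-1))))"
    unfolding sum_subtractf[symmetric] by (intro sum.cong refl) (simp add: algebra_simps)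
  also have "\<dots> = u0 * f n - u1 * e n"
    unfolding n sum_unshift_left[where u = u0 and E = "\<lambda>a. e (2*a)" and F = "\<lambda>a. f (2*a)"]
      sum_unshift_right[where E = "\<lambda>a. e (2*a)" and u = u1 and F = "\<lambda>a. f (2*a)"] by (simp add: algebra_simps)
  finally show ?thesis .
next
  case False
  then obtain p where n: "n = 2 * p + 1" by (elim oddE)
  let ?S1 = "\<Sum>a<p. e (2*a+1) * f (2*(p-Suc a))" and ?S2 = "\<Sum>a<p. e (2*a) * f (2*(p-Suc a)+1)"
  have 1: "dd_form n e (xmul u1 f)
     = - (\<Sum>a\<le>p. e (2*a+1) * (if p - a = 0 then u1 else f (2*(p-a-1))))
       - 4 * (\<Sum>a\<le>p. e (2*a+1) * f (2*(p-a)) + e (2*a) * f (2*(p-a)+1)) - ?S2"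
    unfolding n dd_form_odd xmul_even xmul_odd
    by (simp only: sum_subtractf sum.distrib minus_add_distrib ring_distribs sum_distrib_left)
      (simp add: algebra_simps)
  have 2: "dd_form n (xmul u0 e) f
     = - (\<Sum>a\<le>p. (if a = 0 then u0 else e (2*(a-1))) * f (2*(p-a)+1))
       - 4 * (\<Sum>a\<le>p. e (2*a+1) * f (2*(p-a)) + e (2*a) * f (2*(p-a)+1)) - ?S1"
    unfolding n dd_form_odd xmul_even xmul_odd
    by (simp only: sum_subtractf sum.distrib minus_add_distrib ring_distribs sum_distrib_left)
      (simp add: algebra_simps)
  show ?thesis unfolding 1 2
    unfolding n sum_unshift_left[where u = u0 and E = "\<lambda>a. e (2*a)" and F = "\<lambda>a. f (2*a+1)"]
      sum_unshift_right[where E = "\<lambda>a. e (2*a+1)" and u = u1 and F = "\<lambda>a. f (2*a)"] by (simp add: algebra_simps)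
qed

lemma theta_expand: "theta f i = (\<Sum>j\<le>i+1. of_int (theta_coeff i j) * f j)"
proof (cases "even i")
  case True
  have "(\<Sum>j\<le>i+1. of_int (theta_coeff i j) * f j)
      = (\<Sum>j\<le>i+1. if j = i + 1 then of_nat (i+1) * f j else 0)"
    using True by (intro sum.cong) (auto simp: theta_coeff_def theta_def)
  then show ?thesis using True by (simp add: theta_def)
next
  case False
  then have "i \<ge> 1" by (metis even_zero less_one not_le)
  have "(\<Sum>j\<le>i+1. of_int (theta_coeff i j) * f j)
      = (\<Sum>j\<le>i+1. (if j = i - 3 then of_nat (i-1) * f j else 0)
          + (if j = i - 1 then 4 * of_nat i * f j else 0))"
    using False by (intro sum.cong refl) (auto simp: theta_coeff_def theta_def algebra_simps)
  moreover have "i - 3 \<le> i + 1" "i - 1 \<le> i + 1" by simp_all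
  ultimately show ?thesis using False by (simp add: theta_def sum.distrib del: sum.atMost_Suc)
qed

lemma theta_coeff_eq_0: "j > i + 1 \<or> i > j + 3 \<Longrightarrow> theta_coeff i j = 0"
  by (auto simp: theta_coeff_def theta_def)

lemma dd_coeff_eq_0: "i + j > n + 1 \<or> i + j + 3 < n \<Longrightarrow> dd_coeff n i j = 0"
  by (auto simp: dd_coeff_def)

lemma quad_coeff_eq_0: "k0 > k + l + 4 \<or> k > k0 \<or> l > k0 \<Longrightarrow> quad_coeff k0 k l = 0"
  by (auto simp: quad_coeff_def)

lemma lin_coeff_eq_0:
  assumes "k0 + j > k + 4 \<or> k > k0 + j + 4"
  shows "lin_coeff k0 j k = 0"
  unfolding lin_coeff_def
proof (rule sum.neutral, rule ballI)
  fix i assume "i \<in> {..k+3}"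
  then have "k0 + i > k + 3 \<or> k0 + i + 3 < k + 2 \<or> j > i + 1 \<or> i > j + 3" using assms by auto
  then show "dd_coeff (k + 2) k0 i * theta_coeff i j = 0"
    using dd_coeff_eq_0[where i = k0 and j = i and n = "k+2"]
      theta_coeff_eq_0[where i = i and j = j] by fastforce
qed

section \<open>The topological recursion for arrays of coefficients\<close>

text \<open>
  Up to the constant -1/2, the planar three-point function is the difference over
  \<open>\<epsilon> = \<plusminus>1\<close> of the product of the simple-pole functions \<open>1
  / (x - 2 \<epsilon>)\<close>, and \<open>1 / (x - 2 \<epsilon>) = (x + 2 \<epsilon>) /
  D\<close>.
\<close>

definition tri_value :: "complex \<Rightarrow> nat \<Rightarrow> complex" where
  "tri_value \<epsilon> k = (if k = 0 then 2 * \<epsilon> else if k = 1 then 1 else 0)"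

text \<open>
  The terms of the recursion in which only \<open>W\<^bsub>0,2\<^esub>\<close> occurs: they
  produce \<open>W\<^bsub>1,1\<^esub>\<close> and \<open>W\<^bsub>0,3\<^esub>\<close>.
\<close>

definition tr_base :: "nat \<Rightarrow> nat list \<Rightarrow> complex" where
  "tr_base g ks = (if g = 1 \<and> ks = [2] then -1
     else if g = 0 \<and> length ks = 3
       then - (1/2) * ((\<Prod>k\<leftarrow>ks. tri_value 1 k) - (\<Prod>k\<leftarrow>ks. tri_value (-1) k))
     else 0)"

text \<open>
  The topological recursion with the basis functions stripped off. The quadratic part comes from
  products of stable factors, the linear part from one factor
  \<open>W\<^bsub>0,2\<^esub>\<close>.
\<close>

function tr_coeff :: "nat \<Rightarrow> nat list \<Rightarrow> complex" where
  "tr_coeff g [] = 0"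
| "tr_coeff g (k0 # ks) =
    (if 2 * g + length ks < 2 then 0
     else tr_base g (k0 # ks)
       + (\<Sum>k\<in>{..k0}. \<Sum>l\<in>{..k0}. of_int (quad_coeff k0 k l) *
           ((if g = 0 then 0 else tr_coeff (g - 1) (k # l # ks)) +
            (\<Sum>g1\<in>{..g}. split_sum (\<lambda>u v. if g1 = 0 \<and> u = [] \<or> g - g1 = 0 \<and> v = [] then 0
               else tr_coeff g1 (k # u) * tr_coeff (g - g1) (l # v)) ks)))
       + pick_sum (\<lambda>j rest. \<Sum>k\<in>{..k0+j+4}. of_int (lin_coeff k0 j k) * tr_coeff g (k # rest)) ks)"
  by pat_completeness auto
termination
proof (relation "Wellfounded.measure (\<lambda>(g, ks). 2 * g + length ks)", goal_cases)
  case (3 g k0 ks k l g1 u v)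
  from 3(4-) mset_split_bounds(1)[of u v ks]
  have l: "length u + length v = length ks" by blast
  have "g1 < g \<or> g1 = g" using 3 by auto
  moreover have "v \<noteq> [] " if "g1 = g" using 3 that by auto
  ultimately show ?case using l by (cases v) auto
next
  case (4 g k0 ks k l g1 u v)
  from 4(4-) mset_split_bounds(1)[of u v ks]
  have l: "length u + length v = length ks" by blast
  have "g1 \<le> g" using 4 by auto
  moreover have "u \<noteq> [] " if "g1 = 0" using 4 that by auto
  ultimately show ?case using l by (cases u; cases g1) auto
next
  case (5 g k0 ks j rest k)
  then have "length ks = Suc (length rest)" using mset_pick_bounds(1)[of j rest ks] by simp
  then show ?case by simp
qed auto

lemmas [simp del] = tr_coeff.simps(2)

lemma tr_coeff_unstable: "2 * g + length ks < 3 \<Longrightarrow> tr_coeff g ks = 0"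
proof (cases ks)
  case (Cons k r)
  then show "2 * g + length ks < 3 \<Longrightarrow> tr_coeff g ks = 0" by (subst Cons, subst tr_coeff.simps(2)) simp
qed simp

lemma tr_coeff_Cons:
  assumes "2 * g + length ks \<ge> 2"
  shows "tr_coeff g (k0 # ks) = tr_base g (k0 # ks)
       + (\<Sum>k\<le>k0. \<Sum>l\<le>k0. of_int (quad_coeff k0 k l) *
           ((if g = 0 then 0 else tr_coeff (g - 1) (k # l # ks)) +
            (\<Sum>g1\<le>g. split_sum (\<lambda>u v. tr_coeff g1 (k # u) * tr_coeff (g - g1) (l # v)) ks)))
       + pick_sum (\<lambda>j rest. \<Sum>k\<le>k0+j+4. of_int (lin_coeff k0 j k) * tr_coeff g (k # rest)) ks"
proof -
  have "split_sum (\<lambda>u v. if g1 = 0 \<and> u = [] \<or> g - g1 = 0 \<and> v = [] then 0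
               else tr_coeff g1 (k # u) * tr_coeff (g - g1) (l # v)) ks
      = split_sum (\<lambda>u v. tr_coeff g1 (k # u) * tr_coeff (g - g1) (l # v)) ks" for g1 k l
    by (rule split_sum_cong) (auto simp: tr_coeff_unstable)
  then show ?thesis using assms by (subst tr_coeff.simps(2)) (simp only: not_less[symmetric] if_False)
qed

lemma tr_base_support: "tr_base g ks \<noteq> 0 \<Longrightarrow> sum_list ks + 8 \<le> 4 * (2 * g + length ks)"
proof -
  assume a: "tr_base g ks \<noteq> 0"
  show ?thesis
  proof (cases "g = 1 \<and> ks = [2]")
    case False
    with a have g: "g = 0" and l: "length ks = 3" by (auto simp: tr_base_def split: if_splits)
    from l obtain a b c where ks: "ks = [a, b, c]" by (auto simp: numeral_3_eq_3 length_Suc_conv)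
    have w: "tr_base g ks = - (1/2) * (tri_value 1 a * tri_value 1 b * tri_value 1 c
        - tri_value (-1) a * tri_value (-1) b * tri_value (-1) c)"
      unfolding ks g tr_base_def by simp
    have tri: "tri_value e k = 0" if "k \<ge> 2" for e k using that by (simp add: tri_value_def)
    have "\<not> (a \<ge> 2 \<or> b \<ge> 2 \<or> c \<ge> 2)" using a tri unfolding w by auto
    then show ?thesis unfolding ks g by simp
  qed simp
qed

text \<open>
  In each step of the recursion the sum of the indices grows by a bounded amount.
\<close>

lemma tr_coeff_support: "tr_coeff g ks \<noteq> 0 \<Longrightarrow> sum_list ks + 8 \<le> 4 * (2 * g + length ks)"
proof (induction "2 * g + length ks" arbitrary: g ks rule: less_induct)
  case less
  show ?case
  proof (cases ks)
    case Nil
    then show ?thesis using less.prems by simp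
  next
    case (Cons k0 r)
    show ?thesis
    proof (rule ccontr)
      assume *: "\<not> sum_list ks + 8 \<le> 4 * (2 * g + length ks)"
      have st: "2 * g + length r \<ge> 2"
        using less.prems tr_coeff_unstable[of g ks] unfolding Cons by (cases "2 * g + length r < 2") auto
      have b: "tr_base g (k0 # r) = 0" using tr_base_support * Cons by blast
      have q: "of_int (quad_coeff k0 k l) * ((if g = 0 then 0 else tr_coeff (g - 1) (k # l # r)) +
            (\<Sum>g1\<le>g. split_sum (\<lambda>u v. tr_coeff g1 (k # u) * tr_coeff (g - g1) (l # v)) r)) = 0" for k l
      proof (cases "quad_coeff k0 k l = 0")
        case False
        then have le: "k0 \<le> k + l + 4" using quad_coeff_eq_0 by (meson not_le)
        have "tr_coeff (g - 1) (k # l # r) = 0" if "g > 0"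
        proof (rule ccontr)
          assume "tr_coeff (g - 1) (k # l # r) \<noteq> 0"
          have m: "2 * (g - 1) + length (k # l # r) < 2 * g + length ks"
            unfolding Cons using that by simp
          show False using less.hyps[OF m \<open>tr_coeff (g - 1) (k # l # r) \<noteq> 0\<close>] that * le
            unfolding Cons by simp
        qed
        moreover have "tr_coeff g1 (k # u) * tr_coeff (g - g1) (l # v) = 0"
          if "g1 \<le> g" "mset u + mset v = mset r" for g1 u v
        proof (rule ccontr)
          assume a: "tr_coeff g1 (k # u) * tr_coeff (g - g1) (l # v) \<noteq> 0"
          then have a: "tr_coeff g1 (k # u) \<noteq> 0" "tr_coeff (g - g1) (l # v) \<noteq> 0" by auto
          have s: "2 * g1 + length u \<ge> 2"
            using a(1) tr_coeff_unstable[of g1 "k # u"] by (cases "2 * g1 + length u < 2") auto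
          have s': "2 * (g - g1) + length v \<ge> 2"
            using a(2) tr_coeff_unstable[of "g - g1" "l # v"] by (cases "2 * (g - g1) + length v < 2") auto
          have len: "length u + length v = length r" using mset_split_bounds(1)[OF that(2)] .
          have sl: "sum_list r = sum_list u + sum_list v"
            using that(2) by (metis sum_mset.union sum_mset_sum_list)
          have m1: "2 * g1 + length (k # u) < 2 * g + length ks"
            and m2: "2 * (g - g1) + length (l # v) < 2 * g + length ks"
            unfolding Cons using s s' len that(1) by auto
          show False using less.hyps[OF m1 a(1)] less.hyps[OF m2 a(2)] * le that(1) len sl
            unfolding Cons by auto
        qed
        then have "split_sum (\<lambda>u v. tr_coeff g1 (k # u) * tr_coeff (g - g1) (l # v)) r = 0" if "g1 \<le> g" for g1
          using that split_sum_cong_mset[of r "\<lambda>u v. tr_coeff g1 (k # u) * tr_coeff (g - g1) (l # v)" "\<lambda>_ _. 0"]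
          by simp
        ultimately show ?thesis by simp
      qed simp
      have p: "of_int (lin_coeff k0 j k) * tr_coeff g (k # rest) = 0" if "mset (j # rest) = mset r" for j k rest
      proof (rule ccontr)
        assume "\<not> ?thesis"
        then have a: "lin_coeff k0 j k \<noteq> 0" "tr_coeff g (k # rest) \<noteq> 0" by auto
        then have le: "k0 + j \<le> k + 4" using lin_coeff_eq_0 by (meson not_le)
        note mp = mset_pick_bounds[OF that] sum_list_pick[OF that]
        have "2 * g + length (k # rest) < 2 * g + length ks" unfolding Cons using mp by simp
        from less.hyps[OF this a(2)] show False using * le mp unfolding Cons by auto
      qed
      have "pick_sum (\<lambda>j rest. \<Sum>k\<le>k0+j+4. of_int (lin_coeff k0 j k) * tr_coeff g (k # rest)) r = 0"
        using pick_sum_cong_mset[of r "\<lambda>j rest. \<Sum>k\<le>k0+j+4. of_int (lin_coeff k0 j k) * tr_coeff g (k # rest)"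
            "\<lambda>_ _. 0"] p by simp
      then have "tr_coeff g ks = 0" unfolding Cons tr_coeff_Cons[OF st] b q by simp
      then show False using less.prems by simp
    qed
  qed
qed

text \<open>
  The one-point functions only involve basis functions with poles of order at least four. This
  excludes \<open>w\<^sub>0\<close>, for which the residue against \<open>\<Phi>\<close> does
  not follow the general pattern.
\<close>

lemma tr_coeff_root_ge_2: "tr_coeff g [k] \<noteq> 0 \<Longrightarrow> k \<ge> 2"
proof -
  assume a: "tr_coeff g [k] \<noteq> 0"
  then have st: "2 * g + length ([]::nat list) \<ge> 2" using tr_coeff_unstable[of g "[k]"] by (cases g) auto
  show "k \<ge> 2"
  proof (rule ccontr)
    assume k: "\<not> k \<ge> 2"
    have "quad_coeff k i j = 0" for i j
    proof -
      have "odd i \<Longrightarrow> odd j \<Longrightarrow> i + j \<ge> 2" using odd_pos[of i] odd_pos[of j] by simp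
      then show ?thesis using k by (auto simp: quad_coeff_def)
    qed
    moreover have "tr_base g [k] = 0" using k by (auto simp: tr_base_def)
    ultimately show False using a unfolding tr_coeff_Cons[OF st] by simp
  qed
qed

abbreviation tr_slot :: "('p \<Rightarrow> nat \<Rightarrow> complex) \<Rightarrow> nat \<Rightarrow> nat \<Rightarrow> nat \<Rightarrow> 'p list \<Rightarrow> complex" where
  "tr_slot M K g k ps \<equiv> contract M K (\<lambda>ks. tr_coeff g (k # ks)) ps"

definition tr_pair :: "('p \<Rightarrow> nat \<Rightarrow> complex) \<Rightarrow> nat \<Rightarrow> nat \<Rightarrow> nat \<Rightarrow> nat \<Rightarrow> 'p list \<Rightarrow> complex" where
  "tr_pair M K g k l ps = (if g = 0 then 0 else contract M K (\<lambda>ks. tr_coeff (g - 1) (k # l # ks)) ps)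
     + (\<Sum>g1\<le>g. split_sum (\<lambda>u v. tr_slot M K g1 k u * tr_slot M K (g - g1) l v) ps)"

lemma tr_slot_unstable: "2 * g + length ps < 2 \<Longrightarrow> tr_slot M K g k ps = 0"
  by (rule contract_0) (simp add: tr_coeff_unstable)

lemma tr_slot_eq_0: "k + 4 > 4 * (2 * g + length ps) \<Longrightarrow> tr_slot M K g k ps = 0"
proof (rule contract_0)
  fix ks :: "nat list" assume "k + 4 > 4 * (2 * g + length ps)" "length ks = length ps"
  then show "tr_coeff g (k # ks) = 0" using tr_coeff_support[of g "k # ks"] by fastforce
qed

lemma tr_pair_eq_0:
  assumes "k + l + 4 \<ge> 4 * (2 * g + length ps)"
  shows "tr_pair M K g k l ps = 0"
proof -
  have "contract M K (\<lambda>ks. tr_coeff (g - 1) (k # l # ks)) ps = 0" if "g \<noteq> 0"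
  proof (rule contract_0)
    fix ks :: "nat list" assume "length ks = length ps"
    then show "tr_coeff (g - 1) (k # l # ks) = 0"
      using tr_coeff_support[of "g - 1" "k # l # ks"] assms that by fastforce
  qed
  moreover have "split_sum (\<lambda>u v. tr_slot M K g1 k u * tr_slot M K (g - g1) l v) ps
      = split_sum (\<lambda>u v. 0) ps" if "g1 \<le> g" for g1
  proof (rule split_sum_cong[OF refl])
    fix u v assume "mset u + mset v = mset ps"
    note len = mset_split_bounds(1)[OF this]
    have "4 * (2 * g1 + length u) + 4 * (2 * (g - g1) + length v) = 4 * (2 * g + length ps)"
      using len that by simp
    then have "k + 4 > 4 * (2 * g1 + length u) \<or> l + 4 > 4 * (2 * (g - g1) + length v)"
      using assms by (cases "k + 4 > 4 * (2 * g1 + length u)") simp_all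
    then show "tr_slot M K g1 k u * tr_slot M K (g - g1) l v = 0"
      using tr_slot_eq_0[of g1 u k M K] tr_slot_eq_0[of "g - g1" v l M K] by auto
  qed
  ultimately show ?thesis by (simp add: tr_pair_def)
qed

lemma sum_quad_coeff:
  assumes "k + l + 4 < K"
  shows "(\<Sum>k0<K. if k \<le> k0 \<and> l \<le> k0 then e k0 * of_int (quad_coeff k0 k l) else 0)
    = quad_form e k l" (is "?L = _")
proof (cases "odd k \<and> odd l")
  case True
  have "?L = (\<Sum>k0<K. (if k0 = k + l then - e k0 else 0)
      + (if k0 = k + l + 2 then - 4 * e k0 else 0))"
    using True by (intro sum.cong) (auto simp: quad_coeff_def)
  then show ?thesis using True assms by (simp add: sum.distrib quad_form_def)
next
  case False
  have "?L = (\<Sum>k0<K. if k0 = k + l + 4 then - e k0 else 0)"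
    using False by (intro sum.cong) (auto simp: quad_coeff_def)
  then show ?thesis using assms unfolding quad_form_def if_not_P[OF False] by simp
qed

lemma sum_lin_coeff:
  assumes "k + 4 < K"
  shows "(\<Sum>k0<K. \<Sum>j<K. if k \<le> k0 + j + 4 then e k0 * (f j * of_int (lin_coeff k0 j k)) else 0)
    = dd_form (k + 2) e (theta f)" (is "?L = _")
proof -
  have th: "(\<Sum>j<K. f j * of_int (theta_coeff i j)) = theta f i" if "i \<le> k + 3" for i
    unfolding theta_expand[of f]
    by (rule sum.mono_neutral_cong_right) (use that assms in \<open>auto simp: theta_coeff_eq_0 mult.commute\<close>)
  have "?L = (\<Sum>k0<K. \<Sum>j<K. e k0 * (f j * of_int (lin_coeff k0 j k)))"
    by (intro sum.cong refl) (simp add: lin_coeff_eq_0)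
  also have "\<dots> = (\<Sum>k0<K. \<Sum>j<K. \<Sum>i\<le>k+3.
        of_int (dd_coeff (k + 2) k0 i) * (e k0 * (f j * of_int (theta_coeff i j))))"
    by (simp add: lin_coeff_def sum_distrib_left mult_ac)
  also have "\<dots> = (\<Sum>k0<K. \<Sum>i\<le>k+3. \<Sum>j<K.
        of_int (dd_coeff (k + 2) k0 i) * (e k0 * (f j * of_int (theta_coeff i j))))"
    by (intro sum.cong refl sum.swap)
  also have "\<dots> = (\<Sum>k0<K. \<Sum>i\<le>k+3. of_int (dd_coeff (k + 2) k0 i) * (e k0 * theta f i))"
    by (intro sum.cong refl) (simp add: th sum_distrib_left[symmetric])
  also have "\<dots> = (\<Sum>k0\<le>k+3. \<Sum>i\<le>k+3. of_int (dd_coeff (k + 2) k0 i) * (e k0 * theta f i))"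
    by (rule sum.mono_neutral_right) (use assms in \<open>auto simp: dd_coeff_eq_0\<close>)
  finally show ?thesis by (simp add: dd_form_def add.commute numeral_3_eq_3)
qed

text \<open>
  The recursion for arrays, contracted with arbitrary vectors. Values at points and moments at
  infinity are both obtained from it.
\<close>

theorem contract_tr_coeff:
  assumes st: "2 * g + length ps \<ge> 2" and K: "4 * (2 * g + length ps) < K"
  shows "contract M K (tr_coeff g) (p # ps) = contract M K (tr_base g) (p # ps)
     + (\<Sum>k<K. \<Sum>l<K. quad_form (M p) k l * tr_pair M K g k l ps)
     + pick_sum (\<lambda>q qs. \<Sum>k<K. dd_form (k + 2) (M p) (theta (M q)) * tr_slot M K g k qs) ps"
proof -
  define X where "X = (\<lambda>k l ks. (if g = 0 then 0 else tr_coeff (g - 1) (k # l # ks)) +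
            (\<Sum>g1\<le>g. split_sum (\<lambda>u v. tr_coeff g1 (k # u) * tr_coeff (g - g1) (l # v)) ks))"
  let ?Q = "\<lambda>k0 k l. if k \<le> k0 \<and> l \<le> k0 then of_int (quad_coeff k0 k l) else (0::complex)"
  let ?L = "\<lambda>k0 j k. if k \<le> k0 + j + 4 then of_int (lin_coeff k0 j k) else (0::complex)"
  have X: "contract M K (\<lambda>ks. X k l ks) ps = tr_pair M K g k l ps" for k l
    unfolding tr_pair_def X_def contract_add contract_sum contract_split
    by (cases "g = 0") (simp_all add: contract_0)
  have Y: "contract M K (\<lambda>ks. pick_sum (\<lambda>j rest. ?L k0 j k * tr_coeff g (k # rest)) ks) ps
      = pick_sum (\<lambda>q qs. (\<Sum>j<K. M q j * ?L k0 j k) * tr_slot M K g k qs) ps" for k0 k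
    by (rule contract_pick)
  have "contract M K (\<lambda>ks. tr_coeff g (k0 # ks)) ps
     = contract M K (\<lambda>ks. tr_base g (k0 # ks)
       + (\<Sum>k<K. \<Sum>l<K. ?Q k0 k l * X k l ks)
       + (\<Sum>k<K. pick_sum (\<lambda>j rest. ?L k0 j k * tr_coeff g (k # rest)) ks)) ps" if "k0 < K" for k0
  proof (rule contract_cong)
    fix ks assume ks: "length ks = length ps" "set ks \<subseteq> {..<K}"
    have st': "2 * g + length ks \<ge> 2" using st ks by simp
    have 1: "(\<Sum>k\<le>k0. \<Sum>l\<le>k0. of_int (quad_coeff k0 k l) * X k l ks)
        = (\<Sum>k<K. \<Sum>l<K. ?Q k0 k l * X k l ks)"
    proof (rule sum.mono_neutral_cong_left)
      fix k assume "k \<in> {..k0}"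
      then show "(\<Sum>l\<le>k0. of_int (quad_coeff k0 k l) * X k l ks) = (\<Sum>l<K. ?Q k0 k l * X k l ks)"
        by (intro sum.mono_neutral_cong_left) (use that in auto)
    qed (use that in auto)
    have 2: "pick_sum (\<lambda>j rest. \<Sum>k\<le>k0+j+4. of_int (lin_coeff k0 j k) * tr_coeff g (k # rest)) ks
        = pick_sum (\<lambda>j rest. \<Sum>k<K. ?L k0 j k * tr_coeff g (k # rest)) ks"
    proof (rule pick_sum_cong[OF refl])
      fix j rest assume "mset (j # rest) = mset ks"
      then have len: "length ks = Suc (length rest)" by (rule mset_pick_bounds(1))
      have z: "tr_coeff g (k # rest) = 0" if "k \<ge> K" for k
        using tr_coeff_support[of g "k # rest"] that K ks(1) len by fastforce
      have "(\<Sum>k\<le>k0+j+4. of_int (lin_coeff k0 j k) * tr_coeff g (k # rest))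
          = (\<Sum>k\<in>{..k0+j+4} \<union> {..<K}. ?L k0 j k * tr_coeff g (k # rest))"
        by (rule sum.mono_neutral_cong_left) auto
      also have "\<dots> = (\<Sum>k<K. ?L k0 j k * tr_coeff g (k # rest))"
        by (rule sum.mono_neutral_right) (auto simp: z)
      finally show "(\<Sum>k\<le>k0+j+4. of_int (lin_coeff k0 j k) * tr_coeff g (k # rest))
          = (\<Sum>k<K. ?L k0 j k * tr_coeff g (k # rest))" .
    qed
    show "tr_coeff g (k0 # ks) = tr_base g (k0 # ks)
       + (\<Sum>k<K. \<Sum>l<K. ?Q k0 k l * X k l ks)
       + (\<Sum>k<K. pick_sum (\<lambda>j rest. ?L k0 j k * tr_coeff g (k # rest)) ks)"
      using 1 by (simp only: tr_coeff_Cons[OF st'] 2 pick_sum_sum X_def)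
  qed
  then have "contract M K (tr_coeff g) (p # ps) = (\<Sum>k0<K. M p k0 * (contract M K (\<lambda>ks. tr_base g (k0 # ks)) ps
       + (\<Sum>k<K. \<Sum>l<K. ?Q k0 k l * tr_pair M K g k l ps)
       + (\<Sum>k<K. pick_sum (\<lambda>q qs. (\<Sum>j<K. M q j * ?L k0 j k) * tr_slot M K g k qs) ps)))"
    unfolding contract.simps
    by (intro sum.cong refl) (simp only: lessThan_iff contract_add contract_sum contract_cmult X Y)
  also have "\<dots> = contract M K (tr_base g) (p # ps)
       + (\<Sum>k0<K. \<Sum>k<K. \<Sum>l<K. M p k0 * ?Q k0 k l * tr_pair M K g k l ps)
       + (\<Sum>k0<K. \<Sum>k<K. pick_sum (\<lambda>q qs. (\<Sum>j<K. M p k0 * (M q j * ?L k0 j k)) * tr_slot M K g k qs) ps)"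
  proof -
    have 1: "M p k0 * (\<Sum>k<K. \<Sum>l<K. ?Q k0 k l * tr_pair M K g k l ps)
        = (\<Sum>k<K. \<Sum>l<K. M p k0 * ?Q k0 k l * tr_pair M K g k l ps)" for k0
      by (simp only: sum_distrib_left mult.assoc)
    have 2: "M p k0 * (\<Sum>k<K. pick_sum (\<lambda>q qs. (\<Sum>j<K. M q j * ?L k0 j k) * tr_slot M K g k qs) ps)
        = (\<Sum>k<K. pick_sum (\<lambda>q qs. (\<Sum>j<K. M p k0 * (M q j * ?L k0 j k)) * tr_slot M K g k qs) ps)"
      for k0
      unfolding sum_distrib_left[of "M p k0"] pick_sum_cmult[symmetric] mult.assoc[symmetric] ..
    show ?thesis by (simp only: contract.simps distrib_left sum.distrib 1 2)
  qed
  also have "(\<Sum>k0<K. \<Sum>k<K. \<Sum>l<K. M p k0 * ?Q k0 k l * tr_pair M K g k l ps)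
      = (\<Sum>k<K. \<Sum>l<K. quad_form (M p) k l * tr_pair M K g k l ps)"
  proof -
    have "(\<Sum>k0<K. \<Sum>k<K. \<Sum>l<K. M p k0 * ?Q k0 k l * tr_pair M K g k l ps)
      = (\<Sum>k<K. \<Sum>l<K. \<Sum>k0<K. M p k0 * ?Q k0 k l * tr_pair M K g k l ps)"
      by (subst sum.swap) (intro sum.cong refl sum.swap)
    also have "\<dots> = (\<Sum>k<K. \<Sum>l<K. quad_form (M p) k l * tr_pair M K g k l ps)"
    proof (intro sum.cong refl)
      fix k l
      show "(\<Sum>k0<K. M p k0 * ?Q k0 k l * tr_pair M K g k l ps)
          = quad_form (M p) k l * tr_pair M K g k l ps"
      proof (cases "k + l + 4 < K")
        case True
        have "(\<Sum>k0<K. M p k0 * ?Q k0 k l)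
          = (\<Sum>k0<K. if k \<le> k0 \<and> l \<le> k0 then M p k0 * of_int (quad_coeff k0 k l) else 0)"
          by (intro sum.cong) auto
        then show ?thesis using sum_quad_coeff[OF True, of "M p"] by (simp add: sum_distrib_right[symmetric])
      qed (use tr_pair_eq_0[of g ps k l M K] K in simp)
    qed
    finally show ?thesis .
  qed
  also have "(\<Sum>k0<K. \<Sum>k<K. pick_sum (\<lambda>q qs. (\<Sum>j<K. M p k0 * (M q j * ?L k0 j k)) * tr_slot M K g k qs) ps)
      = pick_sum (\<lambda>q qs. \<Sum>k<K. (\<Sum>k0<K. \<Sum>j<K. M p k0 * (M q j * ?L k0 j k)) * tr_slot M K g k qs) ps"
    unfolding pick_sum_sum[symmetric] sum_distrib_right
    by (rule pick_sum_cong[OF refl]) (rule sum.swap)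
  also have "\<dots> = pick_sum (\<lambda>q qs. \<Sum>k<K. dd_form (k + 2) (M p) (theta (M q)) * tr_slot M K g k qs) ps"
  proof (rule pick_sum_cong[OF refl], rule sum.cong[OF refl])
    fix q qs k assume "mset (q # qs) = mset ps"
    then have len: "length ps = Suc (length qs)" by (rule mset_pick_bounds(1))
    show "(\<Sum>k0<K. \<Sum>j<K. M p k0 * (M q j * ?L k0 j k)) * tr_slot M K g k qs
        = dd_form (k + 2) (M p) (theta (M q)) * tr_slot M K g k qs"
    proof (cases "k + 4 < K")
      case True
      have "(\<Sum>k0<K. \<Sum>j<K. M p k0 * (M q j * ?L k0 j k)) = (\<Sum>k0<K. \<Sum>j<K.
          if k \<le> k0 + j + 4 then M p k0 * (M q j * of_int (lin_coeff k0 j k)) else 0)"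
        by (intro sum.cong refl) auto
      then show ?thesis unfolding sum_lin_coeff[OF True] by simp
    qed (use tr_slot_eq_0[of g qs k M K] K len in simp)
  qed
  finally show ?thesis .
qed

section \<open>The basis functions and residues at the ramification points\<close>

definition joukowski :: "complex \<Rightarrow> complex" where "joukowski z = z + 1 / z"

text \<open>The functions \<open>w\<^sub>k\<close> as functions of x.\<close>

definition basis_fun :: "nat \<Rightarrow> complex \<Rightarrow> complex" where
  "basis_fun k x = x ^ (k mod 2) / (x\<^sup>2 - 4) ^ (k div 2 + 1)"

definition punct_holo :: "(complex \<Rightarrow> complex) \<Rightarrow> bool" where
  "punct_holo f \<longleftrightarrow> (\<forall>r\<in>{1, -1}. \<exists>e>0. f holomorphic_on ball r e - {r})"

definition res_sum :: "(complex \<Rightarrow> complex) \<Rightarrow> complex" where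
  "res_sum f = (\<Sum>r\<in>{1, -1}. residue f r)"

lemma punct_holo_common:
  assumes "punct_holo f" "punct_holo g" "r \<in> {1, -1}"
  obtains e where "e > 0" "f holomorphic_on ball r e - {r}" "g holomorphic_on ball r e - {r}"
proof -
  from assms obtain e1 e2 where "e1 > 0" "e2 > 0" "f holomorphic_on ball r e1 - {r}"
    "g holomorphic_on ball r e2 - {r}" unfolding punct_holo_def by blast
  then show ?thesis
    by (intro that[of "min e1 e2"]) (auto intro: holomorphic_on_subset)
qed

lemma punct_holo_add: "punct_holo f \<Longrightarrow> punct_holo g \<Longrightarrow> punct_holo (\<lambda>z. f z + g z)"
  unfolding punct_holo_def[of "\<lambda>z. f z + g z"]
  by (metis punct_holo_common holomorphic_on_add)

lemma punct_holo_mult: "punct_holo f \<Longrightarrow> punct_holo g \<Longrightarrow> punct_holo (\<lambda>z. f z * g z)"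
  unfolding punct_holo_def[of "\<lambda>z. f z * g z"]
  by (metis punct_holo_common holomorphic_on_mult)

lemma punct_holo_analytic:
  assumes "f analytic_on {1, -1}"
  shows "punct_holo f"
  unfolding punct_holo_def
proof
  fix r :: complex assume "r \<in> {1, -1}"
  then have "f analytic_on {r}" using assms analytic_on_subset by blast
  then obtain e where "e > 0" "f holomorphic_on ball r e" by (auto simp: analytic_at_ball)
  then show "\<exists>e>0. f holomorphic_on ball r e - {r}" by (auto intro: holomorphic_on_subset)
qed

lemma punct_holo_const [simp]: "punct_holo (\<lambda>z. c)"
  by (rule punct_holo_analytic) auto

lemma punct_holo_sum: "(\<And>i. i \<in> A \<Longrightarrow> punct_holo (f i)) \<Longrightarrow> punct_holo (\<lambda>z. \<Sum>i\<in>A. f i z)"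
  by (induction A rule: infinite_finite_induct) (auto intro: punct_holo_add)

lemma res_sum_add:
  assumes "punct_holo f" "punct_holo g"
  shows "res_sum (\<lambda>z. f z + g z) = res_sum f + res_sum g"
proof -
  have "residue (\<lambda>z. f z + g z) r = residue f r + residue g r" if r: "r \<in> {1, -1}" for r
  proof -
    obtain e where "e > 0" "f holomorphic_on ball r e - {r}" "g holomorphic_on ball r e - {r}"
      using punct_holo_common[OF assms r] .
    then show ?thesis by (intro residue_add[of "ball r e"]) auto
  qed
  then show ?thesis unfolding res_sum_def by (simp add: sum.distrib[symmetric])
qed

lemma res_sum_cmult:
  assumes "punct_holo f"
  shows "res_sum (\<lambda>z. c * f z) = c * res_sum f"
proof -
  have "residue (\<lambda>z. c * f z) r = c * residue f r" if r: "r \<in> {1, -1}" for r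
  proof -
    obtain e where "e > 0" "f holomorphic_on ball r e - {r}"
      using punct_holo_common[OF assms assms r] .
    then show ?thesis by (intro residue_lmul[of "ball r e"]) auto
  qed
  then show ?thesis unfolding res_sum_def by (simp add: distrib_left)
qed

lemma res_sum_analytic:
  assumes "f analytic_on {1, -1}"
  shows "res_sum f = 0"
proof -
  have "residue f r = 0" if "r \<in> {1, -1}" for r
  proof -
    have "f analytic_on {r}" using assms that analytic_on_subset by blast
    then obtain e where "e > 0" "f holomorphic_on ball r e" by (auto simp: analytic_at_ball)
    then show ?thesis by (intro residue_holo[of "ball r e"]) auto
  qed
  then show ?thesis unfolding res_sum_def by simp
qed

lemma res_sum_sum:
  "(\<And>i. i \<in> A \<Longrightarrow> punct_holo (f i)) \<Longrightarrow> res_sum (\<lambda>z. \<Sum>i\<in>A. f i z) = (\<Sum>i\<in>A. res_sum (f i))"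
  by (induction A rule: infinite_finite_induct)
    (simp_all add: res_sum_add punct_holo_sum res_sum_analytic)

lemma res_sum_pick:
  assumes "\<And>y ys. y \<in> set xs \<Longrightarrow> punct_holo (f y ys)"
  shows "punct_holo (\<lambda>z. pick_sum (\<lambda>y ys. f y ys z) xs)
    \<and> res_sum (\<lambda>z. pick_sum (\<lambda>y ys. f y ys z) xs) = pick_sum (\<lambda>y ys. res_sum (f y ys)) xs"
  using assms
proof (induction xs arbitrary: f)
  case (Cons x xs)
  have "punct_holo (\<lambda>z. pick_sum (\<lambda>y ys. f y (x # ys) z) xs)"
    "res_sum (\<lambda>z. pick_sum (\<lambda>y ys. f y (x # ys) z) xs) = pick_sum (\<lambda>y ys. res_sum (f y (x # ys))) xs"
    using Cons.IH[of "\<lambda>y ys. f y (x # ys)"] Cons.prems by auto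
  then show ?case using Cons.prems by (simp add: punct_holo_add res_sum_add)
qed (simp add: res_sum_analytic)

lemma res_sum_cong:
  assumes "\<And>r. r \<in> {1, -1} \<Longrightarrow> eventually (\<lambda>z. f z = g z) (at r)"
  shows "res_sum f = res_sum g"
  unfolding res_sum_def using assms by (intro sum.cong refl residue_cong) auto

text \<open>
  Integrate around a small circle. All evaluations of residues below are integrations by parts
  that rest on this.
\<close>

lemma residue_deriv_eq_0:
  assumes "e > 0" "\<And>z. z \<in> ball r e - {r} \<Longrightarrow> (f has_field_derivative f' z) (at z)"
  shows "residue f' r = 0"
proof -
  have hol: "f holomorphic_on ball r e - {r}"
    unfolding holomorphic_on_def field_differentiable_def
    using assms(2) has_field_derivative_at_within by blast
  have "deriv f holomorphic_on ball r e - {r}"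
    by (rule holomorphic_deriv[OF hol]) (auto intro: open_delete)
  moreover have "deriv f z = f' z" if "z \<in> ball r e - {r}" for z
    using DERIV_imp_deriv[OF assms(2)[OF that]] .
  ultimately have hol': "f' holomorphic_on ball r e - {r}"
    using holomorphic_cong[OF refl, of "ball r e - {r}" "deriv f" f'] by auto
  have "(f' has_contour_integral 2 * pi * \<i> * residue f' r) (circlepath r (e/2))"
    by (rule base_residue[of "ball r e"]) (use assms(1) hol' in auto)
  moreover have "(f' has_contour_integral 0) (circlepath r (e/2))"
  proof (rule Cauchy_theorem_primitive[of "ball r e - {r}" f])
    show "\<And>x. x \<in> ball r e - {r} \<Longrightarrow> (f has_field_derivative f' x) (at x within ball r e - {r})"
      using assms(2) has_field_derivative_at_within by blast
  qed (use assms(1) in \<open>auto simp: path_image_circlepath dist_commute dist_norm\<close>)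
  ultimately have "2 * pi * \<i> * residue f' r = 0" using has_contour_integral_unique by blast
  then show ?thesis by simp
qed

lemma res_sum_deriv:
  assumes "e > 0" "\<And>r z. r \<in> {1, -1} \<Longrightarrow> z \<in> ball r e - {r} \<Longrightarrow> (f has_field_derivative f' z) (at z)"
  shows "res_sum f' = 0"
  unfolding res_sum_def using residue_deriv_eq_0[OF assms(1) assms(2)] by simp

text \<open>Points away from the poles of the correlation functions.\<close>

definition regular_pt :: "complex \<Rightarrow> bool" where
  "regular_pt z \<longleftrightarrow> z \<noteq> 0 \<and> z \<noteq> 1 \<and> z \<noteq> -1"

lemma regular_ball: "r \<in> {1, -1} \<Longrightarrow> z \<in> ball r 1 - {r} \<Longrightarrow> regular_pt z"
proof -
  assume "r \<in> {1, -1}" "z \<in> ball r 1 - {r}"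
  then show ?thesis unfolding regular_pt_def by (auto simp: dist_norm)
qed

lemma joukowski_sq: "z \<noteq> 0 \<Longrightarrow> (joukowski z)\<^sup>2 - 4 = (z - 1 / z)\<^sup>2"
  by (simp add: joukowski_def power2_eq_square field_simps)

lemma regular_conj_diff: "regular_pt z \<Longrightarrow> z - 1 / z \<noteq> 0"
  by (auto simp: regular_pt_def field_simps square_eq_1_iff)

lemma regular_D: "regular_pt z \<Longrightarrow> (joukowski z)\<^sup>2 - 4 \<noteq> 0"
  using joukowski_sq[of z] regular_conj_diff[of z] by (simp add: regular_pt_def)

lemma D_factor: "(x::complex)\<^sup>2 - 4 = (x - 2) * (x + 2)"
  by (simp add: power2_eq_square algebra_simps)

lemma joukowski_ramification: "r \<in> {1, -1} \<Longrightarrow> joukowski r = 2 * r"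
  by (auto simp: joukowski_def)

lemma joukowski_DERIV: "z \<noteq> 0 \<Longrightarrow> (joukowski has_field_derivative (1 - 1 / z\<^sup>2)) (at z)"
  unfolding joukowski_def[abs_def] by (auto intro!: derivative_eq_intros simp: power2_eq_square)

lemma joukowski_analytic: "joukowski analytic_on {1, -1}"
  unfolding joukowski_def[abs_def] by (auto intro!: analytic_intros)

lemma joukowski_DERIV': "1 - 1 / z\<^sup>2 = (z - 1 / z) / z" if "z \<noteq> 0" for z :: complex
  using that by (simp add: field_simps power2_eq_square)

lemma basis_fun_even: "basis_fun (2 * m) x = 1 / (x\<^sup>2 - 4) ^ (m + 1)"
  and basis_fun_odd: "basis_fun (2 * m + 1) x = x / (x\<^sup>2 - 4) ^ (m + 1)"
  by (simp_all add: basis_fun_def)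

lemma basis_fun_xmul:
  assumes "x\<^sup>2 - 4 \<noteq> 0"
  shows "xmul 1 (\<lambda>k. basis_fun k x) i = x * basis_fun i x"
proof (cases "even i")
  case True
  then obtain m where "i = 2 * m" by blast
  then show ?thesis by (simp only: xmul_even basis_fun_even basis_fun_odd) simp
next
  case False
  then obtain m where i: "i = 2 * m + 1" by (elim oddE)
  define D where "D = x\<^sup>2 - 4"
  have D: "D \<noteq> 0" "x * x = D + 4" using assms by (simp_all add: D_def power2_eq_square)
  show ?thesis
  proof (cases m)
    case 0
    then show ?thesis unfolding i by (simp only: xmul_odd basis_fun_even basis_fun_odd D_def[symmetric])
        (use D in \<open>simp add: field_simps\<close>)
  next
    case (Suc n)
    then show ?thesis unfolding i by (simp only: xmul_odd basis_fun_even basis_fun_odd D_def[symmetric])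
        (use D in \<open>simp add: field_simps basis_fun_even D_def[symmetric]\<close>)
  qed
qed

lemma basis_fun_quad:
  assumes "x\<^sup>2 - 4 \<noteq> 0"
  shows "quad_form (\<lambda>k. basis_fun k x) k l = - (basis_fun k x * basis_fun l x) / (x\<^sup>2 - 4)"
proof -
  define D where "D = x\<^sup>2 - 4"
  have D: "D \<noteq> 0" "x * x = D + 4" using assms by (simp_all add: D_def power2_eq_square)
  have c: "basis_fun (2 * m) x = 1 / D ^ (m + 1)" "basis_fun (2 * m + 1) x = x / D ^ (m + 1)" for m
    by (simp_all only: basis_fun_even basis_fun_odd D_def)
  obtain a where "k = 2 * a \<or> k = 2 * a + 1" by (metis evenE oddE)
  moreover obtain b where "l = 2 * b \<or> l = 2 * b + 1" by (metis evenE oddE)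
  moreover have "quad_form (\<lambda>k. basis_fun k x) (2*a) (2*b) = - (basis_fun (2*a) x * basis_fun (2*b) x) / D"
  proof -
    have e: "2*a + 2*b + 4 = 2 * (a + b + 2)" by simp
    show ?thesis using D(1) unfolding quad_form_def e c by (simp add: power_add power2_eq_square)
  qed
  moreover have "quad_form (\<lambda>k. basis_fun k x) (2*a+1) (2*b) = - (basis_fun (2*a+1) x * basis_fun (2*b) x) / D"
  proof -
    have e: "2*a + 1 + 2*b + 4 = 2 * (a + b + 2) + 1" by simp
    show ?thesis using D(1) unfolding quad_form_def e c by (simp add: power_add power2_eq_square)
  qed
  moreover have "quad_form (\<lambda>k. basis_fun k x) (2*a) (2*b+1) = - (basis_fun (2*a) x * basis_fun (2*b+1) x) / D"
  proof -
    have e: "2*a + (2*b + 1) + 4 = 2 * (a + b + 2) + 1" by simp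
    show ?thesis using D(1) unfolding quad_form_def e c by (simp add: power_add power2_eq_square)
  qed
  moreover have "quad_form (\<lambda>k. basis_fun k x) (2*a+1) (2*b+1) = - (basis_fun (2*a+1) x * basis_fun (2*b+1) x) / D"
  proof -
    have e: "2*a+1 + (2*b+1) = 2 * (a + b + 1)" "2 * (a + b + 1) + 2 = 2 * (a + b + 2)" by simp_all
    have "quad_form (\<lambda>k. basis_fun k x) (2*a+1) (2*b+1) = - 1 / D ^ (a + b + 2) - 4 * (1 / D ^ (a + b + 3))"
      unfolding quad_form_def e c by (simp add: numeral_3_eq_3)
    also have "\<dots> = - (D + 4) / D ^ (a + b + 3)"
      using D by (simp add: field_simps numeral_3_eq_3 numeral_2_eq_2)
    also have "\<dots> = - (x * x) / (D ^ (a + 1) * D ^ (b + 1) * D)"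
      unfolding D(2) by (simp add: power_add numeral_3_eq_3 mult_ac)
    finally show ?thesis unfolding c by (simp add: mult_ac)
  qed
  ultimately show ?thesis unfolding D_def[symmetric] by auto
qed

lemma dd_form_cmult_right: "dd_form n e (\<lambda>j. c * f j) = c * dd_form n e f"
  unfolding dd_form_def sum_distrib_left by (intro sum.cong refl) (simp add: mult_ac)

lemma dd_form_cmult_left: "dd_form n (\<lambda>j. c * e j) f = c * dd_form n e f"
  unfolding dd_form_def sum_distrib_left by (intro sum.cong refl) (simp add: mult_ac)

lemma dd_form_add_right: "dd_form n e (\<lambda>j. f j + h j) = dd_form n e f + dd_form n e h"
  unfolding dd_form_def sum.distrib[symmetric] by (intro sum.cong refl) (simp add: algebra_simps)

lemma basis_fun_dd:
  assumes "x\<^sup>2 - 4 \<noteq> 0" "y\<^sup>2 - 4 \<noteq> 0"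
  shows "(y - x) * dd_form n (\<lambda>k. basis_fun k x) (\<lambda>k. basis_fun k y) = basis_fun n y - basis_fun n x"
proof -
  have "xmul 1 (\<lambda>k. basis_fun k x) = (\<lambda>k. x * basis_fun k x)" "xmul 1 (\<lambda>k. basis_fun k y) = (\<lambda>k. y * basis_fun k y)"
    using assms by (auto simp: basis_fun_xmul)
  then show ?thesis
    using dd_form_xmul[of n "\<lambda>k. basis_fun k x" 1 "\<lambda>k. basis_fun k y" 1]
    by (simp add: dd_form_cmult_right dd_form_cmult_left left_diff_distrib)
qed

lemma basis_fun_DERIV:
  assumes "x\<^sup>2 - 4 \<noteq> 0"
  shows "(basis_fun i has_field_derivative - (theta (\<lambda>k. basis_fun k x) i + x * basis_fun i x) / (x\<^sup>2 - 4)) (at x)"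
proof -
  define D where "D = x\<^sup>2 - 4"
  have D: "D \<noteq> 0" "x * x = D + 4" using assms by (simp_all add: D_def power2_eq_square)
  have c: "basis_fun (2 * m) x = 1 / D ^ (m + 1)" "basis_fun (2 * m + 1) x = x / D ^ (m + 1)" for m
    by (simp_all only: basis_fun_even basis_fun_odd D_def)
  have dp: "((\<lambda>x. (x\<^sup>2 - 4) ^ (m + 1)) has_field_derivative of_nat (m+1) * D ^ m * (2 * x)) (at x)" for m
  proof -
    have "((\<lambda>x. x\<^sup>2 - 4) has_field_derivative 2 * x) (at x)" by (auto intro!: derivative_eq_intros)
    from DERIV_power[OF this, of "m + 1"] show ?thesis by (simp add: D_def mult_ac)
  qed
  have nz: "(x\<^sup>2 - 4) ^ (m + 1) \<noteq> 0" for m using assms by simp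
  show ?thesis
  proof (cases "even i")
    case True
    then obtain m where i: "i = 2 * m" by blast
    have "((\<lambda>x. 1 / (x\<^sup>2 - 4) ^ (m + 1)) has_field_derivative
        (- (of_nat (m+1) * D ^ m * (2 * x)) / (D ^ (m + 1) * D ^ (m + 1)))) (at x)"
      using DERIV_divide[OF DERIV_const[of 1] dp nz, of m] by (simp add: D_def)
    moreover have "- (of_nat (m+1) * D ^ m * (2 * x)) / (D ^ (m + 1) * D ^ (m + 1))
        = - (theta (\<lambda>k. basis_fun k x) i + x * basis_fun i x) / D"
    proof -
      have th: "theta (\<lambda>k. basis_fun k x) i = of_nat (2*m+1) * (x / D ^ (m + 1))"
        unfolding i theta_def c(2)[symmetric] by simp
      have xx: "x * basis_fun i x = x / D ^ (m + 1)" unfolding i c by simp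
      show ?thesis unfolding th xx using D(1) by (simp add: field_simps)
    qed
    ultimately show ?thesis unfolding D_def[symmetric] i basis_fun_even[abs_def] by simp
  next
    case False
    then obtain m where i: "i = 2 * m + 1" by (elim oddE)
    have "((\<lambda>x. x / (x\<^sup>2 - 4) ^ (m + 1)) has_field_derivative
        ((D ^ (m + 1) - x * (of_nat (m+1) * D ^ m * (2 * x))) / (D ^ (m + 1) * D ^ (m + 1)))) (at x)"
      using DERIV_divide[OF DERIV_ident dp nz, of m] by (simp add: D_def)
    moreover have "(D ^ (m + 1) - x * (of_nat (m+1) * D ^ m * (2 * x))) / (D ^ (m + 1) * D ^ (m + 1))
        = - (theta (\<lambda>k. basis_fun k x) i + x * basis_fun i x) / D"
    proof -
      have "x * (of_nat (m+1) * D ^ m * (2 * x)) = 2 * of_nat (m+1) * D ^ m * (D + 4)"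
        using D(2) by (simp add: mult_ac)
      then have l: "(D ^ (m + 1) - x * (of_nat (m+1) * D ^ m * (2 * x))) / (D ^ (m + 1) * D ^ (m + 1))
         = (D - 2 * of_nat (m+1) * (D + 4)) / D ^ (m + 2)"
        using D(1) by (simp add: field_simps)
      have xx: "x * basis_fun i x = (D + 4) / D ^ (m + 1)" unfolding i c using D(2) by simp
      have th: "theta (\<lambda>k. basis_fun k x) i = of_nat (2*m) / D ^ m + 4 * of_nat (2*m+1) / D ^ (m + 1)"
      proof (cases m)
        case 0 then show ?thesis unfolding i theta_def using c(1)[of 0] by simp
      next
        case (Suc n)
        have "2 * m + 1 - 3 = 2 * n" "2 * m + 1 - 1 = 2 * m" using Suc by auto
        then show ?thesis unfolding i theta_def using c(1)[of n] c(1)[of m] Suc by simp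
      qed
      show ?thesis unfolding l xx th using D(1) by (simp add: field_simps)
    qed
    ultimately show ?thesis unfolding D_def[symmetric] i basis_fun_odd[abs_def] by simp
  qed
qed

text \<open>
  The function \<open>z p / (z - p)\<^sup>2 + z p / (1 - z p)\<^sup>2\<close> in terms of
  \<open>x = z + 1/z\<close> and \<open>y = p + 1/p\<close>: the symmetrisation of
  \<open>W\<^bsub>0,2\<^esub>\<close> under the conjugate map.
\<close>

definition two_point_kernel :: "complex \<Rightarrow> complex \<Rightarrow> complex" where
  "two_point_kernel x y = (x * y - 4) / (x - y)\<^sup>2"

text \<open>
  As a function of x, the kernel has a double pole at y. Taking it off leaves the part with
  poles at the ramification points only, which is a divided difference; this explains the
  operator \<open>theta\<close> in the linear term of the recursion.
\<close>

lemma two_point_kernel_principal_part: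
  assumes x: "x\<^sup>2 - 4 \<noteq> 0" and y: "y\<^sup>2 - 4 \<noteq> 0" and ne: "x \<noteq> y"
  shows "- (basis_fun n x * two_point_kernel x y) = dd_form n (\<lambda>k. basis_fun k x) (theta (\<lambda>k. basis_fun k y))
    + (- theta (\<lambda>k. basis_fun k y) n / (y - x) - (y\<^sup>2 - 4) * basis_fun n y / (y - x)\<^sup>2)"
proof -
  define A where "A = y\<^sup>2 - 4"
  define w' where "w' j = - (theta (\<lambda>k. basis_fun k y) j + y * basis_fun j y) / A" for j
  have A: "A \<noteq> 0" using y by (simp add: A_def)
  have d: "(basis_fun j has_field_derivative w' j) (at y)" for j
    using basis_fun_DERIV[OF y, of j] by (simp add: w'_def A_def)
  let ?e = "\<lambda>k. basis_fun k x"
  have 1: "((\<lambda>y. dd_form n ?e (\<lambda>k. basis_fun k y)) has_field_derivative dd_form n ?e w') (at y)"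
    unfolding dd_form_def by (intro DERIV_sum DERIV_cmult d)
  have ev: "eventually (\<lambda>y. dd_form n ?e (\<lambda>k. basis_fun k y) = (basis_fun n y - basis_fun n x) / (y - x)) (nhds y)"
  proof -
    have "eventually (\<lambda>y. y\<^sup>2 - 4 \<noteq> 0 \<and> y - x \<noteq> 0) (nhds y)"
      using y ne by (intro eventually_conj tendsto_imp_eventually_ne) (auto intro!: tendsto_eq_intros filterlim_ident)
    then show ?thesis
    proof eventually_elim
      case (elim y)
      then show ?case using basis_fun_dd[OF x, of y n] by (auto simp: field_simps)
    qed
  qed
  have "((\<lambda>y. (basis_fun n y - basis_fun n x) / (y - x)) has_field_derivative
     (w' n * (y - x) - (basis_fun n y - basis_fun n x)) / (y - x)\<^sup>2) (at y)"
    using ne by (auto intro!: derivative_eq_intros d simp: power2_eq_square)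
  then have 2: "((\<lambda>y. dd_form n ?e (\<lambda>k. basis_fun k y)) has_field_derivative
     (w' n * (y - x) - (basis_fun n y - basis_fun n x)) / (y - x)\<^sup>2) (at y)"
    using DERIV_cong_ev[OF refl ev refl] by blast
  have eq1: "dd_form n ?e w' = (w' n * (y - x) - (basis_fun n y - basis_fun n x)) / (y - x)\<^sup>2"
    using DERIV_unique[OF 1 2] .
  have eq2: "A * dd_form n ?e w' = - dd_form n ?e (theta (\<lambda>k. basis_fun k y))
      - y * dd_form n ?e (\<lambda>k. basis_fun k y)"
  proof -
    have "(\<lambda>j. A * w' j) = (\<lambda>j. (-1) * theta (\<lambda>k. basis_fun k y) j + (-y) * basis_fun j y)"
      using A by (auto simp: w'_def fun_eq_iff divide_simps algebra_simps)
    then have "dd_form n ?e (\<lambda>j. A * w' j) = - dd_form n ?e (theta (\<lambda>k. basis_fun k y))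
      - y * dd_form n ?e (\<lambda>k. basis_fun k y)"
      by (simp only: dd_form_add_right dd_form_cmult_right) simp
    then show ?thesis by (simp only: dd_form_cmult_right)
  qed
  have eq3: "dd_form n ?e (\<lambda>k. basis_fun k y) = (basis_fun n y - basis_fun n x) / (y - x)"
    using basis_fun_dd[OF x y, of n] ne by (simp add: field_simps)
  have "A * w' n = - theta (\<lambda>k. basis_fun k y) n - y * basis_fun n y"
    using A by (simp add: w'_def)
  moreover have "A * (w' n * (y - x) - (basis_fun n y - basis_fun n x))
     = (A * w' n) * (y - x) - A * (basis_fun n y - basis_fun n x)"
    by (simp add: algebra_simps)
  ultimately have eq4: "A * (w' n * (y - x) - (basis_fun n y - basis_fun n x))
     = (- theta (\<lambda>k. basis_fun k y) n - y * basis_fun n y) * (y - x) - A * (basis_fun n y - basis_fun n x)"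
    by simp
  have "dd_form n ?e (theta (\<lambda>k. basis_fun k y)) = - y * dd_form n ?e (\<lambda>k. basis_fun k y) - A * dd_form n ?e w'"
    unfolding eq2 by simp
  also have "\<dots> = - y * ((basis_fun n y - basis_fun n x) / (y - x))
       - ((- theta (\<lambda>k. basis_fun k y) n - y * basis_fun n y) * (y - x) - A * (basis_fun n y - basis_fun n x)) / (y - x)\<^sup>2"
    unfolding eq3 eq1 times_divide_eq_right eq4 ..
  finally have "dd_form n ?e (theta (\<lambda>k. basis_fun k y)) = - y * ((basis_fun n y - basis_fun n x) / (y - x))
       - ((- theta (\<lambda>k. basis_fun k y) n - y * basis_fun n y) * (y - x) - A * (basis_fun n y - basis_fun n x)) / (y - x)\<^sup>2" .
  moreover have "two_point_kernel x y = (A - y * (y - x)) / (y - x)\<^sup>2"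
    by (simp add: two_point_kernel_def A_def power2_eq_square algebra_simps)
  moreover have "- (wx * ((A - y * d) / d\<^sup>2)) = - y * ((wy - wx) / d)
       - ((- th - y * wy) * d - A * (wy - wx)) / d\<^sup>2 + (- th / d - A * wy / d\<^sup>2)"
    if "d \<noteq> 0" for d wx wy th :: complex
    using that by (simp add: divide_simps power2_eq_square) (simp add: algebra_simps)
  ultimately show ?thesis unfolding A_def[symmetric] using ne by simp
qed

section \<open>Residues of the basis functions\<close>

lemma basis_fun_punct_holo: "punct_holo (\<lambda>z. basis_fun k (joukowski z))"
  unfolding punct_holo_def
proof
  fix r :: complex assume r: "r \<in> {1, -1}"
  have "(\<lambda>z. basis_fun k (joukowski z)) holomorphic_on ball r 1 - {r}"
    unfolding basis_fun_def joukowski_def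
    using regular_D[OF regular_ball[OF r]] regular_ball[OF r]
    by (intro holomorphic_intros) (auto simp: joukowski_def regular_pt_def)
  then show "\<exists>e>0. (\<lambda>z. basis_fun k (joukowski z)) holomorphic_on ball r e - {r}" by (intro exI[of _ 1]) auto
qed

lemma conj_diff_power_DERIV:
  assumes "z \<noteq> 0"
  shows "((\<lambda>z. (z - 1 / z) ^ Suc n) has_field_derivative of_nat (Suc n) * (z - 1 / z) ^ n * (joukowski z / z)) (at z)"
proof -
  have "((\<lambda>z. z - 1 / z) has_field_derivative joukowski z / z) (at z)"
    using assms by (auto intro!: derivative_eq_intros simp: joukowski_def field_simps power2_eq_square)
  from DERIV_power[OF this, of "Suc n"] show ?thesis by (simp add: mult_ac)
qed

text \<open>
  With \<open>\<sigma> = z - 1/z\<close>, the derivative of \<open>x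
  \<sigma>\<^bsup>-2m-2\<^esup>\<close> is a combination of two consecutive forms, so the
  statement follows by induction; for \<open>m = 0\<close> the residues at the two ramification
  points cancel.
\<close>

lemma res_sum_odd_power: "res_sum (\<lambda>z. 1 / (z * (z - 1 / z) ^ (2 * m + 1))) = 0"
  and punct_holo_odd_power: "punct_holo (\<lambda>z. 1 / (z * (z - 1 / z) ^ n))"
proof -
  show ph: "punct_holo (\<lambda>z. 1 / (z * (z - 1 / z) ^ n))" for n
    unfolding punct_holo_def
  proof
    fix r :: complex assume r: "r \<in> {1, -1}"
    have "(\<lambda>z. 1 / (z * (z - 1 / z) ^ n)) holomorphic_on ball r 1 - {r}"
      using regular_conj_diff[OF regular_ball[OF r]] regular_ball[OF r]
      by (intro holomorphic_intros) (auto simp: regular_pt_def)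
    then show "\<exists>e>0. (\<lambda>z. 1 / (z * (z - 1 / z) ^ n)) holomorphic_on ball r e - {r}"
      by (intro exI[of _ 1]) auto
  qed
  show "res_sum (\<lambda>z. 1 / (z * (z - 1 / z) ^ (2 * m + 1))) = 0"
  proof (induction m)
    case 0
    have "res_sum (\<lambda>z. 1 / (z * (z - 1 / z) ^ (2 * 0 + 1))) = res_sum (\<lambda>z. (1/2) / (z - 1) + (-1/2) / (z + 1))"
    proof (rule res_sum_cong)
      fix r :: complex assume r: "r \<in> {1, -1}"
      have "eventually (\<lambda>z. z \<in> ball r 1 - {r}) (at r)" by (rule eventually_at_in_open) auto
      then show "eventually (\<lambda>z. 1 / (z * (z - 1 / z) ^ (2 * 0 + 1)) = (1/2) / (z - 1) + (-1/2) / (z + 1)) (at r)"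
      proof eventually_elim
        case (elim z)
        then have "regular_pt z" using regular_ball[OF r] by blast
        then have z: "z \<noteq> 0" "z - 1 \<noteq> 0" "z + 1 \<noteq> 0" by (auto simp: regular_pt_def eq_neg_iff_add_eq_0)
        then have "z * (z - 1 / z) = (z - 1) * (z + 1)" by (simp add: field_simps)
        then have "1 / (z * (z - 1 / z) ^ (2 * 0 + 1)) = 1 / ((z - 1) * (z + 1))" by simp
        also have "\<dots> = (1/2) / (z - 1) + (-1/2) / (z + 1)"
        proof -
          have "(1/2) / a + (-1/2) / b = (b - a) / (2 * (a * b))" if "a \<noteq> 0" "b \<noteq> 0" for a b :: complex
            using that by (simp add: field_simps)
          from this[OF z(2,3)] show ?thesis by simp
        qed
        finally show ?case .
      qed
    qed
    also have "\<dots> = res_sum (\<lambda>z. (1/2) / (z - 1)) + res_sum (\<lambda>z. (-1/2) / (z + 1))"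
    proof (rule res_sum_add)
      have "(\<lambda>z::complex. (1/2) / (z - 1)) holomorphic_on ball r 1 - {r}"
        "(\<lambda>z::complex. (-1/2) / (z + 1)) holomorphic_on ball r 1 - {r}" if r: "r \<in> {1, -1}" for r
      proof -
        have "z - 1 \<noteq> 0" "z + 1 \<noteq> 0" if "z \<in> ball r 1 - {r}" for z
          using regular_ball[OF r that] by (auto simp: regular_pt_def eq_neg_iff_add_eq_0)
        then show "(\<lambda>z::complex. (1/2) / (z - 1)) holomorphic_on ball r 1 - {r}"
          "(\<lambda>z::complex. (-1/2) / (z + 1)) holomorphic_on ball r 1 - {r}"
          by (intro holomorphic_intros; blast)+
      qed
      then show "punct_holo (\<lambda>z::complex. (1/2) / (z - 1))" "punct_holo (\<lambda>z::complex. (-1/2) / (z + 1))"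
        unfolding punct_holo_def by (meson zero_less_one)+
    qed
    also have "\<dots> = 0"
    proof -
      have "residue (\<lambda>z::complex. (1/2) / (z - 1)) 1 = 1/2" "residue (\<lambda>z::complex. (-1/2) / (z - -1)) (-1) = -1/2"
        by (rule residue_simple[of UNIV]; simp)+
      moreover have "residue (\<lambda>z::complex. (1/2) / (z - 1)) (-1) = 0"
        by (rule residue_holo[of "- {1}"]) (auto intro!: holomorphic_intros)
      moreover have "residue (\<lambda>z::complex. (-1/2) / (z + 1)) 1 = 0"
      proof (rule residue_holo[of "- {-1}"])
        have "z + 1 \<noteq> 0" if "z \<in> - {-1}" for z :: complex
          using that by (auto simp: eq_neg_iff_add_eq_0)
        then show "(\<lambda>z::complex. (-1/2) / (z + 1)) holomorphic_on - {-1}"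
          by (intro holomorphic_intros; blast)
      qed auto
      ultimately show ?thesis by (simp add: res_sum_def)
    qed
    finally show ?case .
  next
    case (Suc m)
    let ?h = "\<lambda>n z::complex. 1 / (z * (z - 1 / z) ^ n)"
    let ?a = "of_nat (2*m+1) :: complex" and ?b = "8 * of_nat (m+1) :: complex"
    have "res_sum (\<lambda>z. (- ?a) * ?h (2*m+1) z + (- ?b) * ?h (2*m+3) z) = 0"
    proof (rule res_sum_deriv[of 1 "\<lambda>z. joukowski z / (z - 1 / z) ^ Suc (2*m+1)"])
      fix r z :: complex assume r: "r \<in> {1, -1}" "z \<in> ball r 1 - {r}"
      then have reg: "regular_pt z" using regular_ball by blast
      then have z: "z \<noteq> 0" and c0: "z - 1 / z \<noteq> 0" using regular_conj_diff by (auto simp: regular_pt_def)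
      define c where "c = z - 1 / z"
      have c: "c \<noteq> 0" using c0 by (simp add: c_def)
      have j2: "joukowski z * joukowski z = c\<^sup>2 + 4" using joukowski_sq[OF z] unfolding c_def by (simp add: power2_eq_square algebra_simps)
      have "((\<lambda>z. joukowski z / (z - 1 / z) ^ Suc (2*m+1)) has_field_derivative
         ((1 - 1 / z\<^sup>2) * c ^ Suc (2*m+1) - joukowski z * (of_nat (Suc (2*m+1)) * c ^ (2*m+1) * (joukowski z / z)))
          / (c ^ Suc (2*m+1) * c ^ Suc (2*m+1))) (at z)"
        using DERIV_divide[OF joukowski_DERIV[OF z] conj_diff_power_DERIV[OF z, of "2*m+1"]] c
        unfolding c_def by simp
      moreover have "((1 - 1 / z\<^sup>2) * c ^ Suc (2*m+1) - joukowski z * (of_nat (Suc (2*m+1)) * c ^ (2*m+1) * (joukowski z / z)))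
          / (c ^ Suc (2*m+1) * c ^ Suc (2*m+1)) = (- ?a) * ?h (2*m+1) z + (- ?b) * ?h (2*m+3) z"
      proof -
        have e: "joukowski z * (of_nat (Suc (2*m+1)) * c ^ (2*m+1) * (joukowski z / z))
            = of_nat (Suc (2*m+1)) * c ^ (2*m+1) * (c\<^sup>2 + 4) / z" using j2 by (simp add: mult_ac)
        show ?thesis unfolding e joukowski_DERIV'[OF z] c_def[symmetric] using c z
          by (simp add: divide_simps power_add power2_eq_square power3_eq_cube) (simp add: algebra_simps)
      qed
      ultimately show "((\<lambda>z. joukowski z / (z - 1 / z) ^ Suc (2*m+1)) has_field_derivative
          (- ?a) * ?h (2*m+1) z + (- ?b) * ?h (2*m+3) z) (at z)" by simp
    qed simp
    moreover have "res_sum (\<lambda>z. (- ?a) * ?h (2*m+1) z + (- ?b) * ?h (2*m+3) z)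
        = (- ?a) * res_sum (?h (2*m+1)) + (- ?b) * res_sum (?h (2*m+3))"
      unfolding res_sum_add[OF punct_holo_mult[OF punct_holo_const ph] punct_holo_mult[OF punct_holo_const ph]]
        res_sum_cmult[OF ph] ..
    ultimately have "- ?b * res_sum (?h (2*m+3)) = 0" by (simp only: Suc mult_zero_right add_0)
    moreover have "- ?b \<noteq> 0"
      by (metis add_eq_0_iff_both_eq_0 mult_eq_0_iff neg_equal_0_iff_equal of_nat_eq_0_iff one_neq_zero
          zero_neq_numeral)
    ultimately have "res_sum (?h (2*m+3)) = 0" by (simp only: mult_eq_0_iff simp_thms)
    moreover have "2 * Suc m + 1 = 2*m+3" by simp
    ultimately show ?case by (simp only:)
  qed
qed

lemma res_sum_basis_fun: "res_sum (\<lambda>z. 1/2 * (1 - 1 / z\<^sup>2) * basis_fun i (joukowski z)) = of_bool (i = 1)"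
proof (cases "even i")
  case True
  then obtain m where i: "i = 2 * m" by blast
  have "res_sum (\<lambda>z. 1/2 * (1 - 1 / z\<^sup>2) * basis_fun i (joukowski z))
      = res_sum (\<lambda>z. 1/2 * (1 / (z * (z - 1 / z) ^ (2 * m + 1))))"
  proof (rule res_sum_cong)
    fix r :: complex assume r: "r \<in> {1, -1}"
    have "eventually (\<lambda>z. z \<in> ball r 1 - {r}) (at r)" by (rule eventually_at_in_open) auto
    then show "eventually (\<lambda>z. 1/2 * (1 - 1 / z\<^sup>2) * basis_fun i (joukowski z)
        = 1/2 * (1 / (z * (z - 1 / z) ^ (2 * m + 1)))) (at r)"
    proof eventually_elim
      case (elim z)
      then have reg: "regular_pt z" using regular_ball[OF r] by blast
      then have z: "z \<noteq> 0" by (simp add: regular_pt_def)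
      define c where "c = z - 1 / z"
      have c: "c \<noteq> 0" using regular_conj_diff[OF reg] by (simp add: c_def)
      have "(c * c) ^ m = c ^ (2 * m)" by (simp add: power_mult power2_eq_square)
      then have "(c\<^sup>2) ^ (m + 1) = c * c ^ (2 * m + 1)" by (simp add: power2_eq_square)
      then show ?case unfolding i basis_fun_even joukowski_sq[OF z] joukowski_DERIV'[OF z] c_def[symmetric] using c z
        by (simp add: divide_simps)
    qed
  qed
  also have "\<dots> = 0" unfolding res_sum_cmult[OF punct_holo_odd_power] res_sum_odd_power by simp
  finally show ?thesis using True by auto
next
  case False
  then obtain m where i: "i = 2 * m + 1" by (elim oddE)
  show ?thesis
  proof (cases m)
    case 0
    have "residue (\<lambda>z. 1/2 * (1 - 1 / z\<^sup>2) * basis_fun i (joukowski z)) r = 1/2" if r: "r \<in> {1, -1}" for r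
    proof -
      let ?f = "\<lambda>z. (z\<^sup>2 + 1) / (2 * z * (z + r))"
      have "residue (\<lambda>z. 1/2 * (1 - 1 / z\<^sup>2) * basis_fun i (joukowski z)) r = residue (\<lambda>z. ?f z / (z - r)) r"
      proof (rule residue_cong[OF _ refl])
        have "eventually (\<lambda>z. z \<in> ball r 1 - {r}) (at r)" by (rule eventually_at_in_open) auto
        then show "eventually (\<lambda>z. 1/2 * (1 - 1 / z\<^sup>2) * basis_fun i (joukowski z) = ?f z / (z - r)) (at r)"
        proof eventually_elim
          case (elim z)
          then have reg: "regular_pt z" using regular_ball[OF r] by blast
          then have z: "z \<noteq> 0" by (simp add: regular_pt_def)
          have c: "z - 1 / z \<noteq> 0" using regular_conj_diff[OF reg] .
          have rr: "(z + r) * (z - r) = z * (z - 1 / z)" using r z by (auto simp: field_simps)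
          have "1/2 * (1 - 1 / z\<^sup>2) * basis_fun i (joukowski z) = joukowski z / (2 * z * (z - 1 / z))"
            unfolding i 0 basis_fun_odd joukowski_sq[OF z] joukowski_DERIV'[OF z] using c z
            by (simp add: power2_eq_square)
          also have "\<dots> = (z\<^sup>2 + 1) / (2 * z * (z * (z - 1 / z)))"
            using z by (simp add: joukowski_def field_simps power2_eq_square)
          also have "\<dots> = ?f z / (z - r)" unfolding rr[symmetric] by simp
          finally show ?case .
        qed
      qed
      also have "\<dots> = ?f r"
      proof (rule residue_simple[of "ball r 1"])
        show "?f holomorphic_on ball r 1"
        proof (intro holomorphic_intros)
          fix z assume z: "z \<in> ball r 1"
          have "z \<noteq> 0" "z + r \<noteq> 0"
          proof -
            have "norm r = 1" "norm (- r - r) = 2" using r by auto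
            then show "z \<noteq> 0" "z + r \<noteq> 0" using z by (auto simp: dist_norm norm_minus_commute eq_neg_iff_add_eq_0[symmetric])
          qed
          then show "2 * z * (z + r) \<noteq> 0" by simp
        qed
      qed auto
      also have "\<dots> = 1/2" using r by auto
      finally show ?thesis .
    qed
    then have "res_sum (\<lambda>z. 1/2 * (1 - 1 / z\<^sup>2) * basis_fun i (joukowski z)) = (\<Sum>r\<in>{1, -1::complex}. 1/2)"
      unfolding res_sum_def by (intro sum.cong refl)
    then show ?thesis using i 0 by simp
  next
    case (Suc n)
    have "res_sum (\<lambda>z. 1/2 * (1 - 1 / z\<^sup>2) * basis_fun i (joukowski z)) = 0"
    proof (rule res_sum_deriv[of 1 "\<lambda>z. (- 1 / (4 * of_nat (Suc n))) * (1 / ((joukowski z)\<^sup>2 - 4) ^ Suc n)"])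
      fix r z :: complex assume r: "r \<in> {1, -1}" "z \<in> ball r 1 - {r}"
      then have reg: "regular_pt z" using regular_ball by blast
      then have z: "z \<noteq> 0" by (simp add: regular_pt_def)
      define D where "D = (joukowski z)\<^sup>2 - 4"
      have D: "D \<noteq> 0" using regular_D[OF reg] by (simp add: D_def)
      have "((\<lambda>z. (joukowski z)\<^sup>2 - 4) has_field_derivative 2 * joukowski z * (1 - 1 / z\<^sup>2)) (at z)"
        using joukowski_DERIV[OF z] by (auto intro!: derivative_eq_intros)
      from DERIV_power[OF this, of "Suc n"]
      have "((\<lambda>z. ((joukowski z)\<^sup>2 - 4) ^ Suc n) has_field_derivative
          of_nat (Suc n) * (2 * joukowski z * (1 - 1 / z\<^sup>2) * D ^ n)) (at z)" by (simp add: D_def)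
      from DERIV_divide[OF DERIV_const[of 1] this] D
      have "((\<lambda>z. 1 / ((joukowski z)\<^sup>2 - 4) ^ Suc n) has_field_derivative
          - (of_nat (Suc n) * (2 * joukowski z * (1 - 1 / z\<^sup>2) * D ^ n)) / (D ^ Suc n * D ^ Suc n)) (at z)"
        by (simp add: D_def)
      from DERIV_cmult[OF this, of "- 1 / (4 * of_nat (Suc n))"]
      have "((\<lambda>z. (- 1 / (4 * of_nat (Suc n))) * (1 / ((joukowski z)\<^sup>2 - 4) ^ Suc n)) has_field_derivative
          (- 1 / (4 * of_nat (Suc n))) *
          (- (of_nat (Suc n) * (2 * joukowski z * (1 - 1 / z\<^sup>2) * D ^ n)) / (D ^ Suc n * D ^ Suc n))) (at z)" .
      moreover have "(- 1 / (4 * of_nat (Suc n))) *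
          (- (of_nat (Suc n) * (2 * joukowski z * (1 - 1 / z\<^sup>2) * D ^ n)) / (D ^ Suc n * D ^ Suc n))
          = 1/2 * (1 - 1 / z\<^sup>2) * basis_fun i (joukowski z)"
      proof -
        have "(- 1 / (4 * N)) * (- (N * (2 * x * d * D ^ n)) / (D ^ Suc n * D ^ Suc n))
            = 1/2 * d * (x / D ^ (Suc n + 1))" if "N \<noteq> 0" for N x d :: complex
          using that D by (simp add: divide_simps)
        from this[of "of_nat (Suc n)" "joukowski z" "1 - 1 / z\<^sup>2"]
        show ?thesis unfolding i Suc basis_fun_odd D_def[symmetric] by (simp del: of_nat_Suc)
      qed
      ultimately show "((\<lambda>z. (- 1 / (4 * of_nat (Suc n))) * (1 / ((joukowski z)\<^sup>2 - 4) ^ Suc n))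
          has_field_derivative 1/2 * (1 - 1 / z\<^sup>2) * basis_fun i (joukowski z)) (at z)" by (simp only:)
    qed simp
    then show ?thesis using i Suc by simp
  qed
qed

section \<open>Principal parts and the recursion kernel\<close>

text \<open>
  The sum of the principal parts at the ramification points, as a function of \<open>y =
  x(z\<^sub>0)\<close>. The factor 1/2 accounts for the double cover by z.
\<close>

definition principal_part :: "(complex \<Rightarrow> complex) \<Rightarrow> complex \<Rightarrow> complex" where
  "principal_part h y = res_sum (\<lambda>z. 1/2 * (1 - 1 / z\<^sup>2) / (y - joukowski z) * h z)"

lemma principal_part_kernel_analytic:
  assumes "y\<^sup>2 - 4 \<noteq> 0"
  shows "(\<lambda>z. 1/2 * (1 - 1 / z\<^sup>2) / (y - joukowski z)) analytic_on {1, -1}"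
proof -
  have "y \<noteq> 2" "y \<noteq> -2" using assms by auto
  then show ?thesis by (intro analytic_intros joukowski_analytic) (auto simp: joukowski_def)
qed

lemma principal_part_kernel_punct:
  assumes "y\<^sup>2 - 4 \<noteq> 0"
  shows "punct_holo (\<lambda>z. 1/2 * (1 - 1 / z\<^sup>2) / (y - joukowski z))"
  using punct_holo_analytic principal_part_kernel_analytic[OF assms] by blast

lemma principal_part_add:
  assumes "y\<^sup>2 - 4 \<noteq> 0" "punct_holo f" "punct_holo h"
  shows "principal_part (\<lambda>z. f z + h z) y = principal_part f y + principal_part h y"
  unfolding principal_part_def distrib_left
  by (intro res_sum_add punct_holo_mult principal_part_kernel_punct assms)

lemma principal_part_cmult:
  assumes "y\<^sup>2 - 4 \<noteq> 0" "punct_holo f"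
  shows "principal_part (\<lambda>z. c * f z) y = c * principal_part f y"
proof -
  have "principal_part (\<lambda>z. c * f z) y = res_sum (\<lambda>z. c * (1/2 * (1 - 1 / z\<^sup>2) / (y - joukowski z) * f z))"
    unfolding principal_part_def by (simp add: mult_ac)
  also have "\<dots> = c * principal_part f y"
    unfolding principal_part_def by (intro res_sum_cmult punct_holo_mult principal_part_kernel_punct assms)
  finally show ?thesis .
qed

lemma principal_part_sum:
  assumes "y\<^sup>2 - 4 \<noteq> 0" "\<And>i. i \<in> A \<Longrightarrow> punct_holo (f i)"
  shows "principal_part (\<lambda>z. \<Sum>i\<in>A. f i z) y = (\<Sum>i\<in>A. principal_part (f i) y)"
  unfolding principal_part_def sum_distrib_left
  by (intro res_sum_sum punct_holo_mult principal_part_kernel_punct assms)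

lemma principal_part_pick:
  assumes "y\<^sup>2 - 4 \<noteq> 0" "\<And>u v. u \<in> set xs \<Longrightarrow> punct_holo (f u v)"
  shows "principal_part (\<lambda>z. pick_sum (\<lambda>u v. f u v z) xs) y = pick_sum (\<lambda>u v. principal_part (f u v) y) xs"
  unfolding principal_part_def pick_sum_cmult[symmetric]
  using res_sum_pick[of xs "\<lambda>u v z. 1/2 * (1 - 1 / z\<^sup>2) / (y - joukowski z) * f u v z"]
    punct_holo_mult[OF principal_part_kernel_punct[OF assms(1)] assms(2)] by blast

lemma principal_part_analytic:
  assumes "y\<^sup>2 - 4 \<noteq> 0" "f analytic_on {1, -1}"
  shows "principal_part f y = 0"
  unfolding principal_part_def
  by (intro res_sum_analytic analytic_on_mult principal_part_kernel_analytic assms)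

lemma principal_part_cong:
  assumes "\<And>r. r \<in> {1, -1} \<Longrightarrow> eventually (\<lambda>z. f z = h z) (at r)"
  shows "principal_part f y = principal_part h y"
  unfolding principal_part_def
proof (rule res_sum_cong)
  fix r :: complex assume "r \<in> {1, -1}"
  from assms[OF this]
  show "eventually (\<lambda>z. 1/2 * (1 - 1 / z\<^sup>2) / (y - joukowski z) * f z
      = 1/2 * (1 - 1 / z\<^sup>2) / (y - joukowski z) * h z) (at r)"
    by eventually_elim simp
qed

lemma eventually_regular: "r \<in> {1, -1} \<Longrightarrow> eventually regular_pt (at r)"
proof -
  assume r: "r \<in> {1, -1}"
  have "eventually (\<lambda>z. z \<in> ball r 1 - {r}) (at r)" by (rule eventually_at_in_open) auto
  then show ?thesis by eventually_elim (rule regular_ball[OF r])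
qed

lemma eventually_joukowski_neq:
  assumes "r \<in> {1, -1}" "y\<^sup>2 - 4 \<noteq> 0"
  shows "eventually (\<lambda>z. joukowski z \<noteq> y) (at r)"
proof -
  have r: "r \<noteq> 0" using assms by auto
  have "joukowski r \<noteq> y" using assms joukowski_ramification[of r] by (auto simp: power2_eq_square)
  moreover have "isCont joukowski r" using joukowski_DERIV[OF r] DERIV_isCont by blast
  ultimately show ?thesis using tendsto_imp_eventually_ne[of joukowski "joukowski r" "at r" y] by (simp add: isCont_def)
qed

lemma punct_holo_cong:
  assumes "punct_holo f" "\<And>r. r \<in> {1, -1} \<Longrightarrow> eventually (\<lambda>z. f z = h z) (at r)"
  shows "punct_holo h"
  unfolding punct_holo_def
proof
  fix r :: complex assume r: "r \<in> {1, -1}"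
  obtain e where e: "e > 0" "f holomorphic_on ball r e - {r}" using assms(1) r unfolding punct_holo_def by blast
  obtain d where d: "d > 0" "\<And>z. z \<noteq> r \<Longrightarrow> dist z r < d \<Longrightarrow> f z = h z"
    using assms(2)[OF r] unfolding eventually_at by blast
  have "f holomorphic_on ball r (min d e) - {r}" by (rule holomorphic_on_subset[OF e(2)]) auto
  then have "h holomorphic_on ball r (min d e) - {r}"
    using holomorphic_cong[OF refl, of "ball r (min d e) - {r}" f h] d(2) by (auto simp: dist_commute)
  then show "\<exists>e>0. h holomorphic_on ball r e - {r}" using d e by (intro exI[of _ "min d e"]) auto
qed

text \<open>
  The basis functions consist of principal parts only, so the projection reproduces them.
\<close>

lemma principal_part_basis_fun:
  assumes y: "y\<^sup>2 - 4 \<noteq> 0"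
  shows "principal_part (\<lambda>z. basis_fun n (joukowski z)) y = basis_fun n y"
proof -
  let ?W = "\<lambda>i j z. - (of_int (dd_coeff n i j) * basis_fun j y) * (1/2 * (1 - 1 / z\<^sup>2) * basis_fun i (joukowski z))"
  have hp: "punct_holo (\<lambda>z. 1/2 * (1 - 1 / z\<^sup>2))"
    by (rule punct_holo_analytic) (auto intro!: analytic_intros)
  have ph: "punct_holo (\<lambda>z. 1/2 * (1 - 1 / z\<^sup>2) * basis_fun i (joukowski z))" for i
    by (intro punct_holo_mult hp basis_fun_punct_holo)
  have "principal_part (\<lambda>z. basis_fun n (joukowski z)) y = res_sum (\<lambda>z. basis_fun n y * (1/2 * (1 - 1 / z\<^sup>2) / (y - joukowski z))
      + (\<Sum>i\<le>n+1. \<Sum>j\<le>n+1. ?W i j z))"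
    unfolding principal_part_def
  proof (rule res_sum_cong)
    fix r :: complex assume r: "r \<in> {1, -1}"
    from eventually_regular[OF r] eventually_joukowski_neq[OF r y]
    show "eventually (\<lambda>z. 1/2 * (1 - 1 / z\<^sup>2) / (y - joukowski z) * basis_fun n (joukowski z)
       = basis_fun n y * (1/2 * (1 - 1 / z\<^sup>2) / (y - joukowski z)) + (\<Sum>i\<le>n+1. \<Sum>j\<le>n+1. ?W i j z)) (at r)"
    proof eventually_elim
      case (elim z)
      let ?d = "dd_form n (\<lambda>k. basis_fun k (joukowski z)) (\<lambda>k. basis_fun k y)"
      have "(y - joukowski z) * ?d = basis_fun n y - basis_fun n (joukowski z)"
        by (rule basis_fun_dd) (use regular_D[OF elim(1)] y in auto)
      then have w: "basis_fun n (joukowski z) = basis_fun n y - (y - joukowski z) * ?d" by (simp add: algebra_simps)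
      have gen: "u / d * (w - d * t) = w * (u / d) - u * t" if "d \<noteq> 0" for u d w t :: complex
        using that by (simp add: field_simps)
      have "1/2 * (1 - 1 / z\<^sup>2) / (y - joukowski z) * basis_fun n (joukowski z)
          = basis_fun n y * (1/2 * (1 - 1 / z\<^sup>2) / (y - joukowski z)) - 1/2 * (1 - 1 / z\<^sup>2) * ?d"
        unfolding w by (rule gen) (use elim(2) in auto)
      also have "1/2 * (1 - 1 / z\<^sup>2) * ?d = - (\<Sum>i\<le>n+1. \<Sum>j\<le>n+1. ?W i j z)"
        unfolding dd_form_def sum_distrib_left sum_negf[symmetric]
        by (intro sum.cong refl) (simp add: mult_ac)
      finally show ?case by simp
    qed
  qed
  also have "\<dots> = res_sum (\<lambda>z. basis_fun n y * (1/2 * (1 - 1 / z\<^sup>2) / (y - joukowski z)))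
      + res_sum (\<lambda>z. \<Sum>i\<le>n+1. \<Sum>j\<le>n+1. ?W i j z)"
    by (intro res_sum_add punct_holo_mult punct_holo_const principal_part_kernel_punct y punct_holo_sum ph)
  also have "res_sum (\<lambda>z. basis_fun n y * (1/2 * (1 - 1 / z\<^sup>2) / (y - joukowski z))) = 0"
    by (intro res_sum_analytic analytic_on_mult principal_part_kernel_analytic[OF y]) auto
  also have "res_sum (\<lambda>z. \<Sum>i\<le>n+1. \<Sum>j\<le>n+1. ?W i j z) = (\<Sum>i\<le>n+1. \<Sum>j\<le>n+1. res_sum (?W i j))"
    by (simp only: res_sum_sum punct_holo_sum punct_holo_mult[OF punct_holo_const ph])
  also have "\<dots> = (\<Sum>i\<le>n+1. \<Sum>j\<le>n+1. if i = 1 then - (of_int (dd_coeff n i j) * basis_fun j y) else 0)"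
    by (simp only: res_sum_cmult[OF ph] res_sum_basis_fun) (intro sum.cong refl, simp)
  also have "\<dots> = (\<Sum>i\<le>n+1. if i = 1 then (\<Sum>j\<le>n+1. - (of_int (dd_coeff n 1 j) * basis_fun j y)) else 0)"
    by (intro sum.cong refl) auto
  also have "\<dots> = (\<Sum>j\<le>n+1. - (of_int (dd_coeff n 1 j) * basis_fun j y))"
    by (subst sum.delta) auto
  also have "\<dots> = (\<Sum>j\<le>n+1. if j = n then basis_fun j y else 0)"
    by (intro sum.cong refl) (auto simp: dd_coeff_def)
  also have "\<dots> = basis_fun n y" by (subst sum.delta) auto
  finally show ?thesis by simp
qed

lemma principal_part_quad_form:
  assumes y: "y\<^sup>2 - 4 \<noteq> 0"
  shows "principal_part (\<lambda>z. quad_form (\<lambda>k. basis_fun k (joukowski z)) k l) y = quad_form (\<lambda>k. basis_fun k y) k l"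
proof -
  have 1: "principal_part (\<lambda>z. (-1) * basis_fun a (joukowski z) + (-4) * basis_fun b (joukowski z)) y = (-1) * basis_fun a y + (-4) * basis_fun b y" for a b
    by (simp only: principal_part_add[OF y] principal_part_cmult[OF y] basis_fun_punct_holo principal_part_basis_fun[OF y]
        punct_holo_mult punct_holo_const)
  have 2: "principal_part (\<lambda>z. (-1) * basis_fun a (joukowski z)) y = (-1) * basis_fun a y" for a
    by (simp only: principal_part_cmult[OF y] basis_fun_punct_holo principal_part_basis_fun[OF y])
  show ?thesis using 1[of "k+l" "k+l+2"] 2[of "k+l+4"] by (simp add: quad_form_def)
qed

lemma punct_holo_dd_form: "punct_holo (\<lambda>z. dd_form n (\<lambda>k. basis_fun k (joukowski z)) f)"
  unfolding dd_form_def
  by (intro punct_holo_sum punct_holo_mult punct_holo_const basis_fun_punct_holo)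

lemma principal_part_dd_form:
  assumes y: "y\<^sup>2 - 4 \<noteq> 0"
  shows "principal_part (\<lambda>z. dd_form n (\<lambda>k. basis_fun k (joukowski z)) f) y = dd_form n (\<lambda>k. basis_fun k y) f"
proof -
  have "principal_part (\<lambda>z. dd_form n (\<lambda>k. basis_fun k (joukowski z)) f) y
     = principal_part (\<lambda>z. \<Sum>i\<le>n+1. \<Sum>j\<le>n+1. (of_int (dd_coeff n i j) * f j) * basis_fun i (joukowski z)) y"
    unfolding dd_form_def by (simp only: mult_ac)
  also have "\<dots> = (\<Sum>i\<le>n+1. \<Sum>j\<le>n+1. (of_int (dd_coeff n i j) * f j) * basis_fun i y)"
    by (simp only: principal_part_sum[OF y] punct_holo_sum punct_holo_mult[OF punct_holo_const basis_fun_punct_holo]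
        principal_part_cmult[OF y basis_fun_punct_holo] principal_part_basis_fun[OF y])
  finally show ?thesis unfolding dd_form_def by (simp only: mult_ac)
qed

text \<open>
  Only the divided difference has poles at the ramification points; the other terms of the
  partial fraction decomposition are analytic there.
\<close>

lemma principal_part_two_point_kernel:
  assumes y: "y\<^sup>2 - 4 \<noteq> 0" and q: "q\<^sup>2 - 4 \<noteq> 0"
  shows "principal_part (\<lambda>z. - (basis_fun n (joukowski z) * two_point_kernel (joukowski z) q)) y = dd_form n (\<lambda>k. basis_fun k y) (theta (\<lambda>k. basis_fun k q))"
    and "punct_holo (\<lambda>z. - (basis_fun n (joukowski z) * two_point_kernel (joukowski z) q))"
proof -
  let ?H = "\<lambda>z. - theta (\<lambda>k. basis_fun k q) n / (q - joukowski z) - (q\<^sup>2 - 4) * basis_fun n q / (q - joukowski z)\<^sup>2"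
  have q2: "q \<noteq> 2" "q \<noteq> -2" using q by auto
  have an: "?H analytic_on {1, -1}"
    by (intro analytic_intros joukowski_analytic) (use q2 in \<open>auto simp: joukowski_def\<close>)
  have ev: "eventually (\<lambda>z. - (basis_fun n (joukowski z) * two_point_kernel (joukowski z) q)
      = dd_form n (\<lambda>k. basis_fun k (joukowski z)) (theta (\<lambda>k. basis_fun k q)) + ?H z) (at r)" if r: "r \<in> {1, -1}" for r
    using eventually_regular[OF r] eventually_joukowski_neq[OF r q]
  proof eventually_elim
    case (elim z)
    then show ?case using two_point_kernel_principal_part[OF regular_D q, of z n] by simp
  qed
  have "principal_part (\<lambda>z. - (basis_fun n (joukowski z) * two_point_kernel (joukowski z) q)) y
      = principal_part (\<lambda>z. dd_form n (\<lambda>k. basis_fun k (joukowski z)) (theta (\<lambda>k. basis_fun k q)) + ?H z) y"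
    by (rule principal_part_cong) (rule ev)
  also have "\<dots> = dd_form n (\<lambda>k. basis_fun k y) (theta (\<lambda>k. basis_fun k q))"
    by (simp only: principal_part_add[OF y punct_holo_dd_form punct_holo_analytic[OF an]] principal_part_dd_form[OF y]
        principal_part_analytic[OF y an] add_0_right)
  finally show "principal_part (\<lambda>z. - (basis_fun n (joukowski z) * two_point_kernel (joukowski z) q)) y
      = dd_form n (\<lambda>k. basis_fun k y) (theta (\<lambda>k. basis_fun k q))" .
  have "punct_holo (\<lambda>z. dd_form n (\<lambda>k. basis_fun k (joukowski z)) (theta (\<lambda>k. basis_fun k q)) + ?H z)"
    by (intro punct_holo_add punct_holo_dd_form punct_holo_analytic an)
  then show "punct_holo (\<lambda>z. - (basis_fun n (joukowski z) * two_point_kernel (joukowski z) q))"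
  proof (rule punct_holo_cong)
    fix r :: complex assume "r \<in> {1, -1}"
    from ev[OF this]
    show "eventually (\<lambda>z. dd_form n (\<lambda>k. basis_fun k (joukowski z)) (theta (\<lambda>k. basis_fun k q)) + ?H z
        = - (basis_fun n (joukowski z) * two_point_kernel (joukowski z) q)) (at r)"
      by eventually_elim (rule sym)
  qed
qed

lemma principal_part_simple_pole:
  assumes y: "y\<^sup>2 - 4 \<noteq> 0" and an: "h analytic_on {1, -1}"
  shows "principal_part (\<lambda>z. - (h z / ((joukowski z)\<^sup>2 - 4))) y = - (\<Sum>r\<in>{1,-1}. h r * r / (4 * (y - 2 * r)))"
    and "punct_holo (\<lambda>z. - (h z / ((joukowski z)\<^sup>2 - 4)))"
proof -
  have y2: "y \<noteq> 2" "y \<noteq> -2" using y by auto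
  have "residue (\<lambda>z. 1/2 * (1 - 1 / z\<^sup>2) / (y - joukowski z) * - (h z / ((joukowski z)\<^sup>2 - 4))) r
      = - (h r * r / (4 * (y - 2 * r)))" if r: "r \<in> {1, -1}" for r
  proof -
    let ?f = "\<lambda>z. - h z / (2 * (z + r) * (y - joukowski z))"
    have r1: "r * r = 1" "r \<noteq> 0" using r by auto
    have "h analytic_on {r}" "joukowski analytic_on {r}" using an joukowski_analytic r analytic_on_subset by blast+
    moreover have "2 * (r + r) * (y - joukowski r) \<noteq> 0" using r y2 joukowski_ramification[OF r] by auto
    ultimately have "?f analytic_on {r}" by (auto intro!: analytic_intros)
    then obtain e where e: "e > 0" "?f holomorphic_on ball r e" by (auto simp: analytic_at_ball)
    have "residue (\<lambda>z. 1/2 * (1 - 1 / z\<^sup>2) / (y - joukowski z) * - (h z / ((joukowski z)\<^sup>2 - 4))) r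
        = residue (\<lambda>z. ?f z / (z - r)) r"
    proof (rule residue_cong[OF _ refl])
      show "eventually (\<lambda>z. 1/2 * (1 - 1 / z\<^sup>2) / (y - joukowski z) * - (h z / ((joukowski z)\<^sup>2 - 4))
          = ?f z / (z - r)) (at r)"
        using eventually_regular[OF r] eventually_joukowski_neq[OF r y]
      proof eventually_elim
        case (elim z)
        then have z: "z \<noteq> 0" by (simp add: regular_pt_def)
        define c where "c = z - 1 / z"
        have c: "c \<noteq> 0" using regular_conj_diff[OF elim(1)] by (simp add: c_def)
        have rr: "2 * (z + r) * (y - joukowski z) * (z - r) = 2 * (z * c) * (y - joukowski z)"
          unfolding c_def using r z by (auto simp: field_simps)
        show ?case unfolding joukowski_DERIV'[OF z] joukowski_sq[OF z] c_def[symmetric] divide_divide_eq_left rr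
          using c z elim(2) by (simp add: field_simps power2_eq_square)
      qed
    qed
    also have "\<dots> = ?f r" by (rule residue_simple[of "ball r e"]) (use e in auto)
    also have "\<dots> = - (h r * r / (4 * (y - 2 * r)))"
    proof -
      have "- h r / (2 * (r + r) * (y - 2 * r)) = - (h r * (1 / r) / (4 * (y - 2 * r)))" by simp
      also have "1 / r = r" using r by auto
      finally show ?thesis unfolding joukowski_ramification[OF r] .
    qed
    finally show ?thesis .
  qed
  then show "principal_part (\<lambda>z. - (h z / ((joukowski z)\<^sup>2 - 4))) y = - (\<Sum>r\<in>{1,-1}. h r * r / (4 * (y - 2 * r)))"
    unfolding principal_part_def res_sum_def sum_negf[symmetric] by (rule sum.cong[OF refl])
  have "punct_holo (\<lambda>z. (-1) * (h z * basis_fun 0 (joukowski z)))"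
    by (intro punct_holo_mult punct_holo_const basis_fun_punct_holo punct_holo_analytic an)
  then show "punct_holo (\<lambda>z. - (h z / ((joukowski z)\<^sup>2 - 4)))" by (simp add: basis_fun_def)
qed

text \<open>
  Near a ramification point the segment from 1/z to z avoids \<open>z\<^sub>0\<close>, and the
  integral of the double pole is elementary. The result is exactly the projection kernel, with
  an additional factor -1/D.
\<close>

lemma weber_kernel_eq:
  assumes s: "s \<noteq> 0" and z0: "regular_pt z0" and r: "r \<in> {1, -1}"
  shows "eventually (\<lambda>z. weber_kernel s z0 z * deriv weber_conj z * (s\<^sup>2 * z0)
     = 1/2 * (1 - 1 / z\<^sup>2) / (joukowski z0 - joukowski z) * - (1 / ((joukowski z)\<^sup>2 - 4))) (at r)"
proof -
  have rn: "r \<noteq> 0" "1 / r = r" using r by auto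
  define e where "e = dist r z0"
  have e: "e > 0" using z0 r by (auto simp: e_def regular_pt_def)
  have "isCont (\<lambda>z. 1 / z) r" using rn by (intro continuous_intros)
  then have "eventually (\<lambda>z. 1 / z \<in> ball r e) (at r)"
    using rn e topological_tendstoD[of "\<lambda>z. 1 / z" r "at r" "ball r e"] by (simp add: isCont_def)
  moreover have "eventually (\<lambda>z. z \<in> ball r e) (at r)"
    using e eventually_at_in_open'[of "ball r e" r] by simp
  moreover have "eventually (\<lambda>z. joukowski z \<noteq> joukowski z0) (at r)"
    by (rule eventually_joukowski_neq[OF r regular_D[OF z0]])
  ultimately show ?thesis using eventually_regular[OF r]
  proof eventually_elim
    case (elim z)
    have z: "z \<noteq> 0" and z0': "z0 \<noteq> 0" using elim(4) z0 by (simp_all add: regular_pt_def)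
    define c where "c = z - 1 / z"
    have c: "c \<noteq> 0" using regular_conj_diff[OF elim(4)] by (simp add: c_def)
    have ne: "z0 \<noteq> z" "z0 \<noteq> 1 / z" using elim(3) z by (auto simp: joukowski_def)
    have "((\<lambda>\<zeta>. bidiff z0 \<zeta>) has_contour_integral 1 / (z0 - pathfinish (linepath (1 / z) z))
        - 1 / (z0 - pathstart (linepath (1 / z) z))) (linepath (1 / z) z)"
    proof (rule contour_integral_primitive[of "ball r e"])
      fix \<zeta> assume "\<zeta> \<in> ball r e"
      then have "z0 - \<zeta> \<noteq> 0" by (auto simp: e_def)
      then show "((\<lambda>\<zeta>. 1 / (z0 - \<zeta>)) has_field_derivative bidiff z0 \<zeta>) (at \<zeta> within ball r e)"
        by (auto intro!: derivative_eq_intros simp: bidiff_def power2_eq_square)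
    next
      show "path_image (linepath (1 / z) z) \<subseteq> ball r e"
        using elim(1,2) by (simp add: closed_segment_subset)
    qed simp
    then have ci: "contour_integral (linepath (1 / z) z) (\<lambda>\<zeta>. bidiff z0 \<zeta>) = 1 / (z0 - z) - 1 / (z0 - 1 / z)"
      using contour_integral_unique by simp
    have "(weber_conj has_field_derivative - 1 / z\<^sup>2) (at z)"
      unfolding weber_conj_def[abs_def] using z
      by (auto intro!: derivative_eq_intros simp: power2_eq_square)
    then have dc: "deriv weber_conj z = - 1 / z\<^sup>2" by (rule DERIV_imp_deriv)
    have "(weber_x s has_field_derivative s * (1 - 1 / z\<^sup>2)) (at z)"
      unfolding weber_x_def[abs_def] using z
      by (auto intro!: derivative_eq_intros simp: power2_eq_square)
    then have dx: "deriv (weber_x s) z = s * (c / z)" unfolding c_def joukowski_DERIV'[OF z, symmetric]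
      by (rule DERIV_imp_deriv)
    have dy: "weber_y s z - weber_y s (weber_conj z) = s * c"
      using z by (simp add: weber_y_def weber_conj_def c_def field_simps)
    have nd: "z0 - z \<noteq> 0" "z0 - 1 / z \<noteq> 0" "joukowski z0 - joukowski z \<noteq> 0" using ne elim(3) by auto
    have "(z0 - z) * (z0 - 1 / z) = z0 * (joukowski z0 - joukowski z)" using z z0' by (simp add: joukowski_def field_simps)
    moreover have "1 / a - 1 / b = (b - a) / (a * b)" if "a \<noteq> 0" "b \<noteq> 0" for a b :: complex
      using that by (simp add: field_simps)
    ultimately have I: "1 / (z0 - z) - 1 / (z0 - 1 / z) = c / (z0 * (joukowski z0 - joukowski z))"
      using nd by (simp add: c_def)
    have ci': "contour_integral (linepath (weber_conj z) z) (\<lambda>\<zeta>. bidiff z0 \<zeta>)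
        = c / (z0 * (joukowski z0 - joukowski z))" using ci I by (simp only: weber_conj_def)
    have "weber_kernel s z0 z * deriv weber_conj z * (s\<^sup>2 * z0)
        = 1 / (2 * (s * c) * (s * (c / z))) * (c / (z0 * (joukowski z0 - joukowski z))) * (- 1 / z\<^sup>2) * (s\<^sup>2 * z0)"
      unfolding weber_kernel_def dc dx dy ci' ..
    also have "\<dots> = 1/2 * (c / z) / (joukowski z0 - joukowski z) * - (1 / c\<^sup>2)"
      using s c z z0' nd(3) by (simp add: field_simps power2_eq_square)
    finally show ?case unfolding joukowski_DERIV'[OF z] joukowski_sq[OF z] c_def .
  qed
qed

text \<open>
  The bracket of the topological recursion, with splittings instead of sets of positions.
\<close>

definition weber_bracket :: "complex \<Rightarrow> nat \<Rightarrow> complex \<Rightarrow> complex list \<Rightarrow> complex" where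
  "weber_bracket s g z zs =
     (if g = 0 then 0 else weber_W s (g - 1) (z # weber_conj z # zs)) +
     (\<Sum>g1\<le>g. split_sum (\<lambda>u v. if g1 = 0 \<and> u = [] \<or> g1 = g \<and> v = [] then 0
        else weber_W s g1 (z # u) * weber_W s (g - g1) (weber_conj z # v)) zs)"

lemma weber_W_stable:
  assumes "2 * g + length zs \<ge> 2"
  shows "weber_W s g (z0 # zs)
    = res_sum (\<lambda>z. weber_kernel s z0 z * deriv weber_conj z * weber_bracket s g z zs)"
proof -
  have n: "nths zs I = [] \<longleftrightarrow> I = {}" if "I \<subseteq> {0..<length zs}" for I
  proof -
    have "set (nths zs I) = {zs!i|i. i < length zs \<and> i \<in> I}" by (rule set_nths)
    then have "set (nths zs I) = {} \<longleftrightarrow> I = {}" using that by fastforce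
    then show ?thesis by simp
  qed
  have "(\<Sum>I\<in>Pow {0..<length zs}.
             if (g1 = 0 \<and> I = {}) \<or> (g - g1 = 0 \<and> {0..<length zs} - I = {}) then 0
             else weber_W s g1 (z # nths zs I)
                * weber_W s (g - g1) (weber_conj z # nths zs ({0..<length zs} - I)))
      = split_sum (\<lambda>u v. if g1 = 0 \<and> u = [] \<or> g1 = g \<and> v = [] then 0
        else weber_W s g1 (z # u) * weber_W s (g - g1) (weber_conj z # v)) zs"
    if "g1 \<le> g" for g1 z
    unfolding sum_Pow_nths[symmetric] using that
    by (intro sum.cong refl) (simp add: n)
  then have "weber_bracket s g z zs = (if g = 0 then 0 else weber_W s (g - 1) (z # weber_conj z # zs)) +
          (\<Sum>g1\<in>{0..g}. \<Sum>I\<in>Pow {0..<length zs}.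
             if (g1 = 0 \<and> I = {}) \<or> (g - g1 = 0 \<and> {0..<length zs} - I = {}) then 0
             else weber_W s g1 (z # nths zs I)
                * weber_W s (g - g1) (weber_conj z # nths zs ({0..<length zs} - I)))" for z
    unfolding weber_bracket_def atLeast0AtMost by (intro arg_cong2[where f = "(+)"] refl sum.cong) simp
  moreover have "\<not> (g = 0 \<and> length zs = 0)" "\<not> (g = 0 \<and> length zs = 1)" using assms by auto
  ultimately show ?thesis
    unfolding res_sum_def weber_ramification_def[symmetric] by (subst weber_W.simps(2)) (simp only: if_False)
qed

section \<open>The correlation functions as contractions\<close>

lemmas [simp del] = weber_W.simps(2)

lemma weber_W_02: "weber_W s 0 [a, b] = bidiff a b"
  by (subst weber_W.simps(2)) simp

definition point_slot :: "complex \<Rightarrow> nat \<Rightarrow> complex" where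
  "point_slot z k = basis_fun k (joukowski z)"

text \<open>
  The coefficient of \<open>W\<^bsub>0,2\<^esub>\<close> with respect to \<open>dz/z
  dp/p\<close>.
\<close>

definition bidiff_log :: "complex \<Rightarrow> complex \<Rightarrow> complex" where
  "bidiff_log p z = z * p * bidiff z p"

text \<open>
  The products of two factors \<open>W\<^bsub>0,2\<^esub>\<close>, which occur for \<open>(g, n)
  = (0, 3)\<close> only.
\<close>

definition pair_term :: "nat \<Rightarrow> complex list \<Rightarrow> complex \<Rightarrow> complex" where
  "pair_term g zs z = (if g = 0 \<and> length zs = 2 then
     bidiff_log (zs ! 0) z * bidiff_log (zs ! 1) (1 / z) + bidiff_log (zs ! 1) z * bidiff_log (zs ! 0) (1 / z) else 0)"

lemma joukowski_conj: "joukowski (1 / z) = joukowski z"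
  by (simp add: joukowski_def add.commute)

lemma bidiff_log_sum:
  assumes "z \<noteq> 0" "p \<noteq> 0" "joukowski z \<noteq> joukowski p"
  shows "bidiff_log p z + bidiff_log p (1 / z) = two_point_kernel (joukowski z) (joukowski p)"
proof -
  have ne: "z - p \<noteq> 0" "1 - z * p \<noteq> 0"
  proof -
    show "z - p \<noteq> 0" using assms(3) by auto
    show "1 - z * p \<noteq> 0"
    proof
      assume "1 - z * p = 0"
      then have "p = 1 / z" using assms(1) by (simp add: field_simps)
      then show False using assms(3) by (simp add: joukowski_conj)
    qed
  qed
  have 1: "bidiff_log p (1 / z) = z * p / (1 - z * p)\<^sup>2"
  proof -
    have "1 / z - p = (1 - z * p) / z" using assms(1) by (simp add: field_simps)
    then show ?thesis using assms(1) ne unfolding bidiff_log_def bidiff_def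
      by (simp add: power_divide power2_eq_square)
  qed
  have d: "z * p * (joukowski z - joukowski p) = - ((z - p) * (1 - z * p))"
    using assms by (simp add: joukowski_def field_simps)
  have n: "z * p * (joukowski z * joukowski p - 4) = (1 - z * p)\<^sup>2 + (z - p)\<^sup>2"
    using assms by (simp add: joukowski_def field_simps power2_eq_square)
  have "two_point_kernel (joukowski z) (joukowski p) = z * p * (z * p * (joukowski z * joukowski p - 4)) / (z * p * (joukowski z - joukowski p))\<^sup>2"
    using assms by (simp add: two_point_kernel_def power_mult_distrib power2_eq_square)
  also have "\<dots> = z * p * ((1 - z * p)\<^sup>2 + (z - p)\<^sup>2) / ((z - p)\<^sup>2 * (1 - z * p)\<^sup>2)"
    unfolding n d by (simp add: power_mult_distrib)
  also have "\<dots> = z * p / (z - p)\<^sup>2 + z * p / (1 - z * p)\<^sup>2"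
    using ne by (simp add: field_simps)
  finally show ?thesis unfolding 1 by (simp add: bidiff_log_def bidiff_def)
qed

lemma bidiff_log_ramification:
  assumes "regular_pt p" "r \<in> {1, -1}"
  shows "bidiff_log p r = r / (joukowski p - 2 * r)"
proof -
  have p: "p \<noteq> 0" and pr: "p - r \<noteq> 0" using assms by (auto simp: regular_pt_def)
  have "r * r = 1" using assms by auto
  then have "p * (joukowski p - 2 * r) = (r - p)\<^sup>2"
    using p by (simp add: joukowski_def field_simps power2_eq_square)
  then have "joukowski p - 2 * r = (r - p)\<^sup>2 / p" using p by (simp add: field_simps)
  then show ?thesis by (simp add: bidiff_log_def bidiff_def)
qed

lemma bidiff_log_analytic:
  assumes "regular_pt p"
  shows "bidiff_log p analytic_on {1, -1}" "(\<lambda>z. bidiff_log p (1 / z)) analytic_on {1, -1}"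
  unfolding bidiff_log_def bidiff_def
  using assms by (auto intro!: analytic_intros simp: regular_pt_def)

lemma pair_term_analytic:
  assumes "\<forall>p\<in>set zs. regular_pt p"
  shows "pair_term g zs analytic_on {1, -1}"
proof (cases "g = 0 \<and> length zs = 2")
  case True
  then have "regular_pt (zs ! 0)" "regular_pt (zs ! 1)" using assms by auto
  then show ?thesis using True unfolding pair_term_def[abs_def]
    by (auto intro!: analytic_intros bidiff_log_analytic)
next
  case False
  then show ?thesis unfolding pair_term_def[abs_def] by auto
qed

lemma sum_split_pair_term:
  "(\<Sum>g1\<le>g. split_sum (\<lambda>u v. (if g1 = 0 \<and> length u = 1 then bidiff_log (hd u) z else 0)
      * (if g - g1 = 0 \<and> length v = 1 then bidiff_log (hd v) (1 / z) else 0)) zs) = pair_term g zs z"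
proof (cases "g = 0 \<and> length zs = 2")
  case True
  then obtain a b where "zs = [a, b]" by (auto simp: numeral_2_eq_2 length_Suc_conv)
  then show ?thesis using True by (simp add: pair_term_def)
next
  case False
  have "split_sum (\<lambda>u v. (if g1 = 0 \<and> length u = 1 then bidiff_log (hd u) z else 0)
      * (if g - g1 = 0 \<and> length v = 1 then bidiff_log (hd v) (1 / z) else 0)) zs
      = split_sum (\<lambda>u v. 0) zs" if "g1 \<le> g" for g1
  proof (rule split_sum_cong[OF refl])
    fix u v assume "mset u + mset v = mset zs"
    then have "length u + length v = length zs" by (rule mset_split_bounds(1))
    then show "(if g1 = 0 \<and> length u = 1 then bidiff_log (hd u) z else 0)
      * (if g - g1 = 0 \<and> length v = 1 then bidiff_log (hd v) (1 / z) else 0) = 0"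
      using False that by auto
  qed
  then show ?thesis unfolding pair_term_def if_not_P[OF False] by simp
qed

lemma prod_list_split: "mset u + mset v = mset zs \<Longrightarrow> prod_list u * prod_list v = prod_list zs"
  for zs :: "complex list"
  by (metis prod_mset.union prod_mset_prod_list)

text \<open>
  Up to the factor dz/z, a stable factor only depends on x(z) and is therefore insensitive to
  \<open>z \<mapsto> 1/z\<close>. So a product with one factor
  \<open>W\<^bsub>0,2\<^esub>\<close> occurs together with its conjugate, and the two add up to
  the symmetric kernel.
\<close>

lemma weber_bracket_eq:
  assumes s: "s \<noteq> 0" and reg: "\<forall>p\<in>set zs. regular_pt p" and st: "2 * g + length zs \<ge> 2"
    and z: "regular_pt z" "\<And>p. p \<in> set zs \<Longrightarrow> joukowski z \<noteq> joukowski p"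
    and IH: "\<And>g' zs'. 2 * g' + length zs' \<le> 2 * g + length zs \<Longrightarrow> 2 * g' + length zs' \<ge> 3 \<Longrightarrow>
      \<forall>p\<in>set zs'. regular_pt p \<Longrightarrow>
      weber_W s g' zs' * prod_list zs' * (s\<^sup>2) ^ (2 * g' + length zs' - 2) = contract point_slot K (tr_coeff g') zs'"
  shows "weber_bracket s g z zs * prod_list zs * (s\<^sup>2) ^ (2 * g + length zs - 2)
    = (\<Sum>k<K. \<Sum>l<K. basis_fun k (joukowski z) * basis_fun l (joukowski z) * tr_pair point_slot K g k l zs)
      + pick_sum (\<lambda>p qs. \<Sum>k<K. two_point_kernel (joukowski z) (joukowski p) * basis_fun k (joukowski z) * tr_slot point_slot K g k qs) zs
      + ((if g = 1 \<and> zs = [] then 1 / ((joukowski z)\<^sup>2 - 4) else 0) + pair_term g zs z)"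
proof -
  define P where "P = s\<^sup>2"
  have z0: "z \<noteq> 0" and reg': "regular_pt (1 / z)"
    using z(1) by (auto simp: regular_pt_def divide_eq_eq eq_divide_eq minus_equation_iff)
  have conj: "weber_conj z = 1 / z" by (simp add: weber_conj_def)
  define S where "S g1 u = (\<Sum>k<K. basis_fun k (joukowski z) * tr_slot point_slot K g1 k u)" for g1 u
  define \<beta> where "\<beta> g1 u w = (if g1 = 0 \<and> length u = 1 then bidiff_log (hd u) w else 0)"
    for g1 :: nat and u w
  have S: "contract point_slot K (tr_coeff g1) (w # u) = S g1 u" if "joukowski w = joukowski z" for g1 u w
    by (simp add: S_def point_slot_def that)
  have S0: "S 0 u = 0" if "length u < 2" for u
    unfolding S_def using that by (simp add: tr_slot_unstable)
  have one: "weber_W s g1 (w # u) * (w * prod_list u) * P ^ (2 * g1 + length u - 1) = S g1 u + \<beta> g1 u w"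
    if le: "2 * g1 + length u + 1 \<le> 2 * g + length zs" and ne: "\<not> (g1 = 0 \<and> u = [])"
      and w: "regular_pt w" "joukowski w = joukowski z" and u: "set u \<subseteq> set zs" for g1 u w
  proof (cases "g1 = 0 \<and> length u = 1")
    case True
    then obtain p where "u = [p]" by (auto simp: length_Suc_conv)
    then show ?thesis using True by (simp add: S0 \<beta>_def bidiff_log_def weber_W_02)
  next
    case False
    have "2 * g1 + length (w # u) \<ge> 3" using False ne by (cases g1; cases u) (auto simp: Suc_le_eq)
    from IH[OF _ this] le w(1) u reg
    have "weber_W s g1 (w # u) * prod_list (w # u) * (s\<^sup>2) ^ (2 * g1 + length (w # u) - 2)
        = contract point_slot K (tr_coeff g1) (w # u)" by auto
    then show ?thesis unfolding S[OF w(2)] using False by (auto simp: \<beta>_def P_def)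
  qed
  have two: "weber_W s (g - 1) (z # 1 / z # zs) * prod_list zs * P ^ (2 * g + length zs - 2)
      = (\<Sum>k<K. \<Sum>l<K. basis_fun k (joukowski z) * basis_fun l (joukowski z) * contract point_slot K (\<lambda>ks. tr_coeff (g - 1) (k # l # ks)) zs)
        + (if g = 1 \<and> zs = [] then 1 / ((joukowski z)\<^sup>2 - 4) else 0)" if g: "g > 0"
  proof (cases "g = 1 \<and> zs = []")
    case True
    have "weber_W s 0 [z, 1 / z] = 1 / ((joukowski z)\<^sup>2 - 4)" unfolding joukowski_sq[OF z0] weber_W_02 by (simp add: bidiff_def)
    then show ?thesis using True by (simp add: tr_coeff_unstable)
  next
    case False
    have h1: "2 * (g - 1) + length (z # 1 / z # zs) \<ge> 3" using False g by (cases zs) auto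
    have h2: "2 * (g - 1) + length (z # 1 / z # zs) \<le> 2 * g + length zs" using g by simp
    have h3: "\<forall>p\<in>set (z # 1 / z # zs). regular_pt p" using z(1) reg' reg by simp
    note IH[OF h2 h1 h3]
    moreover have "2 * (g - 1) + length (z # 1 / z # zs) - 2 = 2 * g + length zs - 2" using g by simp
    ultimately show ?thesis unfolding if_not_P[OF False] using z0
      by (simp add: P_def point_slot_def joukowski_conj sum_distrib_left mult_ac)
  qed
  have split: "(if g1 = 0 \<and> u = [] \<or> g1 = g \<and> v = [] then 0
        else weber_W s g1 (z # u) * weber_W s (g - g1) (weber_conj z # v))
        * (prod_list zs * P ^ (2 * g + length zs - 2))
      = (S g1 u + \<beta> g1 u z) * (S (g - g1) v + \<beta> (g - g1) v (1 / z))"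
    if g1: "g1 \<le> g" and uv: "mset u + mset v = mset zs" for g1 u v
  proof (cases "g1 = 0 \<and> u = [] \<or> g1 = g \<and> v = []")
    case True
    then show ?thesis by (auto simp: S0 \<beta>_def)
  next
    case False
    note len = mset_split_bounds[OF uv]
    have "2 * g1 + length u \<ge> 1" "2 * (g - g1) + length v \<ge> 1" using False g1 by (cases u; cases v; auto)+
    then have e: "2 * g + length zs - 2 = (2 * g1 + length u - 1) + (2 * (g - g1) + length v - 1)"
      using g1 len(1) by simp
    have 1: "weber_W s g1 (z # u) * (z * prod_list u) * P ^ (2 * g1 + length u - 1) = S g1 u + \<beta> g1 u z"
    proof (rule one)
      show "2 * g1 + length u + 1 \<le> 2 * g + length zs"
        using \<open>2 * (g - g1) + length v \<ge> 1\<close> len(1) g1 by linarith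
    qed (use False z(1) len in auto)
    have 2: "weber_W s (g - g1) (1 / z # v) * (1 / z * prod_list v) * P ^ (2 * (g - g1) + length v - 1)
        = S (g - g1) v + \<beta> (g - g1) v (1 / z)"
    proof (rule one)
      show "2 * (g - g1) + length v + 1 \<le> 2 * g + length zs"
        using \<open>2 * g1 + length u \<ge> 1\<close> len(1) g1 by linarith
    qed (use False reg' len g1 joukowski_conj in auto)
    have "weber_W s g1 (z # u) * weber_W s (g - g1) (1 / z # v) * (prod_list zs * P ^ (2 * g + length zs - 2))
      = (weber_W s g1 (z # u) * (z * prod_list u) * P ^ (2 * g1 + length u - 1)) *
        (weber_W s (g - g1) (1 / z # v) * (1 / z * prod_list v) * P ^ (2 * (g - g1) + length v - 1))"
      unfolding e power_add prod_list_split[OF uv, symmetric] using z0 by (simp add: field_simps)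
    then show ?thesis unfolding conj if_not_P[OF False] 1 2 .
  qed
  have "(\<Sum>g1\<le>g. split_sum (\<lambda>u v. if g1 = 0 \<and> u = [] \<or> g1 = g \<and> v = [] then 0
        else weber_W s g1 (z # u) * weber_W s (g - g1) (weber_conj z # v)) zs)
        * (prod_list zs * P ^ (2 * g + length zs - 2))
      = (\<Sum>g1\<le>g. split_sum (\<lambda>u v. (S g1 u + \<beta> g1 u z) * (S (g - g1) v + \<beta> (g - g1) v (1 / z))) zs)"
    unfolding sum_distrib_right split_sum_cmult_right[symmetric]
    by (intro sum.cong refl split_sum_cong split) auto
  also have "\<dots> = (\<Sum>g1\<le>g. split_sum (\<lambda>u v. S g1 u * S (g - g1) v) zs)
      + ((\<Sum>g1\<le>g. split_sum (\<lambda>u v. \<beta> g1 u z * S (g - g1) v) zs)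
      + (\<Sum>g1\<le>g. split_sum (\<lambda>u v. S g1 u * \<beta> (g - g1) v (1 / z)) zs))
      + (\<Sum>g1\<le>g. split_sum (\<lambda>u v. \<beta> g1 u z * \<beta> (g - g1) v (1 / z)) zs)"
    unfolding sum.distrib[symmetric] split_sum_add[symmetric]
    by (intro sum.cong refl split_sum_cong) (simp add: algebra_simps)
  also have "(\<Sum>g1\<le>g. split_sum (\<lambda>u v. \<beta> g1 u z * \<beta> (g - g1) v (1 / z)) zs) = pair_term g zs z"
    unfolding \<beta>_def sum_split_pair_term ..
  also have "(\<Sum>g1\<le>g. split_sum (\<lambda>u v. S g1 u * S (g - g1) v) zs)
      = (\<Sum>k<K. \<Sum>l<K. basis_fun k (joukowski z) * basis_fun l (joukowski z)
          * (\<Sum>g1\<le>g. split_sum (\<lambda>u v. tr_slot point_slot K g1 k u * tr_slot point_slot K (g - g1) l v) zs))"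
  proof -
    have "split_sum (\<lambda>u v. S g1 u * S (g - g1) v) zs = (\<Sum>k<K. \<Sum>l<K. basis_fun k (joukowski z) * basis_fun l (joukowski z)
          * split_sum (\<lambda>u v. tr_slot point_slot K g1 k u * tr_slot point_slot K (g - g1) l v) zs)" for g1
      unfolding S_def sum_product split_sum_sum split_sum_cmult[symmetric]
      by (simp add: mult_ac)
    then show ?thesis by (simp add: sum_distrib_left) (subst sum.swap, intro sum.cong refl sum.swap)
  qed
  also have "(\<Sum>g1\<le>g. split_sum (\<lambda>u v. \<beta> g1 u z * S (g - g1) v) zs)
      = pick_sum (\<lambda>p qs. bidiff_log p z * S g qs) zs"
  proof -
    have "(\<Sum>g1\<le>g. split_sum (\<lambda>u v. \<beta> g1 u z * S (g - g1) v) zs)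
        = (\<Sum>g1\<in>{0}. split_sum (\<lambda>u v. \<beta> g1 u z * S (g - g1) v) zs)"
      by (rule sum.mono_neutral_right) (auto simp: \<beta>_def)
    also have "\<dots> = split_sum (\<lambda>u v. if length u = 1 then bidiff_log (hd u) z * S g v else 0) zs"
      by (auto simp: \<beta>_def intro!: split_sum_cong)
    also have "\<dots> = pick_sum (\<lambda>p qs. bidiff_log p z * S g qs) zs"
      by (rule split_sum_singleton_left[of "\<lambda>p qs. bidiff_log p z * S g qs"])
    finally show ?thesis .
  qed
  also have "(\<Sum>g1\<le>g. split_sum (\<lambda>u v. S g1 u * \<beta> (g - g1) v (1 / z)) zs)
      = pick_sum (\<lambda>p qs. bidiff_log p (1 / z) * S g qs) zs"
  proof -
    have "(\<Sum>g1\<le>g. split_sum (\<lambda>u v. S g1 u * \<beta> (g - g1) v (1 / z)) zs)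
        = (\<Sum>g1\<in>{g}. split_sum (\<lambda>u v. S g1 u * \<beta> (g - g1) v (1 / z)) zs)"
      by (rule sum.mono_neutral_right) (auto simp: \<beta>_def)
    also have "\<dots> = split_sum (\<lambda>v u. S g u * \<beta> 0 v (1 / z)) zs"
      by (subst split_sum_commute) simp
    also have "\<dots> = split_sum (\<lambda>v u. if length v = 1 then bidiff_log (hd v) (1 / z) * S g u else 0) zs"
      by (auto simp: \<beta>_def intro!: split_sum_cong)
    also have "\<dots> = pick_sum (\<lambda>p qs. bidiff_log p (1 / z) * S g qs) zs"
      by (rule split_sum_singleton_left[of "\<lambda>p qs. bidiff_log p (1 / z) * S g qs"])
    finally show ?thesis .
  qed
  also have "pick_sum (\<lambda>p qs. bidiff_log p z * S g qs) zs + pick_sum (\<lambda>p qs. bidiff_log p (1 / z) * S g qs) zs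
     = pick_sum (\<lambda>p qs. \<Sum>k<K. two_point_kernel (joukowski z) (joukowski p) * basis_fun k (joukowski z) * tr_slot point_slot K g k qs) zs"
    unfolding pick_sum_add[symmetric]
  proof (rule pick_sum_cong[OF refl])
    fix p qs assume "mset (p # qs) = mset zs"
    then have "p \<in> set zs" by (rule mset_pick_bounds(2))
    then have b: "bidiff_log p z + bidiff_log p (1 / z) = two_point_kernel (joukowski z) (joukowski p)"
      using bidiff_log_sum[of z p] z(2) z0 reg by (auto simp: regular_pt_def)
    show "bidiff_log p z * S g qs + bidiff_log p (1 / z) * S g qs
        = (\<Sum>k<K. two_point_kernel (joukowski z) (joukowski p) * basis_fun k (joukowski z) * tr_slot point_slot K g k qs)"
      unfolding distrib_right[symmetric] b
      unfolding S_def sum_distrib_left mult.assoc ..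
  qed
  finally have sp: "(\<Sum>g1\<le>g. split_sum (\<lambda>u v. if g1 = 0 \<and> u = [] \<or> g1 = g \<and> v = [] then 0
        else weber_W s g1 (z # u) * weber_W s (g - g1) (weber_conj z # v)) zs)
        * (prod_list zs * P ^ (2 * g + length zs - 2))
     = (\<Sum>k<K. \<Sum>l<K. basis_fun k (joukowski z) * basis_fun l (joukowski z)
          * (\<Sum>g1\<le>g. split_sum (\<lambda>u v. tr_slot point_slot K g1 k u * tr_slot point_slot K (g - g1) l v) zs))
       + pick_sum (\<lambda>p qs. \<Sum>k<K. two_point_kernel (joukowski z) (joukowski p) * basis_fun k (joukowski z) * tr_slot point_slot K g k qs) zs
       + pair_term g zs z" .
  show ?thesis
  proof (cases "g = 0")
    case True
    then show ?thesis unfolding weber_bracket_def P_def[symmetric] mult.assoc distrib_right sp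
      by (simp add: tr_pair_def)
  next
    case False
    then have g: "g > 0" by simp
    have "weber_bracket s g z zs * (prod_list zs * P ^ (2 * g + length zs - 2))
      = weber_W s (g - 1) (z # 1 / z # zs) * prod_list zs * P ^ (2 * g + length zs - 2)
       + (\<Sum>g1\<le>g. split_sum (\<lambda>u v. if g1 = 0 \<and> u = [] \<or> g1 = g \<and> v = [] then 0
        else weber_W s g1 (z # u) * weber_W s (g - g1) (weber_conj z # v)) zs)
        * (prod_list zs * P ^ (2 * g + length zs - 2))"
      unfolding weber_bracket_def using False by (simp add: distrib_right conj mult.assoc)
    then show ?thesis unfolding two[OF g] sp P_def[symmetric] mult.assoc[of "weber_bracket s g z zs"] tr_pair_def
      using False by (simp add: distrib_left sum.distrib)
  qed
qed

lemma contract_tr_base: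
  assumes y: "regular_pt z0" and reg: "\<forall>p\<in>set zs. regular_pt p" and st: "2 * g + length zs \<ge> 2"
    and K: "K > 4"
  shows "contract point_slot K (tr_base g) (z0 # zs)
    = (if g = 1 \<and> zs = [] then - basis_fun 2 (joukowski z0) else 0)
      - (\<Sum>r\<in>{1,-1}. pair_term g zs r * r / (4 * (joukowski z0 - 2 * r)))"
proof -
  consider "g = 1" "zs = []" | "g = 0" "length zs = 2" | "\<not> (g = 1 \<and> zs = [])" "\<not> (g = 0 \<and> length zs = 2)"
    by blast
  then show ?thesis
  proof cases
    case 1
    have "tr_base 1 [k] = (if k = 2 then -1 else 0)" for k by (simp add: tr_base_def)
    then have "contract point_slot K (tr_base g) (z0 # zs) = (\<Sum>k<K. point_slot z0 k * (if k = 2 then -1 else 0))"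
      unfolding 1 by simp
    also have "\<dots> = (\<Sum>k<K. if k = 2 then - basis_fun 2 (joukowski z0) else 0)"
      by (intro sum.cong refl) (auto simp: point_slot_def)
    also have "\<dots> = - basis_fun 2 (joukowski z0)" using K by simp
    finally show ?thesis using 1 by (simp add: pair_term_def)
  next
    case 2
    then obtain p q where zs: "zs = [p, q]" by (auto simp: numeral_2_eq_2 length_Suc_conv)
    have tri: "(\<Sum>k<K. point_slot w k * tri_value e k) = 1 / (joukowski w - 2 * e)" if "regular_pt w" "e \<in> {1,-1}" for w e
    proof -
      have "(\<Sum>k<K. point_slot w k * tri_value e k) = (\<Sum>k\<in>{0,1}. point_slot w k * tri_value e k)"
        by (rule sum.mono_neutral_right) (use K in \<open>auto simp: tri_value_def\<close>)
      also have "\<dots> = (joukowski w + 2 * e) / ((joukowski w)\<^sup>2 - 4)"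
        by (simp add: point_slot_def basis_fun_def tri_value_def add_divide_distrib)
      also have "(joukowski w)\<^sup>2 - 4 = (joukowski w - 2 * e) * (joukowski w + 2 * e)"
        using that(2) by (auto simp: D_factor)
      finally show ?thesis using regular_D[OF that(1)] that(2) by (auto simp: D_factor)
    qed
    have "contract point_slot K (tr_base g) (z0 # zs) = contract point_slot K (\<lambda>ks. (- (1/2)) * (\<Prod>k\<leftarrow>ks. tri_value 1 k)
       + (1/2) * (\<Prod>k\<leftarrow>ks. tri_value (-1) k)) (z0 # zs)"
      by (rule contract_cong) (use 2 in \<open>auto simp: tr_base_def algebra_simps\<close>)
    also have "\<dots> = (- (1/2)) * (\<Prod>w\<leftarrow>z0 # zs. \<Sum>k<K. point_slot w k * tri_value 1 k)
       + (1/2) * (\<Prod>w\<leftarrow>z0 # zs. \<Sum>k<K. point_slot w k * tri_value (-1) k)"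
      unfolding contract_add contract_cmult contract_prod ..
    also have "\<dots> = - (\<Sum>r\<in>{1,-1}. pair_term g zs r * r / (4 * (joukowski z0 - 2 * r)))"
    proof -
      have rp: "regular_pt p" "regular_pt q" using reg zs by auto
      have D: "joukowski z0 - 2 \<noteq> 0" "joukowski z0 + 2 \<noteq> 0" "joukowski p - 2 \<noteq> 0" "joukowski p + 2 \<noteq> 0" "joukowski q - 2 \<noteq> 0" "joukowski q + 2 \<noteq> 0"
        using regular_D[OF y] regular_D[OF rp(1)] regular_D[OF rp(2)] unfolding D_factor by auto
      have t: "pair_term g zs r = 2 / ((joukowski p - 2 * r) * (joukowski q - 2 * r))" if r: "r \<in> {1,-1}" for r
      proof -
        have "1 / r = r" "r * r = 1" using r by auto
        then have "pair_term g zs r = 2 * (r / (joukowski p - 2 * r) * (r / (joukowski q - 2 * r)))"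
          using 2 zs by (simp add: pair_term_def bidiff_log_ramification[OF rp(1) r]
              bidiff_log_ramification[OF rp(2) r] mult_ac)
        also have "\<dots> = 2 * (r * r) / ((joukowski p - 2 * r) * (joukowski q - 2 * r))" by simp
        finally show ?thesis using \<open>r * r = 1\<close> by simp
      qed
      have "(\<Sum>r\<in>{1,-1}. pair_term g zs r * r / (4 * (joukowski z0 - 2 * r)))
         = (\<Sum>r\<in>{1,-1::complex}. 2 / ((joukowski p - 2 * r) * (joukowski q - 2 * r)) * r / (4 * (joukowski z0 - 2 * r)))"
        by (intro sum.cong refl) (simp add: t)
      also have "\<dots> = 2 / ((joukowski p - 2) * (joukowski q - 2)) * 1 / (4 * (joukowski z0 - 2))
          + 2 / ((joukowski p + 2) * (joukowski q + 2)) * (-1) / (4 * (joukowski z0 + 2))"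
        by simp
      finally have R: "(\<Sum>r\<in>{1,-1}. pair_term g zs r * r / (4 * (joukowski z0 - 2 * r)))
        = 2 / ((joukowski p - 2) * (joukowski q - 2)) * 1 / (4 * (joukowski z0 - 2))
          + 2 / ((joukowski p + 2) * (joukowski q + 2)) * (-1) / (4 * (joukowski z0 + 2))" .
      have tri': "(\<Sum>k<K. point_slot w k * tri_value 1 k) = 1 / (joukowski w - 2)"
        "(\<Sum>k<K. point_slot w k * tri_value (-1) k) = 1 / (joukowski w + 2)" if "regular_pt w" for w
        using tri[OF that, of 1] tri[OF that, of "-1"] by simp_all
      have alg: "(- (1/2)) * (1 / A * (1 / B * (1 / C))) + (1/2) * (1 / A' * (1 / B' * (1 / C')))
          = - (2 / (B * C) * 1 / (4 * A) + 2 / (B' * C') * (-1) / (4 * A'))" for A B C A' B' C' :: complex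
        by simp
      show ?thesis unfolding R
        by (simp only: zs list.map prod_list.Cons prod_list.Nil mult_1_right
            tri'[OF y] tri'[OF rp(1)] tri'[OF rp(2)] alg)
    qed
    finally show ?thesis using 2 by auto
  next
    case 3
    have "contract point_slot K (tr_base g) (z0 # zs) = 0"
      by (rule contract_0) (use 3 in \<open>auto simp: tr_base_def\<close>)
    then show ?thesis using 3 by (auto simp: pair_term_def)
  qed
qed

text \<open>
  Induction over 2g + n. The recursion kernel projects onto principal parts, and the projections
  of the three kinds of terms in the bracket are the three terms of the recursion for arrays.
\<close>

theorem weber_W_eq_contract:
  assumes s: "s \<noteq> 0"
  shows "2 * g + length zs \<ge> 3 \<Longrightarrow> \<forall>p\<in>set zs. regular_pt p \<Longrightarrow> 4 * (2 * g + length zs) < K \<Longrightarrow>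
    weber_W s g zs * prod_list zs * (s\<^sup>2) ^ (2 * g + length zs - 2) = contract point_slot K (tr_coeff g) zs"
proof (induction "2 * g + length zs" arbitrary: g zs rule: less_induct)
  case less
  from less.prems(1) show ?case
  proof (cases zs)
    case (Cons z0 r)
    let ?y = "joukowski z0"
    have st: "2 * g + length r \<ge> 2" using less.prems Cons by simp
    have z0: "regular_pt z0" and reg: "\<forall>p\<in>set r. regular_pt p" using less.prems Cons by auto
    have y: "?y\<^sup>2 - 4 \<noteq> 0" by (rule regular_D[OF z0])
    define E where "E = prod_list r * (s\<^sup>2) ^ (2 * g + length r - 2)"
    let ?B = "\<lambda>z. (\<Sum>k<K. \<Sum>l<K. tr_pair point_slot K g k l r * quad_form (\<lambda>k. basis_fun k (joukowski z)) k l)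
       + pick_sum (\<lambda>p qs. \<Sum>k<K. tr_slot point_slot K g k qs * - (basis_fun (k + 2) (joukowski z) * two_point_kernel (joukowski z) (joukowski p))) r
       + ((if g = 1 \<and> r = [] then -1 else 0) * basis_fun 2 (joukowski z) + - (pair_term g r z / ((joukowski z)\<^sup>2 - 4)))"
    have exp: "2 * g + length zs - 2 = (2 * g + length r - 2) + 1" using st Cons by simp
    have br: "eventually (\<lambda>z. weber_kernel s z0 z * deriv weber_conj z * weber_bracket s g z r * (s\<^sup>2 * z0 * E)
        = 1/2 * (1 - 1 / z\<^sup>2) / (?y - joukowski z) * ?B z) (at e)" if e: "e \<in> {1, -1}" for e
    proof -
      have "eventually (\<lambda>z. \<forall>p\<in>set r. joukowski z \<noteq> joukowski p) (at e)"
        using e reg by (intro eventually_ball_finite) (auto intro!: eventually_joukowski_neq regular_D)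
      from this eventually_regular[OF e] weber_kernel_eq[OF s z0 e]
      show ?thesis
      proof eventually_elim
        case (elim z)
        let ?D = "(joukowski z)\<^sup>2 - 4"
        have D: "?D \<noteq> 0" by (rule regular_D[OF elim(2)])
        have b: "weber_bracket s g z r * E = (\<Sum>k<K. \<Sum>l<K. basis_fun k (joukowski z) * basis_fun l (joukowski z) * tr_pair point_slot K g k l r)
            + pick_sum (\<lambda>p qs. \<Sum>k<K. two_point_kernel (joukowski z) (joukowski p) * basis_fun k (joukowski z) * tr_slot point_slot K g k qs) r
            + ((if g = 1 \<and> r = [] then 1 / ?D else 0) + pair_term g r z)"
          unfolding E_def mult.assoc[symmetric]
        proof (rule weber_bracket_eq[OF s reg st elim(2)])
          fix g' zs' assume "2 * g' + length zs' \<le> 2 * g + length r" "2 * g' + length zs' \<ge> 3"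
            "\<forall>p\<in>set zs'. regular_pt p"
          then show "weber_W s g' zs' * prod_list zs' * (s\<^sup>2) ^ (2 * g' + length zs' - 2)
              = contract point_slot K (tr_coeff g') zs'"
            using less.hyps[of g' zs'] less.prems(3) Cons by simp
        qed (use elim(1) in auto)
        have w2: "basis_fun (k + 2) x = basis_fun k x / (x\<^sup>2 - 4)" for k x
          by (simp add: basis_fun_def)
        have 1: "- (1 / ?D) * (\<Sum>k<K. \<Sum>l<K. basis_fun k (joukowski z) * basis_fun l (joukowski z) * tr_pair point_slot K g k l r)
            = (\<Sum>k<K. \<Sum>l<K. tr_pair point_slot K g k l r * quad_form (\<lambda>k. basis_fun k (joukowski z)) k l)"
          unfolding sum_distrib_left by (intro sum.cong refl) (simp add: basis_fun_quad[OF D])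
        have 2: "- (1 / ?D) * pick_sum (\<lambda>p qs. \<Sum>k<K. two_point_kernel (joukowski z) (joukowski p) * basis_fun k (joukowski z) * tr_slot point_slot K g k qs) r
            = pick_sum (\<lambda>p qs. \<Sum>k<K. tr_slot point_slot K g k qs * - (basis_fun (k + 2) (joukowski z) * two_point_kernel (joukowski z) (joukowski p))) r"
          unfolding pick_sum_cmult[symmetric] sum_distrib_left w2
          by (intro pick_sum_cong refl sum.cong) simp
        have "- (1 / ?D) * (weber_bracket s g z r * E) = ?B z"
          unfolding b distrib_left 1 2 using D by (simp add: basis_fun_def numeral_2_eq_2)
        then have "1/2 * (1 - 1 / z\<^sup>2) / (?y - joukowski z) * ?B z
            = (1/2 * (1 - 1 / z\<^sup>2) / (?y - joukowski z) * - (1 / ?D)) * (weber_bracket s g z r * E)"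
          by (simp only: mult.assoc)
        then show ?case unfolding elim(3)[symmetric] by (simp only: mult_ac)
      qed
    qed
    have "2 * g + length r \<ge> 2" using st .
    have M: "point_slot q = (\<lambda>k. basis_fun k (joukowski q))" for q by (rule ext) (simp add: point_slot_def)
    have phQ: "punct_holo (\<lambda>z. quad_form (\<lambda>k. basis_fun k (joukowski z)) k l)" for k l
    proof -
      have "punct_holo (\<lambda>z. (-1) * basis_fun a (joukowski z) + (-4) * basis_fun b (joukowski z))" "punct_holo (\<lambda>z. (-1) * basis_fun a (joukowski z))"
        for a b
        by (intro punct_holo_add punct_holo_mult punct_holo_const basis_fun_punct_holo)+
      note p = this(1)[of "k + l" "k + l + 2"] this(2)[of "k + l + 4"]
      show ?thesis
      proof (cases "odd k \<and> odd l")
        case True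
        then show ?thesis using p(1) by (simp add: quad_form_def)
      next
        case False
        show ?thesis unfolding quad_form_def if_not_P[OF False] using p(2) by simp
      qed
    qed
    have phq: "punct_holo (\<lambda>z. - (basis_fun n (joukowski z) * two_point_kernel (joukowski z) (joukowski p)))" if "p \<in> set r" for n p
      by (rule principal_part_two_point_kernel[OF y regular_D]) (use reg that in blast)
    note pan = pair_term_analytic[OF reg, of g]
    let ?B1 = "\<lambda>z. \<Sum>k<K. \<Sum>l<K. tr_pair point_slot K g k l r * quad_form (\<lambda>k. basis_fun k (joukowski z)) k l"
    let ?B2 = "\<lambda>z. pick_sum (\<lambda>p qs. \<Sum>k<K. tr_slot point_slot K g k qs * - (basis_fun (k + 2) (joukowski z) * two_point_kernel (joukowski z) (joukowski p))) r"
    let ?B3 = "\<lambda>z. (if g = 1 \<and> r = [] then -1 else 0) * basis_fun 2 (joukowski z) + - (pair_term g r z / ((joukowski z)\<^sup>2 - 4))"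
    have ph1: "punct_holo ?B1" by (intro punct_holo_sum punct_holo_mult punct_holo_const phQ)
    have ph2: "punct_holo ?B2"
      by (rule conjunct1[OF res_sum_pick]) (intro punct_holo_sum punct_holo_mult punct_holo_const phq)
    have ph3: "punct_holo ?B3"
      by (intro punct_holo_add punct_holo_mult punct_holo_const basis_fun_punct_holo principal_part_simple_pole[OF y pan])
    have p1: "principal_part ?B1 ?y = (\<Sum>k<K. \<Sum>l<K. quad_form (point_slot z0) k l * tr_pair point_slot K g k l r)"
    proof -
      have "principal_part ?B1 ?y = (\<Sum>k<K. \<Sum>l<K. tr_pair point_slot K g k l r * quad_form (point_slot z0) k l)"
        by (simp only: principal_part_sum[OF y] punct_holo_sum[OF punct_holo_mult[OF punct_holo_const phQ]]
          punct_holo_mult[OF punct_holo_const phQ] principal_part_cmult[OF y phQ] principal_part_quad_form[OF y] M)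
      also have "\<dots> = (\<Sum>k<K. \<Sum>l<K. quad_form (point_slot z0) k l * tr_pair point_slot K g k l r)"
        by (intro sum.cong refl mult.commute)
      finally show ?thesis .
    qed
    have p2: "principal_part ?B2 ?y = pick_sum (\<lambda>p qs. \<Sum>k<K. dd_form (k + 2) (point_slot z0) (theta (point_slot p)) * tr_slot point_slot K g k qs) r"
    proof -
      have "principal_part ?B2 ?y = pick_sum (\<lambda>p qs. principal_part (\<lambda>z. \<Sum>k<K. tr_slot point_slot K g k qs
          * - (basis_fun (k + 2) (joukowski z) * two_point_kernel (joukowski z) (joukowski p))) ?y) r"
        by (rule principal_part_pick[OF y]) (intro punct_holo_sum punct_holo_mult punct_holo_const phq)
      also have "\<dots> = pick_sum (\<lambda>p qs. \<Sum>k<K. dd_form (k + 2) (point_slot z0) (theta (point_slot p)) * tr_slot point_slot K g k qs) r"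
      proof (rule pick_sum_cong[OF refl])
        fix p qs assume "mset (p # qs) = mset r"
        then have p: "p \<in> set r" by (rule mset_pick_bounds(2))
        then have q: "(joukowski p)\<^sup>2 - 4 \<noteq> 0" using reg regular_D by blast
        have "principal_part (\<lambda>z. \<Sum>k<K. tr_slot point_slot K g k qs * - (basis_fun (k + 2) (joukowski z) * two_point_kernel (joukowski z) (joukowski p))) ?y
            = (\<Sum>k<K. principal_part (\<lambda>z. tr_slot point_slot K g k qs * - (basis_fun (k + 2) (joukowski z) * two_point_kernel (joukowski z) (joukowski p))) ?y)"
          by (rule principal_part_sum[OF y]) (intro punct_holo_mult punct_holo_const phq p)
        also have "\<dots> = (\<Sum>k<K. dd_form (k + 2) (point_slot z0) (theta (point_slot p)) * tr_slot point_slot K g k qs)"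
          unfolding principal_part_cmult[OF y phq[OF p]] principal_part_two_point_kernel(1)[OF y q] M by (intro sum.cong refl mult.commute)
        finally show "principal_part (\<lambda>z. \<Sum>k<K. tr_slot point_slot K g k qs * - (basis_fun (k + 2) (joukowski z) * two_point_kernel (joukowski z) (joukowski p))) ?y
            = (\<Sum>k<K. dd_form (k + 2) (point_slot z0) (theta (point_slot p)) * tr_slot point_slot K g k qs)" .
      qed
      finally show ?thesis .
    qed
    have K4: "K > 4" using less.prems by simp
    have p3: "principal_part ?B3 ?y = contract point_slot K (tr_base g) (z0 # r)"
      unfolding contract_tr_base[OF z0 reg st K4]
      by (simp only: principal_part_add[OF y punct_holo_mult[OF punct_holo_const basis_fun_punct_holo]
            principal_part_simple_pole(2)[OF y pan]] principal_part_cmult[OF y basis_fun_punct_holo] principal_part_basis_fun[OF y]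
            principal_part_simple_pole(1)[OF y pan]) simp
    have "principal_part ?B ?y = contract point_slot K (tr_coeff g) (z0 # r)"
    proof -
      have "principal_part ?B ?y = principal_part ?B1 ?y + principal_part ?B2 ?y + principal_part ?B3 ?y"
        by (simp only: principal_part_add[OF y] punct_holo_add ph1 ph2 ph3)
      also have "\<dots> = contract point_slot K (tr_coeff g) (z0 # r)"
        unfolding p1 p2 p3 by (subst contract_tr_coeff[OF st]) (use less.prems Cons in auto)
      finally show ?thesis .
    qed
    moreover have "s\<^sup>2 * z0 * E * weber_W s g (z0 # r) = principal_part ?B ?y"
    proof -
      have c: "s\<^sup>2 * z0 * E \<noteq> 0"
        using s z0 reg unfolding E_def by (auto simp: regular_pt_def prod_list_zero_iff)
      have "weber_W s g (z0 # r) = res_sum (\<lambda>z. 1 / (s\<^sup>2 * z0 * E) * (1/2 * (1 - 1 / z\<^sup>2) / (?y - joukowski z) * ?B z))"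
        unfolding weber_W_stable[OF st]
      proof (rule res_sum_cong)
        fix e :: complex assume "e \<in> {1, -1}"
        from br[OF this]
        show "eventually (\<lambda>z. weber_kernel s z0 z * deriv weber_conj z * weber_bracket s g z r
           = 1 / (s\<^sup>2 * z0 * E) * (1/2 * (1 - 1 / z\<^sup>2) / (?y - joukowski z) * ?B z)) (at e)"
        proof eventually_elim
          case (elim z)
          show ?case unfolding elim[symmetric] using c by simp
        qed
      qed
      also have "\<dots> = 1 / (s\<^sup>2 * z0 * E) * principal_part ?B ?y"
        unfolding principal_part_def
        by (rule res_sum_cmult) (intro punct_holo_mult[OF principal_part_kernel_punct[OF y]] punct_holo_add ph1 ph2 ph3)
      finally show ?thesis using c by simp
    qed
    moreover have "weber_W s g zs * prod_list zs * (s\<^sup>2) ^ (2 * g + length zs - 2)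
        = s\<^sup>2 * z0 * E * weber_W s g (z0 # r)"
      unfolding exp unfolding Cons power_add E_def by (simp add: mult_ac)
    ultimately show ?thesis unfolding Cons by (simp only:)
  qed simp
qed

section \<open>Expansion of the basis differentials at infinity\<close>

text \<open>
  The expansion of \<open>\<surd>D / x\<close> at infinity, where \<open>X = 1/x\<close>, as a
  binomial series.
\<close>

definition disc_root :: "complex fps" where
  "disc_root = fps_radical (\<lambda>_ _. 1) 2 (1 - 4 * fps_X\<^sup>2)"

definition disc_inv :: "complex fps" where "disc_inv = inverse disc_root"

lemma disc_root_square: "disc_root\<^sup>2 = 1 - 4 * fps_X\<^sup>2"
proof -
  have "(1 - 4 * fps_X\<^sup>2 :: complex fps) $ 0 = 1" by simp
  then show ?thesis
    using power_radical[of "1 - 4 * fps_X\<^sup>2 :: complex fps" "\<lambda>_ _. 1" 1]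
    by (simp add: disc_root_def numeral_2_eq_2[symmetric])
qed

lemma disc_root_0: "disc_root $ 0 = 1"
  by (simp add: disc_root_def)

lemma disc_inv_root: "disc_inv * disc_root = 1"
  unfolding disc_inv_def by (rule inverse_mult_eq_1) (simp add: disc_root_0)

lemma disc_inv_0: "disc_inv $ 0 = 1"
  by (simp add: disc_inv_def disc_root_0)

lemma disc_inv_square: "disc_inv\<^sup>2 * (1 - 4 * fps_X\<^sup>2) = 1"
  unfolding disc_root_square[symmetric] power_mult_distrib[symmetric] disc_inv_root by simp

lemma disc_inv_square_expand: "1 + 4 * fps_X\<^sup>2 * disc_inv\<^sup>2 = disc_inv\<^sup>2"
  using disc_inv_square by (simp add: algebra_simps)

lemma disc_root_eq: "disc_root = disc_inv * (1 - 4 * fps_X\<^sup>2)"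
  using disc_inv_root disc_root_square by (metis mult.commute mult.left_commute mult.right_neutral power2_eq_square)

lemma deriv_disc_root: "fps_deriv disc_root = - 4 * fps_X * disc_inv"
proof -
  have "fps_deriv (disc_root\<^sup>2) = fps_deriv (1 - 4 * fps_X\<^sup>2)" unfolding disc_root_square ..
  then have "2 * (disc_root * fps_deriv disc_root) = 2 * (- 4 * fps_X)"
    by (simp add: power2_eq_square algebra_simps)
  moreover have "(2 :: complex fps) \<noteq> 0" by (simp add: numeral_fps_const)
  ultimately have "disc_root * fps_deriv disc_root = - 4 * fps_X" using mult_left_cancel by blast
  then have "disc_inv * disc_root * fps_deriv disc_root = disc_inv * (- 4 * fps_X)" by (simp only: mult.assoc)
  then show ?thesis by (simp add: disc_inv_root mult_ac)
qed

lemma deriv_disc_inv: "fps_deriv disc_inv = 4 * fps_X * disc_inv ^ 3"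
proof -
  have "fps_deriv (disc_inv * disc_root) = 0" by (simp add: disc_inv_root)
  then have "fps_deriv disc_inv * disc_root = - disc_inv * fps_deriv disc_root" by (simp add: algebra_simps eq_neg_iff_add_eq_0)
  then have "fps_deriv disc_inv * (disc_inv * disc_root) = - disc_inv * fps_deriv disc_root * disc_inv" by (simp only: mult_ac)
  then show ?thesis unfolding disc_inv_root deriv_disc_root by (simp add: power3_eq_cube mult_ac)
qed

lemma deriv_disc_inv_power: "fps_deriv (disc_inv ^ n) = of_nat (4 * n) * fps_X * disc_inv ^ (n + 2)"
proof (induction n)
  case (Suc n)
  have "fps_deriv (disc_inv ^ Suc n) = disc_inv * fps_deriv (disc_inv ^ n) + fps_deriv disc_inv * disc_inv ^ n" by simp
  also have "\<dots> = of_nat (4 * Suc n) * fps_X * disc_inv ^ (Suc n + 2)"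
    unfolding Suc deriv_disc_inv by (simp add: algebra_simps power3_eq_cube numeral_2_eq_2)
  finally show ?case .
qed simp

text \<open>
  The same sequence shifted by two places, continued to the expansions of \<open>1 /
  \<surd>D\<close> and \<open>x / \<surd>D\<close>, which do not belong to basis functions.
\<close>

definition tau :: "nat \<Rightarrow> complex fps" where
  "tau k = (if even k then fps_X ^ (k + 1) * disc_inv ^ (k + 1) else fps_X ^ (k - 1) * disc_inv ^ k)"

text \<open>
  The expansion of \<open>w\<^sub>k / \<surd>D\<close>. Since \<open>dz / z = dx /
  \<surd>D\<close> up to the choice of the sheet, this is the coefficient of dx in
  \<open>w\<^sub>k dz / z\<close>.
\<close>

definition eta :: "nat \<Rightarrow> complex fps" where
  "eta k = fps_X\<^sup>2 * disc_inv\<^sup>2 * tau k"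

lemma tau_even: "tau (2*b) = fps_X ^ (2*b+1) * disc_inv ^ (2*b+1)"
  and tau_odd: "tau (2*b+1) = fps_X ^ (2*b) * disc_inv ^ (2*b+1)"
  by (simp_all add: tau_def)

lemma tau_add_2: "tau (k + 2) = eta k"
proof (cases "even k")
  case True
  then obtain b where k: "k = 2 * b" by blast
  have "k + 2 = 2 * (b + 1)" using k by simp
  then show ?thesis unfolding eta_def k
    by (simp only: tau_even) (simp add: power_add power2_eq_square mult_ac)
next
  case False
  then obtain b where k: "k = 2 * b + 1" by (elim oddE)
  have "k + 2 = 2 * (b + 1) + 1" using k by simp
  then show ?thesis unfolding eta_def k
    by (simp only: tau_odd) (simp add: power_add power2_eq_square mult_ac)
qed

lemma tau_xmul: "fps_X * (xmul 0 tau j) + (if j = 1 then disc_root else 0) = tau j"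
proof (cases "even j")
  case True
  then obtain b where "j = 2 * b" by blast
  then show ?thesis by (simp only: xmul_even tau_even tau_odd) (auto simp: mult_ac)
next
  case False
  then obtain b where j: "j = 2 * b + 1" by (elim oddE)
  show ?thesis
  proof (cases b)
    case 0
    have "fps_X * (4 * (fps_X * disc_inv)) + disc_root = disc_inv"
      unfolding disc_root_eq by (simp add: power2_eq_square algebra_simps)
    then show ?thesis unfolding j 0 by (simp only: xmul_odd tau_def) simp
  next
    case (Suc c)
    have "fps_X * (fps_X ^ (2*c+1) * disc_inv ^ (2*c+1) + 4 * (fps_X ^ (2*b+1) * disc_inv ^ (2*b+1)))
        = fps_X ^ (2*b) * disc_inv ^ (2*c+1) * (1 + 4 * fps_X\<^sup>2 * disc_inv\<^sup>2)"
      unfolding Suc by (simp add: power2_eq_square algebra_simps)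
    also have "\<dots> = fps_X ^ (2*b) * disc_inv ^ (2*b+1)"
      unfolding disc_inv_square_expand Suc by (simp add: power2_eq_square algebra_simps)
    finally show ?thesis unfolding j using Suc
      by (simp only: xmul_odd tau_even tau_odd) (simp add: tau_even[simplified])
  qed
qed

lemma tau_nth_xmul: "xmul (disc_root $ (a + 1)) (\<lambda>j. tau j $ a) j = tau j $ (a + 1)"
proof -
  have "tau j $ (a + 1) = (fps_X * (xmul 0 tau j) + (if j = 1 then disc_root else 0)) $ (a + 1)"
    by (simp only: tau_xmul)
  also have "\<dots> = xmul 0 tau j $ a + (if j = 1 then disc_root $ (a + 1) else 0)" by simp
  also have "\<dots> = xmul (disc_root $ (a + 1)) (\<lambda>j. tau j $ a) j"
    by (auto simp: xmul_def numeral_fps_const)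
  finally show ?thesis by simp
qed

lemma eta_xmul: "fps_X * xmul (fps_X * disc_inv) eta j = eta j"
proof -
  have "xmul (fps_X * disc_inv) eta j = fps_X\<^sup>2 * disc_inv\<^sup>2 * xmul 0 tau j + (if j = 1 then fps_X * disc_inv else 0)"
    by (auto simp: xmul_def eta_def algebra_simps)
  moreover have "fps_X * disc_inv = fps_X * disc_inv\<^sup>2 * disc_root"
    using disc_inv_root by (simp add: power2_eq_square mult.assoc)
  ultimately have "fps_X * xmul (fps_X * disc_inv) eta j
      = fps_X\<^sup>2 * disc_inv\<^sup>2 * (fps_X * (xmul 0 tau j) + (if j = 1 then disc_root else 0))"
    by (auto simp: algebra_simps power2_eq_square)
  then show ?thesis unfolding tau_xmul by (simp add: eta_def)
qed

lemma eta_theta: "theta eta j = fps_X\<^sup>2 * fps_deriv (tau j)"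
proof -
  have dX: "fps_deriv (fps_X ^ n :: complex fps) = of_nat n * fps_X ^ (n - 1)" for n
    by (simp add: fps_deriv_power fps_of_nat mult_ac)
  have t: "fps_deriv (fps_X ^ n * disc_inv ^ m)
      = of_nat n * (fps_X ^ (n - 1) * disc_inv ^ m) + of_nat (4 * m) * fps_X ^ (n + 1) * disc_inv ^ (m + 2)" for n m
    by (simp add: dX deriv_disc_inv_power algebra_simps)
  show ?thesis
  proof (cases "even j")
    case True
    then obtain b where j: "j = 2 * b" by blast
    have "fps_deriv (tau j) = of_nat (2*b+1) * (fps_X ^ (2*b) * disc_inv ^ (2*b+1) * (1 + 4 * fps_X\<^sup>2 * disc_inv\<^sup>2))"
      unfolding j tau_even t by (simp add: power2_eq_square algebra_simps)
    then show ?thesis unfolding disc_inv_square_expand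
      unfolding j theta_def eta_def tau_odd by (simp add: mult_ac)
  next
    case False
    then obtain b where j: "j = 2 * b + 1" by (elim oddE)
    show ?thesis
    proof (cases b)
      case 0
      then show ?thesis unfolding j theta_def eta_def tau_odd
        by (simp add: tau_def deriv_disc_inv algebra_simps power2_eq_square power3_eq_cube)
    next
      case (Suc c)
      have i: "2 * b + 1 - 3 = 2 * c" "2 * b + 1 - 1 = 2 * b" using Suc by auto
      have th: "theta eta j = of_nat (2*b) * eta (2 * c) + 4 * of_nat (2*b+1) * eta (2 * b)"
        unfolding j theta_def i by simp
      show ?thesis unfolding th unfolding eta_def tau_even unfolding j tau_odd t unfolding Suc
        by (simp add: algebra_simps power2_eq_square)
    qed
  qed
qed

lemma eta_quad: "quad_form eta k l = - (fps_X * disc_inv) * (eta k * eta l)"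
proof -
  have e: "eta (2*b) = fps_X ^ (2*b+3) * disc_inv ^ (2*b+3)" "eta (2*b+1) = fps_X ^ (2*b+2) * disc_inv ^ (2*b+3)" for b
    unfolding eta_def tau_even tau_odd by (simp_all add: power2_eq_square power3_eq_cube power_add mult_ac)
  obtain a where "k = 2 * a \<or> k = 2 * a + 1" by (metis evenE oddE)
  moreover obtain b where "l = 2 * b \<or> l = 2 * b + 1" by (metis evenE oddE)
  moreover have pw: "f ^ (2 * (a + b + 2) + 3) = f * (f ^ (2*a+3) * f ^ (2*b+3))"
    "f ^ (2 * (a + b + 2) + 2) = f * (f ^ (2*a+2) * f ^ (2*b+3))"
    "f ^ (2 * (a + b + 2) + 2) = f * (f ^ (2*a+3) * f ^ (2*b+2))"
    "f ^ (2 * (a + b + 1) + 3) = f * (f ^ (2*a+2) * f ^ (2*b+2))"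
    "f ^ (2 * (a + b + 2) + 3) = f ^ (2 * (a + b + 1) + 3) * f\<^sup>2" for f :: "complex fps"
    unfolding power_add[symmetric] power_Suc[symmetric] by (rule arg_cong[where f = "power f"], simp)+
  moreover have "quad_form eta (2*a) (2*b) = - (fps_X * disc_inv) * (eta (2*a) * eta (2*b))"
  proof -
    have i: "2*a + 2*b + 4 = 2 * (a + b + 2)" by simp
    have "quad_form eta (2*a) (2*b) = - eta (2 * (a + b + 2))" unfolding quad_form_def i by simp
    then show ?thesis unfolding e pw(1) by (simp only: mult_ac mult_minus_left mult_minus_right)
  qed
  moreover have "quad_form eta (2*a+1) (2*b) = - (fps_X * disc_inv) * (eta (2*a+1) * eta (2*b))"
  proof -
    have i: "2*a + 1 + 2*b + 4 = 2 * (a + b + 2) + 1" by simp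
    have "quad_form eta (2*a+1) (2*b) = - eta (2 * (a + b + 2) + 1)" unfolding quad_form_def i by simp
    then show ?thesis unfolding e pw(1) pw(2) by (simp only: mult_ac mult_minus_left mult_minus_right)
  qed
  moreover have "quad_form eta (2*a) (2*b+1) = - (fps_X * disc_inv) * (eta (2*a) * eta (2*b+1))"
  proof -
    have i: "2*a + (2*b + 1) + 4 = 2 * (a + b + 2) + 1" by simp
    have "quad_form eta (2*a) (2*b+1) = - eta (2 * (a + b + 2) + 1)" unfolding quad_form_def i by simp
    then show ?thesis unfolding e pw(1) pw(3) by (simp only: mult_ac mult_minus_left mult_minus_right)
  qed
  moreover have "quad_form eta (2*a+1) (2*b+1) = - (fps_X * disc_inv) * (eta (2*a+1) * eta (2*b+1))"
  proof -
    have i: "2*a+1 + (2*b+1) = 2 * (a + b + 1)" "2 * (a + b + 1) + 2 = 2 * (a + b + 2)" by simp_all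
    have "quad_form eta (2*a+1) (2*b+1) = - (eta (2 * (a+b+1)) + 4 * eta (2 * (a+b+2)))"
      unfolding quad_form_def i by simp
    also have "\<dots> = - (fps_X ^ (2*(a+b+1)+3) * disc_inv ^ (2*(a+b+1)+3) * (1 + 4 * fps_X\<^sup>2 * disc_inv\<^sup>2))"
      unfolding e pw(5) by (simp only: distrib_left mult_1_right mult_1_left mult_ac)
    also have "\<dots> = - (fps_X ^ (2*(a+b+1)+3) * disc_inv ^ (2*(a+b+2)+3))"
      unfolding disc_inv_square_expand pw(5) by (simp only: mult_ac)
    also have "\<dots> = - (fps_X * disc_inv) * (eta (2*a+1) * eta (2*b+1))"
      unfolding e pw(4) pw(1) by (simp only: mult_ac mult_minus_left mult_minus_right)
    finally show ?thesis .
  qed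
  ultimately show ?thesis by auto
qed

lemma eta_nth_0: "eta k $ 0 = 0" and eta_nth_1: "eta k $ 1 = 0"
  by (simp_all add: eta_def power2_eq_square mult.assoc)

text \<open>
  The linear term of the recursion, in which the second point has been replaced by its moment of
  order a.
\<close>

definition slot_series :: "nat \<Rightarrow> nat \<Rightarrow> complex fps" where
  "slot_series n a = dd_form n eta (\<lambda>j. fps_const (tau j $ a))"

lemma slot_series_0: "slot_series n 0 = - eta n"
proof -
  have tau0: "tau j $ 0 = of_bool (j = 1)" for j
  proof (cases "even j")
    case False
    then obtain b where "j = 2 * b + 1" by (elim oddE)
    then show ?thesis by (cases b) (simp_all add: tau_def disc_inv_0 mult.assoc)
  qed (auto simp: tau_def mult.assoc)
  have "slot_series n 0 = (\<Sum>i\<le>n+1. \<Sum>j\<le>n+1. if j = 1 then of_int (dd_coeff n i 1) * eta i else 0)"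
    unfolding slot_series_def dd_form_def tau0 by (intro sum.cong refl) auto
  also have "\<dots> = (\<Sum>i\<le>n+1. of_int (dd_coeff n i 1) * eta i)" by (subst sum.delta) auto
  also have "\<dots> = (\<Sum>i\<le>n+1. if i = n then - eta i else 0)"
    by (intro sum.cong refl) (auto simp: dd_coeff_def)
  also have "\<dots> = - eta n" by (subst sum.delta) auto
  finally show ?thesis .
qed

lemma slot_series_Suc:
  "fps_X * slot_series n (Suc a) = slot_series n a
     + fps_X * (fps_X * disc_inv * fps_const (tau n $ a) - fps_const (disc_root $ (a + 1)) * eta n)"
proof -
  let ?f = "\<lambda>j. fps_const (tau j $ a)"
  have "xmul (fps_const (disc_root $ (a + 1))) ?f = (\<lambda>j. fps_const (tau j $ (a + 1)))"
    unfolding tau_nth_xmul[symmetric] by (auto simp: xmul_def numeral_fps_const)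
  then have "slot_series n (Suc a) = dd_form n eta (xmul (fps_const (disc_root $ (a + 1))) ?f)"
    by (simp add: slot_series_def)
  also have "\<dots> = dd_form n (xmul (fps_X * disc_inv) eta) ?f
      + (fps_X * disc_inv * ?f n - fps_const (disc_root $ (a + 1)) * eta n)"
    using dd_form_xmul[of n eta "fps_const (disc_root $ (a + 1))" ?f "fps_X * disc_inv"] by (simp add: algebra_simps)
  finally have "fps_X * slot_series n (Suc a) = fps_X * dd_form n (xmul (fps_X * disc_inv) eta) ?f
      + fps_X * (fps_X * disc_inv * ?f n - fps_const (disc_root $ (a + 1)) * eta n)"
    by (simp only: distrib_left)
  also have "fps_X * dd_form n (xmul (fps_X * disc_inv) eta) ?f = slot_series n a"
    unfolding dd_form_cmult_left[symmetric] eta_xmul slot_series_def ..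
  finally show ?thesis .
qed

lemma fps_cutoff_Suc: "fps_cutoff (Suc a) f = fps_cutoff a f + fps_const (f $ a) * fps_X ^ a"
  for f :: "complex fps"
  by (rule fps_ext) (auto simp: fps_X_power_nth less_Suc_eq)

text \<open>
  Multiplication by x turns the moment of order a into the one of order a + 1, which gives a
  recursion in a. The solution is a truncation: it expresses that the singular part at the
  second point is subtracted.
\<close>

lemma slot_series_closed:
  "fps_X ^ a * slot_series n a = - eta n * fps_cutoff (a + 1) disc_root + fps_X\<^sup>2 * disc_inv * fps_cutoff a (tau n)"
proof (induction a)
  case 0
  have "fps_cutoff 1 disc_root = 1" by (rule fps_ext) (simp add: disc_root_0)
  then show ?case by (simp add: slot_series_0)
next
  case (Suc a)
  have "fps_X ^ Suc a * slot_series n (Suc a) = fps_X ^ a * (fps_X * slot_series n (Suc a))"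
    by (simp add: mult_ac)
  also have "\<dots> = fps_X ^ a * slot_series n a
     + fps_X ^ Suc a * (fps_X * disc_inv * fps_const (tau n $ a) - fps_const (disc_root $ (a + 1)) * eta n)"
    unfolding slot_series_Suc by (simp add: algebra_simps)
  also have "\<dots> = - eta n * fps_cutoff (Suc a + 1) disc_root + fps_X\<^sup>2 * disc_inv * fps_cutoff (Suc a) (tau n)"
    unfolding Suc fps_cutoff_Suc[of "Suc a"] fps_cutoff_Suc[of a "tau n"] add.commute[of _ 1] plus_1_eq_Suc
    by (simp add: algebra_simps power2_eq_square)
  finally show ?case .
qed

section \<open>Generating series of the cumulants\<close>

unbundle no vec_syntax

text \<open>The moment of order a of the k-th basis differential.\<close>

definition moment_slot :: "nat \<Rightarrow> nat \<Rightarrow> complex" where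
  "moment_slot a k = eta k $ (a + 1)"

definition stable_sum :: "nat \<Rightarrow> nat \<Rightarrow> nat list \<Rightarrow> complex fps" where
  "stable_sum K g as = (\<Sum>k<K. fps_const (tr_slot moment_slot K g k as) * eta k)"

text \<open>
  The generating series of the planar two-point cumulants \<open>\<langle>tr M\<^sup>i tr
  M\<^sup>a\<rangle>\<close> for fixed a.
\<close>

definition omega02 :: "nat \<Rightarrow> complex fps" where
  "omega02 a = fps_const (- of_nat a / 2) * (fps_X\<^sup>2 * disc_inv * fps_shift (a + 1) disc_root)"

text \<open>
  The generating series of the Catalan numbers, \<open>(1 - \<surd>(1 - 4 X\<^sup>2)) / (2
  X)\<close>.
\<close>

definition omega01 :: "complex fps" where
  "omega01 = fps_const (- 1 / 2) * fps_shift 1 disc_root"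

definition unstable_series :: "nat \<Rightarrow> nat list \<Rightarrow> complex fps" where
  "unstable_series g as = (if g = 0 \<and> as = [] then omega01 else if g = 0 \<and> length as = 1 then omega02 (hd as) else 0)"

text \<open>
  The generating series, in the order of the first trace, of the cumulants of genus g in which
  the other traces have orders as. Sign and unstable terms are chosen in such a way that the
  loop equations take a uniform form.
\<close>

definition omega :: "nat \<Rightarrow> nat list \<Rightarrow> complex fps" where
  "omega g as = (-1) ^ (length as + 1) * stable_sum (4 * (2 * g + length as) + 1) g as + unstable_series g as"

definition cumulant :: "nat \<Rightarrow> nat list \<Rightarrow> complex" where
  "cumulant g as = (case as of [] \<Rightarrow> 0 | a # bs \<Rightarrow> omega g bs $ (a + 1))"

lemma cumulant_Cons: "cumulant g (a # bs) = omega g bs $ (a + 1)"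
  by (simp add: cumulant_def)

lemma fps_nth_pick_sum: "pick_sum f xs $ n = pick_sum (\<lambda>y ys. f y ys $ n) xs"
  by (induction xs arbitrary: f) simp_all

lemma fps_nth_split_sum: "split_sum f xs $ n = split_sum (\<lambda>y ys. f y ys $ n) xs"
  by (induction xs arbitrary: f) simp_all

lemma shift_eq: "fps_X ^ n * fps_shift n f = f - fps_cutoff n f" for f :: "complex fps"
  using fps_shift_cutoff[of n f] by (simp add: algebra_simps)

lemma stable_sum_K:
  assumes "K > 4 * (2 * g + length as)" "K' > 4 * (2 * g + length as)"
  shows "stable_sum K g as = stable_sum K' g as"
proof -
  let ?K0 = "4 * (2 * g + length as) + 1"
  have "stable_sum K g as = stable_sum ?K0 g as" if K: "K \<ge> ?K0" for K
  proof -
    have w: "tr_slot moment_slot K g k as = tr_slot moment_slot ?K0 g k as" for k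
    proof (rule contract_mono[OF K])
      fix ks :: "nat list" assume ks: "length ks = length as" "\<not> set ks \<subseteq> {..<?K0}"
      then obtain j where j: "j \<in> set ks" "\<not> j < ?K0" by blast
      have "j \<le> sum_list ks" using member_le_sum_list[OF j(1)] by simp
      then show "tr_coeff g (k # ks) = 0" using tr_coeff_support[of g "k # ks"] ks(1) j(2) by fastforce
    qed
    have "stable_sum K g as = (\<Sum>k<K. fps_const (tr_slot moment_slot ?K0 g k as) * eta k)" unfolding stable_sum_def w ..
    also have "\<dots> = stable_sum ?K0 g as" unfolding stable_sum_def
      by (rule sum.mono_neutral_right) (use K in \<open>auto simp: tr_slot_eq_0\<close>)
    finally show ?thesis .
  qed
  then show ?thesis using assms by (metis Suc_eq_plus1 Suc_leI)
qed

lemma omega_K: "K > 4 * (2 * g + length as) \<Longrightarrow> omega g as = (-1) ^ (length as + 1) * stable_sum K g as + unstable_series g as"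
  unfolding omega_def using stable_sum_K[of g as K "4 * (2 * g + length as) + 1"] by simp

lemma stable_sum_unstable: "2 * g + length as < 2 \<Longrightarrow> stable_sum K g as = 0"
  by (simp add: stable_sum_def tr_slot_unstable)

lemma slot_series_nth_0: "slot_series n a $ 0 = 0"
  by (simp add: slot_series_def dd_form_def fps_sum_nth eta_nth_0)

lemma theta_moment_slot: "theta (moment_slot q) j = of_nat q * tau j $ q"
proof -
  have "theta (moment_slot q) j = theta eta j $ (q + 1)"
    by (auto simp: theta_def moment_slot_def fps_mult_of_nat_nth mult.assoc numeral_fps_const
        simp del: of_nat_Suc of_nat_add)
  also have "\<dots> = of_nat q * tau j $ q"
  proof (cases q)
    case (Suc p)
    have "(fps_X\<^sup>2 * fps_deriv (tau j)) $ Suc (Suc p) = fps_deriv (tau j) $ p"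
      by (simp add: power2_eq_square mult.assoc)
    then show ?thesis unfolding eta_theta Suc by simp
  qed (simp add: eta_theta power2_eq_square mult.assoc)
  finally show ?thesis .
qed

text \<open>
  The recursion for arrays, with the moments as vectors; since the coefficients of the series
  are moments, the identity is checked coefficient by coefficient.
\<close>

lemma stable_sum_expand:
  assumes st: "2 * g + length as \<ge> 2" and K: "4 * (2 * g + length as) < K"
  shows "stable_sum K g as = (\<Sum>k<K. fps_const (contract moment_slot K (\<lambda>ks. tr_base g (k # ks)) as) * eta k)
     + (\<Sum>k<K. \<Sum>l<K. fps_const (tr_pair moment_slot K g k l as) * quad_form eta k l)
     + pick_sum (\<lambda>q qs. \<Sum>k<K. fps_const (tr_slot moment_slot K g k qs * of_nat q) * slot_series (k + 2) q) as"
    (is "?L = ?R")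
proof (rule fps_ext)
  fix m
  show "?L $ m = ?R $ m"
  proof (cases m)
    case 0
    have "quad_form eta k l $ 0 = 0" for k l
      by (simp add: quad_form_def eta_nth_0 numeral_fps_const)
    then show ?thesis unfolding 0
      by (simp add: stable_sum_def fps_sum_nth fps_nth_pick_sum eta_nth_0 slot_series_nth_0)
  next
    case (Suc n)
    have q: "quad_form (moment_slot n) k l = quad_form eta k l $ m" for k l
      unfolding Suc by (auto simp: quad_form_def moment_slot_def numeral_fps_const)
    have d: "dd_form (k + 2) (moment_slot n) (theta (moment_slot q)) = of_nat q * slot_series (k + 2) q $ m" for k q
    proof -
      have "slot_series (k + 2) q $ m = dd_form (k + 2) (moment_slot n) (\<lambda>j. tau j $ q)"
        unfolding slot_series_def dd_form_def Suc moment_slot_def fps_sum_nth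
        by (intro sum.cong refl) (simp add: mult.assoc[symmetric] fps_of_int[symmetric])
      then show ?thesis by (simp add: dd_form_cmult_right theta_moment_slot[abs_def] theta_moment_slot)
    qed
    have "?L $ m = contract moment_slot K (tr_coeff g) (n # as)"
      by (simp add: stable_sum_def fps_sum_nth Suc moment_slot_def mult.commute)
    also have "\<dots> = contract moment_slot K (tr_base g) (n # as)
       + (\<Sum>k<K. \<Sum>l<K. quad_form (moment_slot n) k l * tr_pair moment_slot K g k l as)
       + pick_sum (\<lambda>q qs. \<Sum>k<K. dd_form (k + 2) (moment_slot n) (theta (moment_slot q)) * tr_slot moment_slot K g k qs) as"
      by (rule contract_tr_coeff[OF st K])
    also have "\<dots> = ?R $ m"
      unfolding q d by (simp add: fps_sum_nth fps_nth_pick_sum Suc moment_slot_def mult_ac)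
    finally show ?thesis .
  qed
qed

lemma fps_cutoff_sum: "fps_cutoff a (\<Sum>k\<in>A. fps_const (c k) * f k) = (\<Sum>k\<in>A. fps_const (c k) * fps_cutoff a (f k))"
  for f :: "'i \<Rightarrow> complex fps"
  by (rule fps_ext) (simp add: fps_sum_nth)

lemma omega02_cutoff:
  "fps_X ^ q * (2 * fps_X * omega02 q) = - of_nat q * (fps_X\<^sup>2 * (1 - disc_inv * fps_cutoff (q+1) disc_root))"
proof -
    have c1: "2 * fps_const (- of_nat q / 2) = (- of_nat q :: complex fps)"
      by (simp add: numeral_fps_const fps_of_nat flip: fps_const_neg)
    have c2: "disc_inv * (fps_X ^ (q+1) * fps_shift (q+1) disc_root) = 1 - disc_inv * fps_cutoff (q+1) disc_root"
      unfolding shift_eq right_diff_distrib disc_inv_root ..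
    have "fps_X ^ q * (2 * fps_X * omega02 q)
        = (2 * fps_const (- of_nat q / 2)) * (fps_X\<^sup>2 * (disc_inv * (fps_X ^ (q+1) * fps_shift (q+1) disc_root)))"
      unfolding omega02_def power_add power_one_right by (simp only: mult_ac)
    then show ?thesis unfolding c1 c2 .
qed

text \<open>
  Up to the factor \<open>\<surd>D / x\<close>, the linear term of the recursion becomes the
  operation that joins two traces, plus a product with the planar two-point function.
\<close>

lemma slot_sum:
  "disc_root * (\<Sum>k<K. fps_const (tr_slot moment_slot K g k qs * of_nat q) * slot_series (k + 2) q)
    = - (of_nat q * fps_X\<^sup>2 * fps_shift q (stable_sum K g qs) + 2 * fps_X * omega02 q * stable_sum K g qs)"
proof -
  let ?w = "stable_sum K g qs" and ?c = "\<lambda>k. fps_const (tr_slot moment_slot K g k qs)"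
  have e2: "eta (k + 2) = fps_X\<^sup>2 * disc_inv\<^sup>2 * eta k" for k
    unfolding eta_def[of "k+2"] tau_add_2 ..
  have "fps_X ^ q * (\<Sum>k<K. ?c k * slot_series (k + 2) q)
      = (\<Sum>k<K. ?c k * (fps_X ^ q * slot_series (k + 2) q))"
    by (simp add: sum_distrib_left mult_ac)
  also have "\<dots> = (\<Sum>k<K. - (fps_X\<^sup>2 * disc_inv\<^sup>2 * fps_cutoff (q+1) disc_root) * (?c k * eta k)
        + fps_X\<^sup>2 * disc_inv * (?c k * fps_cutoff q (eta k)))"
    unfolding slot_series_closed e2 tau_add_2 by (intro sum.cong refl) (simp add: algebra_simps)
  also have "\<dots> = - (fps_X\<^sup>2 * disc_inv\<^sup>2 * fps_cutoff (q+1) disc_root) * ?w + fps_X\<^sup>2 * disc_inv * fps_cutoff q ?w"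
    unfolding stable_sum_def fps_cutoff_sum sum.distrib sum_distrib_left ..
  finally have A: "fps_X ^ q * (\<Sum>k<K. ?c k * slot_series (k + 2) q)
      = - (fps_X\<^sup>2 * disc_inv\<^sup>2 * fps_cutoff (q+1) disc_root) * ?w + fps_X\<^sup>2 * disc_inv * fps_cutoff q ?w" .
  have "fps_X ^ q * (disc_root * (\<Sum>k<K. ?c k * slot_series (k + 2) q))
      = disc_root * (fps_X ^ q * (\<Sum>k<K. ?c k * slot_series (k + 2) q))" by (simp add: mult_ac)
  also have "\<dots> = (disc_inv * disc_root) * (- (fps_X\<^sup>2 * disc_inv * fps_cutoff (q+1) disc_root) * ?w + fps_X\<^sup>2 * fps_cutoff q ?w)"
    unfolding A by (simp add: algebra_simps power2_eq_square)
  finally have A': "fps_X ^ q * (disc_root * (\<Sum>k<K. ?c k * slot_series (k + 2) q))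
      = - (fps_X\<^sup>2 * disc_inv * fps_cutoff (q+1) disc_root) * ?w + fps_X\<^sup>2 * fps_cutoff q ?w"
    unfolding disc_inv_root by simp
  note om = omega02_cutoff[of q]
  have "fps_X ^ q * - (of_nat q * fps_X\<^sup>2 * fps_shift q ?w + 2 * fps_X * omega02 q * ?w)
      = - (of_nat q * fps_X\<^sup>2 * (fps_X ^ q * fps_shift q ?w) + fps_X ^ q * (2 * fps_X * omega02 q) * ?w)"
    by (simp add: algebra_simps)
  also have "\<dots> = of_nat q * (- (fps_X\<^sup>2 * disc_inv * fps_cutoff (q+1) disc_root) * ?w + fps_X\<^sup>2 * fps_cutoff q ?w)"
    unfolding om shift_eq by (simp add: algebra_simps)
  also have "\<dots> = fps_X ^ q * (of_nat q * (disc_root * (\<Sum>k<K. ?c k * slot_series (k + 2) q)))"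
    unfolding A'[symmetric] by (simp add: mult_ac)
  finally have "- (of_nat q * fps_X\<^sup>2 * fps_shift q ?w + 2 * fps_X * omega02 q * ?w)
      = of_nat q * (disc_root * (\<Sum>k<K. ?c k * slot_series (k + 2) q))" by simp
  also have "\<dots> = disc_root * (\<Sum>k<K. fps_const (tr_slot moment_slot K g k qs * of_nat q) * slot_series (k + 2) q)"
    by (simp add: sum_distrib_left fps_of_nat[symmetric] fps_const_mult[symmetric] mult_ac del: fps_const_mult)
  finally show ?thesis by simp
qed

lemma omega01_eq: "disc_root = 1 - 2 * fps_X * omega01"
proof -
  have "2 * fps_X * omega01 = (2 * fps_const (- 1 / 2)) * (fps_X ^ 1 * fps_shift 1 disc_root)"
    unfolding omega01_def by (simp only: mult_ac power_one_right)
  also have "(2 * fps_const (- 1 / 2) :: complex fps) = -1"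
    by (simp add: numeral_fps_const flip: fps_const_neg)
  also have "fps_X ^ 1 * fps_shift 1 disc_root = disc_root - 1"
    unfolding shift_eq by (simp add: fps_eq_iff disc_root_0)
  finally show ?thesis by simp
qed

text \<open>The planar loop equation.\<close>

lemma omega01_quadratic: "omega01 = fps_X * omega01\<^sup>2 + fps_X"
proof -
  have "(1 - 2 * fps_X * omega01)\<^sup>2 = 1 - 4 * fps_X\<^sup>2" using disc_root_square omega01_eq by simp
  then have "(4 * fps_X) * omega01 = (4 * fps_X) * (fps_X * omega01\<^sup>2 + fps_X)"
    by (simp add: power2_eq_square algebra_simps)
  moreover have "(4 * fps_X :: complex fps) \<noteq> 0" by (simp add: numeral_fps_const)
  ultimately show ?thesis using mult_left_cancel by blast
qed

lemma omega02_rec: "disc_root * omega02 a = of_nat a * fps_X\<^sup>2 * fps_shift a omega01"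
proof -
  have "disc_root * omega02 a = (disc_inv * disc_root) * (fps_const (- of_nat a / 2) * (fps_X\<^sup>2 * fps_shift (a + 1) disc_root))"
    by (simp add: omega02_def mult_ac)
  also have "\<dots> = fps_X\<^sup>2 * (fps_const (of_nat a) * (fps_const (- 1 / 2) * fps_shift (a + 1) disc_root))"
  proof -
    have c: "fps_const (- of_nat a / 2) = fps_const (of_nat a) * fps_const (- 1 / 2 :: complex)" by simp
    show ?thesis unfolding disc_inv_root c by (simp only: mult_1_left mult_ac)
  qed
  also have "fps_const (- 1 / 2) * fps_shift (a + 1) disc_root = fps_shift a omega01"
    by (rule fps_ext) (simp add: omega01_def)
  finally show ?thesis by (simp add: fps_of_nat mult_ac)
qed

section \<open>The planar three-point function at infinity\<close>

lemma eta_0: "eta 0 = fps_X ^ 3 * disc_inv ^ 3" and eta_1: "eta 1 = fps_X\<^sup>2 * disc_inv ^ 3"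
  and eta_2: "eta 2 = fps_X ^ 5 * disc_inv ^ 5"
  by (simp_all add: eta_def tau_def power2_eq_square power3_eq_cube numeral_eq_Suc mult_ac)

lemma chi1: "eta 1 $ (b + 1) = of_nat b * (if b = 0 then 0 else disc_inv $ (b - 1))"
proof (cases b)
  case (Suc n)
  have "fps_deriv (fps_X * disc_inv) = disc_inv * (1 + 4 * fps_X\<^sup>2 * disc_inv\<^sup>2)"
    by (simp add: deriv_disc_inv power2_eq_square power3_eq_cube algebra_simps)
  then have "disc_inv ^ 3 = fps_deriv (fps_X * disc_inv)"
    unfolding disc_inv_square_expand by (simp add: power2_eq_square power3_eq_cube)
  moreover have "eta 1 $ (b + 1) = disc_inv ^ 3 $ n"
    unfolding eta_1 Suc by (simp add: power2_eq_square mult.assoc)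
  ultimately show ?thesis unfolding Suc by (cases n) (simp_all add: algebra_simps)
qed (simp add: eta_nth_1[unfolded One_nat_def])

lemma chi0: "4 * eta 0 $ (b + 1) = of_nat b * disc_inv $ b"
proof -
  have "4 * eta 0 = fps_X * (fps_X * fps_deriv disc_inv)"
    unfolding eta_0 deriv_disc_inv by (simp add: power3_eq_cube mult_ac)
  then have "4 * eta 0 $ (b + 1) = (fps_X * (fps_X * fps_deriv disc_inv)) $ (b + 1)"
    by (metis fps_mult_left_const_nth numeral_fps_const)
  also have "\<dots> = of_nat b * disc_inv $ b" by (cases b) simp_all
  finally show ?thesis .
qed

text \<open>
  Modulo \<open>1 - 4 X\<^sup>2\<close> every polynomial is represented by a linear one. For the
  three-point function, all products are reduced in this way;
  \<open>X\<^bsup>b-1\<^esup>\<close> times the linear polynomial below represents the truncated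
  root.
\<close>

definition ell :: "nat \<Rightarrow> complex fps" where
  "ell b = fps_const (eta 1 $ (b + 1)) + fps_const (4 * eta 0 $ (b + 1)) * fps_X"

definition tcut :: "nat \<Rightarrow> complex fps" where
  "tcut b = of_nat b * fps_cutoff (b + 1) disc_root"

definition mrem :: "nat \<Rightarrow> complex fps" where
  "mrem b = disc_inv\<^sup>2 * (tcut b - fps_X ^ (b - 1) * ell b)"

lemma tcut_eq: "tcut b = fps_X ^ (b - 1) * ell b + (1 - 4 * fps_X\<^sup>2) * mrem b"
proof -
  have "(1 - 4 * fps_X\<^sup>2) * mrem b = (disc_inv\<^sup>2 * (1 - 4 * fps_X\<^sup>2)) * (tcut b - fps_X ^ (b - 1) * ell b)"
    unfolding mrem_def by (simp only: mult_ac)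
  then show ?thesis unfolding disc_inv_square by simp
qed

lemma disc_inv_square_nth: "disc_inv\<^sup>2 $ 0 = 1" "disc_inv\<^sup>2 $ 1 = 0"
proof -
  have h: "disc_inv\<^sup>2 $ n = (1 + 4 * fps_X\<^sup>2 * disc_inv\<^sup>2) $ n" for n unfolding disc_inv_square_expand ..
  show "disc_inv\<^sup>2 $ 0 = 1" "disc_inv\<^sup>2 $ 1 = 0"
    by (subst h, simp add: power2_eq_square mult.assoc numeral_fps_const)+
qed

text \<open>
  The quotient is a polynomial: up to degree b, its first part agrees with the expansion of
  \<open>b / \<surd>(1 - 4 X\<^sup>2)\<close>, and the coefficients of degree b - 1 and b are
  those of the linear polynomial; beyond, division by \<open>1 - 4 X\<^sup>2\<close> is a
  two-step recursion with vanishing initial values.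
\<close>

lemma mrem_nth:
  assumes b: "b \<ge> 1"
  shows "n \<ge> b - 1 \<Longrightarrow> mrem b $ n = 0"
proof (induction n rule: less_induct)
  case (less n)
  have low: "(disc_inv\<^sup>2 * tcut b) $ k = of_nat b * disc_inv $ k" if "k \<le> b" for k
  proof -
    have "(disc_inv\<^sup>2 * fps_cutoff (b + 1) disc_root) $ k = (disc_inv\<^sup>2 * disc_root) $ k"
      unfolding fps_mult_nth by (intro sum.cong refl) (use that in auto)
    also have "disc_inv\<^sup>2 * disc_root = disc_inv" using disc_inv_root by (simp add: power2_eq_square mult.assoc)
    finally have "(disc_inv\<^sup>2 * fps_cutoff (b + 1) disc_root) $ k = disc_inv $ k" .
    moreover have "disc_inv\<^sup>2 * tcut b = fps_const (of_nat b) * (disc_inv\<^sup>2 * fps_cutoff (b + 1) disc_root)"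
      by (simp add: tcut_def fps_of_nat mult_ac)
    ultimately show ?thesis by (simp only: fps_mult_left_const_nth)
  qed
  obtain c where c: "b = Suc c" using b by (cases b) auto
  have m: "mrem b $ k = (disc_inv\<^sup>2 * tcut b) $ k - (fps_X ^ c * (disc_inv\<^sup>2 * ell b)) $ k" for k
    unfolding mrem_def c by (simp add: right_diff_distrib mult_ac)
  consider "n = c" | "n = Suc c" | k where "n = k + 2" "k \<ge> c" using less.prems c
    by (metis Suc_1 add_2_eq_Suc' diff_Suc_1 le_neq_implies_less less_Suc_eq_le nat_le_iff_add not_less_eq_eq order_antisym_conv add_Suc_right add.commute Suc_leI)
  then show ?case
  proof cases
    case 1
    have "(fps_X ^ c * (disc_inv\<^sup>2 * ell b)) $ c = eta 1 $ (b + 1)"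
      by (simp add: fps_X_power_mult_nth disc_inv_square_nth ell_def)
    then show ?thesis unfolding m 1 using low[of c] c chi1[of b] by simp
  next
    case 2
    have "(fps_X ^ c * (disc_inv\<^sup>2 * ell b)) $ Suc c = (disc_inv\<^sup>2 * ell b) $ 1"
      by (simp add: fps_X_power_mult_nth)
    also have "\<dots> = 4 * eta 0 $ (b + 1)"
      using disc_inv_square_nth by (simp add: fps_mult_nth ell_def)
    finally show ?thesis unfolding m 2 using low[of b] c chi0[of b] by simp
  next
    case 3
    have "((1 - 4 * fps_X\<^sup>2) * mrem b) $ n = (tcut b - fps_X ^ c * ell b) $ n"
      using tcut_eq[of b] c by simp
    also have "\<dots> = 0"
      using 3 c by (simp add: tcut_def fps_of_nat[symmetric] fps_X_power_mult_nth ell_def)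
    finally have "mrem b $ n = 4 * mrem b $ k"
      using 3 by (simp add: left_diff_distrib power2_eq_square mult.assoc numeral_fps_const)
    then show ?thesis using less.IH[of k] 3 c by simp
  qed
qed

lemma fps_mult_nth_eq_0:
  fixes f h :: "complex fps"
  assumes "\<And>i. i \<ge> p \<Longrightarrow> f $ i = 0" "\<And>i. i \<ge> q \<Longrightarrow> h $ i = 0" "n + 1 \<ge> p + q"
  shows "(f * h) $ n = 0"
  unfolding fps_mult_nth
proof (rule sum.neutral, rule ballI)
  fix i assume "i \<in> {0..n}"
  then have "i \<ge> p \<or> n - i \<ge> q" using assms(3) by auto
  then show "f $ i * h $ (n - i) = 0" using assms by auto
qed

lemma ell_nth: "n \<ge> 2 \<Longrightarrow> ell b $ n = 0"
  by (simp add: ell_def)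

lemma omega02_tcut: "fps_X ^ b * (2 * omega02 b) = - fps_X * (of_nat b - disc_inv * tcut b)"
proof -
  have "fps_X * (fps_X ^ b * (2 * omega02 b)) = fps_X ^ b * (2 * fps_X * omega02 b)" by (simp add: mult_ac)
  also have "\<dots> = fps_X * (- fps_X * (of_nat b - disc_inv * tcut b))"
    unfolding omega02_cutoff tcut_def by (simp add: algebra_simps power2_eq_square)
  finally show ?thesis by (metis mult_left_cancel fps_X_neq_zero)
qed

text \<open>
  The terms of the planar three-point loop equation that involve two-point functions only.
\<close>

definition pair_series :: "nat \<Rightarrow> nat \<Rightarrow> complex fps" where
  "pair_series b c = 2 * fps_X * omega02 b * omega02 c
     + (of_nat b * fps_X\<^sup>2 * fps_shift b (omega02 c) + of_nat c * fps_X\<^sup>2 * fps_shift c (omega02 b))"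

lemma omega02_nth_low: "omega02 b $ 0 = 0" "omega02 b $ 1 = 0"
  by (simp_all add: omega02_def power2_eq_square mult.assoc)

text \<open>
  Both sides are power series; multiplied by a suitable power of X, the shifts become
  truncations, and the products of remainders have too low a degree to contribute.
\<close>

lemma pair_series_closed:
  assumes b: "b \<ge> 1" and c: "c \<ge> 1"
  shows "4 * pair_series b c = 2 * fps_X * (disc_inv\<^sup>2 * ell b * ell c - fps_const (eta 1 $ (b + 1) * eta 1 $ (c + 1)))"
proof -
  obtain b' c' where bc: "b = Suc b'" "c = Suc c'" using b c by (cases b; cases c) auto
  let ?U = "4 * of_nat b * fps_X ^ (c + 2) * fps_cutoff b (omega02 c) + 4 * of_nat c * fps_X ^ (b + 2) * fps_cutoff c (omega02 b)"
  let ?M = "fps_X ^ b' * (mrem c * ell b) + fps_X ^ c' * (mrem b * ell c) + (1 - 4 * fps_X\<^sup>2) * (mrem b * mrem c)"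
  let ?Z = "2 * fps_X ^ 3 * ?M - (2 * of_nat b * of_nat c * fps_X ^ 3 + ?U)"
  have s1: "fps_X ^ (b + c) * (4 * (of_nat b * fps_X\<^sup>2 * fps_shift b (omega02 c)))
     = 2 * of_nat b * fps_X\<^sup>2 * (fps_X ^ c * (2 * omega02 c)) - 4 * of_nat b * fps_X ^ (c + 2) * fps_cutoff b (omega02 c)" for b c
  proof -
    have "fps_X ^ (b + c) * (4 * (of_nat b * fps_X\<^sup>2 * fps_shift b (omega02 c)))
       = 4 * of_nat b * fps_X\<^sup>2 * fps_X ^ c * (fps_X ^ b * fps_shift b (omega02 c))"
      by (simp add: power_add mult_ac)
    then show ?thesis unfolding shift_eq by (simp add: algebra_simps power2_eq_square)
  qed
  have "fps_X ^ (b + c) * (4 * pair_series b c)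
     = 2 * fps_X * (fps_X ^ b * (2 * omega02 b)) * (fps_X ^ c * (2 * omega02 c))
       + 2 * of_nat b * fps_X\<^sup>2 * (fps_X ^ c * (2 * omega02 c))
       + 2 * of_nat c * fps_X\<^sup>2 * (fps_X ^ b * (2 * omega02 b)) - ?U"
  proof -
    have "fps_X ^ (b + c) * (4 * pair_series b c)
     = fps_X ^ (b + c) * (4 * (2 * fps_X * omega02 b * omega02 c))
       + fps_X ^ (b + c) * (4 * (of_nat b * fps_X\<^sup>2 * fps_shift b (omega02 c)))
       + fps_X ^ (c + b) * (4 * (of_nat c * fps_X\<^sup>2 * fps_shift c (omega02 b)))"
      by (simp add: pair_series_def algebra_simps)
    also have "fps_X ^ (b + c) * (4 * (2 * fps_X * omega02 b * omega02 c))
       = 2 * fps_X * (fps_X ^ b * (2 * omega02 b)) * (fps_X ^ c * (2 * omega02 c))"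
      by (simp add: power_add mult_ac)
    finally show ?thesis unfolding s1 by (simp add: algebra_simps)
  qed
  also have "\<dots> = 2 * fps_X ^ 3 * (disc_inv\<^sup>2 * (tcut b * tcut c)) - (2 * of_nat b * of_nat c * fps_X ^ 3 + ?U)"
    unfolding omega02_tcut by (simp add: algebra_simps power2_eq_square power3_eq_cube)
  also have "disc_inv\<^sup>2 * (tcut b * tcut c) = disc_inv\<^sup>2 * (fps_X ^ b' * ell b * (fps_X ^ c' * ell c)) + ?M"
  proof -
    have t: "tcut b = fps_X ^ b' * ell b + (1 - 4 * fps_X\<^sup>2) * mrem b"
      "tcut c = fps_X ^ c' * ell c + (1 - 4 * fps_X\<^sup>2) * mrem c"
      using tcut_eq[of b] tcut_eq[of c] bc by simp_all
    have "disc_inv\<^sup>2 * (tcut b * tcut c) = disc_inv\<^sup>2 * (fps_X ^ b' * ell b * (fps_X ^ c' * ell c))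
       + (disc_inv\<^sup>2 * (1 - 4 * fps_X\<^sup>2)) * ?M"
    proof -
      have "q * ((a * e + d * m) * (a' * e' + d * m')) = q * (a * e * (a' * e'))
          + (q * d) * (a * (m' * e) + a' * (m * e') + d * (m * m'))"
        for q a e d m a' e' m' :: "complex fps" by (simp add: algebra_simps)
      then show ?thesis unfolding t .
    qed
    then show ?thesis unfolding disc_inv_square by simp
  qed
  finally have "fps_X ^ (b + c) * (4 * pair_series b c)
     = 2 * fps_X ^ 3 * (disc_inv\<^sup>2 * (fps_X ^ b' * ell b * (fps_X ^ c' * ell c))) + ?Z"
    by (simp only: distrib_left diff_conv_add_uminus add.assoc)
  also have "2 * fps_X ^ 3 * (disc_inv\<^sup>2 * (fps_X ^ b' * ell b * (fps_X ^ c' * ell c)))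
      = fps_X ^ (b + c) * (2 * fps_X * (disc_inv\<^sup>2 * ell b * ell c))"
    unfolding bc by (simp add: power_add power3_eq_cube mult_ac)
  finally have Z: "fps_X ^ (b + c) * (4 * pair_series b c - 2 * fps_X * (disc_inv\<^sup>2 * ell b * ell c)) = ?Z"
    by (simp add: algebra_simps)
  have M0: "?M $ n = 0" if n: "n \<ge> b' + c' + 1" for n
  proof -
    note mb = mrem_nth[OF b, unfolded bc(1), simplified] and mc = mrem_nth[OF c, unfolded bc(2), simplified]
    have 1: "(mrem c * ell b) $ (n - b') = 0"
      by (rule fps_mult_nth_eq_0[of c' _ 2]) (use n mc bc ell_nth in auto)
    have 2: "(mrem b * ell c) $ (n - c') = 0"
      by (rule fps_mult_nth_eq_0[of b' _ 2]) (use n mb bc ell_nth in auto)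
    have 3: "(mrem b * mrem c) $ k = 0" if "k + 1 \<ge> b' + c'" for k
      by (rule fps_mult_nth_eq_0[of b' _ c']) (use that mb mc bc in auto)
    have 4: "((1 - 4 * fps_X\<^sup>2) * (mrem b * mrem c)) $ n = 0"
    proof (cases "n \<ge> 2")
      case True
      then obtain k where k: "n = k + 2" by (metis add.commute le_Suc_ex)
      have "((1 - 4 * fps_X\<^sup>2) * (mrem b * mrem c)) $ n = (mrem b * mrem c) $ n - 4 * (mrem b * mrem c) $ k"
        unfolding k by (simp add: left_diff_distrib power2_eq_square mult.assoc numeral_fps_const)
      also have "\<dots> = 0" using 3[of n] 3[of k] n k by simp
      finally show ?thesis .
    next
      case False
      then have "n = 1" using n by auto
      then show ?thesis using 3[of 1] n by (simp add: left_diff_distrib power2_eq_square mult.assoc numeral_fps_const)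
    qed
    show ?thesis using 1 2 4 n by (simp add: fps_X_power_mult_nth)
  qed
  have Z0: "?Z $ n = 0" if n: "n \<ge> b + c + 2" for n
  proof -
    define k where "k = n - 3"
    have k: "n = k + 3" using n bc by (simp add: k_def)
    have "(2 * fps_X ^ 3 * ?M) $ n = 2 * ?M $ k"
      unfolding k by (simp add: power3_eq_cube mult.assoc numeral_fps_const del: fps_add_nth fps_sub_nth)
    also have "?M $ k = 0" by (rule M0) (use n k bc in simp)
    finally have 1: "(2 * fps_X ^ 3 * ?M) $ n = 0" by simp
    have "fps_X ^ 3 $ n = (0::complex)" using n bc by (simp add: fps_X_power_nth)
    then have 2: "(2 * of_nat b * of_nat c * fps_X ^ 3 :: complex fps) $ n = 0"
      by (simp add: numeral_fps_const fps_of_nat[symmetric])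
    have 3: "?U $ n = 0"
    proof -
      have z: "(fps_X ^ (c + 2) * fps_cutoff b h) $ n = 0" "(fps_X ^ (b + 2) * fps_cutoff c h) $ n = 0"
        for h :: "complex fps"
        using n unfolding fps_X_power_mult_nth by auto
      have k: "(4 * of_nat a * f * h) $ n = 4 * of_nat a * (f * h) $ n" for a f and h :: "complex fps"
        by (simp add: numeral_fps_const fps_of_nat[symmetric] mult.assoc)
      show ?thesis unfolding fps_add_nth k z by simp
    qed
    show ?thesis using 1 2 3 by (simp only: fps_sub_nth fps_add_nth) simp
  qed
  have hi: "(4 * pair_series b c) $ n = (2 * fps_X * (disc_inv\<^sup>2 * ell b * ell c)) $ n" if "n \<ge> 2" for n
  proof -
    have "(4 * pair_series b c - 2 * fps_X * (disc_inv\<^sup>2 * ell b * ell c)) $ n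
        = (fps_X ^ (b + c) * (4 * pair_series b c - 2 * fps_X * (disc_inv\<^sup>2 * ell b * ell c))) $ (n + b + c)"
      by (subst fps_X_power_mult_nth) (simp add: add.assoc)
    also have "\<dots> = 0" unfolding Z by (rule Z0) (use that in simp)
    finally show ?thesis by simp
  qed
  have lo: "(4 * pair_series b c) $ n = 0" if "n \<le> 1" for n
    using that omega02_nth_low by (cases n)
      (auto simp: pair_series_def numeral_fps_const power2_eq_square mult.assoc fps_of_nat[symmetric])
  show ?thesis
  proof (rule fps_ext)
    fix n :: nat
    consider "n = 0" | "n = 1" | "n \<ge> 2" by linarith
    then show "(4 * pair_series b c) $ n
      = (2 * fps_X * (disc_inv\<^sup>2 * ell b * ell c - fps_const (eta 1 $ (b + 1) * eta 1 $ (c + 1)))) $ n"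
    proof cases
      case 3
      then show ?thesis unfolding hi[OF 3] by (simp add: mult.assoc numeral_fps_const)
    qed (use lo disc_inv_square_nth in \<open>auto simp: mult.assoc numeral_fps_const ell_def\<close>)
  qed
qed

text \<open>
  The expansion of the simple-pole differential, \<open>dz / (z (x - 2 \<epsilon>))\<close>.
\<close>

definition zeta :: "complex \<Rightarrow> complex fps" where
  "zeta e = fps_const (2 * e) * eta 0 + eta 1"

lemma zeta_nth: "zeta e $ n = 2 * e * eta 0 $ n + eta 1 $ n"
  by (simp add: zeta_def)

lemma disc_root_zeta: "disc_root * zeta e = fps_X\<^sup>2 * disc_inv\<^sup>2 * (1 + fps_const (2 * e) * fps_X)"
proof -
  have "disc_root * zeta e = (disc_inv * disc_root) * (fps_X\<^sup>2 * disc_inv\<^sup>2 * (1 + fps_const (2 * e) * fps_X))"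
    unfolding zeta_def eta_0 eta_1 by (simp add: algebra_simps power2_eq_square power3_eq_cube)
  then show ?thesis unfolding disc_inv_root by simp
qed

text \<open>
  The planar three-point function computed from the loop equation agrees with the one from the
  topological recursion.
\<close>

lemma base_03_identity:
  "disc_root * (fps_const (1 / 2) * (fps_const (zeta 1 $ (b+1) * zeta 1 $ (c+1)) * zeta 1
      - fps_const (zeta (-1) $ (b+1) * zeta (-1) $ (c+1)) * zeta (-1))) = pair_series b c"
    (is "?L = _")
proof (cases "b = 0 \<or> c = 0")
  case True
  have "zeta e $ 1 = 0" for e by (simp add: zeta_nth eta_nth_1[simplified])
  moreover have "pair_series b c = 0" using True by (auto simp: pair_series_def omega02_def)
  ultimately show ?thesis using True by auto
next
  case False
  define p q p' q' where pq: "p = fps_const (eta 0 $ (b+1))" "q = fps_const (eta 1 $ (b+1))"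
    "p' = fps_const (eta 0 $ (c+1))" "q' = fps_const (eta 1 $ (c+1))"
  have z: "fps_const (zeta 1 $ (b+1) * zeta 1 $ (c+1)) = (2 * p + q) * (2 * p' + q')"
    "fps_const (zeta (-1) $ (b+1) * zeta (-1) $ (c+1)) = (q - 2 * p) * (q' - 2 * p')"
    unfolding zeta_nth pq numeral_fps_const fps_const_add fps_const_mult fps_const_sub
    by (simp_all add: algebra_simps)
  have c4: "4 * fps_const (1 / 2) = (2 :: complex fps)" "fps_const (2 * 1) = (2 :: complex fps)"
    "fps_const (2 * (-1)) = (-2 :: complex fps)"
    by (simp_all add: numeral_fps_const)
  have "4 * ?L = (4 * fps_const (1 / 2)) * ((2 * p + q) * (2 * p' + q') * (disc_root * zeta 1)
      - (q - 2 * p) * (q' - 2 * p') * (disc_root * zeta (-1)))"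
    unfolding z by (simp only: algebra_simps)
  also have "\<dots> = 2 * ((2 * p + q) * (2 * p' + q') * (fps_X\<^sup>2 * disc_inv\<^sup>2 * (1 + 2 * fps_X))
      - (q - 2 * p) * (q' - 2 * p') * (fps_X\<^sup>2 * disc_inv\<^sup>2 * (1 + - 2 * fps_X)))"
    unfolding disc_root_zeta c4 ..
  also have "\<dots> = 2 * fps_X * ((4 * fps_X\<^sup>2 * disc_inv\<^sup>2) * (q * q')
      + disc_inv\<^sup>2 * (4 * p * fps_X * q' + q * (4 * p') * fps_X + 16 * p * p' * fps_X\<^sup>2))"
    by (simp add: algebra_simps power2_eq_square)
  also have "4 * fps_X\<^sup>2 * disc_inv\<^sup>2 = disc_inv\<^sup>2 - 1" by (metis add_diff_cancel_left' disc_inv_square_expand)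
  also have "2 * fps_X * ((disc_inv\<^sup>2 - 1) * (q * q')
      + disc_inv\<^sup>2 * (4 * p * fps_X * q' + q * (4 * p') * fps_X + 16 * p * p' * fps_X\<^sup>2))
      = 2 * fps_X * (disc_inv\<^sup>2 * (q + 4 * p * fps_X) * (q' + 4 * p' * fps_X) - q * q')"
    by (simp add: algebra_simps power2_eq_square)
  also have "\<dots> = 4 * pair_series b c"
    using False pair_series_closed[of b c] unfolding ell_def pq
    by (simp add: numeral_fps_const)
  finally show ?thesis by (simp add: numeral_fps_const)
qed

section \<open>The contribution of two points on the same trace\<close>

text \<open>
  The contribution to the loop equation of splitting one trace into two within a connected
  cumulant.
\<close>

definition diagonal_series :: "nat \<Rightarrow> nat list \<Rightarrow> complex fps" where
  "diagonal_series g as = (if g = 0 then 0 else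
     Abs_fps (\<lambda>m. if m < 2 then 0 else \<Sum>i\<le>m-2. cumulant (g - 1) (i # (m - 2 - i) # as)))"

lemma omega02_antidiagonal:
  assumes "k \<le> n"
  shows "omega02 k $ (n - k + 1) = - (of_nat k / 2) * (\<Sum>q\<le>n. if k < q then disc_inv $ (n - q) * disc_root $ q else 0)"
proof (cases "k = n")
  case True
  then have "(\<Sum>q\<le>n. if k < q then disc_inv $ (n - q) * disc_root $ q else 0) = 0" by (intro sum.neutral) auto
  then show ?thesis using True omega02_nth_low by simp
next
  case False
  define p where "p = n - k - 1"
  have p: "n - k + 1 = p + 2" "n = p + k + 1" using assms False by (simp_all add: p_def)
  have "omega02 k $ (p + 2) = - (of_nat k / 2) * (disc_inv * fps_shift (k + 1) disc_root) $ p"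
    by (simp add: omega02_def power2_eq_square mult.assoc)
  also have "(disc_inv * fps_shift (k + 1) disc_root) $ p = (\<Sum>i\<in>{0..p}. disc_inv $ i * disc_root $ (p - i + k + 1))"
    by (simp add: fps_mult_nth add.assoc)
  also have "\<dots> = (\<Sum>i\<in>{0..p}. disc_inv $ i * disc_root $ (n - i))"
    unfolding p(2) by (intro sum.cong refl) (simp add: Suc_diff_le)
  also have "\<dots> = (\<Sum>q\<in>{k+1..n}. disc_inv $ (n - q) * disc_root $ q)"
    by (rule sum.reindex_bij_witness[of _ "\<lambda>q. n - q" "\<lambda>i. n - i"]) (auto simp: p(2))
  also have "\<dots> = (\<Sum>q\<le>n. if k < q then disc_inv $ (n - q) * disc_root $ q else 0)"
    by (rule sum.mono_neutral_cong_left) auto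
  finally show ?thesis unfolding p(1) .
qed

text \<open>
  Joining the two points of the planar two-point function is the source of
  \<open>W\<^bsub>1,1\<^esub>\<close>. The antidiagonal sums form the series of \<open>1 /
  (x\<^sup>2 (1 - 4 / x\<^sup>2)\<^sup>2)\<close>; the proof recognises in them the second
  derivative of the root.
\<close>

lemma omega02_antidiagonal_sum: "(\<Sum>i\<le>n. omega02 (n - i) $ (i + 1)) = (fps_X\<^sup>2 * disc_inv ^ 4) $ n"
proof -
  have "(\<Sum>i\<le>n. omega02 (n - i) $ (i + 1)) = (\<Sum>k\<le>n. omega02 k $ (n - k + 1))"
    by (rule sum.reindex_bij_witness[of _ "\<lambda>k. n - k" "\<lambda>i. n - i"]) auto
  also have "\<dots> = (\<Sum>k\<le>n. \<Sum>q\<le>n. if k < q then - (of_nat k / 2) * (disc_inv $ (n - q) * disc_root $ q) else 0)"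
  proof (rule sum.cong[OF refl])
    fix k assume "k \<in> {..n}"
    then have "omega02 k $ (n - k + 1) = - (of_nat k / 2) * (\<Sum>q\<le>n. if k < q then disc_inv $ (n - q) * disc_root $ q else 0)"
      by (intro omega02_antidiagonal) simp
    also have "\<dots> = (\<Sum>q\<le>n. if k < q then - (of_nat k / 2) * (disc_inv $ (n - q) * disc_root $ q) else 0)"
      unfolding sum_distrib_left by (intro sum.cong) auto
    finally show "omega02 k $ (n - k + 1) = \<dots>" .
  qed
  also have "\<dots> = (\<Sum>q\<le>n. \<Sum>k\<le>n. if k < q then - (of_nat k / 2) * (disc_inv $ (n - q) * disc_root $ q) else 0)"
    by (rule sum.swap)
  also have "\<dots> = (\<Sum>q\<le>n. disc_inv $ (n - q) * (- (1/4) * (of_nat q * of_nat (q - 1) * disc_root $ q)))"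
  proof (rule sum.cong[OF refl])
    fix q assume q: "q \<in> {..n}"
    have "(\<Sum>k\<le>n. if k < q then - (of_nat k / 2) * (disc_inv $ (n - q) * disc_root $ q) else 0)
        = (\<Sum>k<q. - (of_nat k / 2) * (disc_inv $ (n - q) * disc_root $ q))"
      by (rule sum.mono_neutral_cong_right) (use q in auto)
    also have "\<dots> = (\<Sum>k<q. of_nat k) * (- (1/2) * (disc_inv $ (n - q) * disc_root $ q))"
      unfolding sum_distrib_right by (intro sum.cong) auto
    also have "(\<Sum>k<q. of_nat k :: complex) = of_nat q * of_nat (q - 1) / 2"
    proof (induction q)
      case (Suc q)
      then show ?case by (cases q) (simp_all add: field_simps)
    qed simp
    finally show "(\<Sum>k\<le>n. if k < q then - (of_nat k / 2) * (disc_inv $ (n - q) * disc_root $ q) else 0)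
        = disc_inv $ (n - q) * (- (1/4) * (of_nat q * of_nat (q - 1) * disc_root $ q))" by (simp add: mult_ac)
  qed
  also have "\<dots> = (\<Sum>q\<le>n. disc_inv $ (n - q) * (fps_const (- (1/4)) * (fps_X\<^sup>2 * fps_deriv (fps_deriv disc_root))) $ q)"
  proof -
    have "(fps_X\<^sup>2 * fps_deriv (fps_deriv disc_root)) $ q = of_nat q * of_nat (q - 1) * disc_root $ q" for q
    proof (cases q)
      case (Suc r)
      then show ?thesis by (cases r) (simp_all add: power2_eq_square mult.assoc)
    qed (simp add: power2_eq_square mult.assoc)
    then show ?thesis by simp
  qed
  also have "\<dots> = (disc_inv * (fps_const (- (1/4)) * (fps_X\<^sup>2 * fps_deriv (fps_deriv disc_root)))) $ n"
    unfolding fps_mult_nth atLeast0AtMost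
    by (rule sum.reindex_bij_witness[of _ "\<lambda>q. n - q" "\<lambda>i. n - i"]) auto
  also have "fps_deriv (fps_deriv disc_root) = - 4 * disc_inv * (1 + 4 * fps_X\<^sup>2 * disc_inv\<^sup>2)"
    unfolding deriv_disc_root by (simp add: deriv_disc_inv algebra_simps power2_eq_square power3_eq_cube)
  also have "disc_inv * (fps_const (- (1/4)) * (fps_X\<^sup>2 * (- 4 * disc_inv * (1 + 4 * fps_X\<^sup>2 * disc_inv\<^sup>2)))) = fps_X\<^sup>2 * disc_inv ^ 4"
  proof -
    have "fps_const (- (1/4)) * - 4 = (1 :: complex fps)"
      by (simp add: numeral_fps_const flip: fps_const_neg)
    moreover have "disc_inv * (fps_const (- (1/4)) * (fps_X\<^sup>2 * ((- 4) * disc_inv * disc_inv\<^sup>2)))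
      = (fps_const (- (1/4)) * - 4) * (fps_X\<^sup>2 * (disc_inv * disc_inv * disc_inv\<^sup>2))" by (simp only: mult_ac)
    moreover have "disc_inv * disc_inv * disc_inv\<^sup>2 = disc_inv ^ 4" by (simp add: power2_eq_square power4_eq_xxxx)
    ultimately show ?thesis unfolding disc_inv_square_expand by (simp only: mult_1_left)
  qed
  finally show ?thesis .
qed

lemma fps_mult_nth_no_const:
  fixes f h :: "complex fps"
  assumes "f $ 0 = 0" "h $ 0 = 0"
  shows "(f * h) $ m = (if m < 2 then 0 else \<Sum>i\<le>m-2. f $ (i + 1) * h $ (m - 2 - i + 1))"
proof (cases "m < 2")
  case True
  then have "m = 0 \<or> m = 1" by auto
  then show ?thesis using assms True by (auto simp: fps_mult_nth)
next
  case False
  then obtain n where m: "m = n + 2" by (metis add.commute le_Suc_ex not_less)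
  have "(f * h) $ m = (\<Sum>i\<in>{1..n+1}. f $ i * h $ (m - i))"
    unfolding fps_mult_nth
    by (rule sum.mono_neutral_right) (use assms m in \<open>auto simp: not_le less_Suc_eq_le not_less_eq_eq\<close>)
  also have "\<dots> = (\<Sum>i\<le>n. f $ (i + 1) * h $ (n - i + 1))"
    by (rule sum.reindex_bij_witness[of _ "\<lambda>i. i + 1" "\<lambda>i. i - 1"]) (auto simp: m Suc_diff_le)
  finally show ?thesis using m by simp
qed

lemma minus_one_power_mult_nth: "((-1) ^ n * f) $ m = (-1) ^ n * f $ m" for f :: "complex fps"
  by (cases "even n") simp_all

lemma diagonal_series_eq:
  assumes g: "g > 0" and K: "4 * (2 * g + length as) < K"
  shows "diagonal_series g as = (-1) ^ length as * (\<Sum>k<K. \<Sum>l<K.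
      fps_const (contract moment_slot K (\<lambda>ks. tr_coeff (g - 1) (k # l # ks)) as) * (eta k * eta l))
    + (if g = 1 \<and> as = [] then fps_X ^ 4 * disc_inv ^ 4 else 0)"
proof (rule fps_ext)
  fix m
  let ?C = "\<lambda>k l. contract moment_slot K (\<lambda>ks. tr_coeff (g - 1) (k # l # ks)) as"
  let ?s = "(-1) ^ length as :: complex"
  have nm: "cumulant (g - 1) (i # j # as) = ?s * (\<Sum>k<K. \<Sum>l<K. ?C k l * (eta k $ (i + 1) * eta l $ (j + 1)))
      + (if g = 1 \<and> as = [] then omega02 j $ (i + 1) else 0)" for i j
  proof -
    have "K > 4 * (2 * (g - 1) + length (j # as))" using K g by simp
    then have "cumulant (g - 1) (i # j # as) = ((-1) ^ (length (j # as) + 1) * stable_sum K (g - 1) (j # as)) $ (i + 1)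
        + unstable_series (g - 1) (j # as) $ (i + 1)"
      unfolding cumulant_Cons by (simp only: omega_K fps_add_nth)
    also have "((-1) ^ (length (j # as) + 1) * stable_sum K (g - 1) (j # as)) $ (i + 1) = ?s * stable_sum K (g - 1) (j # as) $ (i + 1)"
      unfolding minus_one_power_mult_nth by simp
    also have "stable_sum K (g - 1) (j # as) $ (i + 1) = (\<Sum>k<K. \<Sum>l<K. ?C k l * (eta k $ (i + 1) * eta l $ (j + 1)))"
      by (simp add: stable_sum_def fps_sum_nth moment_slot_def sum_distrib_right sum_distrib_left mult_ac)
    also have "unstable_series (g - 1) (j # as) $ (i + 1) = (if g = 1 \<and> as = [] then omega02 j $ (i + 1) else 0)"
      using g by (auto simp: unstable_series_def)
    finally show ?thesis .
  qed
  let ?R = "(-1) ^ length as * (\<Sum>k<K. \<Sum>l<K. fps_const (?C k l) * (eta k * eta l))"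
  have R: "?R $ m = ?s * (\<Sum>k<K. \<Sum>l<K. ?C k l * (eta k * eta l) $ m)"
    unfolding minus_one_power_mult_nth by (simp add: fps_sum_nth)
  show "diagonal_series g as $ m = (?R + (if g = 1 \<and> as = [] then fps_X ^ 4 * disc_inv ^ 4 else 0)) $ m"
  proof (cases "m < 2")
    case True
    have "(fps_X ^ 4 * disc_inv ^ 4) $ m = 0" using True by (simp add: fps_X_power_mult_nth)
    moreover have "?R $ m = 0" unfolding R using True by (simp add: fps_mult_nth_no_const eta_nth_0)
    ultimately show ?thesis using True g by (simp add: diagonal_series_def)
  next
    case False
    then obtain n where m: "m = n + 2" by (metis add.commute le_Suc_ex not_less)
    have "diagonal_series g as $ m = (\<Sum>i\<le>n. cumulant (g - 1) (i # (n - i) # as))" using g m by (simp add: diagonal_series_def)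
    also have "\<dots> = ?s * (\<Sum>i\<le>n. \<Sum>k<K. \<Sum>l<K. ?C k l * (eta k $ (i + 1) * eta l $ (n - i + 1)))
        + (\<Sum>i\<le>n. if g = 1 \<and> as = [] then omega02 (n - i) $ (i + 1) else 0)"
      unfolding nm sum.distrib sum_distrib_left ..
    also have "(\<Sum>i\<le>n. \<Sum>k<K. \<Sum>l<K. ?C k l * (eta k $ (i + 1) * eta l $ (n - i + 1)))
        = (\<Sum>k<K. \<Sum>l<K. ?C k l * (eta k * eta l) $ m)"
      unfolding fps_mult_nth_no_const[OF eta_nth_0 eta_nth_0] m sum_distrib_left
      by (simp add: sum_distrib_left) (subst sum.swap, intro sum.cong refl sum.swap)
    also have "(\<Sum>i\<le>n. if g = 1 \<and> as = [] then omega02 (n - i) $ (i + 1) else 0)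
        = (if g = 1 \<and> as = [] then fps_X ^ 4 * disc_inv ^ 4 else 0) $ m"
    proof -
      have "(fps_X ^ 4 * disc_inv ^ 4) $ m = (fps_X\<^sup>2 * disc_inv ^ 4) $ n"
        unfolding m by (simp add: fps_X_power_mult_nth)
      then show ?thesis using omega02_antidiagonal_sum[of n] by (cases "g = 1 \<and> as = []") auto
    qed
    finally show ?thesis unfolding R[symmetric] by simp
  qed
qed

section \<open>Loop equations\<close>

lemma sum_tri_value: "2 \<le> K \<Longrightarrow> (\<Sum>k<K. f k * tri_value e k) = 2 * e * f 0 + f 1"
proof -
  assume "2 \<le> K"
  then have "(\<Sum>k<K. f k * tri_value e k) = (\<Sum>k\<in>{0,1}. f k * tri_value e k)"
    by (intro sum.mono_neutral_right) (auto simp: tri_value_def)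
  then show ?thesis by (simp add: tri_value_def)
qed

lemma sum_tri_value_eta: "2 \<le> K \<Longrightarrow> (\<Sum>k<K. fps_const (tri_value e k) * eta k) = zeta e"
  by (rule fps_ext) (simp add: fps_sum_nth mult.commute[of "tri_value e _"] sum_tri_value zeta_nth)

definition base_series :: "nat \<Rightarrow> nat \<Rightarrow> nat list \<Rightarrow> complex fps" where
  "base_series K g as = (\<Sum>k<K. fps_const (contract moment_slot K (\<lambda>ks. tr_base g (k # ks)) as) * eta k)"

lemma base_series_11: "3 \<le> K \<Longrightarrow> base_series K 1 [] = - eta 2"
proof -
  assume "3 \<le> K"
  then have "base_series K 1 [] = (\<Sum>k\<in>{2}. fps_const (tr_base 1 [k]) * eta k)"
    unfolding base_series_def contract.simps by (intro sum.mono_neutral_right) (auto simp: tr_base_def)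
  then show ?thesis by (simp add: tr_base_def flip: fps_const_neg)
qed

lemma base_series_03:
  assumes K: "2 \<le> K"
  shows "disc_root * base_series K 0 [b, c] = - pair_series b c"
proof -
  let ?Z = "\<lambda>e. zeta e $ (b + 1) * zeta e $ (c + 1)"
  have pr: "contract moment_slot K (\<lambda>ks. \<Prod>k\<leftarrow>ks. tri_value e k) [b, c] = ?Z e" for e
    unfolding contract_prod using K by (simp add: sum_tri_value zeta_nth moment_slot_def)
  have "contract moment_slot K (\<lambda>ks. tr_base 0 (k # ks)) [b, c] = - (1/2) * (tri_value 1 k * ?Z 1 - tri_value (-1) k * ?Z (-1))" for k
  proof -
    have "contract moment_slot K (\<lambda>ks. tr_base 0 (k # ks)) [b, c]
      = contract moment_slot K (\<lambda>ks. (- (1/2) * tri_value 1 k) * (\<Prod>k\<leftarrow>ks. tri_value 1 k)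
          + (1/2 * tri_value (-1) k) * (\<Prod>k\<leftarrow>ks. tri_value (-1) k)) [b, c]"
      by (rule contract_cong) (simp add: tr_base_def algebra_simps)
    also have "\<dots> = (- (1/2) * tri_value 1 k) * ?Z 1 + (1/2 * tri_value (-1) k) * ?Z (-1)"
      unfolding contract_add contract_cmult pr ..
    finally show ?thesis by (simp add: algebra_simps)
  qed
  then have "base_series K 0 [b, c] = (\<Sum>k<K. fps_const (- (1/2) * (tri_value 1 k * ?Z 1 - tri_value (-1) k * ?Z (-1))) * eta k)"
    unfolding base_series_def by simp
  also have "\<dots> = (\<Sum>k<K. - (fps_const (1/2) * (fps_const (?Z 1) * (fps_const (tri_value 1 k) * eta k)
      - fps_const (?Z (-1)) * (fps_const (tri_value (-1) k) * eta k))))"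
    by (intro sum.cong refl fps_ext) (simp add: algebra_simps)
  also have "\<dots> = - (fps_const (1/2) * (fps_const (?Z 1) * zeta 1 - fps_const (?Z (-1)) * zeta (-1)))"
    unfolding sum_negf sum_distrib_left[symmetric] sum_subtractf sum_tri_value_eta[OF K] ..
  finally show ?thesis using base_03_identity[of b c] by simp
qed

lemma base_series_0: "2 * g + length as \<ge> 2 \<Longrightarrow> \<not> (g = 1 \<and> as = []) \<Longrightarrow> \<not> (g = 0 \<and> length as = 2) \<Longrightarrow> base_series K g as = 0"
proof -
  assume "2 * g + length as \<ge> 2" "\<not> (g = 1 \<and> as = [])" "\<not> (g = 0 \<and> length as = 2)"
  then have "contract moment_slot K (\<lambda>ks. tr_base g (k # ks)) as = 0" for k
    by (intro contract_0) (auto simp: tr_base_def)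
  then show ?thesis by (simp add: base_series_def)
qed

text \<open>The part of the generating series that comes from the arrays.\<close>

definition stable_series :: "nat \<Rightarrow> nat \<Rightarrow> nat list \<Rightarrow> complex fps" where
  "stable_series K g as = (-1) ^ (length as + 1) * stable_sum K g as"

lemma stable_series_pair_sum:
  assumes K: "4 * (2 * g + length as) < K"
  shows "(-1) ^ (length as + 1) * disc_root * (\<Sum>k<K. \<Sum>l<K. fps_const (tr_pair moment_slot K g k l as) * quad_form eta k l)
    = fps_X * (diagonal_series g as + (\<Sum>g1\<le>g. split_sum (\<lambda>u v. stable_series K g1 u * stable_series K (g - g1) v) as))
      - (if g = 1 \<and> as = [] then fps_X ^ 5 * disc_inv ^ 4 else 0)"
proof -
  let ?s = "(-1) ^ length as :: complex fps"
  let ?C = "\<lambda>k l. fps_const (contract moment_slot K (\<lambda>ks. tr_coeff (g - 1) (k # l # ks)) as)"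
  let ?S = "\<lambda>k l. \<Sum>g1\<le>g. split_sum (\<lambda>u v. tr_slot moment_slot K g1 k u * tr_slot moment_slot K (g - g1) l v) as"
  have "disc_root * (\<Sum>k<K. \<Sum>l<K. fps_const (tr_pair moment_slot K g k l as) * quad_form eta k l)
      = - ((disc_inv * disc_root) * fps_X * (\<Sum>k<K. \<Sum>l<K. fps_const (tr_pair moment_slot K g k l as) * (eta k * eta l)))"
    unfolding eta_quad by (simp add: sum_distrib_left sum_negf mult_ac)
  also have "\<dots> = - (fps_X * (\<Sum>k<K. \<Sum>l<K. fps_const (tr_pair moment_slot K g k l as) * (eta k * eta l)))"
    unfolding disc_inv_root by simp
  also have "(\<Sum>k<K. \<Sum>l<K. fps_const (tr_pair moment_slot K g k l as) * (eta k * eta l))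
      = (if g = 0 then 0 else \<Sum>k<K. \<Sum>l<K. ?C k l * (eta k * eta l))
        + (\<Sum>k<K. \<Sum>l<K. fps_const (?S k l) * (eta k * eta l))"
    unfolding tr_pair_def fps_const_add[symmetric] distrib_right sum.distrib by (cases "g = 0") simp_all
  also have "(\<Sum>k<K. \<Sum>l<K. fps_const (?S k l) * (eta k * eta l))
      = (\<Sum>g1\<le>g. split_sum (\<lambda>u v. stable_sum K g1 u * stable_sum K (g - g1) v) as)"
  proof (rule fps_ext)
    fix n
    have e: "(stable_sum K g1 u * stable_sum K g2 v) $ n = (\<Sum>k<K. \<Sum>l<K. tr_slot moment_slot K g1 k u * tr_slot moment_slot K g2 l v * (eta k * eta l) $ n)" for g1 g2 u v
    proof -
      have "stable_sum K g1 u * stable_sum K g2 v = (\<Sum>k<K. \<Sum>l<K. fps_const (tr_slot moment_slot K g1 k u * tr_slot moment_slot K g2 l v) * (eta k * eta l))"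
        unfolding stable_sum_def sum_product by (intro sum.cong refl) (simp add: mult_ac flip: fps_const_mult)
      then show ?thesis by (simp add: fps_sum_nth)
    qed
    have "(\<Sum>k<K. \<Sum>l<K. fps_const (?S k l) * (eta k * eta l)) $ n = (\<Sum>k<K. \<Sum>l<K. \<Sum>g1\<le>g. split_sum (\<lambda>u v. tr_slot moment_slot K g1 k u * tr_slot moment_slot K (g - g1) l v * (eta k * eta l) $ n) as)"
      by (simp add: fps_sum_nth sum_distrib_right split_sum_cmult_right)
    also have "\<dots> = (\<Sum>k<K. \<Sum>g1\<le>g. \<Sum>l<K. split_sum (\<lambda>u v. tr_slot moment_slot K g1 k u * tr_slot moment_slot K (g - g1) l v * (eta k * eta l) $ n) as)"
      by (intro sum.cong refl sum.swap)
    also have "\<dots> = (\<Sum>g1\<le>g. \<Sum>k<K. \<Sum>l<K. split_sum (\<lambda>u v. tr_slot moment_slot K g1 k u * tr_slot moment_slot K (g - g1) l v * (eta k * eta l) $ n) as)"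
      by (rule sum.swap)
    also have "\<dots> = (\<Sum>g1\<le>g. split_sum (\<lambda>u v. stable_sum K g1 u * stable_sum K (g - g1) v) as) $ n"
      by (simp add: fps_sum_nth fps_nth_split_sum e split_sum_sum)
    finally show "(\<Sum>k<K. \<Sum>l<K. fps_const (?S k l) * (eta k * eta l)) $ n
      = (\<Sum>g1\<le>g. split_sum (\<lambda>u v. stable_sum K g1 u * stable_sum K (g - g1) v) as) $ n" .
  qed
  finally have A: "disc_root * (\<Sum>k<K. \<Sum>l<K. fps_const (tr_pair moment_slot K g k l as) * quad_form eta k l)
     = - (fps_X * ((if g = 0 then 0 else \<Sum>k<K. \<Sum>l<K. ?C k l * (eta k * eta l))
        + (\<Sum>g1\<le>g. split_sum (\<lambda>u v. stable_sum K g1 u * stable_sum K (g - g1) v) as)))" .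
  have B: "diagonal_series g as = ?s * (if g = 0 then 0 else \<Sum>k<K. \<Sum>l<K. ?C k l * (eta k * eta l))
     + (if g = 1 \<and> as = [] then fps_X ^ 4 * disc_inv ^ 4 else 0)"
    using diagonal_series_eq[OF _ K] by (cases "g = 0") (auto simp: diagonal_series_def)
  have "split_sum (\<lambda>u v. stable_series K g1 u * stable_series K g2 v) as = split_sum (\<lambda>u v. ?s * (stable_sum K g1 u * stable_sum K g2 v)) as" for g1 g2
  proof (rule split_sum_cong[OF refl])
    fix u v assume "mset u + mset v = mset as"
    from mset_split_bounds(1)[OF this] have "length as = length u + length v" by simp
    then show "stable_series K g1 u * stable_series K g2 v = ?s * (stable_sum K g1 u * stable_sum K g2 v)"
      by (simp add: stable_series_def power_add mult_ac)
  qed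
  then have D: "(\<Sum>g1\<le>g. split_sum (\<lambda>u v. stable_series K g1 u * stable_series K (g - g1) v) as)
      = ?s * (\<Sum>g1\<le>g. split_sum (\<lambda>u v. stable_sum K g1 u * stable_sum K (g - g1) v) as)"
    by (simp add: split_sum_cmult sum_distrib_left)
  have p5: "fps_X * (if g = 1 \<and> as = [] then fps_X ^ 4 * disc_inv ^ 4 else 0) = (if g = 1 \<and> as = [] then fps_X ^ 5 * disc_inv ^ 4 else 0 :: complex fps)"
    by (simp add: mult.assoc[symmetric] power_Suc[symmetric])
  show ?thesis unfolding B D mult.assoc A distrib_left p5 power_add power_one_right by (simp add: algebra_simps)
qed

lemma split_sum_unstable_series:
  "(\<Sum>g1\<le>g. split_sum (\<lambda>u v. unstable_series g1 u * f (g - g1) v) as)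
     = omega01 * f g as + pick_sum (\<lambda>a qs. omega02 a * f g qs) as"
proof -
  have "(\<Sum>g1\<le>g. split_sum (\<lambda>u v. unstable_series g1 u * f (g - g1) v) as)
      = (\<Sum>g1\<in>{0}. split_sum (\<lambda>u v. unstable_series g1 u * f (g - g1) v) as)"
    by (rule sum.mono_neutral_right) (auto simp: unstable_series_def)
  also have "\<dots> = split_sum (\<lambda>u v. (if u = [] then omega01 * f g v else 0) + (if length u = 1 then omega02 (hd u) * f g v else 0)) as"
    by (simp, intro split_sum_cong refl) (auto simp: unstable_series_def)
  finally show ?thesis
    unfolding split_sum_add split_sum_Nil_left
      split_sum_singleton_left[of "\<lambda>a v. omega02 a * f g v"] .
qed

text \<open>The recursion for arrays, after multiplication by \<open>\<surd>D / x\<close>.\<close>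

lemma stable_rec:
  assumes st: "2 * g + length as \<ge> 2" and K: "4 * (2 * g + length as) < K"
  shows "disc_root * stable_series K g as = fps_X * (diagonal_series g as + (\<Sum>g1\<le>g. split_sum (\<lambda>u v. stable_series K g1 u * stable_series K (g - g1) v) as))
    + pick_sum (\<lambda>a qs. of_nat a * fps_X\<^sup>2 * fps_shift a (stable_series K g qs)) as
    + 2 * fps_X * pick_sum (\<lambda>a qs. omega02 a * stable_series K g qs) as
    + (if g = 0 \<and> length as = 2 then pair_series (as ! 0) (as ! 1) else 0)"
proof -
  let ?t = "(-1) ^ (length as + 1) :: complex fps"
  have sl: "?t * (disc_root * pick_sum (\<lambda>q qs. \<Sum>k<K. fps_const (tr_slot moment_slot K g k qs * of_nat q) * slot_series (k + 2) q) as)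
    = pick_sum (\<lambda>a qs. of_nat a * fps_X\<^sup>2 * fps_shift a (stable_series K g qs) + 2 * fps_X * (omega02 a * stable_series K g qs)) as"
    unfolding pick_sum_cmult[symmetric]
  proof (rule pick_sum_cong[OF refl])
    fix a qs assume "mset (a # qs) = mset as"
    from mset_pick_bounds(1)[OF this] have l: "length as = length qs + 1" by simp
    have sh: "fps_shift a (stable_series K g qs) = - ?t * fps_shift a (stable_sum K g qs)"
      unfolding stable_series_def l by (rule fps_ext) (simp add: minus_one_power_mult_nth)
    show "?t * (disc_root * (\<Sum>k<K. fps_const (tr_slot moment_slot K g k qs * of_nat a) * slot_series (k + 2) a))
      = of_nat a * fps_X\<^sup>2 * fps_shift a (stable_series K g qs) + 2 * fps_X * (omega02 a * stable_series K g qs)"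
      unfolding slot_sum sh unfolding stable_series_def l by (simp add: algebra_simps)
  qed
  have base: "?t * (disc_root * base_series K g as) = (if g = 1 \<and> as = [] then fps_X ^ 5 * disc_inv ^ 4 else 0)
    + (if g = 0 \<and> length as = 2 then pair_series (as ! 0) (as ! 1) else 0)"
  proof -
    consider "g = 1" "as = []" | "g = 0" "length as = 2" | "\<not> (g = 1 \<and> as = [])" "\<not> (g = 0 \<and> length as = 2)" by blast
    then show ?thesis
    proof cases
      case 1
      have "disc_root * eta 2 = (disc_inv * disc_root) * (fps_X ^ 5 * disc_inv ^ 4)" unfolding eta_2 by (simp add: numeral_eq_Suc mult_ac)
      then show ?thesis using 1 K base_series_11[of K] by (simp add: disc_inv_root)
    next
      case 2
      then obtain b c where "as = [b, c]" by (auto simp: length_Suc_conv numeral_2_eq_2)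
      then show ?thesis using 2 K base_series_03[of K b c] by simp
    next
      case 3
      then show ?thesis using base_series_0[OF st 3] by auto
    qed
  qed
  have "disc_root * stable_series K g as = ?t * (disc_root * base_series K g as)
      + ?t * disc_root * (\<Sum>k<K. \<Sum>l<K. fps_const (tr_pair moment_slot K g k l as) * quad_form eta k l)
      + ?t * (disc_root * pick_sum (\<lambda>q qs. \<Sum>k<K. fps_const (tr_slot moment_slot K g k qs * of_nat q) * slot_series (k + 2) q) as)"
    unfolding stable_series_def stable_sum_expand[OF st K] base_series_def by (simp only: algebra_simps)
  moreover have "x = y + P + Q + E'" if "x = (E + E') + (y - E) + (P + Q)" for x y P Q E E' :: "complex fps"
    using that by simp
  ultimately show ?thesis
    unfolding sl base pick_sum_add pick_sum_cmult stable_series_pair_sum[OF K] by blast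
qed

text \<open>
  In the recursion for the stable parts, \<open>\<surd>D / x = 1 - 2 X
  \<omega>\<^bsub>0,1\<^esub>\<close>. So the factor in front and the products with the planar
  two-point function are precisely the products with one unstable factor that are missing in the
  sum over splittings; the products of two unstable factors are the three-point terms.
\<close>

theorem omega_rec:
  "omega g as = fps_X * (diagonal_series g as + (\<Sum>g1\<le>g. split_sum (\<lambda>u v. omega g1 u * omega (g - g1) v) as))
    + pick_sum (\<lambda>a qs. of_nat a * fps_X\<^sup>2 * fps_shift a (omega g qs)) as
    + (if g = 0 \<and> as = [] then fps_X else 0)"
proof (cases "2 * g + length as < 2")
  case True
  then have g: "g = 0" by simp
  have o0: "omega 0 [] = omega01" "omega 0 [a] = omega02 a" for a
    by (simp_all add: omega_def stable_sum_unstable unstable_series_def)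
  show ?thesis
  proof (cases as)
    case Nil
    then show ?thesis using g omega01_quadratic by (simp add: o0 diagonal_series_def power2_eq_square)
  next
    case (Cons a r)
    then have as: "as = [a]" using True by simp
    have "omega02 a = 2 * fps_X * omega01 * omega02 a + of_nat a * fps_X\<^sup>2 * fps_shift a omega01"
      using omega02_rec[of a] unfolding omega01_eq by (simp add: algebra_simps)
    then show ?thesis unfolding as g by (simp add: o0 diagonal_series_def algebra_simps)
  qed
next
  case False
  then have st: "2 * g + length as \<ge> 2" by simp
  \<comment> \<open>a cutoff beyond the support of the arrays for this and for all smaller arguments\<close>
  define K where "K = 4 * (2 * g + length as) + 1"
  have K: "4 * (2 * g + length as) < K" by (simp add: K_def)
  have os: "omega h u = stable_series K h u + unstable_series h u" if "2 * h + length u \<le> 2 * g + length as" for h u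
    using omega_K[of h u K] K that by (simp add: stable_series_def)
  have u0: "unstable_series g as = 0" using st by (auto simp: unstable_series_def)
  have "(\<Sum>g1\<le>g. split_sum (\<lambda>u v. omega g1 u * omega (g - g1) v) as)
    = (\<Sum>g1\<le>g. split_sum (\<lambda>u v. (stable_series K g1 u * stable_series K (g - g1) v + unstable_series g1 u * stable_series K (g - g1) v)
         + (stable_series K g1 u * unstable_series (g - g1) v + unstable_series g1 u * unstable_series (g - g1) v)) as)"
  proof (intro sum.cong refl split_sum_cong)
    fix g1 u v assume "g1 \<in> {..g}" "mset u + mset v = mset as"
    with mset_split_bounds(1)[OF this(2)]
    have "2 * g1 + length u \<le> 2 * g + length as" "2 * (g - g1) + length v \<le> 2 * g + length as" by auto
    then show "omega g1 u * omega (g - g1) v = (stable_series K g1 u * stable_series K (g - g1) v + unstable_series g1 u * stable_series K (g - g1) v)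
         + (stable_series K g1 u * unstable_series (g - g1) v + unstable_series g1 u * unstable_series (g - g1) v)"
      by (simp add: os algebra_simps)
  qed
  also have "\<dots> = (\<Sum>g1\<le>g. split_sum (\<lambda>u v. stable_series K g1 u * stable_series K (g - g1) v) as)
     + (\<Sum>g1\<le>g. split_sum (\<lambda>u v. unstable_series g1 u * stable_series K (g - g1) v) as)
     + ((\<Sum>g1\<le>g. split_sum (\<lambda>u v. stable_series K g1 u * unstable_series (g - g1) v) as)
     + (\<Sum>g1\<le>g. split_sum (\<lambda>u v. unstable_series g1 u * unstable_series (g - g1) v) as))"
    unfolding split_sum_add sum.distrib by simp
  also have "(\<Sum>g1\<le>g. split_sum (\<lambda>u v. stable_series K g1 u * unstable_series (g - g1) v) as)
      = (\<Sum>g1\<le>g. split_sum (\<lambda>u v. unstable_series g1 u * stable_series K (g - g1) v) as)"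
    by (rule sum.reindex_bij_witness[of _ "\<lambda>h. g - h" "\<lambda>h. g - h"])
      (auto simp: mult.commute split_sum_commute[of "\<lambda>u v. stable_series K _ u * unstable_series _ v"])
  finally have S: "(\<Sum>g1\<le>g. split_sum (\<lambda>u v. omega g1 u * omega (g - g1) v) as)
    = (\<Sum>g1\<le>g. split_sum (\<lambda>u v. stable_series K g1 u * stable_series K (g - g1) v) as)
     + 2 * omega01 * stable_series K g as + 2 * pick_sum (\<lambda>a qs. omega02 a * stable_series K g qs) as
     + pick_sum (\<lambda>a qs. omega02 a * unstable_series g qs) as"
    unfolding split_sum_unstable_series u0 by (simp add: algebra_simps)
  have P: "pick_sum (\<lambda>a qs. of_nat a * fps_X\<^sup>2 * fps_shift a (omega g qs)) as
     = pick_sum (\<lambda>a qs. of_nat a * fps_X\<^sup>2 * fps_shift a (stable_series K g qs)) as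
       + pick_sum (\<lambda>a qs. of_nat a * fps_X\<^sup>2 * fps_shift a (unstable_series g qs)) as"
    unfolding pick_sum_add[symmetric]
  proof (rule pick_sum_cong[OF refl])
    fix a qs assume "mset (a # qs) = mset as"
    from mset_pick_bounds(1)[OF this] have "2 * g + length qs \<le> 2 * g + length as" by simp
    note e = os[OF this]
    show "of_nat a * fps_X\<^sup>2 * fps_shift a (omega g qs) = of_nat a * fps_X\<^sup>2 * fps_shift a (stable_series K g qs)
       + of_nat a * fps_X\<^sup>2 * fps_shift a (unstable_series g qs)"
      unfolding e distrib_left[symmetric] by (rule arg_cong[where f = "(*) _"], rule fps_ext) simp
  qed
  have Q: "fps_X * pick_sum (\<lambda>a qs. omega02 a * unstable_series g qs) as + pick_sum (\<lambda>a qs. of_nat a * fps_X\<^sup>2 * fps_shift a (unstable_series g qs)) as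
     = (if g = 0 \<and> length as = 2 then pair_series (as ! 0) (as ! 1) else 0)"
  proof (cases "g = 0 \<and> length as = 2")
    case True
    then obtain b c where "as = [b, c]" by (auto simp: length_Suc_conv numeral_2_eq_2)
    then show ?thesis using True by (simp add: unstable_series_def pair_series_def algebra_simps)
  next
    case False
    have "unstable_series g qs = 0" if "mset (a # qs) = mset as" for a qs
      using mset_pick_bounds(1)[OF that] st False by (auto simp: unstable_series_def)
    then have "pick_sum (\<lambda>a qs. omega02 a * unstable_series g qs) as = pick_sum (\<lambda>a qs. 0) as"
      "pick_sum (\<lambda>a qs. of_nat a * fps_X\<^sup>2 * fps_shift a (unstable_series g qs)) as = pick_sum (\<lambda>a qs. 0) as"
      by (intro pick_sum_cong refl; simp)+
    then show ?thesis using False by auto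
  qed
  have "omega g as = disc_root * stable_series K g as + 2 * fps_X * omega01 * stable_series K g as"
    unfolding os[OF order.refl] u0 omega01_eq by (simp add: algebra_simps)
  moreover have "(if g = 0 \<and> as = [] then fps_X else 0 :: complex fps) = 0" using st by auto
  ultimately show ?thesis unfolding stable_rec[OF st K] S P Q[symmetric] by (simp add: algebra_simps)
qed

lemma cumulant_0: "cumulant g (0 # as) = (if g = 0 \<and> as = [] then 1 else 0)"
proof -
  have c: "pick_sum (\<lambda>a qs. of_nat a * fps_X\<^sup>2 * fps_shift a (omega g qs)) as $ 1 = (0 :: complex)"
    by (simp add: fps_nth_pick_sum power2_eq_square mult.assoc mult.left_commute[of "of_nat _"])
  have z: "omega g as $ 0 = 0" for g as
    by (subst omega_rec) (simp add: fps_nth_pick_sum power2_eq_square mult.assoc mult.left_commute[of "of_nat _"])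
  have d: "diagonal_series g as $ 0 = 0" by (simp add: diagonal_series_def)
  have "omega g as $ 1 = (if g = 0 \<and> as = [] then 1 else 0)"
    by (subst omega_rec) (simp only: fps_add_nth c, simp add: d fps_sum_nth fps_nth_split_sum z)
  then show ?thesis by (simp add: cumulant_Cons)
qed

lemma omega_nth_0: "omega g as $ 0 = 0"
  by (subst omega_rec) (simp add: fps_nth_pick_sum power2_eq_square mult.assoc mult.left_commute[of "of_nat _"])

text \<open>
  The loop equation for coefficients. Combinatorially, one removes an edge from the first trace:
  it is joined to the same trace, which then splits, or to another trace, and the two merge.
\<close>

theorem cumulant_Suc:
  "cumulant g (Suc a # as) = (if a = 0 then 0 else
     \<Sum>i\<le>a-1. (if g = 0 then 0 else cumulant (g - 1) (i # (a - 1 - i) # as))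
        + (\<Sum>g1\<le>g. split_sum (\<lambda>u v. cumulant g1 (i # u) * cumulant (g - g1) ((a - 1 - i) # v)) as))
     + pick_sum (\<lambda>b qs. of_nat b * cumulant g ((a + b - 1) # qs)) as"
proof -
  have p: "(of_nat b * fps_X\<^sup>2 * fps_shift b (omega g qs)) $ (a + 2) = of_nat b * cumulant g ((a + b - 1) # qs)"
    if "mset (b # qs) = mset as" for b qs
  proof (cases "a + b = 0")
    case False
    then show ?thesis by (simp add: power2_eq_square mult.assoc fps_mult_of_nat_nth cumulant_Cons add.commute)
  qed (simp add: power2_eq_square mult.assoc)
  have "cumulant g (Suc a # as) = omega g as $ (a + 2)" by (simp add: cumulant_Cons)
  also have "\<dots> = diagonal_series g as $ (a + 1) + (\<Sum>g1\<le>g. split_sum (\<lambda>u v. (omega g1 u * omega (g - g1) v) $ (a + 1)) as)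
      + pick_sum (\<lambda>b qs. (of_nat b * fps_X\<^sup>2 * fps_shift b (omega g qs)) $ (a + 2)) as"
    by (subst omega_rec) (simp add: fps_sum_nth fps_nth_split_sum fps_nth_pick_sum)
  also have "pick_sum (\<lambda>b qs. (of_nat b * fps_X\<^sup>2 * fps_shift b (omega g qs)) $ (a + 2)) as
      = pick_sum (\<lambda>b qs. of_nat b * cumulant g ((a + b - 1) # qs)) as"
    by (intro pick_sum_cong refl p)
  also have "diagonal_series g as $ (a + 1) + (\<Sum>g1\<le>g. split_sum (\<lambda>u v. (omega g1 u * omega (g - g1) v) $ (a + 1)) as)
    = (if a = 0 then 0 else
     \<Sum>i\<le>a-1. (if g = 0 then 0 else cumulant (g - 1) (i # (a - 1 - i) # as))
        + (\<Sum>g1\<le>g. split_sum (\<lambda>u v. cumulant g1 (i # u) * cumulant (g - g1) ((a - 1 - i) # v)) as))"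
  proof (cases a)
    case 0
    then show ?thesis by (simp add: diagonal_series_def fps_mult_nth_no_const omega_nth_0)
  next
    case (Suc m)
    have "(\<Sum>g1\<le>g. split_sum (\<lambda>u v. (omega g1 u * omega (g - g1) v) $ (a + 1)) as)
       = (\<Sum>g1\<le>g. \<Sum>i\<le>m. split_sum (\<lambda>u v. cumulant g1 (i # u) * cumulant (g - g1) ((m - i) # v)) as)"
      unfolding fps_mult_nth_no_const[OF omega_nth_0 omega_nth_0] Suc cumulant_Cons by (simp add: split_sum_sum)
    also have "\<dots> = (\<Sum>i\<le>m. \<Sum>g1\<le>g. split_sum (\<lambda>u v. cumulant g1 (i # u) * cumulant (g - g1) ((m - i) # v)) as)"
      by (rule sum.swap)
    finally show ?thesis unfolding Suc by (simp add: diagonal_series_def sum.distrib)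
  qed
  finally show ?thesis .
qed

section \<open>Joint moments and their symmetry\<close>

lemma cumulant_Suc_less:
  "cumulant g (Suc a # as) = (\<Sum>i<a. (if g = 0 then 0 else cumulant (g - 1) (i # (a - 1 - i) # as))
        + (\<Sum>g1\<le>g. split_sum (\<lambda>u v. cumulant g1 (i # u) * cumulant (g - g1) ((a - 1 - i) # v)) as))
     + pick_sum (\<lambda>b qs. of_nat b * cumulant g ((a + b - 1) # qs)) as"
proof -
  have "a \<noteq> 0 \<Longrightarrow> {..a-1} = {..<a}" by auto
  then show ?thesis unfolding cumulant_Suc by auto
qed

text \<open>
  The sum over the genus. With t = \<open>\<hbar>\<^sup>2\<close>, a cumulant of n traces
  carries \<open>t\<^bsup>n-1\<^esup>\<close>, so that splitting, in either form, and merging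
  get uniform weights.
\<close>

definition cumulant_series :: "nat list \<Rightarrow> complex fps" where
  "cumulant_series as = fps_X ^ (length as - 1) * Abs_fps (\<lambda>g. cumulant g as)"

lemma cumulant_series_0: "cumulant_series (0 # as) = (if as = [] then 1 else 0)"
  by (rule fps_ext) (auto simp: cumulant_series_def cumulant_0 fps_X_power_mult_nth)

lemma cumulant_series_Suc:
  "cumulant_series (Suc a # as) = (\<Sum>i<a. cumulant_series (i # (a - 1 - i) # as)
        + split_sum (\<lambda>u v. cumulant_series (i # u) * cumulant_series ((a - 1 - i) # v)) as)
     + fps_X * pick_sum (\<lambda>b qs. of_nat b * cumulant_series ((a + b - 1) # qs)) as"
proof -
  let ?N = "\<lambda>as. Abs_fps (\<lambda>g. cumulant g as)"
  have N: "?N (Suc a # as) = (\<Sum>i<a. fps_X * ?N (i # (a - 1 - i) # as)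
        + split_sum (\<lambda>u v. ?N (i # u) * ?N ((a - 1 - i) # v)) as)
     + pick_sum (\<lambda>b qs. of_nat b * ?N ((a + b - 1) # qs)) as"
  proof (rule fps_ext)
    fix g
    have "(?N x * ?N y) $ g = (\<Sum>g1\<le>g. cumulant g1 x * cumulant (g - g1) y)" for x y
      by (simp add: fps_mult_nth atLeast0AtMost)
    then show "?N (Suc a # as) $ g = ((\<Sum>i<a. fps_X * ?N (i # (a - 1 - i) # as)
        + split_sum (\<lambda>u v. ?N (i # u) * ?N ((a - 1 - i) # v)) as)
     + pick_sum (\<lambda>b qs. of_nat b * ?N ((a + b - 1) # qs)) as) $ g"
      by (cases "g = 0") (simp_all add: cumulant_Suc_less fps_sum_nth fps_nth_split_sum fps_nth_pick_sum
          fps_mult_of_nat_nth split_sum_sum)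
  qed
  have s: "fps_X ^ length as * split_sum (\<lambda>u v. ?N (i # u) * ?N (k # v)) as
    = split_sum (\<lambda>u v. cumulant_series (i # u) * cumulant_series (k # v)) as" for i k
    unfolding split_sum_cmult[symmetric]
  proof (rule split_sum_cong[OF refl])
    fix u v assume "mset u + mset v = mset as"
    from mset_split_bounds(1)[OF this] have l: "length as = length u + length v" by simp
    show "fps_X ^ length as * (?N (i # u) * ?N (k # v)) = cumulant_series (i # u) * cumulant_series (k # v)"
      unfolding l by (simp add: cumulant_series_def power_add mult_ac)
  qed
  have p: "fps_X ^ length as * pick_sum (\<lambda>b qs. of_nat b * ?N ((a + b - 1) # qs)) as
    = fps_X * pick_sum (\<lambda>b qs. of_nat b * cumulant_series ((a + b - 1) # qs)) as"
    unfolding pick_sum_cmult[symmetric]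
  proof (rule pick_sum_cong[OF refl])
    fix b qs assume "mset (b # qs) = mset as"
    from mset_pick_bounds(1)[OF this] have l: "length as = length qs + 1" by simp
    show "fps_X ^ length as * (of_nat b * ?N ((a + b - 1) # qs)) = fps_X * (of_nat b * cumulant_series ((a + b - 1) # qs))"
      unfolding l by (simp add: cumulant_series_def mult_ac)
  qed
  have "cumulant_series (Suc a # as) = fps_X ^ length as * ?N (Suc a # as)" by (simp add: cumulant_series_def)
  also have "\<dots> = (\<Sum>i<a. fps_X ^ length as * (fps_X * ?N (i # (a - 1 - i) # as))
        + fps_X ^ length as * split_sum (\<lambda>u v. ?N (i # u) * ?N ((a - 1 - i) # v)) as)
     + fps_X ^ length as * pick_sum (\<lambda>b qs. of_nat b * ?N ((a + b - 1) # qs)) as"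
    unfolding N by (simp only: distrib_left sum_distrib_left)
  also have "\<dots> = (\<Sum>i<a. cumulant_series (i # (a - 1 - i) # as)
        + split_sum (\<lambda>u v. cumulant_series (i # u) * cumulant_series ((a - 1 - i) # v)) as)
     + fps_X * pick_sum (\<lambda>b qs. of_nat b * cumulant_series ((a + b - 1) # qs)) as"
    unfolding s p by (simp add: cumulant_series_def mult_ac)
  finally show ?thesis .
qed

text \<open>
  Moments from cumulants: the block that contains the first argument is singled out. Symmetry in
  the arguments is not visible from this definition.
\<close>

function joint_moment :: "nat list \<Rightarrow> complex fps" where
  "joint_moment [] = 1"
| "joint_moment (a # J) = split_sum (\<lambda>u v. cumulant_series (a # u) * joint_moment v) J"
  by pat_completeness auto
termination
proof (relation "Wellfounded.measure length", goal_cases)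
  case (2 a J u v)
  have "length v \<le> length J" using mset_split_bounds(1)[of u v J] 2 by simp
  then show ?case by simp
qed simp

lemmas [simp del] = joint_moment.simps(2)

lemma joint_moment_0: "joint_moment (0 # J) = joint_moment J"
proof -
  have "joint_moment (0 # J) = split_sum (\<lambda>u v. if u = [] then joint_moment v else 0) J"
    unfolding joint_moment.simps cumulant_series_0 by (intro split_sum_cong refl) auto
  then show ?thesis by (simp add: split_sum_Nil_left)
qed

text \<open>
  For moments the loop equation is linear: the two terms of splitting, connected or not, combine
  into one.
\<close>

lemma joint_moment_Suc:
  "joint_moment (Suc a # J) = (\<Sum>i<a. joint_moment (i # (a - 1 - i) # J))
     + fps_X * pick_sum (\<lambda>b r. of_nat b * joint_moment ((a + b - 1) # r)) J"
proof -
  have 1: "split_sum (\<lambda>u v. (\<Sum>i<a. cumulant_series (i # (a - 1 - i) # u)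
        + split_sum (\<lambda>u1 u2. cumulant_series (i # u1) * cumulant_series ((a - 1 - i) # u2)) u) * joint_moment v) J
      = (\<Sum>i<a. joint_moment (i # (a - 1 - i) # J))"
  proof -
    have "joint_moment (i # k # J) = split_sum (\<lambda>u v. cumulant_series (i # k # u) * joint_moment v) J
        + split_sum (\<lambda>u v. split_sum (\<lambda>u1 u2. cumulant_series (i # u1) * cumulant_series (k # u2)) u * joint_moment v) J" for i k
    proof -
      have "joint_moment (i # k # J) = split_sum (\<lambda>u v. cumulant_series (i # k # u) * joint_moment v) J
        + split_sum (\<lambda>u v. split_sum (\<lambda>v1 v2. cumulant_series (i # u) * (cumulant_series (k # v1) * joint_moment v2)) v) J"
        by (simp add: joint_moment.simps split_sum_cmult)
      also have "split_sum (\<lambda>u v. split_sum (\<lambda>v1 v2. cumulant_series (i # u) * (cumulant_series (k # v1) * joint_moment v2)) v) J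
        = split_sum (\<lambda>u v. split_sum (\<lambda>u1 u2. cumulant_series (i # u1) * cumulant_series (k # u2)) u * joint_moment v) J"
        unfolding split_sum_assoc[symmetric, where f = "\<lambda>u v1 v2. cumulant_series (i # u) * (cumulant_series (k # v1) * joint_moment v2)"]
        by (simp add: split_sum_cmult_right[symmetric] mult.assoc)
      finally show ?thesis .
    qed
    then show ?thesis by (simp add: sum_distrib_right split_sum_sum distrib_right split_sum_add)
  qed
  have 2: "split_sum (\<lambda>u v. fps_X * pick_sum (\<lambda>b qs. of_nat b * cumulant_series ((a + b - 1) # qs)) u * joint_moment v) J
    = fps_X * pick_sum (\<lambda>b r. of_nat b * joint_moment ((a + b - 1) # r)) J"
  proof -
    have "pick_sum (\<lambda>b qs. of_nat b * cumulant_series ((a + b - 1) # qs)) u * c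
        = pick_sum (\<lambda>b qs. of_nat b * cumulant_series ((a + b - 1) # qs) * c) u" for u and c :: "complex fps"
      by (simp add: pick_sum_cmult[symmetric] mult.commute[of _ c])
    then show ?thesis
      unfolding mult.assoc split_sum_cmult
      by (simp only: split_sum_pick_left[of "\<lambda>b qs v. of_nat b * (cumulant_series ((a + b - 1) # qs) * joint_moment v)"]
          mult.assoc split_sum_cmult joint_moment.simps)
  qed
  show ?thesis unfolding joint_moment.simps cumulant_series_Suc distrib_right split_sum_add 1 2 ..
qed

lemma pick_sum_eq_sum_mset:
  "pick_sum (\<lambda>y ys. F y (mset ys)) xs = (\<Sum>y\<in>#mset xs. F y (mset xs - {#y#}))"
proof (induction xs arbitrary: F)
  case (Cons x xs)
  have "pick_sum (\<lambda>y ys. F y (mset (x # ys))) xs = (\<Sum>y\<in>#mset xs. F y (add_mset x (mset xs - {#y#})))"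
    using Cons.IH[of "\<lambda>y M. F y (add_mset x M)"] by simp
  also have "\<dots> = (\<Sum>y\<in>#mset xs. F y (add_mset x (mset xs) - {#y#}))"
    by (intro arg_cong[where f = sum_mset] image_mset_cong) simp
  finally show ?case by simp
qed simp

text \<open>
  A sum over entries is a sum over a multiset as soon as the summand does not depend on the
  order of the remaining entries.
\<close>

lemma pick_sum_perm:
  assumes "mset xs = mset xs'"
    "\<And>y ys ys'. mset (y # ys) = mset xs \<Longrightarrow> mset ys = mset ys' \<Longrightarrow> f y ys = f y ys'"
  shows "pick_sum f xs = pick_sum f xs'"
proof -
  define F where "F = (\<lambda>y M. f y (SOME ys. mset ys = M))"
  have F: "f y ys = F y (mset ys)" if "mset (y # ys) = mset xs" for y ys
  proof -
    have "mset (SOME zs. mset zs = mset ys) = mset ys" by (rule someI) (rule refl)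
    then show ?thesis unfolding F_def by (intro assms(2)[OF that]) simp
  qed
  have "pick_sum f xs = pick_sum (\<lambda>y ys. F y (mset ys)) xs"
    by (rule pick_sum_cong_mset) (rule F)
  also have "\<dots> = pick_sum (\<lambda>y ys. F y (mset ys)) xs'"
    unfolding pick_sum_eq_sum_mset assms(1) ..
  also have "\<dots> = pick_sum f xs'"
    by (rule pick_sum_cong_mset, rule F[symmetric]) (simp only: assms(1))
  finally show ?thesis .
qed

lemma pick_sum_swap:
  "pick_sum (\<lambda>c r. pick_sum (\<lambda>d q. f c d q) r) xs = pick_sum (\<lambda>d r. pick_sum (\<lambda>c q. f c d q) r) xs"
proof (induction xs arbitrary: f)
  case (Cons x xs)
  show ?case using Cons.IH[of "\<lambda>c d q. f c d (x # q)"] by (simp add: pick_sum_add add_ac)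
qed simp

text \<open>
  The commutator of two loop equations. Reflecting \<open>p \<mapsto> N - p\<close> in one of
  the sums combines the two partial sums into a full one, and in a symmetric sequence the mean
  of p is N/2.
\<close>

lemma virasoro_sum:
  fixes s :: "nat \<Rightarrow> 'a::comm_ring_1"
  assumes N: "A + B = N + 2" and sym: "\<And>p. p \<le> N \<Longrightarrow> s p = s (N - p)"
  shows "(of_nat B - of_nat A) * (\<Sum>p\<le>N. s p) + 2 * (\<Sum>i<A. of_nat i * s (B + i - 1))
     - 2 * (\<Sum>i<B. of_nat i * s (A + i - 1)) = 0"
proof -
  have re: "(\<Sum>i<A. of_nat i * s (B + i - 1)) = (\<Sum>p\<le>N. of_nat (p + 1 - B) * s p)"
    if "A + B = N + 2" for A B
  proof -
    have "(\<Sum>i<A. of_nat i * s (B + i - 1)) = (\<Sum>i\<in>{1..<A}. of_nat i * s (B + i - 1))"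
      by (rule sum.mono_neutral_right) (auto simp: Suc_le_eq)
    also have "\<dots> = (\<Sum>p\<in>{p. p \<le> N \<and> B \<le> p}. of_nat (p + 1 - B) * s p)"
      by (rule sum.reindex_bij_witness[of _ "\<lambda>p. p + 1 - B" "\<lambda>i. B + i - 1"]) (use that in auto)
    also have "\<dots> = (\<Sum>p\<le>N. of_nat (p + 1 - B) * s p)"
    proof (rule sum.mono_neutral_left)
      show "\<forall>p\<in>{..N} - {p. p \<le> N \<and> B \<le> p}. of_nat (p + 1 - B) * s p = 0"
      proof
        fix p assume "p \<in> {..N} - {p. p \<le> N \<and> B \<le> p}"
        then have "p + 1 - B = 0" by auto
        then show "of_nat (p + 1 - B) * s p = 0" by (simp only: of_nat_0 mult_zero_left)
      qed
    qed auto
    finally show ?thesis .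
  qed
  have r: "(\<Sum>p\<le>N. f p * s p) = (\<Sum>p\<le>N. f (N - p) * s p)" for f :: "nat \<Rightarrow> 'a"
    by (rule sum.reindex_bij_witness[of _ "\<lambda>p. N - p" "\<lambda>p. N - p"]) (auto simp: sym[symmetric])
  have "(\<Sum>i<B. of_nat i * s (A + i - 1)) = (\<Sum>p\<le>N. of_nat (B - 1 - p) * s p)"
    unfolding re[OF N[unfolded add.commute[of A B]]] r[of "\<lambda>p. of_nat (p + 1 - A)"]
    by (intro sum.cong refl arg_cong[where f = "\<lambda>n. of_nat n * _"]) (use N in auto)
  moreover have "(\<Sum>p\<le>N. of_nat (p + 1 - B) * s p) - (\<Sum>p\<le>N. of_nat (B - 1 - p) * s p)
      = (\<Sum>p\<le>N. (of_nat p + 1 - of_nat B) * s p)"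
    unfolding sum_subtractf[symmetric] left_diff_distrib[symmetric]
  proof (intro sum.cong refl arg_cong[where f = "\<lambda>c. c * _"])
    fix p show "of_nat (p + 1 - B) - of_nat (B - 1 - p) = (of_nat p + 1 - of_nat B :: 'a)"
      by (cases "B \<le> p + 1") (auto simp: of_nat_diff)
  qed
  ultimately have H1: "(\<Sum>i<A. of_nat i * s (B + i - 1)) - (\<Sum>i<B. of_nat i * s (A + i - 1))
      = (\<Sum>p\<le>N. of_nat p * s p) + (1 - of_nat B) * (\<Sum>p\<le>N. s p)"
    unfolding re[OF N] by (simp add: algebra_simps sum.distrib sum_subtractf sum_distrib_left)
  have H2: "2 * (\<Sum>p\<le>N. of_nat p * s p) = of_nat N * (\<Sum>p\<le>N. s p)"
  proof -
    have "2 * (\<Sum>p\<le>N. of_nat p * s p) = (\<Sum>p\<le>N. of_nat p * s p) + (\<Sum>p\<le>N. of_nat (N - p) * s p)"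
      using r[of of_nat] by simp
    also have "\<dots> = of_nat N * (\<Sum>p\<le>N. s p)"
      unfolding sum.distrib[symmetric] sum_distrib_left
      by (intro sum.cong refl) (simp add: of_nat_diff algebra_simps)
    finally show ?thesis .
  qed
  have H3: "of_nat A + of_nat B = (of_nat N + 2 :: 'a)" using arg_cong[OF N, of "of_nat :: nat \<Rightarrow> 'a"]
    unfolding of_nat_add of_nat_numeral .
  have "2 * (\<Sum>i<A. of_nat i * s (B + i - 1)) - 2 * (\<Sum>i<B. of_nat i * s (A + i - 1))
      = 2 * (\<Sum>p\<le>N. of_nat p * s p) + 2 * (1 - of_nat B) * (\<Sum>p\<le>N. s p)"
    unfolding right_diff_distrib[symmetric] H1 by (simp only: distrib_left mult.assoc)
  also have "\<dots> = ((of_nat N + 2) - 2 * of_nat B) * (\<Sum>p\<le>N. s p)"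
    unfolding H2 by (simp add: algebra_simps)
  also have "\<dots> = - ((of_nat B - of_nat A) * (\<Sum>p\<le>N. s p))"
    unfolding H3[symmetric] by (simp add: algebra_simps)
  finally show ?thesis by (simp add: algebra_simps)
qed

text \<open>
  Apply the loop equation for the first trace and then, in each term, the one for the second
  trace. Symmetry for smaller arguments allows to move the second trace to the front.
\<close>

lemma joint_moment_Suc_Suc:
  assumes sym: "\<And>xs ys. sum_list xs + length xs < sum_list (Suc a # Suc b # J) + length (Suc a # Suc b # J) \<Longrightarrow>
      mset xs = mset ys \<Longrightarrow> joint_moment xs = joint_moment ys"
  shows "joint_moment (Suc a # Suc b # J) = (\<Sum>i<a. \<Sum>p<b. joint_moment (p # (b - 1 - p) # i # (a - 1 - i) # J))
     + fps_X * (2 * (\<Sum>i<a. of_nat i * joint_moment ((b + i - 1) # (a - 1 - i) # J)))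
     + fps_X * (\<Sum>i<a. pick_sum (\<lambda>c r. of_nat c * joint_moment ((b + c - 1) # i # (a - 1 - i) # r)) J)
     + fps_X * pick_sum (\<lambda>c r. of_nat c * (\<Sum>p<b. joint_moment ((a + c - 1) # p # (b - 1 - p) # r))) J
     + fps_X * (of_nat (Suc b) * joint_moment ((a + b) # J))
     + fps_X * (fps_X * pick_sum (\<lambda>c r. of_nat c * of_nat (a + c - 1) * joint_moment ((a + b + c - 2) # r)) J)
     + fps_X * (fps_X * pick_sum (\<lambda>c r. pick_sum (\<lambda>d q. of_nat c * of_nat d * joint_moment ((b + d - 1) # (a + c - 1) # q)) r) J)"
proof -
  have e1: "joint_moment (i # (a - 1 - i) # Suc b # J) = (\<Sum>p<b. joint_moment (p # (b - 1 - p) # i # (a - 1 - i) # J))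
      + fps_X * (of_nat i * joint_moment ((b + i - 1) # (a - 1 - i) # J) + of_nat (a - 1 - i) * joint_moment ((b + (a - 1 - i) - 1) # i # J))
      + fps_X * pick_sum (\<lambda>c r. of_nat c * joint_moment ((b + c - 1) # i # (a - 1 - i) # r)) J" if "i < a" for i
  proof -
    have "joint_moment (i # (a - 1 - i) # Suc b # J) = joint_moment (Suc b # i # (a - 1 - i) # J)"
      by (rule sym) (use that in auto)
    then show ?thesis unfolding joint_moment_Suc by (simp add: algebra_simps)
  qed
  have e2: "of_nat c * joint_moment ((a + c - 1) # Suc b # r) = of_nat c * (\<Sum>p<b. joint_moment ((a + c - 1) # p # (b - 1 - p) # r))
     + fps_X * (of_nat c * of_nat (a + c - 1) * joint_moment ((a + b + c - 2) # r))
     + fps_X * pick_sum (\<lambda>d q. of_nat c * of_nat d * joint_moment ((b + d - 1) # (a + c - 1) # q)) r"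
    if J: "mset (c # r) = mset J" for c r
  proof (cases "c = 0")
    case False
    have l: "length J = Suc (length r)" "sum_list J = c + sum_list r"
      using mset_pick_bounds(1)[OF J] sum_list_pick[OF J] by auto
    have "joint_moment ((a + c - 1) # Suc b # r) = joint_moment (Suc b # (a + c - 1) # r)"
      by (rule sym) (use l False in auto)
    also have "\<dots> = (\<Sum>p<b. joint_moment (p # (b - 1 - p) # (a + c - 1) # r))
       + fps_X * (of_nat (a + c - 1) * joint_moment ((b + (a + c - 1) - 1) # r))
       + fps_X * pick_sum (\<lambda>d q. of_nat d * joint_moment ((b + d - 1) # (a + c - 1) # q)) r"
      unfolding joint_moment_Suc by (simp add: algebra_simps)
    also have "(\<Sum>p<b. joint_moment (p # (b - 1 - p) # (a + c - 1) # r)) = (\<Sum>p<b. joint_moment ((a + c - 1) # p # (b - 1 - p) # r))"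
      by (intro sum.cong refl sym) (use l False in auto)
    also have "b + (a + c - 1) - 1 = a + b + c - 2" using False by simp
    finally show ?thesis by (simp add: algebra_simps pick_sum_cmult[symmetric])
  qed simp
  have "(\<Sum>i<a. of_nat (a - 1 - i) * joint_moment ((b + (a - 1 - i) - 1) # i # J))
      = (\<Sum>i<a. of_nat i * joint_moment ((b + i - 1) # (a - 1 - i) # J))"
    by (rule sum.reindex_bij_witness[of _ "\<lambda>i. a - 1 - i" "\<lambda>i. a - 1 - i"]) auto
  note half = this
  have "(\<Sum>i<a. joint_moment (i # (a - 1 - i) # Suc b # J)) = (\<Sum>i<a. (\<Sum>p<b. joint_moment (p # (b - 1 - p) # i # (a - 1 - i) # J))
      + fps_X * (of_nat i * joint_moment ((b + i - 1) # (a - 1 - i) # J) + of_nat (a - 1 - i) * joint_moment ((b + (a - 1 - i) - 1) # i # J))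
      + fps_X * pick_sum (\<lambda>c r. of_nat c * joint_moment ((b + c - 1) # i # (a - 1 - i) # r)) J)"
    by (intro sum.cong refl e1) simp
  then have s1: "(\<Sum>i<a. joint_moment (i # (a - 1 - i) # Suc b # J)) = (\<Sum>i<a. \<Sum>p<b. joint_moment (p # (b - 1 - p) # i # (a - 1 - i) # J))
     + fps_X * (2 * (\<Sum>i<a. of_nat i * joint_moment ((b + i - 1) # (a - 1 - i) # J)))
     + fps_X * (\<Sum>i<a. pick_sum (\<lambda>c r. of_nat c * joint_moment ((b + c - 1) # i # (a - 1 - i) # r)) J)"
    unfolding sum.distrib sum_distrib_left[symmetric] half by (simp only: mult_2)
  have s2: "pick_sum (\<lambda>c r. of_nat c * joint_moment ((a + c - 1) # Suc b # r)) J
    = pick_sum (\<lambda>c r. of_nat c * (\<Sum>p<b. joint_moment ((a + c - 1) # p # (b - 1 - p) # r))) J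
     + fps_X * pick_sum (\<lambda>c r. of_nat c * of_nat (a + c - 1) * joint_moment ((a + b + c - 2) # r)) J
     + fps_X * pick_sum (\<lambda>c r. pick_sum (\<lambda>d q. of_nat c * of_nat d * joint_moment ((b + d - 1) # (a + c - 1) # q)) r) J"
    unfolding pick_sum_cmult[symmetric] pick_sum_add[symmetric]
    by (rule pick_sum_cong[OF refl]) (simp only: e2 pick_sum_cmult[symmetric])
  have "joint_moment (Suc a # Suc b # J) = (\<Sum>i<a. joint_moment (i # (a - 1 - i) # Suc b # J))
      + fps_X * (of_nat (Suc b) * joint_moment ((a + b) # J)
      + pick_sum (\<lambda>c r. of_nat c * joint_moment ((a + c - 1) # Suc b # r)) J)"
    unfolding joint_moment_Suc[of a] by simp
  then show ?thesis unfolding s1 s2 by (simp only: distrib_left add_ac)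
qed

text \<open>
  In the expansion most terms are symmetric. The others come from operations that involve both
  traces, and cancel by \<open>virasoro_sum\<close> once the loop equation has been applied to
  the merged trace.
\<close>

lemma joint_moment_swap:
  assumes sym: "\<And>xs ys. sum_list xs + length xs < sum_list (a # b # J) + length (a # b # J) \<Longrightarrow>
      mset xs = mset ys \<Longrightarrow> joint_moment xs = joint_moment ys"
  shows "joint_moment (a # b # J) = joint_moment (b # a # J)"
proof -
  have z: "joint_moment (b # 0 # J) = joint_moment (b # J)"
    if sym: "\<And>xs ys. sum_list xs + length xs < b + 2 + sum_list J + length J \<Longrightarrow>
      mset xs = mset ys \<Longrightarrow> joint_moment xs = joint_moment ys" for b
  proof (cases b)
    case (Suc b')
    have "joint_moment (i # (b' - 1 - i) # 0 # J) = joint_moment (i # (b' - 1 - i) # J)" if "i < b'" for i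
    proof -
      have "joint_moment (i # (b' - 1 - i) # 0 # J) = joint_moment (0 # i # (b' - 1 - i) # J)"
        by (rule sym) (use that Suc in auto)
      then show ?thesis by (simp add: joint_moment_0)
    qed
    moreover have "pick_sum (\<lambda>c r. of_nat c * joint_moment ((b' + c - 1) # 0 # r)) J
        = pick_sum (\<lambda>c r. of_nat c * joint_moment ((b' + c - 1) # r)) J"
    proof (rule pick_sum_cong[OF refl])
      fix c r assume J: "mset (c # r) = mset J"
      have l: "length J = Suc (length r)" "sum_list J = c + sum_list r"
        using mset_pick_bounds(1)[OF J] sum_list_pick[OF J] by auto
      have "joint_moment ((b' + c - 1) # 0 # r) = joint_moment (0 # (b' + c - 1) # r)"
        by (rule sym) (use l Suc in auto)
      then show "of_nat c * joint_moment ((b' + c - 1) # 0 # r) = of_nat c * joint_moment ((b' + c - 1) # r)"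
        by (simp add: joint_moment_0)
    qed
    ultimately show ?thesis unfolding Suc joint_moment_Suc by simp
  qed (simp add: joint_moment_0)
  consider "a = 0" | "b = 0" | a' b' where "a = Suc a'" "b = Suc b'" by (metis not0_implies_Suc)
  then show ?thesis
  proof cases
    case 1
    then show ?thesis using z[of b] sym by (simp add: joint_moment_0)
  next
    case 2
    then show ?thesis using z[of a] sym by (simp add: joint_moment_0)
  next
    case (3 a b)
    note sym' = sym[unfolded 3]
    have sw: "sum_list (Suc b # Suc a # J) + length (Suc b # Suc a # J)
      = sum_list (Suc a # Suc b # J) + length (Suc a # Suc b # J)" by simp
    have E: "joint_moment (Suc b # Suc a # J) = (\<Sum>i<b. \<Sum>p<a. joint_moment (p # (a - 1 - p) # i # (b - 1 - i) # J))
     + fps_X * (2 * (\<Sum>i<b. of_nat i * joint_moment ((a + i - 1) # (b - 1 - i) # J)))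
     + fps_X * (\<Sum>i<b. pick_sum (\<lambda>c r. of_nat c * joint_moment ((a + c - 1) # i # (b - 1 - i) # r)) J)
     + fps_X * pick_sum (\<lambda>c r. of_nat c * (\<Sum>p<a. joint_moment ((b + c - 1) # p # (a - 1 - p) # r))) J
     + fps_X * (of_nat (Suc a) * joint_moment ((b + a) # J))
     + fps_X * (fps_X * pick_sum (\<lambda>c r. of_nat c * of_nat (b + c - 1) * joint_moment ((b + a + c - 2) # r)) J)
     + fps_X * (fps_X * pick_sum (\<lambda>c r. pick_sum (\<lambda>d q. of_nat c * of_nat d * joint_moment ((a + d - 1) # (b + c - 1) # q)) r) J)"
      by (rule joint_moment_Suc_Suc, rule sym'[folded sw])
    have q1: "(\<Sum>i<b. \<Sum>p<a. joint_moment (p # (a - 1 - p) # i # (b - 1 - i) # J))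
      = (\<Sum>i<a. \<Sum>p<b. joint_moment (p # (b - 1 - p) # i # (a - 1 - i) # J))"
      by (subst sum.swap, intro sum.cong refl sym') auto
    have q2: "(\<Sum>i<b. pick_sum (\<lambda>c r. of_nat c * joint_moment ((a + c - 1) # i # (b - 1 - i) # r)) J)
      = pick_sum (\<lambda>c r. of_nat c * (\<Sum>p<b. joint_moment ((a + c - 1) # p # (b - 1 - p) # r))) J" for a b
      unfolding pick_sum_sum[symmetric] by (simp add: sum_distrib_left)
    have q3: "pick_sum (\<lambda>c r. pick_sum (\<lambda>d q. of_nat c * of_nat d * joint_moment ((a + d - 1) # (b + c - 1) # q)) r) J
      = pick_sum (\<lambda>c r. pick_sum (\<lambda>d q. of_nat c * of_nat d * joint_moment ((b + d - 1) # (a + c - 1) # q)) r) J"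
    proof (subst pick_sum_swap, rule pick_sum_cong[OF refl], rule pick_sum_cong[OF refl])
      fix c r d q assume J: "mset (c # r) = mset J" "mset (d # q) = mset r"
      have l: "length J = Suc (length r)" "sum_list J = c + sum_list r" "length r = Suc (length q)" "sum_list r = d + sum_list q"
        using mset_pick_bounds(1)[OF J(1)] sum_list_pick[OF J(1)] mset_pick_bounds(1)[OF J(2)] sum_list_pick[OF J(2)] by auto
      have "joint_moment ((a + c - 1) # (b + d - 1) # q) = joint_moment ((b + d - 1) # (a + c - 1) # q)"
        by (rule sym') (use l in auto)
      then show "of_nat d * of_nat c * joint_moment ((a + c - 1) # (b + d - 1) # q) = of_nat c * of_nat d * joint_moment ((b + d - 1) # (a + c - 1) # q)"
        by simp
    qed
    let ?P = "pick_sum (\<lambda>c r. of_nat c * joint_moment ((a + b + c - 2) # r)) J"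
    have q4: "pick_sum (\<lambda>c r. of_nat c * of_nat (a + c - 1) * joint_moment ((a + b + c - 2) # r)) J
      - pick_sum (\<lambda>c r. of_nat c * of_nat (b + c - 1) * joint_moment ((a + b + c - 2) # r)) J = (of_nat a - of_nat b) * ?P"
    proof -
      have "of_nat c * of_nat (a + c - 1) * x = (of_nat a - of_nat b) * (of_nat c * x) + of_nat c * of_nat (b + c - 1) * x"
        for c and x :: "complex fps"
        by (cases c) (simp_all add: algebra_simps)
      then show ?thesis by (simp add: pick_sum_add pick_sum_cmult)
    qed
    have q5: "(of_nat b - of_nat a) * joint_moment ((a + b) # J) + 2 * (\<Sum>i<a. of_nat i * joint_moment ((b + i - 1) # (a - 1 - i) # J))
        - 2 * (\<Sum>i<b. of_nat i * joint_moment ((a + i - 1) # (b - 1 - i) # J)) = (of_nat b - of_nat a) * (fps_X * ?P)"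
    proof (cases "a + b \<ge> 2")
      case True
      define N where "N = a + b - 2"
      have N: "a + b = N + 2" using True by (simp add: N_def)
      have "joint_moment ((a + b) # J) = joint_moment (Suc (N + 1) # J)" by (simp add: N)
      also have "\<dots> = (\<Sum>p\<le>N. joint_moment (p # (N - p) # J)) + fps_X * pick_sum (\<lambda>c r. of_nat c * joint_moment ((N + 1 + c - 1) # r)) J"
        unfolding joint_moment_Suc by (simp add: lessThan_Suc_atMost)
      also have "pick_sum (\<lambda>c r. of_nat c * joint_moment ((N + 1 + c - 1) # r)) J = ?P" using N by simp
      finally have M: "joint_moment ((a + b) # J) = (\<Sum>p\<le>N. joint_moment (p # (N - p) # J)) + fps_X * ?P" .
      have "(\<Sum>i<a. of_nat i * joint_moment ((b + i - 1) # (a - 1 - i) # J)) = (\<Sum>i<a. of_nat i * joint_moment ((b + i - 1) # (N - (b + i - 1)) # J))"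
      proof (intro sum.cong refl)
        fix i assume "i \<in> {..<a}"
        then have "i = 0 \<or> a - 1 - i = N - (b + i - 1)" using N by auto
        then show "of_nat i * joint_moment ((b + i - 1) # (a - 1 - i) # J) = of_nat i * joint_moment ((b + i - 1) # (N - (b + i - 1)) # J)" by auto
      qed
      moreover have "(\<Sum>i<b. of_nat i * joint_moment ((a + i - 1) # (b - 1 - i) # J)) = (\<Sum>i<b. of_nat i * joint_moment ((a + i - 1) # (N - (a + i - 1)) # J))"
      proof (intro sum.cong refl)
        fix i assume "i \<in> {..<b}"
        then have "i = 0 \<or> b - 1 - i = N - (a + i - 1)" using N by auto
        then show "of_nat i * joint_moment ((a + i - 1) # (b - 1 - i) # J) = of_nat i * joint_moment ((a + i - 1) # (N - (a + i - 1)) # J)" by auto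
      qed
      moreover have "joint_moment (p # (N - p) # J) = joint_moment ((N - p) # (N - (N - p)) # J)" if "p \<le> N" for p
        by (rule sym') (use that N in auto)
      ultimately show ?thesis
        using virasoro_sum[OF N, of "\<lambda>p. joint_moment (p # (N - p) # J)"] unfolding M by (simp add: algebra_simps)
    next
      case False
      then consider "a = 0" "b = 0" | "a = 1" "b = 0" | "a = 0" "b = 1" by linarith
      then show ?thesis by cases (simp_all add: joint_moment_Suc[of 0, simplified])
    qed
    have E1: "joint_moment (Suc a # Suc b # J) = (\<Sum>i<a. \<Sum>p<b. joint_moment (p # (b - 1 - p) # i # (a - 1 - i) # J))
     + fps_X * (2 * (\<Sum>i<a. of_nat i * joint_moment ((b + i - 1) # (a - 1 - i) # J)))
     + fps_X * (\<Sum>i<a. pick_sum (\<lambda>c r. of_nat c * joint_moment ((b + c - 1) # i # (a - 1 - i) # r)) J)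
     + fps_X * pick_sum (\<lambda>c r. of_nat c * (\<Sum>p<b. joint_moment ((a + c - 1) # p # (b - 1 - p) # r))) J
     + fps_X * (of_nat (Suc b) * joint_moment ((a + b) # J))
     + fps_X * (fps_X * pick_sum (\<lambda>c r. of_nat c * of_nat (a + c - 1) * joint_moment ((a + b + c - 2) # r)) J)
     + fps_X * (fps_X * pick_sum (\<lambda>c r. pick_sum (\<lambda>d q. of_nat c * of_nat d * joint_moment ((b + d - 1) # (a + c - 1) # q)) r) J)"
      by (rule joint_moment_Suc_Suc, rule sym')
    have ring: "(P + X * (2 * s) + X * q + X * r + X * (of_nat (Suc b) * m) + X * (X * u) + X * (X * w))
      - (P + X * (2 * t) + X * r + X * q + X * (of_nat (Suc a) * m) + X * (X * u') + X * (X * w))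
      = X * ((of_nat b - of_nat a) * m + 2 * s - 2 * t) + X * (X * (u - u'))"
      for P X s q r m u w t u' :: "complex fps"
      by (simp add: algebra_simps)
    have "joint_moment (Suc a # Suc b # J) - joint_moment (Suc b # Suc a # J) = fps_X * ((of_nat b - of_nat a) * joint_moment ((a + b) # J)
      + 2 * (\<Sum>i<a. of_nat i * joint_moment ((b + i - 1) # (a - 1 - i) # J)) - 2 * (\<Sum>i<b. of_nat i * joint_moment ((a + i - 1) # (b - 1 - i) # J)))
      + fps_X * (fps_X * (pick_sum (\<lambda>c r. of_nat c * of_nat (a + c - 1) * joint_moment ((a + b + c - 2) # r)) J
      - pick_sum (\<lambda>c r. of_nat c * of_nat (b + c - 1) * joint_moment ((a + b + c - 2) # r)) J))"
      unfolding E1 E q1 q2 q3 add.commute[of b a] by (rule ring)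
    also have "\<dots> = 0" unfolding q4 q5 by (simp add: algebra_simps)
    finally show ?thesis unfolding 3 by simp
  qed
qed

text \<open>
  The loop equations for different traces must be compatible: this is the commutation relation
  of the Virasoro constraints. By induction on the total order it suffices to exchange the first
  two arguments.
\<close>

theorem joint_moment_perm: "mset xs = mset ys \<Longrightarrow> joint_moment xs = joint_moment ys"
proof (induction "sum_list xs + length xs" arbitrary: xs ys rule: less_induct)
  case less
  \<comment> \<open>after one loop equation, a permutation behind the first argument only affects smaller moments\<close>
  have tail: "joint_moment (a # J) = joint_moment (a # J')"
    if J: "mset J = mset J'" and m: "sum_list (a # J) + length (a # J) = sum_list xs + length xs" for a J J'
  proof (cases a)
    case 0
    show ?thesis unfolding 0 joint_moment_0 by (rule less.hyps) (use m J in auto)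
  next
    case (Suc a')
    have "joint_moment (i # (a' - 1 - i) # J) = joint_moment (i # (a' - 1 - i) # J')" if "i < a'" for i
      by (rule less.hyps) (use that m J Suc in auto)
    moreover have "pick_sum (\<lambda>b r. of_nat b * joint_moment ((a' + b - 1) # r)) J = pick_sum (\<lambda>b r. of_nat b * joint_moment ((a' + b - 1) # r)) J'"
    proof (rule pick_sum_perm[OF J])
      fix y r r' assume p: "mset (y # r) = mset J" "mset r = mset r'"
      have l: "length J = Suc (length r)" "sum_list J = y + sum_list r"
        using mset_pick_bounds(1)[OF p(1)] sum_list_pick[OF p(1)] by auto
      have "joint_moment ((a' + y - 1) # r) = joint_moment ((a' + y - 1) # r')"
        by (rule less.hyps) (use l m p Suc in auto)
      then show "of_nat y * joint_moment ((a' + y - 1) # r) = of_nat y * joint_moment ((a' + y - 1) # r')" by simp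
    qed
    ultimately show ?thesis unfolding Suc joint_moment_Suc by simp
  qed
  show ?case
  proof (cases xs)
    case Nil
    then show ?thesis using less.prems by simp
  next
    case (Cons a J)
    then obtain b J' where ys: "ys = b # J'" using less.prems by (cases ys) auto
    have meas: "sum_list zs + length zs = sum_list xs + length xs" if "mset zs = mset xs" for zs
      using that by (metis size_mset sum_mset_sum_list)
    show ?thesis
    proof (cases "a = b")
      case True
      then show ?thesis using tail[of J J' a] less.prems Cons ys by simp
    next
      case False
      then have "b \<in># mset J" "a \<in># mset J'" using less.prems Cons ys
        by (metis insert_noteq_member mset.simps(2))+
      then obtain M where M: "mset J = add_mset b M" by (metis multi_member_split)
      obtain K where K: "mset K = M" using ex_mset by blast
      have J: "mset J = mset (b # K)" using M K by simp
      have J': "mset (a # K) = mset J'" using less.prems J unfolding Cons ys by simp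
      have "joint_moment (a # J) = joint_moment (a # b # K)" by (rule tail[OF J]) (use Cons in simp)
      also have "\<dots> = joint_moment (b # a # K)"
      proof (rule joint_moment_swap)
        fix us vs :: "nat list" assume "sum_list us + length us < sum_list (a # b # K) + length (a # b # K)" "mset us = mset vs"
        moreover have "sum_list (a # b # K) + length (a # b # K) = sum_list xs + length xs"
          by (rule meas) (use Cons J in simp)
        ultimately show "joint_moment us = joint_moment vs" using less.hyps by simp
      qed
      also have "\<dots> = joint_moment (b # J')"
        by (rule tail[OF J']) (rule meas, use Cons J in simp)
      finally show ?thesis unfolding Cons ys .
    qed
  qed
qed

section \<open>The Harer-Zagier recursion\<close>

definition triples :: "nat \<Rightarrow> (nat \<times> nat \<times> nat) set" where
  "triples n = {(i, k, b). i + k + b = n}"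

lemma sum_triples: "sum f (triples n) = (\<Sum>b\<le>n. \<Sum>i\<le>n-b. f (i, n - b - i, b))"
proof -
  have "(\<Sum>b\<le>n. \<Sum>i\<le>n-b. f (i, n - b - i, b)) = (\<Sum>(b, i)\<in>(SIGMA b:{..n}. {..n-b}). f (i, n - b - i, b))"
    by (simp add: sum.Sigma)
  also have "\<dots> = sum f (triples n)"
    by (rule sum.reindex_bij_witness[of _ "\<lambda>(i, k, b). (b, i)" "\<lambda>(b, i). (i, n - b - i, b)"])
      (auto simp: triples_def)
  finally show ?thesis by simp
qed

lemma sum_of_nat_lessThan: "2 * (\<Sum>b<n. of_nat b :: 'a::comm_ring_1) = of_nat n * (of_nat n - 1)"
  by (induction n) (auto simp: algebra_simps)

lemma sum_squares_lessThan:
  "6 * (\<Sum>b<n. of_nat b * of_nat b :: 'a::comm_ring_1) = of_nat n * (of_nat n - 1) * (2 * of_nat n - 1)"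
  by (induction n) (auto simp: algebra_simps)

abbreviation single_moment :: "nat \<Rightarrow> complex fps" where "single_moment n \<equiv> joint_moment [n]"

definition pair_sum :: "nat \<Rightarrow> complex fps" where "pair_sum n = (\<Sum>b\<le>n. joint_moment [n - b, b])"

definition triple_sum :: "nat \<Rightarrow> complex fps" where
  "triple_sum n = (\<Sum>(i, k, b)\<in>triples n. joint_moment [i, k, b])"

lemma single_moment_rec: "single_moment (n + 2) = pair_sum n"
proof -
  have "single_moment (Suc (n + 1)) = (\<Sum>i<n+1. joint_moment [i, n - i])" unfolding joint_moment_Suc by simp
  also have "\<dots> = pair_sum n" unfolding pair_sum_def
    by (rule sum.reindex_bij_witness[of _ "\<lambda>i. n - i" "\<lambda>i. n - i"]) auto
  finally show ?thesis by simp
qed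

text \<open>
  The loop equation for the first argument, summed with weights in the second one.
\<close>

lemma pair_sum_weighted:
  fixes w :: "nat \<Rightarrow> complex fps"
  shows "(\<Sum>b\<le>N+2. w b * joint_moment [N + 2 - b, b]) = w (N + 2) * single_moment (N + 2)
    + (\<Sum>(i, k, b)\<in>triples N. w b * joint_moment [i, k, b])
    + fps_X * (\<Sum>b<N+2. w b * of_nat b) * single_moment N"
proof -
  have "joint_moment [N + 2 - b, b] = (\<Sum>i<N+1-b. joint_moment [i, N - b - i, b]) + fps_X * (of_nat b * single_moment N)" if "b < N + 2" for b
  proof -
    have "N + 2 - b = Suc (N + 1 - b)" using that by simp
    moreover have "N + 1 - b + b - 1 = N" using that by simp
    moreover have "N + 1 - b - 1 - i = N - b - i" for i by simp
    ultimately show ?thesis unfolding joint_moment_Suc[of "N + 1 - b"] by (simp only: joint_moment_Suc) simp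
  qed
  then have "(\<Sum>b<N+2. w b * joint_moment [N + 2 - b, b])
      = (\<Sum>b<N+2. w b * (\<Sum>i<N+1-b. joint_moment [i, N - b - i, b])) + fps_X * (\<Sum>b<N+2. w b * of_nat b) * single_moment N"
    by (simp add: sum.distrib sum_distrib_left sum_distrib_right algebra_simps)
  also have "(\<Sum>b<N+2. w b * (\<Sum>i<N+1-b. joint_moment [i, N - b - i, b])) = (\<Sum>b\<le>N. w b * (\<Sum>i\<le>N-b. joint_moment [i, N - b - i, b]))"
  proof -
    have "{..<N+1-b} = {..N-b}" if "b \<in> {..N}" for b using that by auto
    moreover have "{..<N+2} = insert (N + 1) {..N}" by auto
    ultimately show ?thesis by simp
  qed
  also have "\<dots> = (\<Sum>(i, k, b)\<in>triples N. w b * joint_moment [i, k, b])"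
    unfolding sum_triples by (simp add: sum_distrib_left)
  finally have E: "(\<Sum>b<N+2. w b * joint_moment [N + 2 - b, b]) = (\<Sum>(i, k, b)\<in>triples N. w b * joint_moment [i, k, b])
      + fps_X * (\<Sum>b<N+2. w b * of_nat b) * single_moment N" .
  have "(\<Sum>b\<le>N+2. w b * joint_moment [N + 2 - b, b]) = (\<Sum>b<N+2. w b * joint_moment [N + 2 - b, b]) + w (N + 2) * joint_moment [0, N + 2]"
    by (simp add: lessThan_Suc_atMost[symmetric])
  then show ?thesis unfolding E by (simp add: joint_moment_0)
qed

lemma pair_sum_symmetric: "2 * (\<Sum>b\<le>n. of_nat b * joint_moment [n - b, b]) = of_nat n * pair_sum n"
proof -
  have "(\<Sum>b\<le>n. of_nat b * joint_moment [n - b, b]) = (\<Sum>b\<le>n. of_nat (n - b) * joint_moment [n - b, b])"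
  proof (rule sum.reindex_bij_witness[of _ "\<lambda>i. n - i" "\<lambda>i. n - i"])
    fix b assume b: "b \<in> {..n}"
    have "joint_moment [n - (n - b), n - b] = joint_moment [n - b, b]" by (rule joint_moment_perm) (use b in auto)
    then show "of_nat (n - (n - b)) * joint_moment [n - (n - b), n - b] = of_nat b * joint_moment [n - b, b]"
      using b by simp
  qed auto
  then have "2 * (\<Sum>b\<le>n. of_nat b * joint_moment [n - b, b]) = (\<Sum>b\<le>n. of_nat b * joint_moment [n - b, b]) + (\<Sum>b\<le>n. of_nat (n - b) * joint_moment [n - b, b])"
    by simp
  also have "\<dots> = of_nat n * pair_sum n"
    unfolding sum.distrib[symmetric] pair_sum_def sum_distrib_left
    by (intro sum.cong refl) (simp add: of_nat_diff algebra_simps)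
  finally show ?thesis .
qed

lemma triple_sum_symmetric: "3 * (\<Sum>(i, k, b)\<in>triples n. of_nat b * joint_moment [i, k, b]) = of_nat n * triple_sum n"
proof -
  have 1: "(\<Sum>(i, k, b)\<in>triples n. of_nat b * joint_moment [i, k, b]) = (\<Sum>(i, k, b)\<in>triples n. of_nat i * joint_moment [i, k, b])"
    by (rule sum.reindex_bij_witness[of _ "\<lambda>(i, k, b). (b, k, i)" "\<lambda>(i, k, b). (b, k, i)"])
      (auto simp: triples_def intro!: arg_cong[where f = "(*) _"] joint_moment_perm)
  have 2: "(\<Sum>(i, k, b)\<in>triples n. of_nat b * joint_moment [i, k, b]) = (\<Sum>(i, k, b)\<in>triples n. of_nat k * joint_moment [i, k, b])"
    by (rule sum.reindex_bij_witness[of _ "\<lambda>(i, k, b). (i, b, k)" "\<lambda>(i, k, b). (i, b, k)"])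
      (auto simp: triples_def intro!: arg_cong[where f = "(*) _"] joint_moment_perm)
  have "3 * (\<Sum>(i, k, b)\<in>triples n. of_nat b * joint_moment [i, k, b])
     = (\<Sum>(i, k, b)\<in>triples n. of_nat i * joint_moment [i, k, b]) + (\<Sum>(i, k, b)\<in>triples n. of_nat k * joint_moment [i, k, b])
       + (\<Sum>(i, k, b)\<in>triples n. of_nat b * joint_moment [i, k, b])"
    unfolding 1[symmetric] 2[symmetric] by simp
  also have "\<dots> = (\<Sum>(i, k, b)\<in>triples n. of_nat (i + k + b) * joint_moment [i, k, b])"
    by (simp add: sum.distrib[symmetric] split_def distrib_right)
  also have "\<dots> = of_nat n * triple_sum n"
    unfolding triple_sum_def sum_distrib_left by (intro sum.cong refl) (auto simp: triples_def)
  finally show ?thesis .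
qed

text \<open>
  Take the weights 1 and b in \<open>pair_sum_weighted\<close>. By symmetry, b may be replaced
  by its mean, n/2 for pairs and N/3 for triples. So both equations involve the same sum over
  triples, which can be eliminated.
\<close>

theorem harer_zagier:
  "(of_nat N + 6) * single_moment (N + 4) = 4 * (of_nat N + 3) * single_moment (N + 2)
     + fps_X * (of_nat N + 3) * (of_nat N + 2) * (of_nat N + 1) * single_moment N"
proof -
  have A: "pair_sum (N + 2) = single_moment (N + 2) + triple_sum N + fps_X * (\<Sum>b<N+2. of_nat b) * single_moment N"
    using pair_sum_weighted[of "\<lambda>b. 1" N] by (simp add: pair_sum_def triple_sum_def)
  let ?B = "\<Sum>(i, k, b)\<in>triples N. of_nat b * joint_moment [i, k, b]"
  have B: "of_nat (N + 2) * pair_sum (N + 2) = 2 * (of_nat (N + 2) * single_moment (N + 2) + ?B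
     + fps_X * (\<Sum>b<N+2. of_nat b * of_nat b) * single_moment N)"
    using pair_sum_weighted[of of_nat N] pair_sum_symmetric[of "N + 2"] by simp
  have s1: "2 * (\<Sum>b<N+2. of_nat b) = (of_nat N + 2) * (of_nat N + 1 :: complex fps)"
    unfolding sum_of_nat_lessThan by (simp add: algebra_simps)
  have s2: "6 * (\<Sum>b<N+2. of_nat b * of_nat b) = (of_nat N + 2) * (of_nat N + 1) * (2 * of_nat N + 3 :: complex fps)"
    unfolding sum_squares_lessThan by (simp add: algebra_simps)
  define n where "n = (of_nat N :: complex fps)"
  have "(n + 6) * pair_sum (N + 2) = 4 * (n + 3) * single_moment (N + 2) + fps_X * (n + 3) * (n + 2) * (n + 1) * single_moment N"
  proof -
    have B': "3 * ((n + 2) * pair_sum (N + 2)) = 6 * ((n + 2) * single_moment (N + 2)) + 2 * (3 * ?B)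
      + fps_X * (6 * (\<Sum>b<N+2. of_nat b * of_nat b)) * single_moment N"
      using arg_cong[OF B, of "\<lambda>x. 3 * x"] by (simp add: n_def algebra_simps)
    have A': "2 * n * triple_sum N = 2 * n * (pair_sum (N + 2) - single_moment (N + 2)) - n * fps_X * (2 * (\<Sum>b<N+2. of_nat b)) * single_moment N"
      unfolding A by (simp add: algebra_simps)
    have "3 * ((n + 2) * pair_sum (N + 2)) = 6 * ((n + 2) * single_moment (N + 2)) + 2 * n * triple_sum N
      + fps_X * ((n + 2) * (n + 1) * (2 * n + 3)) * single_moment N"
      using B' unfolding triple_sum_symmetric s2 n_def[symmetric] by (simp add: mult.assoc)
    then show ?thesis unfolding A' s1 n_def[symmetric] by algebra
  qed
  moreover have "single_moment (N + 4) = pair_sum (N + 2)" using single_moment_rec[of "N + 2"] by (simp add: numeral_eq_Suc)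
  ultimately show ?thesis by (simp only: n_def)
qed

definition even_moment :: "nat \<Rightarrow> nat \<Rightarrow> complex" where "even_moment g k = cumulant g [2 * k]"

lemma single_moment_nth: "single_moment n $ g = cumulant g [n]"
  by (simp add: joint_moment.simps cumulant_series_def)

lemma even_moment_0: "even_moment g 0 = (if g = 0 then 1 else 0)"
  by (simp add: even_moment_def cumulant_0)

lemma even_moment_1: "even_moment g 1 = (if g = 0 then 1 else 0)"
proof -
  have "single_moment 2 = joint_moment [0, 0]" using single_moment_rec[of 0] by (simp add: pair_sum_def numeral_2_eq_2)
  then have "single_moment 2 = 1" by (simp add: joint_moment_0)
  then show ?thesis unfolding even_moment_def single_moment_nth[symmetric] by simp
qed

theorem even_moment_rec:
  "(of_nat k + 3) * even_moment g (k + 2) = 2 * (2 * of_nat k + 3) * even_moment g (k + 1)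
     + (2 * of_nat k + 3) * (of_nat k + 1) * (2 * of_nat k + 1) * (if g = 0 then 0 else even_moment (g - 1) k)"
proof -
  have c: "(of_nat a * f) $ g = of_nat a * f $ g" "((of_nat a + numeral b) * f) $ g = (of_nat a + numeral b) * f $ g"
    "((of_nat a + 1) * f) $ g = (of_nat a + 1) * f $ g" "(numeral b * f) $ g = numeral b * f $ g"
    for a b g and f :: "complex fps"
    by (simp_all add: distrib_right fps_mult_of_nat_nth numeral_fps_const)
  have d: "2 * k + 2 = 2 * (k + 1)" "2 * k + 4 = 2 * (k + 2)" by simp_all
  have "((of_nat (2 * k) + 6) * single_moment (2 * k + 4)) $ g = (4 * ((of_nat (2 * k) + 3) * single_moment (2 * k + 2))
     + fps_X * ((of_nat (2 * k) + 3) * ((of_nat (2 * k) + 2) * ((of_nat (2 * k) + 1) * single_moment (2 * k))))) $ g"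
    using harer_zagier[of "2 * k"] by (simp only: mult.assoc)
  then have "(of_nat (2 * k) + 6) * even_moment g (k + 2) = 4 * ((of_nat (2 * k) + 3) * even_moment g (k + 1))
     + (if g = 0 then 0 else (of_nat (2 * k) + 3) * ((of_nat (2 * k) + 2) * ((of_nat (2 * k) + 1) * even_moment (g - 1) k)))"
    unfolding fps_add_nth c fps_X_mult_nth single_moment_nth even_moment_def d
    by (cases "g = 0") (simp_all only: if_True if_False simp_thms)
  then have "2 * ((of_nat k + 3) * even_moment g (k + 2)) = 2 * (2 * (2 * of_nat k + 3) * even_moment g (k + 1)
     + (2 * of_nat k + 3) * (of_nat k + 1) * (2 * of_nat k + 1) * (if g = 0 then 0 else even_moment (g - 1) k))"
    by (simp add: algebra_simps)
  then show ?thesis by (subst (asm) mult_left_cancel) simp_all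
qed

section \<open>Closed form of the moments\<close>

text \<open>The falling factorial as a polynomial.\<close>

definition falling_poly :: "nat \<Rightarrow> complex poly" where
  "falling_poly k = (\<Prod>i<k. [:- of_nat i, 1:])"

lemma poly_falling_poly: "poly (falling_poly k) x = (\<Prod>i<k. x - of_nat i)"
  by (simp add: falling_poly_def poly_prod)

lemma poly_falling_poly_Suc: "poly (falling_poly (Suc k)) x = x * poly (falling_poly k) (x - 1)"
  unfolding poly_falling_poly prod.lessThan_Suc_shift by (simp add: algebra_simps)

lemma poly_falling_poly_Suc': "poly (falling_poly (Suc k)) x = poly (falling_poly k) x * (x - of_nat k)"
  by (simp add: poly_falling_poly)

lemma pderiv_falling_poly_mult_0: "poly (pderiv (falling_poly (Suc k) * q)) 0 = (-1) ^ k * fact k * poly q 0"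
proof -
  have 0: "poly (falling_poly (Suc k)) 0 = 0" by (simp add: poly_falling_poly_Suc)
  have "poly (pderiv (falling_poly (Suc k))) 0 = (-1) ^ k * fact k"
  proof (induction k)
    case (Suc k)
    have "falling_poly (Suc (Suc k)) = falling_poly (Suc k) * [:- of_nat (Suc k), 1:]" by (simp add: falling_poly_def)
    then have "poly (pderiv (falling_poly (Suc (Suc k)))) 0
        = poly (falling_poly (Suc k)) 0 + - of_nat (Suc k) * poly (pderiv (falling_poly (Suc k))) 0"
      by (simp only: pderiv_mult) (simp add: pderiv_pCons)
    then show ?case using poly_falling_poly_Suc[of k 0] by (simp add: Suc algebra_simps)
  qed (simp add: falling_poly_def pderiv_pCons)
  then show ?thesis by (simp add: pderiv_mult 0)
qed

lemma poly_falling_poly_binomial: "poly (falling_poly k) (of_nat n) = of_nat (n choose k) * fact k"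
  unfolding poly_falling_poly binomial_gbinomial mult.commute[of _ "fact k"] gbinomial_mult_fact atLeast0LessThan ..

text \<open>
  The differential equation \<open>(1 - 4 X\<^sup>2) f = 4 p X f\<close> of \<open>f = (1 - 4
  X\<^sup>2)\<^bsup>-p/2\<^esup>\<close>.
\<close>

lemma disc_inv_power_nth_Suc:
  "of_nat (n + 1) * disc_inv ^ p $ (n + 1) = (if n = 0 then 0 else 4 * of_nat (n - 1 + p) * disc_inv ^ p $ (n - 1))"
proof -
  have "(1 - 4 * fps_X\<^sup>2) * fps_deriv (disc_inv ^ p) = of_nat (4 * p) * fps_X * (disc_inv ^ p * (disc_inv\<^sup>2 * (1 - 4 * fps_X\<^sup>2)))"
    unfolding deriv_disc_inv_power power_add by (simp only: mult_ac)
  then have "fps_deriv (disc_inv ^ p) = 4 * (fps_X * (fps_X * fps_deriv (disc_inv ^ p))) + 4 * (of_nat p * (fps_X * disc_inv ^ p))"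
    unfolding disc_inv_square by (simp add: algebra_simps power2_eq_square)
  then have "fps_deriv (disc_inv ^ p) $ n = (4 * (fps_X * (fps_X * fps_deriv (disc_inv ^ p))) + 4 * (of_nat p * (fps_X * disc_inv ^ p))) $ n"
    by simp
  then show ?thesis
    by (cases n; cases "n - 1") (auto simp: numeral_fps_const fps_mult_of_nat_nth algebra_simps of_nat_diff)
qed

lemma disc_inv_power_odd: "disc_inv ^ p $ (2 * n + 1) = 0"
proof (induction n)
  case 0
  then show ?case using disc_inv_power_nth_Suc[of 0 p] by simp
next
  case (Suc n)
  have "of_nat (2 * n + 3) * disc_inv ^ p $ (2 * n + 3) = 0"
    using disc_inv_power_nth_Suc[of "2 * n + 2" p] Suc by (simp add: numeral_eq_Suc)
  moreover have "of_nat (2 * n + 3) \<noteq> (0 :: complex)" unfolding of_nat_eq_0_iff by simp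
  ultimately have "disc_inv ^ p $ (2 * n + 3) = 0" by (simp only: mult_eq_0_iff simp_thms)
  then show ?case by (simp add: numeral_eq_Suc)
qed

definition central_binom :: "nat \<Rightarrow> complex" where "central_binom n = disc_inv $ (2 * n)"

lemma central_binom_0: "central_binom 0 = 1" by (simp add: central_binom_def disc_inv_0)

lemma central_binom_Suc: "of_nat (n + 1) * central_binom (n + 1) = 2 * (2 * of_nat n + 1) * central_binom n"
proof -
  have "2 * (of_nat (n + 1) * central_binom (n + 1)) = 2 * (2 * (2 * of_nat n + 1) * central_binom n)"
    using disc_inv_power_nth_Suc[of "2 * n + 1" 1] unfolding central_binom_def by (simp add: algebra_simps)
  then show ?thesis by (subst (asm) mult_left_cancel) simp_all
qed

lemma central_binom_nonzero: "central_binom n \<noteq> 0"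
proof (induction n)
  case (Suc n)
  have "2 * (2 * of_nat n + 1) \<noteq> (0 :: complex)"
    by (metis Suc_eq_plus1 mult_2 mult_eq_0_iff of_nat_Suc of_nat_add of_nat_eq_0_iff nat.distinct(1) zero_neq_numeral add.commute)
  then show ?case using central_binom_Suc[of n] Suc by auto
qed (simp add: central_binom_0)

text \<open>
  The moment of order 2n of a basis differential, divided by the central binomial coefficient,
  is a polynomial in n.
\<close>

definition slot_poly :: "nat \<Rightarrow> complex poly" where
  "slot_poly m = smult (1 / (\<Prod>i<m. 4 * of_nat i + 2)) (falling_poly m)"

lemma odd_nonzero: "4 * of_nat i + 2 \<noteq> (0 :: complex)" "2 * of_nat i + 1 \<noteq> (0 :: complex)"
proof -
  have "of_nat (4 * i + 2) \<noteq> (0 :: complex)" "of_nat (2 * i + 1) \<noteq> (0 :: complex)"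
    unfolding of_nat_eq_0_iff by simp_all
  then show "4 * of_nat i + 2 \<noteq> (0 :: complex)" "2 * of_nat i + 1 \<noteq> (0 :: complex)"
    by (simp_all add: add.commute)
qed

text \<open>
  Since \<open>X\<^sup>3 d/dX (X / \<surd>(1 - 4 X\<^sup>2))\<^bsup>2m-1\<^esup>\<close> is a
  multiple of the next odd power, the coefficients satisfy a recursion in m.
\<close>

lemma X_disc_inv_power_nth: "(fps_X * disc_inv) ^ (2 * m + 1) $ (2 * n + 1) = central_binom n * poly (slot_poly m) (of_nat n)"
proof (induction m arbitrary: n)
  case 0
  then show ?case by (simp add: central_binom_def slot_poly_def falling_poly_def)
next
  case (Suc b)
  note IH = Suc.IH
  have "fps_deriv (fps_X * disc_inv) = disc_inv * (1 + 4 * fps_X\<^sup>2 * disc_inv\<^sup>2)"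
    by (simp add: deriv_disc_inv power2_eq_square power3_eq_cube algebra_simps)
  then have d: "fps_deriv (fps_X * disc_inv) = disc_inv ^ 3"
    unfolding disc_inv_square_expand by (simp add: power2_eq_square power3_eq_cube)
  have "fps_X ^ 3 * fps_deriv ((fps_X * disc_inv) ^ (2 * b + 1)) = of_nat (2 * b + 1) * (fps_X * disc_inv) ^ (2 * Suc b + 1)"
    unfolding fps_deriv_power' d fps_of_nat by (simp add: power3_eq_cube mult_ac power_mult_distrib)
  then have Ea: "(fps_X ^ 3 * fps_deriv ((fps_X * disc_inv) ^ (2 * b + 1))) $ (2 * n + 1)
      = of_nat (2 * b + 1) * (fps_X * disc_inv) ^ (2 * Suc b + 1) $ (2 * n + 1)"
    by (simp only: fps_mult_of_nat_nth)
  have Eb: "(fps_X ^ 3 * fps_deriv f) $ (2 * n + 1) = (if n = 0 then 0 else of_nat (2 * n - 1) * f $ (2 * (n - 1) + 1))"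
    for f :: "complex fps"
    by (cases n) (simp_all add: fps_X_power_mult_nth)
  have E: "of_nat (2 * b + 1) * (fps_X * disc_inv) ^ (2 * Suc b + 1) $ (2 * n + 1)
      = (if n = 0 then 0 else of_nat (2 * n - 1) * (fps_X * disc_inv) ^ (2 * b + 1) $ (2 * (n - 1) + 1))"
    using Ea unfolding Eb by (rule sym)
  have pp: "(4 * of_nat b + 2) * poly (slot_poly (Suc b)) x = x * poly (slot_poly b) (x - 1)" for x
  proof -
    have "c * (1 / (p * c) * y) = 1 / p * y" if "c \<noteq> 0" for c p y :: complex using that by simp
    from this[OF odd_nonzero(1)[of b]] show ?thesis
      unfolding slot_poly_def poly_smult poly_falling_poly_Suc prod.lessThan_Suc by simp
  qed
  have "(4 * of_nat b + 2) * (fps_X * disc_inv) ^ (2 * Suc b + 1) $ (2 * n + 1) = (4 * of_nat b + 2) * (central_binom n * poly (slot_poly (Suc b)) (of_nat n))"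
  proof (cases n)
    case 0
    then show ?thesis using E pp[of 0] odd_nonzero by (simp add: mult.left_commute[of _ "central_binom _"])
  next
    case (Suc k)
    have "(4 * of_nat b + 2) * (fps_X * disc_inv) ^ (2 * Suc b + 1) $ (2 * n + 1)
       = 2 * (of_nat (2 * b + 1) * (fps_X * disc_inv) ^ (2 * Suc b + 1) $ (2 * n + 1))" by (simp add: algebra_simps)
    also have "\<dots> = 2 * (of_nat (2 * n - 1) * (fps_X * disc_inv) ^ (2 * b + 1) $ (2 * k + 1))"
      unfolding E using Suc by simp
    also have "\<dots> = (2 * (2 * of_nat k + 1) * central_binom k) * poly (slot_poly b) (of_nat k)"
      unfolding IH[of k] using Suc by (simp add: algebra_simps)
    also have "\<dots> = central_binom n * (of_nat n * poly (slot_poly b) (of_nat n - 1))"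
      unfolding central_binom_Suc[symmetric] Suc by simp
    finally show ?thesis unfolding pp[symmetric] by (simp only: mult_ac)
  qed
  then show ?case using odd_nonzero(1)[of b] by (simp only: mult_left_cancel simp_thms)
qed

text \<open>
  Only even indices matter, since the series with odd index have no coefficients of even order.
  The upper limit comes from the support of the arrays.
\<close>

definition moment_poly :: "nat \<Rightarrow> complex poly" where
  "moment_poly g = - (\<Sum>b<4*g+1. smult (tr_coeff g [2 * b]) (slot_poly (b + 1)))"

lemma sum_even: "(\<And>k. odd k \<Longrightarrow> f k = 0) \<Longrightarrow> (\<Sum>k<2*n. f k) = (\<Sum>b<n. f (2 * b))" for f :: "nat \<Rightarrow> complex"
  by (induction n) auto

lemma even_moment_poly:
  assumes g: "g > 0"
  shows "even_moment g n = central_binom n * poly (moment_poly g) (of_nat n)"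
proof -
  have "omega g [] = - stable_sum (2 * (4 * g + 1)) g []"
    using omega_K[of g "[]" "2 * (4 * g + 1)"] g by (simp add: unstable_series_def)
  then have "even_moment g n = - (\<Sum>k<2*(4*g+1). tr_coeff g [k] * eta k $ (2 * n + 1))"
    unfolding even_moment_def cumulant_Cons by (simp add: stable_sum_def fps_sum_nth)
  also have "(\<Sum>k<2*(4*g+1). tr_coeff g [k] * eta k $ (2 * n + 1)) = (\<Sum>b<4*g+1. tr_coeff g [2 * b] * eta (2 * b) $ (2 * n + 1))"
  proof (rule sum_even)
    fix k :: nat assume "odd k"
    then obtain b where k: "k = 2 * b + 1" by (elim oddE)
    have eta_k: "eta k = fps_X ^ (2 * (b + 1)) * disc_inv ^ (2 * b + 3)"
      unfolding k eta_def tau_odd by (simp add: power2_eq_square power3_eq_cube power_add mult_ac)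
    have "eta k $ (2 * n + 1) = (if n \<ge> b + 1 then disc_inv ^ (2 * b + 3) $ (2 * (n - b - 1) + 1) else 0)"
    proof -
      have "(fps_X ^ (2 * c) * h) $ (2 * n + 1) = (if n \<ge> c then h $ (2 * (n - c) + 1) else 0)"
        for c and h :: "complex fps"
      proof -
        have "2 * n + 1 - 2 * c = 2 * (n - c) + 1" if "n \<ge> c" using that by simp
        then show ?thesis by (simp add: fps_X_power_mult_nth)
      qed
      then show ?thesis unfolding eta_k diff_diff_left .
    qed
    then show "tr_coeff g [k] * eta k $ (2 * n + 1) = 0" using disc_inv_power_odd[of "2 * b + 3" "n - b - 1"] by simp
  qed
  also have "\<dots> = (\<Sum>b<4*g+1. tr_coeff g [2 * b] * (central_binom n * poly (slot_poly (b + 1)) (of_nat n)))"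
  proof -
    have "eta (2 * b) = (fps_X * disc_inv) ^ (2 * (b + 1) + 1)" for b
      unfolding eta_def tau_even by (simp add: power2_eq_square power3_eq_cube power_add power_mult_distrib mult_ac)
    then show ?thesis by (simp only: X_disc_inv_power_nth)
  qed
  also have "\<dots> = central_binom n * (\<Sum>b<4*g+1. tr_coeff g [2 * b] * poly (slot_poly (b + 1)) (of_nat n))"
    unfolding sum_distrib_left by (intro sum.cong refl) (simp only: mult_ac)
  finally show ?thesis by (simp only: moment_poly_def poly_minus poly_sum poly_smult mult_minus_right)
qed

text \<open>
  The series of sinh w / w, of cosh w, of \<open>(w / sinh w)\<^sup>2\<close> and of w coth w.
\<close>

definition sinhc_series :: "complex fps" where "sinhc_series = fps_const (1/2) * fps_shift 1 (fps_exp 1 - fps_exp (-1))"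
definition cosh_series :: "complex fps" where "cosh_series = fps_const (1/2) * (fps_exp 1 + fps_exp (-1))"

lemma X_sinhc_series: "fps_X * sinhc_series = fps_const (1/2) * (fps_exp 1 - fps_exp (-1))"
proof -
  have "fps_X * sinhc_series = fps_const (1/2) * (fps_X ^ 1 * fps_shift 1 (fps_exp 1 - fps_exp (-1)))"
    by (simp add: sinhc_series_def mult_ac)
  also have "fps_X ^ 1 * fps_shift 1 (fps_exp 1 - fps_exp (-1)) = fps_exp 1 - fps_exp (-1 :: complex)"
    unfolding shift_eq by (simp add: fps_eq_iff)
  finally show ?thesis .
qed

lemma sinhc_series_0: "sinhc_series $ 0 = 1" by (simp add: sinhc_series_def)

lemma cosh_series_sq: "cosh_series\<^sup>2 - fps_X\<^sup>2 * sinhc_series\<^sup>2 = 1"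
proof -
  have e: "fps_exp 1 * fps_exp (-1) = (1 :: complex fps)"
    by (metis add.right_inverse fps_exp_0 fps_exp_add_mult)
  have "cosh_series\<^sup>2 - (fps_X * sinhc_series)\<^sup>2 = (fps_const (1/2))\<^sup>2 * (4 * (fps_exp 1 * fps_exp (-1)))"
    unfolding cosh_series_def X_sinhc_series by (simp add: power2_eq_square algebra_simps)
  also have "\<dots> = 1" unfolding e by (simp add: numeral_fps_const power2_eq_square)
  finally show ?thesis by (simp only: power_mult_distrib)
qed

lemma deriv_cosh_series: "fps_deriv cosh_series = fps_X * sinhc_series"
  unfolding X_sinhc_series cosh_series_def by (simp add: algebra_simps flip: fps_const_neg)

lemma deriv_sinhc_series: "fps_X * fps_deriv sinhc_series = cosh_series - sinhc_series"
proof -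
  have "fps_deriv (fps_X * sinhc_series) = cosh_series"
    unfolding X_sinhc_series cosh_series_def by (simp add: algebra_simps flip: fps_const_neg)
  then show ?thesis by (simp add: algebra_simps)
qed

definition csch_square_series :: "complex fps" where "csch_square_series = inverse (sinhc_series\<^sup>2)"
definition coth_series :: "complex fps" where "coth_series = cosh_series * inverse sinhc_series"

lemma inverse_sinhc_series: "inverse sinhc_series * sinhc_series = 1"
  using inverse_mult_eq_1[of sinhc_series] sinhc_series_0 by simp

lemma coth_series_sinhc_series: "coth_series * sinhc_series = cosh_series"
  using inverse_sinhc_series by (simp add: coth_series_def mult.assoc)

lemma csch_square_series_sinhc_series: "csch_square_series * sinhc_series\<^sup>2 = 1"
  unfolding csch_square_series_def using inverse_mult_eq_1[of "sinhc_series\<^sup>2"] sinhc_series_0 by (simp add: power2_eq_square)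

lemma sinhc_series_nonzero: "sinhc_series \<noteq> 0" using sinhc_series_0 by auto

lemma csch_square_series_coth_series: "coth_series\<^sup>2 - fps_X\<^sup>2 = csch_square_series"
proof -
  have "sinhc_series\<^sup>2 * (coth_series\<^sup>2 - fps_X\<^sup>2) = sinhc_series\<^sup>2 * csch_square_series"
    using cosh_series_sq csch_square_series_sinhc_series unfolding coth_series_sinhc_series[symmetric] by (simp add: power_mult_distrib algebra_simps)
  then show ?thesis using sinhc_series_nonzero by simp
qed

text \<open>The Riccati equation of w coth w.\<close>

lemma deriv_coth_series: "fps_X * fps_deriv coth_series = coth_series - coth_series\<^sup>2 + fps_X\<^sup>2"
proof -
  have "fps_deriv (coth_series * sinhc_series) = fps_X * sinhc_series" unfolding coth_series_sinhc_series deriv_cosh_series ..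
  then have "fps_X * (fps_deriv coth_series * sinhc_series) + coth_series * (fps_X * fps_deriv sinhc_series) = fps_X * (fps_X * sinhc_series)"
    by (metis (no_types, lifting) distrib_left fps_deriv_mult mult.left_commute add.commute)
  then have "sinhc_series * (fps_X * fps_deriv coth_series) = sinhc_series * (coth_series - coth_series\<^sup>2 + fps_X\<^sup>2)"
    unfolding deriv_sinhc_series coth_series_sinhc_series[symmetric] by (simp add: algebra_simps power2_eq_square)
  then show ?thesis using sinhc_series_nonzero by simp
qed

lemma coth_series_0: "(coth_series - 1) $ 0 = 0" by (simp add: coth_series_def sinhc_series_0 cosh_series_def)

definition coth_coeff :: "nat \<Rightarrow> nat \<Rightarrow> complex" where "coth_coeff g n = (coth_series ^ n * csch_square_series) $ (2 * g)"

text \<open>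
  The Riccati equation, applied to \<open>Y\<^sup>n (Y\<^sup>2 - w\<^sup>2)\<close>.
\<close>

lemma coth_coeff_rec:
  "(of_nat n + 2) * coth_coeff g (n + 1) - (of_nat n - 2 * of_nat g + 2) * coth_coeff g n
     = of_nat n * (if g = 0 then 0 else coth_coeff (g - 1) (n - 1))"
proof -
  let ?G = "\<lambda>n. coth_series ^ n * csch_square_series"
  have "fps_X * fps_deriv csch_square_series = 2 * coth_series * (fps_X * fps_deriv coth_series) - 2 * fps_X\<^sup>2"
    unfolding csch_square_series_coth_series[symmetric] by (simp add: power2_eq_square algebra_simps)
  also have "\<dots> = 2 * (1 - coth_series) * csch_square_series"
    unfolding deriv_coth_series csch_square_series_coth_series[symmetric] by (simp add: power2_eq_square algebra_simps)
  finally have dk: "fps_X * fps_deriv csch_square_series = 2 * (1 - coth_series) * csch_square_series" .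
  have G: "fps_X * fps_deriv (?G n) = of_nat n * (fps_X\<^sup>2 * ?G (n - 1)) + (of_nat n + 2) * ?G n - (of_nat n + 2) * ?G (n + 1)"
  proof -
    have "fps_X * fps_deriv (?G n) = of_nat n * (coth_series ^ (n - 1) * (fps_X * fps_deriv coth_series)) * csch_square_series + coth_series ^ n * (fps_X * fps_deriv csch_square_series)"
      by (simp add: fps_deriv_power' fps_of_nat algebra_simps)
    also have "\<dots> = of_nat n * (fps_X\<^sup>2 * ?G (n - 1)) + (of_nat n + 2) * ?G n - (of_nat n + 2) * ?G (n + 1)"
      unfolding deriv_coth_series dk by (cases n) (simp_all add: algebra_simps power2_eq_square)
    finally show ?thesis .
  qed
  have "(fps_X * fps_deriv (?G n)) $ (2 * g) = 2 * of_nat g * coth_coeff g n"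
  proof -
    have "(fps_X * fps_deriv f) $ (2 * g) = 2 * of_nat g * f $ (2 * g)" for f :: "complex fps"
      by (cases g) (simp_all add: algebra_simps)
    then show ?thesis unfolding coth_coeff_def .
  qed
  moreover have "(of_nat n * (fps_X\<^sup>2 * ?G (n - 1)) + (of_nat n + 2) * ?G n - (of_nat n + 2) * ?G (n + 1)) $ (2 * g)
    = of_nat n * (if g = 0 then 0 else coth_coeff (g - 1) (n - 1)) + (of_nat n + 2) * coth_coeff g n - (of_nat n + 2) * coth_coeff g (n + 1)"
  proof -
    have "((of_nat n + 2) * f) $ m = (of_nat n + 2) * f $ m" for f :: "complex fps" and m
      by (simp add: distrib_right fps_mult_of_nat_nth numeral_fps_const)
    moreover have "(fps_X\<^sup>2 * f) $ (2 * g) = (if g = 0 then 0 else f $ (2 * (g - 1)))" for f :: "complex fps"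
      by (cases g) (simp_all add: fps_X_power_mult_nth)
    ultimately show ?thesis unfolding coth_coeff_def by (simp add: fps_mult_of_nat_nth)
  qed
  ultimately show ?thesis unfolding G by (simp add: algebra_simps)
qed

text \<open>
  Since Y - 1 has no constant term, the coefficients of \<open>Y\<^sup>n\<close> are polynomials
  in n, by the binomial theorem. This makes it possible to evaluate them at n = 0.
\<close>

definition coth_poly :: "nat \<Rightarrow> complex poly" where
  "coth_poly g = (\<Sum>k\<le>2*g. smult (((coth_series - 1) ^ k * csch_square_series) $ (2 * g) / fact k) (falling_poly k))"

lemma poly_coth_poly: "poly (coth_poly g) (of_nat n) = coth_coeff g n"
proof -
  let ?c = "\<lambda>k. of_nat (n choose k) * ((coth_series - 1) ^ k * csch_square_series) $ (2 * g)"
  have z: "((coth_series - 1) ^ k * csch_square_series) $ (2 * g) = 0" if "k > 2 * g" for k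
  proof -
    have "(coth_series - 1) ^ k $ i = 0" if "i < k" for i using startsby_zero_power_prefix[OF coth_series_0] that by blast
    then show ?thesis using that by (simp add: fps_mult_nth)
  qed
  have "coth_series ^ n * csch_square_series = (\<Sum>k\<le>n. of_nat (n choose k) * ((coth_series - 1) ^ k * csch_square_series))"
    using arg_cong[OF binomial_ring[of "coth_series - 1" 1 n], of "\<lambda>f. f * csch_square_series"]
    unfolding sum_distrib_right by (simp add: mult.assoc)
  then have "coth_coeff g n = (\<Sum>k\<le>n. ?c k)" by (simp add: coth_coeff_def fps_sum_nth fps_mult_of_nat_nth)
  also have "\<dots> = (\<Sum>k\<le>n + 2 * g. ?c k)" by (rule sum.mono_neutral_left) auto
  also have "\<dots> = (\<Sum>k\<le>2*g. ?c k)" by (rule sum.mono_neutral_right) (auto simp: z)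
  also have "\<dots> = poly (coth_poly g) (of_nat n)"
    by (simp add: coth_poly_def poly_sum poly_falling_poly_binomial mult_ac)
  finally show ?thesis ..
qed

lemma coth_poly_0: "poly (coth_poly g) 0 = csch_square_series $ (2 * g)"
  using poly_coth_poly[of g 0] by (simp add: coth_coeff_def)

text \<open>
  The solution of the recursion. The planar value, a Catalan number divided by the central
  binomial coefficient, does not have the form of the other ones.
\<close>

definition moment_value :: "nat \<Rightarrow> nat \<Rightarrow> complex" where
  "moment_value g n = (if g = 0 then 1 / (of_nat n + 1) else poly (falling_poly (2 * g - 1)) (of_nat n) * coth_coeff g n / 4 ^ g)"

lemma csch_square_series_0: "csch_square_series $ 0 = 1"
  by (simp add: csch_square_series_def sinhc_series_0 power2_eq_square)

lemma coth_coeff_0: "coth_coeff 0 n = 1"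
  using coth_series_0 by (simp add: coth_coeff_def csch_square_series_0 fps_nth_power_0)

lemma moment_value_rec:
  "(of_nat k + 3) * moment_value g (k + 2) = (of_nat k + 2) * moment_value g (k + 1)
     + (of_nat k + 2) * (of_nat k + 1)\<^sup>2 / 4 * (if g = 0 then 0 else moment_value (g - 1) k)"
proof (cases g)
  case 0
  have "of_nat (k + 3) \<noteq> (0 :: complex)" "of_nat (k + 2) \<noteq> (0 :: complex)" unfolding of_nat_eq_0_iff by simp_all
  then show ?thesis unfolding 0 by (simp add: moment_value_def add.commute)
next
  case (Suc h)
  define n where "n = (of_nat (k + 1) :: complex)"
  have f1: "poly (falling_poly (2 * g - 1)) (n + 1) = (n + 1) * poly (falling_poly (2 * h)) n"
    using poly_falling_poly_Suc[of "2 * h" "n + 1"] Suc by simp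
  have f2: "poly (falling_poly (2 * g - 1)) n = poly (falling_poly (2 * h)) n * (n - 2 * of_nat h)"
    using poly_falling_poly_Suc'[of "2 * h" n] Suc by simp
  have f3: "n\<^sup>2 * moment_value h k * 4 ^ h = n * poly (falling_poly (2 * h)) n * coth_coeff h k"
  proof (cases h)
    case 0
    have "n \<noteq> 0" unfolding n_def of_nat_eq_0_iff by simp
    moreover have "moment_value 0 k = 1 / n" by (simp add: moment_value_def n_def add.commute)
    ultimately show ?thesis unfolding 0 by (simp add: coth_coeff_0 falling_poly_def power2_eq_square)
  next
    case (Suc j)
    have "poly (falling_poly (2 * h)) n = n * poly (falling_poly (2 * h - 1)) (of_nat k)"
      using poly_falling_poly_Suc[of "2 * h - 1" n] Suc by (simp add: n_def)
    then show ?thesis unfolding moment_value_def using Suc by (simp add: power2_eq_square)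
  qed
  have q: "(n + 2) * coth_coeff g (k + 2) = (n - 2 * of_nat h) * coth_coeff g (k + 1) + n * coth_coeff h k"
    using coth_coeff_rec[of "k + 1" g] Suc by (simp add: n_def algebra_simps)
  have v4: "moment_value g m * 4 ^ g = poly (falling_poly (2 * g - 1)) (of_nat m) * coth_coeff g m" for m
    using Suc by (simp add: moment_value_def)
  have "(n + 2) * moment_value g (k + 2) * 4 ^ g = (n + 1) * poly (falling_poly (2 * h)) n * ((n + 2) * coth_coeff g (k + 2))"
    unfolding mult.assoc v4 using f1 by (simp add: n_def add.commute)
  also have "\<dots> = (n + 1) * (poly (falling_poly (2 * h)) n * (n - 2 * of_nat h)) * coth_coeff g (k + 1) + (n + 1) * (n * poly (falling_poly (2 * h)) n * coth_coeff h k)"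
    unfolding q by (simp add: algebra_simps)
  also have "\<dots> = ((n + 1) * moment_value g (k + 1) + (n + 1) * n\<^sup>2 / 4 * moment_value h k) * 4 ^ g"
  proof -
    have "(4 :: complex) ^ g = 4 * 4 ^ h" unfolding Suc by simp
    then have "((n + 1) * moment_value g (k + 1) + (n + 1) * n\<^sup>2 / 4 * moment_value h k) * 4 ^ g
      = (n + 1) * (moment_value g (k + 1) * 4 ^ g) + (n + 1) * (n\<^sup>2 * moment_value h k * 4 ^ h)"
      by (simp add: algebra_simps)
    then show ?thesis unfolding f2[symmetric] f3[symmetric] v4 n_def[symmetric] by (simp add: mult.assoc)
  qed
  finally have "(n + 2) * moment_value g (k + 2) = (n + 1) * moment_value g (k + 1) + (n + 1) * n\<^sup>2 / 4 * moment_value h k" by simp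
  then show ?thesis using Suc by (simp add: n_def algebra_simps)
qed

text \<open>
  Both sides satisfy the recursion of Harer and Zagier with the same initial values.
\<close>

lemma even_moment_eq: "even_moment g n = central_binom n * moment_value g n"
proof (induction n arbitrary: g rule: less_induct)
  case (less n)
  consider "n = 0" | "n = 1" | k where "n = k + 2"
  proof -
    have "n = 0 \<or> n = 1 \<or> n = (n - 2) + 2" by arith
    then show thesis using that by blast
  qed
  then show ?case
  proof cases
    case 1
    have "poly (falling_poly (2 * g - 1)) 0 = 0" if "g > 0"
      using that by (cases g) (simp_all add: poly_falling_poly_Suc)
    then show ?thesis unfolding 1 by (simp add: even_moment_0 central_binom_0 moment_value_def)
  next
    case 2
    have c: "central_binom 1 = 2" using central_binom_Suc[of 0] by (simp add: central_binom_0)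
    have "moment_value g 1 = 0" if "g > 0"
    proof (cases "g = 1")
      case True
      then show ?thesis using coth_coeff_rec[of 0 1] by (simp add: moment_value_def)
    next
      case False
      then have "2 * g - 1 = Suc (Suc (2 * g - 3))" using that by simp
      then show ?thesis by (simp add: moment_value_def poly_falling_poly_Suc)
    qed
    then show ?thesis unfolding 2 using even_moment_1[of g] c by (cases "g = 0") (simp_all add: moment_value_def)
  next
    case (3 k)
    define a where "a = (of_nat k :: complex)"
    have nz: "a + 3 \<noteq> 0" "a + 2 \<noteq> 0"
    proof -
      have "of_nat (k + 3) \<noteq> (0 :: complex)" "of_nat (k + 2) \<noteq> (0 :: complex)" unfolding of_nat_eq_0_iff by simp_all
      then show "a + 3 \<noteq> 0" "a + 2 \<noteq> 0" by (simp_all add: a_def add.commute)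
    qed
    have c1: "(a + 1) * central_binom (k + 1) = 2 * (2 * a + 1) * central_binom k" using central_binom_Suc[of k] by (simp add: a_def add.commute)
    have c2: "(a + 2) * central_binom (k + 2) = 2 * (2 * a + 3) * central_binom (k + 1)" using central_binom_Suc[of "k + 1"] by (simp add: a_def algebra_simps)
    define W where "W = (if g = 0 then 0 else moment_value (g - 1) k)"
    have "(a + 2) * ((a + 3) * even_moment g n) = (a + 2) * (2 * (2 * a + 3) * (central_binom (k + 1) * moment_value g (k + 1))
     + (2 * a + 3) * (a + 1) * (2 * a + 1) * (central_binom k * W))"
      using even_moment_rec[of k g] 3 less.IH[of "k + 1" g] less.IH[of k "g - 1"] by (simp add: a_def W_def split: if_splits)
    also have "\<dots> = (a + 2) * (2 * (2 * a + 3) * central_binom (k + 1)) * moment_value g (k + 1)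
     + (a + 2) * (2 * a + 3) * (a + 1) / 2 * (2 * (2 * a + 1) * central_binom k) * W" by (simp add: field_simps)
    also have "\<dots> = (2 * (2 * a + 3) * central_binom (k + 1)) * ((a + 2) * moment_value g (k + 1) + (a + 2) * (a + 1)\<^sup>2 / 4 * W)"
      unfolding c1[symmetric] by (simp add: field_simps power2_eq_square)
    also have "\<dots> = (a + 2) * central_binom (k + 2) * ((a + 3) * moment_value g (k + 2))"
      unfolding c2[symmetric] using moment_value_rec[of k g] by (simp only: a_def W_def)
    finally have "((a + 2) * (a + 3)) * even_moment g n = ((a + 2) * (a + 3)) * (central_binom n * moment_value g n)"
      unfolding 3 by (simp only: mult_ac)
    then show ?thesis using nz by simp
  qed
qed

text \<open>The two polynomials agree at all natural numbers.\<close>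

theorem moment_poly_closed:
  assumes g: "g > 0"
  shows "moment_poly g = smult (1 / 4 ^ g) (falling_poly (2 * g - 1) * coth_poly g)"
proof -
  let ?d = "moment_poly g - smult (1 / 4 ^ g) (falling_poly (2 * g - 1) * coth_poly g)"
  have "poly ?d (of_nat n) = 0" for n
  proof -
    have "central_binom n * poly (moment_poly g) (of_nat n) = central_binom n * moment_value g n"
      using even_moment_poly[OF g, of n] unfolding even_moment_eq by (rule sym)
    then have "poly (moment_poly g) (of_nat n) = moment_value g n" unfolding mult_left_cancel[OF central_binom_nonzero] .
    then show ?thesis using g by (simp add: moment_value_def poly_coth_poly)
  qed
  then have "range of_nat \<subseteq> {x. poly ?d x = 0}" by auto
  moreover have "infinite (range (of_nat :: nat \<Rightarrow> complex))"
    using inj_of_nat by (simp add: finite_image_iff)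
  ultimately have "\<not> finite {x. poly ?d x = 0}" using finite_subset by blast
  then have "?d = 0" using poly_roots_finite by blast
  then show ?thesis by simp
qed

theorem moment_poly_deriv_0:
  assumes "g > 0"
  shows "poly (pderiv (moment_poly g)) 0 = fact (2 * g - 2) * csch_square_series $ (2 * g) / 4 ^ g"
proof -
  have "2 * g - 1 = Suc (2 * g - 2)" "even (2 * g - 2)" using assms by auto
  then show ?thesis unfolding moment_poly_closed[OF assms] pderiv_smult
    by (simp add: pderiv_falling_poly_mult_0 coth_poly_0)
qed

text \<open>
  Compare coefficients in \<open>(w / sinh w)\<^sup>2 (cosh 2w - 1) = 2 w\<^sup>2\<close>.
\<close>

lemma csch_square_series_convolution:
  "(\<Sum>j=1..M+1. csch_square_series $ (2 * (M + 1 - j)) * 4 ^ j / fact (2 * j)) = (if M = 0 then 2 else 0)"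
proof -
  have e: "fps_exp 1 * fps_exp (-1) = (1 :: complex fps)"
    by (metis add.right_inverse fps_exp_0 fps_exp_add_mult)
  have ee: "fps_exp 1 * fps_exp 1 = (fps_exp 2 :: complex fps)" "fps_exp (-1) * fps_exp (-1) = (fps_exp (-2) :: complex fps)"
    by (simp_all flip: fps_exp_add_mult)
  define D :: "complex fps" where "D = fps_const (1/2) * (fps_exp 2 + fps_exp (-2)) - 1"
  have "2 * (fps_X * sinhc_series)\<^sup>2 = (2 * (fps_const (1/2))\<^sup>2) * (fps_exp 1 * fps_exp 1 + fps_exp (-1) * fps_exp (-1) - 2 * (fps_exp 1 * fps_exp (-1)))"
    unfolding X_sinhc_series by (simp add: power2_eq_square algebra_simps)
  also have "\<dots> = D" unfolding e ee D_def
    by (simp add: power2_eq_square numeral_fps_const right_diff_distrib)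
  finally have "csch_square_series * D = (csch_square_series * sinhc_series\<^sup>2) * (2 * fps_X\<^sup>2)"
    by (simp add: power_mult_distrib mult_ac)
  then have D: "csch_square_series * D = 2 * fps_X\<^sup>2" unfolding csch_square_series_sinhc_series by simp
  have Dn: "D $ n = (if n = 0 then 0 else if even n then 2 ^ n / fact n else 0)" for n
    by (simp add: D_def)
  have "(\<Sum>i\<le>2*(M+1). D $ i * csch_square_series $ (2 * (M + 1) - i)) = (2 * fps_X\<^sup>2) $ (2 * (M + 1))"
    unfolding D[symmetric] mult.commute[of csch_square_series] by (simp only: fps_mult_nth atLeast0AtMost)
  also have "(\<Sum>i\<le>2*(M+1). D $ i * csch_square_series $ (2 * (M + 1) - i)) = (\<Sum>i\<in>(\<lambda>j. 2 * j) ` {1..M+1}. D $ i * csch_square_series $ (2 * (M + 1) - i))"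
    by (rule sum.mono_neutral_right) (auto simp: Dn image_iff elim!: evenE)
  also have "\<dots> = (\<Sum>j=1..M+1. csch_square_series $ (2 * (M + 1 - j)) * 4 ^ j / fact (2 * j))"
    by (subst sum.reindex, simp add: inj_on_def, unfold o_def, rule sum.cong[OF refl])
      (simp add: Dn power_mult diff_mult_distrib2)
  also have "(2 * fps_X\<^sup>2 :: complex fps) $ (2 * (M + 1)) = (if M = 0 then 2 else 0)"
    by (simp add: numeral_fps_const fps_X_power_nth)
  finally show ?thesis .
qed

section \<open>Residues against a primitive of ydx\<close>

lemma weber_ydx_eq: "z \<noteq> 0 \<Longrightarrow> weber_ydx s z = s\<^sup>2 / 2 * ((z - 1 / z)\<^sup>2 / z)"
proof -
  assume z: "z \<noteq> 0"
  have "(weber_x s has_field_derivative s * (1 - 1 / z\<^sup>2)) (at z)"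
    unfolding weber_x_def using DERIV_cmult[OF joukowski_DERIV[OF z], of s] unfolding joukowski_def .
  then have "deriv (weber_x s) z = s * ((z - 1 / z) / z)" unfolding joukowski_DERIV'[OF z] by (rule DERIV_imp_deriv)
  then show ?thesis unfolding weber_ydx_def weber_y_def
    by (simp add: power2_eq_square)
qed

lemma pderiv_sum': "pderiv (\<Sum>i\<in>A. f i) = (\<Sum>i\<in>A. pderiv (f i))"
  by (induction A rule: infinite_finite_induct) (simp_all add: pderiv_add)

text \<open>
  Everything that is used about \<open>\<Phi>\<close> on the curve with a fixed parameter.
\<close>

locale ydx_primitive =
  fixes s :: complex and \<phi> :: "complex \<Rightarrow> complex"
  assumes prim: "weber_primitive s \<phi>"
begin

lemma prim_ball: "\<exists>e>0. e \<le> 1 \<and> (\<forall>r\<in>{1,-1}. \<forall>z\<in>ball r e. (\<phi> has_field_derivative weber_ydx s z) (at z))"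
proof -
  have "\<exists>e>0. \<forall>z. dist z r < e \<longrightarrow> (\<phi> has_field_derivative weber_ydx s z) (at z)" if "r \<in> {1,-1}" for r
    using prim that unfolding weber_primitive_def weber_ramification_def eventually_nhds_metric by blast
  from this[of 1] this[of "-1"] obtain e1 e2 where e: "e1 > 0" "e2 > 0"
    "\<And>z. dist z 1 < e1 \<Longrightarrow> (\<phi> has_field_derivative weber_ydx s z) (at z)"
    "\<And>z. dist z (-1) < e2 \<Longrightarrow> (\<phi> has_field_derivative weber_ydx s z) (at z)" by auto
  have "\<forall>r\<in>{1,-1}. \<forall>z\<in>ball r (min 1 (min e1 e2)). (\<phi> has_field_derivative weber_ydx s z) (at z)"
    using e(3,4) by (auto simp: dist_commute)
  then show ?thesis using e(1,2) by (intro exI[of _ "min 1 (min e1 e2)"]) auto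
qed

lemma prim_analytic: "\<phi> analytic_on {1, -1}"
proof -
  obtain e where e: "e > 0" "\<forall>r\<in>{1,-1}. \<forall>z\<in>ball r e. (\<phi> has_field_derivative weber_ydx s z) (at z)"
    using prim_ball by blast
  have "\<phi> holomorphic_on ball r e" if "r \<in> {1,-1}" for r
    using e(2) that unfolding holomorphic_on_open[OF open_ball] by blast
  then show ?thesis unfolding analytic_on_def using e(1) by blast
qed

lemma prim_punct: "punct_holo (\<lambda>z. \<phi> z * (1 / (z * (z - 1 / z) ^ n)))"
  by (intro punct_holo_mult punct_holo_analytic prim_analytic punct_holo_odd_power)

text \<open>
  The residue of the primitive against \<open>\<sigma>\<^bsup>-2n\<^esup> dz / z\<close>, where
  \<open>\<sigma> = z - 1/z\<close>.
\<close>

definition prim_residue :: "nat \<Rightarrow> complex" where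
  "prim_residue n = res_sum (\<lambda>z. \<phi> z * (1 / (z * (z - 1 / z) ^ (2 * n))))"

lemma analytic_conj_diff: "(\<lambda>z. (z - 1 / z) * joukowski z / z) analytic_on {1, -1}"
  unfolding joukowski_def by (intro analytic_intros) auto

lemma res_joukowski_power:
  "res_sum (\<lambda>z. (z - 1 / z)\<^sup>2 * joukowski z / (z * (z - 1 / z) ^ (2 * k + 1))) = (if k = 1 then 2 else 0)"
    (is "res_sum ?f = _")
proof -
  consider "k = 0" | "k = 1" | n where "k = Suc (Suc n)"
  proof -
    have "k = 0 \<or> k = 1 \<or> k = Suc (Suc (k - 2))" by arith
    then show thesis using that by blast
  qed
  then show ?thesis
  proof cases
    case 1
    have "res_sum ?f = res_sum (\<lambda>z. (z - 1 / z) * joukowski z / z)"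
    proof (rule res_sum_cong)
      fix r :: complex assume "r \<in> {1, -1}"
      from eventually_regular[OF this] show "\<forall>\<^sub>F z in at r. ?f z = (z - 1 / z) * joukowski z / z"
        by eventually_elim (use 1 in \<open>auto simp: power2_eq_square dest!: regular_conj_diff\<close>)
    qed
    also have "\<dots> = 0" by (rule res_sum_analytic[OF analytic_conj_diff])
    finally show ?thesis using 1 by simp
  next
    case 2
    have "res_sum ?f = res_sum (\<lambda>z. 2 * (1/2 * (1 - 1 / z\<^sup>2) * basis_fun 1 (joukowski z)))"
    proof (rule res_sum_cong)
      fix r :: complex assume "r \<in> {1, -1}"
      from eventually_regular[OF this] show "\<forall>\<^sub>F z in at r. ?f z = 2 * (1/2 * (1 - 1 / z\<^sup>2) * basis_fun 1 (joukowski z))"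
      proof eventually_elim
        case (elim z)
        define c where "c = z - 1 / z"
        have z: "z \<noteq> 0" "c \<noteq> 0" using elim regular_conj_diff[OF elim] by (auto simp: regular_pt_def c_def)
        have "?f z = joukowski z / (z * c)" unfolding 2 c_def[symmetric] using z by (simp add: power2_eq_square power3_eq_cube numeral_eq_Suc)
        moreover have "2 * (1/2 * (1 - 1 / z\<^sup>2) * basis_fun 1 (joukowski z)) = joukowski z / (z * c)"
          unfolding joukowski_DERIV'[OF z(1)] basis_fun_def joukowski_sq[OF z(1)] c_def[symmetric] using z by (simp add: power2_eq_square)
        ultimately show ?case by simp
      qed
    qed
    also have "\<dots> = 2 * res_sum (\<lambda>z. 1/2 * (1 - 1 / z\<^sup>2) * basis_fun 1 (joukowski z))"
    proof (rule res_sum_cmult, intro punct_holo_mult basis_fun_punct_holo)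
      show "punct_holo (\<lambda>z. 1/2)" by simp
      show "punct_holo (\<lambda>z. 1 - 1 / z\<^sup>2)" by (intro punct_holo_analytic analytic_intros) auto
    qed
    finally show ?thesis using 2 res_sum_basis_fun[of 1] by simp
  next
    case (3 n)
    have "res_sum ?f = 0"
    proof (rule res_sum_deriv[of 1 "\<lambda>z. - (1 / (2 * of_nat n + 2)) * inverse ((z - 1 / z) ^ Suc (2 * n + 1))"])
      fix r z :: complex assume "r \<in> {1, -1}" "z \<in> ball r 1 - {r}"
      from regular_ball[OF this] have reg: "regular_pt z" .
      define c where "c = z - 1 / z"
      have z: "z \<noteq> 0" "c \<noteq> 0" using reg regular_conj_diff[OF reg] by (auto simp: regular_pt_def c_def)
      have nz: "2 * of_nat n + 2 \<noteq> (0 :: complex)"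
      proof -
        have "of_nat (2 * n + 2) \<noteq> (0 :: complex)" unfolding of_nat_eq_0_iff by simp
        then show ?thesis by (simp add: add.commute)
      qed
      have d: "((\<lambda>z. - (1 / (2 * of_nat n + 2)) * inverse ((z - 1 / z) ^ Suc (2 * n + 1)))
         has_field_derivative - (1 / (2 * of_nat n + 2)) *
           - (inverse (c ^ Suc (2 * n + 1)) * (of_nat (Suc (2 * n + 1)) * c ^ (2 * n + 1) * (joukowski z / z)) * inverse (c ^ Suc (2 * n + 1)))) (at z)"
        unfolding c_def
        by (intro DERIV_cmult DERIV_inverse' conj_diff_power_DERIV z) (use z in \<open>simp add: c_def\<close>)
      have "- (1 / (2 * of_nat n + 2)) *
           - (inverse (c ^ Suc (2 * n + 1)) * (of_nat (Suc (2 * n + 1)) * c ^ (2 * n + 1) * (joukowski z / z)) * inverse (c ^ Suc (2 * n + 1)))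
          = (1 / (2 * of_nat n + 2)) * of_nat (Suc (2 * n + 1)) * (c ^ (2 * n + 1) * joukowski z / (z * (c ^ Suc (2 * n + 1) * c ^ Suc (2 * n + 1))))"
        by (simp only: divide_inverse inverse_mult_distrib mult_ac mult_minus_left mult_minus_right minus_minus)
      also have "(1 / (2 * of_nat n + 2)) * of_nat (Suc (2 * n + 1)) = (1 :: complex)"
        using nz by (simp add: add.commute)
      also have "c ^ (2 * n + 1) * joukowski z / (z * (c ^ Suc (2 * n + 1) * c ^ Suc (2 * n + 1))) = ?f z"
      proof -
        have "c ^ Suc (2 * n + 1) * c ^ Suc (2 * n + 1) * c\<^sup>2 = c ^ (2 * n + 1) * c ^ (2 * k + 1)"
          unfolding power_add[symmetric] 3 by (simp add: numeral_eq_Suc)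
        then have "c ^ (2 * n + 1) * (z * c ^ (2 * k + 1)) = c\<^sup>2 * (z * (c ^ Suc (2 * n + 1) * c ^ Suc (2 * n + 1)))"
          by (simp only: mult_ac)
        then have "c ^ (2 * n + 1) * joukowski z * (z * c ^ (2 * k + 1)) = c\<^sup>2 * joukowski z * (z * (c ^ Suc (2 * n + 1) * c ^ Suc (2 * n + 1)))"
          by (simp only: mult_ac)
        then show ?thesis unfolding c_def[symmetric] using z by (subst frac_eq_eq) auto
      qed
      finally show "((\<lambda>z. - (1 / (2 * of_nat n + 2)) * inverse ((z - 1 / z) ^ Suc (2 * n + 1))) has_field_derivative ?f z) (at z)"
        using d by simp
    qed simp
    then show ?thesis using 3 by simp
  qed
qed

text \<open>
  The derivative of \<open>\<Phi> x \<sigma>\<^bsup>-2k-1\<^esup>\<close> has no residues.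
  Expanding it with \<open>\<Phi> = (\<lambda>/2) \<sigma>\<^sup>2 / z\<close>, \<open>x =
  \<sigma> / z\<close>, \<open>\<sigma> = x / z\<close> and \<open>x\<^sup>2 = \<sigma>\<^sup>2
  + 4\<close> gives the recursion; the inhomogeneous term is the logarithmic residue for k = 1.
\<close>

lemma prim_residue_rec: "4 * (2 * of_nat k + 1) * prim_residue (Suc k) = (if k = 1 then s\<^sup>2 else 0) - 2 * of_nat k * prim_residue k"
proof -
  obtain e where e: "e > 0" "e \<le> 1" "\<forall>r\<in>{1,-1}. \<forall>z\<in>ball r e. (\<phi> has_field_derivative weber_ydx s z) (at z)"
    using prim_ball by blast
  let ?A = "\<lambda>z. (z - 1 / z)\<^sup>2 * joukowski z / (z * (z - 1 / z) ^ (2 * k + 1))"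
  let ?B = "\<lambda>n z. \<phi> z * (1 / (z * (z - 1 / z) ^ (2 * n)))"
  let ?D = "\<lambda>z. s\<^sup>2 / 2 * ?A z + (- (2 * of_nat k) * ?B k z + - (4 * (2 * of_nat k + 1)) * ?B (Suc k) z)"
  have D0: "res_sum ?D = 0"
  proof (rule res_sum_deriv[OF e(1), of "\<lambda>z. \<phi> z * (joukowski z * inverse ((z - 1 / z) ^ Suc (2 * k)))"])
    fix r z :: complex assume r: "r \<in> {1, -1}" "z \<in> ball r e - {r}"
    then have "z \<in> ball r 1 - {r}" using e(2) by auto
    from regular_ball[OF r(1) this] have reg: "regular_pt z" .
    define c where "c = z - 1 / z"
    define p where "p = c ^ (2 * k)"
    have z: "z \<noteq> 0" "c \<noteq> 0" "p \<noteq> 0" using reg regular_conj_diff[OF reg] by (auto simp: regular_pt_def c_def p_def)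
    have jx2: "joukowski z * joukowski z = c\<^sup>2 + 4" using joukowski_sq[OF z(1)] by (simp add: c_def power2_eq_square algebra_simps)
    have d\<phi>: "(\<phi> has_field_derivative s\<^sup>2 / 2 * (c\<^sup>2 / z)) (at z)"
    proof -
      have "(\<phi> has_field_derivative weber_ydx s z) (at z)" using e(3) r by blast
      then show ?thesis unfolding weber_ydx_eq[OF z(1)] c_def .
    qed
    have dj: "(joukowski has_field_derivative c / z) (at z)"
      using joukowski_DERIV[OF z(1)] unfolding joukowski_DERIV'[OF z(1)] c_def .
    have di: "((\<lambda>z. inverse ((z - 1 / z) ^ Suc (2 * k))) has_field_derivative
        - (inverse (c ^ Suc (2 * k)) * (of_nat (Suc (2 * k)) * c ^ (2 * k) * (joukowski z / z)) * inverse (c ^ Suc (2 * k)))) (at z)"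
      unfolding c_def by (intro DERIV_inverse' conj_diff_power_DERIV z) (use z in \<open>simp add: c_def\<close>)
    from DERIV_mult'[OF d\<phi> DERIV_mult'[OF dj di]]
    have "((\<lambda>z. \<phi> z * (joukowski z * inverse ((z - 1 / z) ^ Suc (2 * k)))) has_field_derivative
       \<phi> z * (joukowski z * - (inverse (c * p) * (of_nat (Suc (2 * k)) * p * (joukowski z / z)) * inverse (c * p)) + c / z * inverse (c * p))
       + s\<^sup>2 / 2 * (c\<^sup>2 / z) * (joukowski z * inverse (c * p))) (at z)"
      by (simp only: p_def power_Suc flip: c_def)
    moreover have "joukowski z * - (inverse (c * p) * (of_nat (Suc (2 * k)) * p * (joukowski z / z)) * inverse (c * p)) + c / z * inverse (c * p)
       = - (2 * of_nat k) * (1 / (z * p)) + - (4 * (2 * of_nat k + 1)) * (1 / (z * (c\<^sup>2 * p)))"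
    proof -
      have "joukowski z * - (inverse (c * p) * (of_nat (Suc (2 * k)) * p * (joukowski z / z)) * inverse (c * p))
          = - of_nat (Suc (2 * k)) * (joukowski z * joukowski z) / (z * (c\<^sup>2 * p))"
        using z by (simp add: field_simps power2_eq_square)
      also have "\<dots> = - (2 * of_nat k + 1) * (1 / (z * p)) - 4 * (2 * of_nat k + 1) / (z * (c\<^sup>2 * p))"
        unfolding jx2 using z by (simp add: field_simps)
      finally show ?thesis using z by (simp add: field_simps)
    qed
    moreover have "s\<^sup>2 / 2 * (c\<^sup>2 / z) * (joukowski z * inverse (c * p)) = s\<^sup>2 / 2 * ?A z"
    proof -
      have "c ^ (2 * k + 1) = c * p" by (simp add: p_def)
      then show ?thesis unfolding c_def[symmetric] by (simp only: divide_inverse inverse_mult_distrib mult_ac)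
    qed
    moreover have "?B k z = \<phi> z * (1 / (z * p))" "?B (Suc k) z = \<phi> z * (1 / (z * (c\<^sup>2 * p)))"
      unfolding c_def[symmetric] by (simp_all add: p_def power2_eq_square mult.assoc)
    moreover have "\<phi> z * (- u * x + - v * y) + w = w + (- u * (\<phi> z * x) + - v * (\<phi> z * y))" for u v w x y
      by (simp add: algebra_simps)
    ultimately show "((\<lambda>z. \<phi> z * (joukowski z * inverse ((z - 1 / z) ^ Suc (2 * k)))) has_field_derivative ?D z) (at z)"
      by (simp only:)
  qed
  have D1: "res_sum ?D = s\<^sup>2 / 2 * res_sum ?A + (- (2 * of_nat k) * prim_residue k + - (4 * (2 * of_nat k + 1)) * prim_residue (Suc k))"
  proof -
    have pA: "punct_holo ?A"
    proof -
      have "punct_holo (\<lambda>z. ((z - 1 / z)\<^sup>2 * joukowski z) * (1 / (z * (z - 1 / z) ^ (2 * k + 1))))"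
        unfolding joukowski_def by (intro punct_holo_mult punct_holo_odd_power punct_holo_analytic analytic_intros) auto
      then show ?thesis by simp
    qed
    have pc: "punct_holo (\<lambda>z. c * f z)" if "punct_holo f" for c f
      by (intro punct_holo_mult punct_holo_const that)
    show ?thesis unfolding prim_residue_def
      by (subst res_sum_add, intro pc pA, intro punct_holo_add pc prim_punct)
        (simp only: res_sum_add pc prim_punct res_sum_cmult pA)
  qed
  have ring: "4 * (2 * of_nat k + 1) * J' = E - 2 * of_nat k * J"
    if "E + (- (2 * of_nat k) * J + - (4 * (2 * of_nat k + 1)) * J') = 0" for E J J' :: complex
    using that by algebra
  have E: "s\<^sup>2 / 2 * (if k = 1 then 2 else 0) = (if k = 1 then s\<^sup>2 else 0)" by simp
  show ?thesis by (rule ring) (use D0 in \<open>unfold D1 res_joukowski_power E\<close>)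
qed

lemma prim_residue_1: "prim_residue 1 = 0"
  using prim_residue_rec[of 0] by simp

lemma pderiv_slot_poly: "poly (pderiv (slot_poly (Suc k))) 0 = (-1) ^ k * fact k / (\<Prod>i<Suc k. 4 * of_nat i + 2)"
  using pderiv_falling_poly_mult_0[of k 1] by (simp add: slot_poly_def pderiv_smult)

text \<open>
  Both sides satisfy the same two-term recursion. This is the link between the free energies and
  the moments.
\<close>

lemma prim_residue_slot_poly: "prim_residue (Suc (Suc n)) = - s\<^sup>2 * poly (pderiv (slot_poly (Suc (Suc n)))) 0"
proof (induction n)
  case 0
  have "12 * prim_residue 2 = s\<^sup>2" using prim_residue_rec[of 1] prim_residue_1 by (simp add: numeral_2_eq_2)
  then show ?case unfolding pderiv_slot_poly by (simp add: numeral_2_eq_2 field_simps)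
next
  case (Suc n)
  define m where "m = Suc (Suc n)"
  have nz: "4 * (2 * of_nat m + 1) \<noteq> (0 :: complex)" using odd_nonzero(2)[of m]
    by (simp only: mult_eq_0_iff de_Morgan_disj) simp
  have "4 * (2 * of_nat m + 1) * prim_residue (Suc m) = - 2 * of_nat m * prim_residue m"
  proof -
    have "(if m = 1 then s\<^sup>2 else 0) = 0" by (simp add: m_def)
    from prim_residue_rec[of m, unfolded this] show ?thesis by simp
  qed
  also have "\<dots> = 4 * (2 * of_nat m + 1) * (- s\<^sup>2 * poly (pderiv (slot_poly (Suc m))) 0)"
  proof -
    have ring: "- 2 * M * (- S * (x / p)) = 4 * c * (- S * (- x * M / (p * (2 * c))))" if "c \<noteq> 0"
      for c p x M S :: complex using that by (cases "p = 0") (simp_all add: field_simps)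
    have P: "(\<Prod>i<Suc m. 4 * of_nat i + 2) = (\<Prod>i<m. 4 * of_nat i + 2 :: complex) * (2 * (2 * of_nat m + 1))"
      by (simp add: algebra_simps)
    have m': "poly (pderiv (slot_poly m)) 0 = (-1) ^ Suc n * fact (Suc n) / (\<Prod>i<m. 4 * of_nat i + 2)"
      using pderiv_slot_poly[of "Suc n"] by (simp only: m_def)
    have f: "(-1) ^ m * fact m = - ((-1) ^ Suc n * fact (Suc n)) * (of_nat m :: complex)"
      by (simp add: m_def algebra_simps)
    have J: "prim_residue m = - s\<^sup>2 * poly (pderiv (slot_poly m)) 0" using Suc by (simp only: m_def)
    show ?thesis unfolding J m' pderiv_slot_poly P f by (rule ring[OF odd_nonzero(2)])
  qed
  finally show ?case using nz unfolding m_def by (simp only: mult_left_cancel simp_thms)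
qed

text \<open>
  Here \<open>x \<sigma>\<^bsup>-2b-2\<^esup> dz / z\<close> is exact. Integrating by parts
  leaves an odd power of \<open>\<sigma>\<close>.
\<close>

lemma res_odd: "res_sum (\<lambda>z. \<phi> z * (basis_fun (2 * b + 1) (joukowski z) / z)) = 0"
proof -
  obtain e where e: "e > 0" "e \<le> 1" "\<forall>r\<in>{1,-1}. \<forall>z\<in>ball r e. (\<phi> has_field_derivative weber_ydx s z) (at z)"
    using prim_ball by blast
  let ?n = "of_nat (Suc (2 * b)) :: complex"
  let ?A = "\<lambda>z. (z - 1 / z)\<^sup>2 / (z * (z - 1 / z) ^ Suc (2 * b))"
  let ?D = "\<lambda>z. s\<^sup>2 / 2 * ?A z + - ?n * (\<phi> z * (basis_fun (2 * b + 1) (joukowski z) / z))"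
  have D0: "res_sum ?D = 0"
  proof (rule res_sum_deriv[OF e(1), of "\<lambda>z. \<phi> z * inverse ((z - 1 / z) ^ Suc (2 * b))"])
    fix r z :: complex assume r: "r \<in> {1, -1}" "z \<in> ball r e - {r}"
    then have "z \<in> ball r 1 - {r}" using e(2) by auto
    from regular_ball[OF r(1) this] have reg: "regular_pt z" .
    define c where "c = z - 1 / z"
    define p where "p = c ^ (2 * b)"
    have z: "z \<noteq> 0" "c \<noteq> 0" "p \<noteq> 0" using reg regular_conj_diff[OF reg] by (auto simp: regular_pt_def c_def p_def)
    have d\<phi>: "(\<phi> has_field_derivative s\<^sup>2 / 2 * (c\<^sup>2 / z)) (at z)"
    proof -
      have "(\<phi> has_field_derivative weber_ydx s z) (at z)" using e(3) r by blast
      then show ?thesis unfolding weber_ydx_eq[OF z(1)] c_def .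
    qed
    have di: "((\<lambda>z. inverse ((z - 1 / z) ^ Suc (2 * b))) has_field_derivative
        - (inverse (c ^ Suc (2 * b)) * (of_nat (Suc (2 * b)) * c ^ (2 * b) * (joukowski z / z)) * inverse (c ^ Suc (2 * b)))) (at z)"
      unfolding c_def by (intro DERIV_inverse' conj_diff_power_DERIV z) (use z in \<open>simp add: c_def\<close>)
    have w: "basis_fun (2 * b + 1) (joukowski z) = joukowski z / (c\<^sup>2 * p)"
    proof -
      have "basis_fun (2 * b + 1) (joukowski z) = joukowski z / (c\<^sup>2) ^ (b + 1)" unfolding basis_fun_def joukowski_sq[OF z(1)] c_def by simp
      then show ?thesis by (simp add: p_def power_mult)
    qed
    from DERIV_mult'[OF d\<phi> di]
    have "((\<lambda>z. \<phi> z * inverse ((z - 1 / z) ^ Suc (2 * b))) has_field_derivative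
       \<phi> z * - (inverse (c * p) * (?n * p * (joukowski z / z)) * inverse (c * p)) + s\<^sup>2 / 2 * (c\<^sup>2 / z) * inverse (c * p)) (at z)"
      by (simp only: p_def power_Suc flip: c_def)
    moreover have "\<phi> z * - (inverse (c * p) * (?n * p * (joukowski z / z)) * inverse (c * p)) = - ?n * (\<phi> z * (basis_fun (2 * b + 1) (joukowski z) / z))"
      unfolding w using z by (simp add: field_simps power2_eq_square del: of_nat_Suc)
    moreover have "s\<^sup>2 / 2 * (c\<^sup>2 / z) * inverse (c * p) = s\<^sup>2 / 2 * ?A z"
    proof -
      have "c ^ Suc (2 * b) = c * p" by (simp add: p_def)
      then show ?thesis unfolding c_def[symmetric] by (simp only: divide_inverse inverse_mult_distrib mult_ac)
    qed
    ultimately show "((\<lambda>z. \<phi> z * inverse ((z - 1 / z) ^ Suc (2 * b))) has_field_derivative ?D z) (at z)"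
      by (simp only: add.commute)
  qed
  have pA: "punct_holo ?A"
  proof -
    have "punct_holo (\<lambda>z. (z - 1 / z)\<^sup>2 * (1 / (z * (z - 1 / z) ^ Suc (2 * b))))"
      by (intro punct_holo_mult punct_holo_odd_power punct_holo_analytic analytic_intros) auto
    then show ?thesis by simp
  qed
  have pw: "punct_holo (\<lambda>z. \<phi> z * (basis_fun (2 * b + 1) (joukowski z) / z))"
  proof -
    have "punct_holo (\<lambda>z. \<phi> z * (basis_fun (2 * b + 1) (joukowski z) * (1 / (z * (z - 1 / z) ^ 0))))"
      by (intro punct_holo_mult basis_fun_punct_holo punct_holo_odd_power punct_holo_analytic prim_analytic)
    then show ?thesis by simp
  qed
  have A0: "res_sum ?A = 0"
  proof (cases b)
    case 0
    have "res_sum ?A = res_sum (\<lambda>z. (z - 1 / z) / z)"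
    proof (rule res_sum_cong)
      fix r :: complex assume "r \<in> {1, -1}"
      from eventually_regular[OF this] show "\<forall>\<^sub>F z in at r. ?A z = (z - 1 / z) / z"
        by eventually_elim (use 0 in \<open>auto simp: power2_eq_square dest!: regular_conj_diff\<close>)
    qed
    also have "\<dots> = 0" by (intro res_sum_analytic analytic_intros) auto
    finally show ?thesis .
  next
    case (Suc m)
    have "res_sum ?A = res_sum (\<lambda>z. 1 / (z * (z - 1 / z) ^ (2 * m + 1)))"
    proof (rule res_sum_cong)
      fix r :: complex assume "r \<in> {1, -1}"
      from eventually_regular[OF this] show "\<forall>\<^sub>F z in at r. ?A z = 1 / (z * (z - 1 / z) ^ (2 * m + 1))"
      proof eventually_elim
        case (elim z)
        define c where "c = z - 1 / z"
        have z: "z \<noteq> 0" "c \<noteq> 0" using elim regular_conj_diff[OF elim] by (auto simp: regular_pt_def c_def)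
        have "c ^ Suc (2 * b) = c\<^sup>2 * c ^ (2 * m + 1)" unfolding Suc by (simp add: power2_eq_square)
        then show ?case unfolding c_def[symmetric] using z by simp
      qed
    qed
    then show ?thesis by (simp only: res_sum_odd_power)
  qed
  have D1: "res_sum ?D = s\<^sup>2 / 2 * res_sum ?A + - ?n * res_sum (\<lambda>z. \<phi> z * (basis_fun (2 * b + 1) (joukowski z) / z))"
    by (subst res_sum_add, intro punct_holo_mult punct_holo_const pA, intro punct_holo_mult[OF punct_holo_const pw])
      (simp only: res_sum_cmult pA pw)
  have "?n * res_sum (\<lambda>z. \<phi> z * (basis_fun (2 * b + 1) (joukowski z) / z)) = 0"
    using D0 unfolding D1 A0
    by (simp only: mult_zero_right add_0 mult_minus_left neg_equal_0_iff_equal)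
  moreover have "?n \<noteq> 0" unfolding of_nat_eq_0_iff by simp
  ultimately show ?thesis by (simp only: mult_eq_0_iff simp_thms)
qed

lemma res_even: "res_sum (\<lambda>z. \<phi> z * (basis_fun (2 * b) (joukowski z) / z)) = prim_residue (Suc b)"
  unfolding prim_residue_def
proof (rule res_sum_cong)
  fix r :: complex assume "r \<in> {1, -1}"
  from eventually_regular[OF this]
  show "\<forall>\<^sub>F z in at r. \<phi> z * (basis_fun (2 * b) (joukowski z) / z) = \<phi> z * (1 / (z * (z - 1 / z) ^ (2 * Suc b)))"
  proof eventually_elim
    case (elim z)
    then have z: "z \<noteq> 0" by (simp add: regular_pt_def)
    have "basis_fun (2 * b) (joukowski z) = 1 / ((z - 1 / z)\<^sup>2) ^ (b + 1)" unfolding basis_fun_even joukowski_sq[OF z] ..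
    also have "\<dots> = 1 / (z - 1 / z) ^ (2 * Suc b)" by (simp only: power_mult Suc_eq_plus1)
    finally show ?case by simp
  qed
qed

text \<open>
  The one-point function is a combination of basis functions, and the residue of each of them is
  the derivative of its contribution to the moment polynomial.
\<close>

theorem res_primitive_W:
  assumes s: "s \<noteq> 0" and g: "g \<ge> 2"
  shows "(\<Sum>r\<in>weber_ramification. residue (\<lambda>z. \<phi> z * weber_W s g [z]) r)
    = fact (2 * g - 2) * csch_square_series $ (2 * g) / 4 ^ g / (s\<^sup>2) ^ (2 * g - 2)"
proof -
  \<comment> \<open>even, so that the indices pair up as 2b and 2b + 1, and beyond the support of the array\<close>
  define K where "K = 2 * (4 * g + 3)"
  define L where "L = (s\<^sup>2) ^ (2 * g - 1)"
  have L: "L \<noteq> 0" using s by (simp add: L_def)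
  let ?f = "\<lambda>k z. \<phi> z * (basis_fun k (joukowski z) / z)"
  have pf: "punct_holo (\<lambda>z. c * ?f k z)" for c k
  proof -
    have "punct_holo (\<lambda>z. c * (\<phi> z * (basis_fun k (joukowski z) * (1 / (z * (z - 1 / z) ^ 0)))))"
      by (intro punct_holo_mult punct_holo_const basis_fun_punct_holo punct_holo_odd_power punct_holo_analytic prim_analytic)
    then show ?thesis by simp
  qed
  have "(\<Sum>r\<in>weber_ramification. residue (\<lambda>z. \<phi> z * weber_W s g [z]) r) = res_sum (\<lambda>z. \<phi> z * weber_W s g [z])"
    unfolding res_sum_def weber_ramification_def ..
  also have "\<dots> = res_sum (\<lambda>z. \<Sum>k<K. (tr_coeff g [k] / L) * ?f k z)"
  proof (rule res_sum_cong)
    fix r :: complex assume "r \<in> {1, -1}"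
    from eventually_regular[OF this]
    show "\<forall>\<^sub>F z in at r. \<phi> z * weber_W s g [z] = (\<Sum>k<K. (tr_coeff g [k] / L) * ?f k z)"
    proof eventually_elim
      case (elim z)
      then have z: "z \<noteq> 0" by (simp add: regular_pt_def)
      have "weber_W s g [z] * prod_list [z] * (s\<^sup>2) ^ (2 * g + length [z] - 2) = contract point_slot K (tr_coeff g) [z]"
        by (rule weber_W_eq_contract[OF s]) (use elim g in \<open>auto simp: K_def\<close>)
      moreover have "2 * g + length [z] - 2 = 2 * g - 1" using g by simp
      ultimately have "weber_W s g [z] * z * L = (\<Sum>k<K. basis_fun k (joukowski z) * tr_coeff g [k])"
        by (simp add: L_def point_slot_def)
      then have "weber_W s g [z] = (\<Sum>k<K. basis_fun k (joukowski z) * tr_coeff g [k]) / (z * L)"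
        using z L by (simp add: field_simps)
      then show ?case by (simp add: sum_distrib_left sum_divide_distrib mult_ac)
    qed
  qed
  also have "\<dots> = (\<Sum>k<K. tr_coeff g [k] / L * res_sum (?f k))"
    using pf[of 1] by (subst res_sum_sum) (simp_all only: pf res_sum_cmult mult_1_left)
  also have "\<dots> = (\<Sum>b<4*g+3. tr_coeff g [2 * b] / L * prim_residue (Suc b))"
    unfolding K_def
  proof (subst sum_even)
    fix k :: nat assume "odd k"
    then obtain b where "k = 2 * b + 1" by (elim oddE)
    then show "tr_coeff g [k] / L * res_sum (?f k) = 0" by (simp only: res_odd mult_zero_right)
  qed (simp only: res_even)
  also have "\<dots> = (\<Sum>b<4*g+1. tr_coeff g [2 * b] / L * (- s\<^sup>2 * poly (pderiv (slot_poly (Suc b))) 0))"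
  proof -
    have "tr_coeff g [2 * b] / L * prim_residue (Suc b) = tr_coeff g [2 * b] / L * (- s\<^sup>2 * poly (pderiv (slot_poly (Suc b))) 0)" for b
    proof (cases b)
      case 0
      have "tr_coeff g [0] = 0" using tr_coeff_root_ge_2[of g 0] by fastforce
      then show ?thesis unfolding 0 by simp
    next
      case (Suc n)
      then show ?thesis by (simp only: prim_residue_slot_poly)
    qed
    then have "(\<Sum>b<4*g+3. tr_coeff g [2 * b] / L * prim_residue (Suc b))
        = (\<Sum>b<4*g+3. tr_coeff g [2 * b] / L * (- s\<^sup>2 * poly (pderiv (slot_poly (Suc b))) 0))" by simp
    also have "\<dots> = (\<Sum>b<4*g+1. tr_coeff g [2 * b] / L * (- s\<^sup>2 * poly (pderiv (slot_poly (Suc b))) 0))"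
    proof (rule sum.mono_neutral_right)
      have "tr_coeff g [2 * b] = 0" if "\<not> b < 4 * g + 1" for b using tr_coeff_support[of g "[2 * b]"] that by auto
      then show "\<forall>b\<in>{..<4*g+3} - {..<4*g+1}. tr_coeff g [2 * b] / L * (- s\<^sup>2 * poly (pderiv (slot_poly (Suc b))) 0) = 0" by auto
    qed auto
    finally show ?thesis .
  qed
  also have "\<dots> = s\<^sup>2 / L * poly (pderiv (moment_poly g)) 0"
    unfolding moment_poly_def
    by (simp add: pderiv_minus pderiv_sum' pderiv_smult poly_sum sum_distrib_left sum_negf mult_ac del: sum.lessThan_Suc)
  also have "s\<^sup>2 / L = 1 / (s\<^sup>2) ^ (2 * g - 2)"
  proof -
    have "2 * g - 1 = Suc (2 * g - 2)" using g by simp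
    then show ?thesis using s by (simp add: L_def)
  qed
  finally show ?thesis using moment_poly_deriv_0[of g] g by simp
qed

end

section \<open>Formal second differences\<close>

unbundle fps_syntax

text \<open>
  The metric on Laurent series measures the order of vanishing of the difference. If the order
  of the n-th term grows with n, the partial sums become constant in each degree.
\<close>

lemma fls_suminf_nth:
  fixes f :: "nat \<Rightarrow> complex fls"
  assumes f: "\<And>n k. k < c + int n \<Longrightarrow> f n $$ k = 0"
  shows "(\<Sum>n. f n) $$ k = (\<Sum>n\<le>nat (k - c). f n $$ k)"
proof -
  define S where "S = Abs_fls (\<lambda>k. \<Sum>n\<le>nat (k - c). f n $$ k)"
  have S: "S $$ k = (\<Sum>n\<le>nat (k - c). f n $$ k)" for k
    unfolding S_def
    by (rule nth_Abs_fls_ex_lower_bound, rule exI[of _ c], intro allI impI sum.neutral ballI f) simp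
  have part: "(\<Sum>i<n. f i) $$ k = S $$ k" if "k < c + int n" for n k
  proof (cases "k < c")
    case True
    have "f i $$ k = 0" for i using True by (intro f) simp
    then show ?thesis unfolding S fls_nth_sum by simp
  next
    case False
    have "(\<Sum>i\<le>nat (k - c). f i $$ k) = (\<Sum>i<n. f i $$ k)"
      by (rule sum.mono_neutral_left) (use that False in \<open>auto intro!: f\<close>)
    then show ?thesis unfolding S fls_nth_sum by simp
  qed
  have "f sums S"
    unfolding sums_def
  proof (rule metric_LIMSEQ_I)
    fix r :: real assume "0 < r"
    then obtain N where N: "(1 / 2) ^ N < r" using real_arch_pow_inv[of r "1 / 2"] by auto
    show "\<exists>no. \<forall>n\<ge>no. dist (\<Sum>i<n. f i) S < r"
    proof (intro exI[of _ "N + nat (- c)"] allI impI)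
      fix n assume n: "n \<ge> N + nat (- c)"
      show "dist (\<Sum>i<n. f i) S < r"
      proof (cases "(\<Sum>i<n. f i) = S")
        case False
        have "c + int n \<le> fls_subdegree ((\<Sum>i<n. f i) - S)"
          by (rule fls_subdegree_geI) (use False part in auto)
        then have sub: "int N \<le> fls_subdegree ((\<Sum>i<n. f i) - S)" using n by linarith
        then have "dist (\<Sum>i<n. f i) S = inverse (2 ^ nat (fls_subdegree ((\<Sum>i<n. f i) - S)))"
          using False by (simp add: dist_fls_def)
        also have "\<dots> \<le> inverse (2 ^ N)"
          by (intro le_imp_inverse_le power_increasing) (use sub in auto)
        finally show ?thesis using N by (simp add: power_divide inverse_eq_divide)
      qed (use \<open>0 < r\<close> in simp)
    qed
  qed
  then show ?thesis using S[of k] by (simp add: sums_iff)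
qed

lemma higher_deriv_zero: "(deriv ^^ n) (\<lambda>\<nu>. 0) = (\<lambda>\<nu>. 0 :: complex)"
  by (induction n) simp_all

text \<open>
  A common lower bound for the degrees guarantees that the coefficientwise derivative is again a
  Laurent series.
\<close>

lemma fls_param_deriv_iterate:
  assumes "\<And>\<nu> k. k < c \<Longrightarrow> F \<nu> $$ k = 0"
  shows "(fls_param_deriv ^^ n) F \<mu> $$ k = (deriv ^^ n) (\<lambda>\<nu>. F \<nu> $$ k) \<mu>"
proof (induction n arbitrary: \<mu> k)
  case (Suc n)
  have "(fls_param_deriv ^^ Suc n) F \<mu> = Abs_fls (\<lambda>k. (deriv ^^ Suc n) (\<lambda>\<nu>. F \<nu> $$ k) \<mu>)"
    by (simp add: fls_param_deriv_def Suc)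
  also have "\<dots> $$ k = (deriv ^^ Suc n) (\<lambda>\<nu>. F \<nu> $$ k) \<mu>"
  proof (rule nth_Abs_fls_ex_lower_bound, rule exI[of _ c], intro allI impI)
    fix j assume "j < c"
    then have "(\<lambda>\<nu>. F \<nu> $$ j) = (\<lambda>\<nu>. 0)" using assms by blast
    then show "(deriv ^^ Suc n) (\<lambda>\<nu>. F \<nu> $$ j) \<mu> = 0" by (simp only: higher_deriv_zero)
  qed
  finally show ?case .
qed simp

lemma fls_param_shift_nth:
  assumes F: "\<And>\<nu> k. k < c \<Longrightarrow> F \<nu> $$ k = 0"
  shows "fls_param_shift e F \<mu> $$ k
    = (\<Sum>n\<le>nat (k - c). e ^ n / fact n * (deriv ^^ n) (\<lambda>\<nu>. F \<nu> $$ (k - int n)) \<mu>)"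
proof -
  have t: "((fls_const e * fls_X) ^ n * fls_const (1 / fact n) * (fls_param_deriv ^^ n) F \<mu>) $$ k
      = e ^ n / fact n * (deriv ^^ n) (\<lambda>\<nu>. F \<nu> $$ (k - int n)) \<mu>" for n k
  proof -
    have "(fls_const e * fls_X) ^ n * fls_const (1 / fact n) * (fls_param_deriv ^^ n) F \<mu>
       = fls_X ^ n * (fls_const (e ^ n / fact n) * (fls_param_deriv ^^ n) F \<mu>)"
    proof -
      have c: "fls_const (e ^ n / fact n) = fls_const (e ^ n) * fls_const (1 / fact n)" by simp
      show ?thesis unfolding c power_mult_distrib fls_const_power[symmetric] by (simp only: mult_ac)
    qed
    then show ?thesis
      by (simp add: fls_X_power_times_conv_shift(1) fls_param_deriv_iterate[OF F])
  qed
  have z: "((fls_const e * fls_X) ^ n * fls_const (1 / fact n) * (fls_param_deriv ^^ n) F \<mu>) $$ k = 0"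
    if "k < c + int n" for n k
    unfolding t by (subst F) (use that in \<open>auto simp: higher_deriv_zero\<close>)
  have "fls_param_shift e F \<mu> $$ k = (\<Sum>n\<le>nat (k - c).
      ((fls_const e * fls_X) ^ n * fls_const (1 / fact n) * (fls_param_deriv ^^ n) F \<mu>) $$ k)"
    unfolding fls_param_shift_def by (rule fls_suminf_nth) (rule z)
  then show ?thesis unfolding t .
qed

lemma weber_free_energy_nth:
  "weber_free_energy s l \<Phi> \<mu> $$ k
     = (if k \<ge> -2 \<and> even k then weber_F s l \<Phi> (nat ((k + 2) div 2)) \<mu> else 0)"
proof -
  have t: "(fls_X_intpow (2 * int g - 2) * fls_const (weber_F s l \<Phi> g \<mu>)) $$ k
    = (if k = 2 * int g - 2 then weber_F s l \<Phi> g \<mu> else 0)" for g k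
    by (auto simp: fls_X_intpow_times_conv_shift(1))
  have "weber_free_energy s l \<Phi> \<mu> $$ k = (\<Sum>g\<le>nat (k - (-2)). if k = 2 * int g - 2 then weber_F s l \<Phi> g \<mu> else 0)"
    unfolding weber_free_energy_def t[symmetric]
    by (rule fls_suminf_nth) (unfold t, auto)
  also have "\<dots> = (if k \<ge> -2 \<and> even k then weber_F s l \<Phi> (nat ((k + 2) div 2)) \<mu> else 0)"
  proof (cases "k \<ge> -2 \<and> even k")
    case True
    define g where "g = nat ((k + 2) div 2)"
    have "2 * ((k + 2) div 2) = k + 2" using True by simp
    moreover from this have "(k + 2) div 2 \<ge> 0" using True by linarith
    ultimately have k: "k = 2 * int g - 2" by (simp add: g_def)
    have "(\<Sum>g'\<le>nat (k - (-2)). if k = 2 * int g' - 2 then weber_F s l \<Phi> g' \<mu> else 0)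
        = (\<Sum>g'\<le>nat (k - (-2)). if g' = g then weber_F s l \<Phi> g' \<mu> else 0)"
      by (intro sum.cong refl) (auto simp: k)
    also have "\<dots> = weber_F s l \<Phi> g \<mu>" by (subst sum.delta) (auto simp: k)
    finally show ?thesis using True by (simp add: k)
  next
    case False
    then show ?thesis by (intro trans[OF sum.neutral]) auto
  qed
  finally show ?thesis .
qed

lemma higher_deriv_cong_open:
  assumes "open U" "\<And>z. z \<in> U \<Longrightarrow> f z = g z"
  shows "z \<in> U \<Longrightarrow> (deriv ^^ n) f z = (deriv ^^ n) g (z :: complex)"
proof (induction n arbitrary: z)
  case (Suc n)
  have "eventually (\<lambda>w. (deriv ^^ n) f w = (deriv ^^ n) g w) (nhds z)"
    using Suc assms(1) by (auto simp: eventually_nhds)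
  then show ?case by (simp add: deriv_cong_ev)
qed (simp add: assms)

lemma higher_deriv_inverse_power:
  "\<mu> \<noteq> 0 \<Longrightarrow> (deriv ^^ n) (\<lambda>\<nu>. c / \<nu> ^ Suc p) \<mu> = c * (-1) ^ n * fact (p + n) / fact p / \<mu> ^ Suc (p + n)"
proof (induction n arbitrary: \<mu>)
  case (Suc n)
  define C where "C = c * (-1) ^ n * fact (p + n) / fact p"
  have "(deriv ^^ Suc n) (\<lambda>\<nu>. c / \<nu> ^ Suc p) \<mu> = deriv (\<lambda>\<nu>. C * inverse (\<nu> ^ Suc (p + n))) \<mu>"
  proof -
    have "eventually (\<lambda>\<nu>. (deriv ^^ n) (\<lambda>\<nu>. c / \<nu> ^ Suc p) \<nu> = C * inverse (\<nu> ^ Suc (p + n))) (nhds \<mu>)"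
      using t1_space_nhds[OF Suc.prems] by eventually_elim (subst Suc.IH, assumption, simp only: C_def divide_inverse)
    then show ?thesis by (simp add: deriv_cong_ev)
  qed
  also have "\<dots> = C * - (inverse (\<mu> ^ Suc (p + n)) * (of_nat (Suc (p + n)) * \<mu> ^ (p + n)) * inverse (\<mu> ^ Suc (p + n)))"
  proof (rule DERIV_imp_deriv, intro DERIV_cmult DERIV_inverse')
    show "((\<lambda>\<nu>. \<nu> ^ Suc (p + n)) has_field_derivative of_nat (Suc (p + n)) * \<mu> ^ (p + n)) (at \<mu>)"
      by (auto intro!: derivative_eq_intros simp del: of_nat_Suc power_Suc)
    show "\<mu> ^ Suc (p + n) \<noteq> 0" using Suc.prems by simp
  qed
  also have "\<dots> = c * (-1) ^ Suc n * fact (p + Suc n) / fact p / \<mu> ^ Suc (p + Suc n)"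
  proof -
    have i: "inverse (\<mu> ^ Suc (p + n)) * (N * \<mu> ^ (p + n)) * inverse (\<mu> ^ Suc (p + n)) = N / \<mu> ^ Suc (p + Suc n)" for N
      using Suc.prems by (simp add: field_simps)
    have f: "fact (p + Suc n) = of_nat (Suc (p + n)) * (fact (p + n) :: complex)" by simp
    show ?thesis unfolding i f C_def by (simp del: of_nat_Suc)
  qed
  finally show ?case .
qed simp

text \<open>
  The data of the theorem: branches and primitives over an open set of parameters.
\<close>

locale weber_branches =
  fixes U :: "complex set" and s l :: "complex \<Rightarrow> complex" and \<Phi> :: "complex \<Rightarrow> complex \<Rightarrow> complex"
  assumes U: "open U" and sb: "sqrt_branch U s" and lb: "log_branch U l"
    and prim: "\<And>\<mu>. \<mu> \<in> U \<Longrightarrow> weber_primitive (s \<mu>) (\<Phi> \<mu>)"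
begin

lemma exp_l: "\<mu> \<in> U \<Longrightarrow> exp (l \<mu>) = \<mu>"
  using lb by (simp add: log_branch_def)

lemma nonzero: "\<mu> \<in> U \<Longrightarrow> \<mu> \<noteq> 0"
  using exp_l by (metis exp_not_eq_zero)

lemma deriv_l: "\<mu> \<in> U \<Longrightarrow> (l has_field_derivative 1 / \<mu>) (at \<mu>)"
proof -
  assume \<mu>: "\<mu> \<in> U"
  have "(exp has_field_derivative \<mu>) (at (l \<mu>))" using DERIV_exp[of "l \<mu>"] exp_l[OF \<mu>] by simp
  moreover have "continuous (at \<mu>) l"
    using lb U \<mu> by (simp add: log_branch_def continuous_on_eq_continuous_at)
  ultimately have "(l has_field_derivative inverse \<mu>) (at \<mu>)"
    by (rule has_field_derivative_inverse_basic[OF _ nonzero[OF \<mu>] _ U \<mu>]) (rule exp_l)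
  then show ?thesis by (simp add: inverse_eq_divide)
qed

lemma higher_deriv_l: "\<mu> \<in> U \<Longrightarrow> (deriv ^^ Suc n) (\<lambda>\<nu>. c * l \<nu>) \<mu> = c * (-1) ^ n * fact n / \<mu> ^ Suc n"
proof -
  assume \<mu>: "\<mu> \<in> U"
  have "(deriv ^^ n) (deriv (\<lambda>\<nu>. c * l \<nu>)) \<mu> = (deriv ^^ n) (\<lambda>\<nu>. c / \<nu> ^ Suc 0) \<mu>"
  proof (rule higher_deriv_cong_open[OF U _ \<mu>])
    fix z assume "z \<in> U"
    from DERIV_imp_deriv[OF DERIV_cmult[OF deriv_l[OF this], of c]]
    show "deriv (\<lambda>\<nu>. c * l \<nu>) z = c / z ^ Suc 0" by simp
  qed
  then show ?thesis using higher_deriv_inverse_power[OF nonzero[OF \<mu>], of n c 0]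
    by (simp add: funpow_swap1)
qed

lemma deriv2_F0: "\<mu> \<in> U \<Longrightarrow> (deriv ^^ 2) (weber_F s l \<Phi> 0) \<mu> = l \<mu>"
proof -
  assume \<mu>: "\<mu> \<in> U"
  have 1: "deriv (weber_F s l \<Phi> 0) z = z * l z - z" if z: "z \<in> U" for z
  proof (rule DERIV_imp_deriv)
    have "((\<lambda>\<nu>. - (3 / 4) * \<nu>\<^sup>2 + 1 / 2 * \<nu>\<^sup>2 * l \<nu>) has_field_derivative
       - (3 / 4) * (2 * z) + (1 / 2 * z\<^sup>2 * (1 / z) + 1 / 2 * (2 * z) * l z)) (at z)"
      by (rule derivative_eq_intros deriv_l z refl | simp)+
    moreover have "- (3 / 4) * (2 * z) + (1 / 2 * z\<^sup>2 * (1 / z) + 1 / 2 * (2 * z) * l z) = z * l z - z"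
      using nonzero[OF z] by (simp add: field_simps power2_eq_square)
    moreover have "weber_F s l \<Phi> 0 = (\<lambda>\<nu>. - (3 / 4) * \<nu>\<^sup>2 + 1 / 2 * \<nu>\<^sup>2 * l \<nu>)"
      by (rule ext) (simp add: weber_F_def)
    ultimately show "(weber_F s l \<Phi> 0 has_field_derivative z * l z - z) (at z)" by (simp only:)
  qed
  have "(deriv ^^ 1) (deriv (weber_F s l \<Phi> 0)) \<mu> = (deriv ^^ 1) (\<lambda>z. z * l z - z) \<mu>"
    by (rule higher_deriv_cong_open[OF U 1 \<mu>])
  also have "\<dots> = l \<mu>"
  proof -
    have "((\<lambda>z. z * l z - z) has_field_derivative (\<mu> * (1 / \<mu>) + 1 * l \<mu>) - 1) (at \<mu>)"
      by (rule derivative_eq_intros deriv_l \<mu> refl | simp)+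
    then show ?thesis using nonzero[OF \<mu>] by (simp add: DERIV_imp_deriv)
  qed
  finally show ?thesis by (simp add: numeral_2_eq_2)
qed

lemma F_stable:
  assumes g: "g \<ge> 2" and \<mu>: "\<mu> \<in> U"
  shows "weber_F s l \<Phi> g \<mu> = - (fact (2 * g - 3) * csch_square_series $ (2 * g) / 4 ^ g) / \<mu> ^ Suc (2 * g - 3)"
proof -
  \<comment> \<open>the factor 2 - 2g turns (2g-2)! into -(2g-3)!\<close>
  interpret ydx_primitive "s \<mu>" "\<Phi> \<mu>" by unfold_locales (rule prim[OF \<mu>])
  have s2: "(s \<mu>)\<^sup>2 = \<mu>" using sb \<mu> by (simp add: sqrt_branch_def)
  then have "s \<mu> \<noteq> 0" using nonzero[OF \<mu>] by auto
  define m where "m = 2 * g - 3"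
  have m: "2 * g - 2 = Suc m" using g by (simp add: m_def)
  have "of_nat (2 * g) = (of_nat (Suc m + 2) :: complex)" using g by (simp add: m_def)
  then have c: "2 - 2 * of_nat g = - (of_nat (Suc m) :: complex)" by simp
  have "weber_F s l \<Phi> g \<mu> = 1 / (2 - 2 * of_nat g) * (fact (2 * g - 2) * csch_square_series $ (2 * g) / 4 ^ g / ((s \<mu>)\<^sup>2) ^ (2 * g - 2))"
    using g by (simp add: weber_F_def res_primitive_W[OF \<open>s \<mu> \<noteq> 0\<close> g])
  also have "\<dots> = - (fact m * csch_square_series $ (2 * g) / 4 ^ g) / \<mu> ^ Suc m"
    unfolding c m s2 fact_Suc by (simp add: field_simps del: of_nat_Suc)
  finally show ?thesis by (simp add: m_def)
qed

lemma csch_square_series_2: "csch_square_series $ 2 = - 1 / 3"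
proof -
  have "(\<Sum>j\<in>{1, 2}. csch_square_series $ (2 * (2 - j)) * 4 ^ j / fact (2 * j)) = 0"
    using csch_square_series_convolution[of 1] by (simp add: numeral_2_eq_2 atLeastAtMostSuc_conv add.commute)
  then have E: "2 + 6 * csch_square_series $ Suc (Suc 0) = 0" by (simp add: csch_square_series_0 fact_numeral field_simps)
  have "csch_square_series $ 2 = ((2 + 6 * csch_square_series $ Suc (Suc 0)) - 2) / 6" by (simp add: numeral_2_eq_2)
  then show ?thesis unfolding E by simp
qed

text \<open>
  One formula for all genera: the cases of genus 0 and 1 involve the logarithm, and their
  constants agree with the general one because the first two coefficients of \<open>(w / sinh
  w)\<^sup>2\<close> are 1 and -1/3.
\<close>

lemma deriv_F:
  assumes M: "M \<ge> 1" and j: "1 \<le> j" "j \<le> M + 1" and \<mu>: "\<mu> \<in> U"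
  shows "(deriv ^^ (2 * j)) (weber_F s l \<Phi> (M + 1 - j)) \<mu>
    = - (fact (2 * M - 1) / 4 ^ (M + 1) / \<mu> ^ (2 * M)) * (csch_square_series $ (2 * (M + 1 - j)) * 4 ^ j)"
proof -
  have e: "Suc (2 * M - 1) = 2 * M" using M by simp
  have h: "(deriv ^^ (2 * M)) (\<lambda>\<nu>. c * l \<nu>) \<mu> = - c * fact (2 * M - 1) / \<mu> ^ (2 * M)" for c
  proof -
    have "odd (2 * M - 1)" using M by simp
    then have "(-1 :: complex) ^ (2 * M - 1) = -1" by simp
    then show ?thesis using higher_deriv_l[OF \<mu>, of "2 * M - 1" c] unfolding e by simp
  qed
  consider "j = M + 1" | "j = M" | g where "g \<ge> 2" "M + 1 = g + j" 
  proof -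
    have "j = M + 1 \<or> j = M \<or> (M + 1 - j \<ge> 2 \<and> M + 1 = (M + 1 - j) + j)" using j by arith
    then show thesis using that by blast
  qed
  then show ?thesis
  proof cases
    case 1
    have "2 * j = Suc (2 * M - 1) + 2" using 1 M by simp
    then have "(deriv ^^ (2 * j)) (weber_F s l \<Phi> 0) \<mu> = (deriv ^^ Suc (2 * M - 1)) ((deriv ^^ 2) (weber_F s l \<Phi> 0)) \<mu>"
      by (simp only: funpow_add o_apply)
    also have "\<dots> = (deriv ^^ Suc (2 * M - 1)) (\<lambda>\<nu>. 1 * l \<nu>) \<mu>"
      by (rule higher_deriv_cong_open[OF U _ \<mu>]) (simp only: deriv2_F0 mult_1_left)
    also have "\<dots> = - (fact (2 * M - 1)) / \<mu> ^ (2 * M)"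
      unfolding e h by simp
    finally show ?thesis using 1 by (simp add: csch_square_series_0)
  next
    case 2
    have "(deriv ^^ (2 * j)) (weber_F s l \<Phi> 1) \<mu> = (deriv ^^ Suc (2 * M - 1)) (\<lambda>\<nu>. - (1 / 12) * l \<nu>) \<mu>"
      unfolding e 2 by (rule higher_deriv_cong_open[OF U _ \<mu>]) (simp add: weber_F_def)
    also have "\<dots> = 1 / 12 * fact (2 * M - 1) / \<mu> ^ (2 * M)"
      unfolding e h by simp
    finally show ?thesis using 2 by (simp add: csch_square_series_2[unfolded numeral_2_eq_2] csch_square_series_2)
  next
    case (3 g)
    let ?c = "- (fact (2 * g - 3) * csch_square_series $ (2 * g) / 4 ^ g)"
    have "(deriv ^^ (2 * j)) (weber_F s l \<Phi> g) \<mu> = (deriv ^^ (2 * j)) (\<lambda>\<nu>. ?c / \<nu> ^ Suc (2 * g - 3)) \<mu>"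
      by (rule higher_deriv_cong_open[OF U _ \<mu>]) (rule F_stable[OF 3(1)])
    also have "\<dots> = ?c * (-1) ^ (2 * j) * fact (2 * g - 3 + 2 * j) / fact (2 * g - 3) / \<mu> ^ Suc (2 * g - 3 + 2 * j)"
      by (rule higher_deriv_inverse_power[OF nonzero[OF \<mu>]])
    also have "2 * g - 3 + 2 * j = 2 * M - 1" using 3 by simp
    also have "?c * (-1) ^ (2 * j) * fact (2 * M - 1) / fact (2 * g - 3) / \<mu> ^ Suc (2 * M - 1)
        = - (fact (2 * M - 1) * csch_square_series $ (2 * g) / 4 ^ g / \<mu> ^ (2 * M))"
      unfolding e by simp
    also have "\<dots> = - (fact (2 * M - 1) / 4 ^ (M + 1) / \<mu> ^ (2 * M)) * (csch_square_series $ (2 * g) * 4 ^ j)"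
    proof -
      have p: "(4 :: complex) ^ (M + 1) = 4 ^ g * 4 ^ j" by (simp only: 3(2) power_add)
      show ?thesis unfolding p by simp
    qed
    finally have D: "(deriv ^^ (2 * j)) (weber_F s l \<Phi> g) \<mu>
      = - (fact (2 * M - 1) / 4 ^ (M + 1) / \<mu> ^ (2 * M)) * (csch_square_series $ (2 * g) * 4 ^ j)" .
    have gj: "M + 1 - j = g" using 3(2) by simp
    show ?thesis unfolding gj by (rule D)
  qed
qed

text \<open>
  Odd derivatives cancel between the two shifts, and the term without derivatives cancels with
  the middle one. What is left in degree 2M is the sum over \<open>1 \<le> j \<le> M + 1\<close>
  described in the introduction.
\<close>

lemma second_difference_nth:
  assumes \<mu>: "\<mu> \<in> U"
  defines "F \<equiv> weber_free_energy s l \<Phi>"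
  shows "(fls_param_shift 1 F \<mu> - 2 * F \<mu> + fls_param_shift (-1) F \<mu>) $$ k = (if k = 0 then l \<mu> else 0)"
proof -
  let ?h = "\<lambda>n. (deriv ^^ n) (\<lambda>\<nu>. F \<nu> $$ (k - int n)) \<mu>"
  have low: "F \<nu> $$ k = 0" if "k < -2" for \<nu> k using that by (simp add: F_def weber_free_energy_nth)
  have odd: "F \<nu> $$ k = 0" if "odd k" for \<nu> k using that by (simp add: F_def weber_free_energy_nth)
  define N where "N = nat (k + 2)"
  have "(2 * F \<mu>) $$ k = 2 * F \<mu> $$ k"
    by (simp only: mult_2 fls_plus_nth)
  then have "(fls_param_shift 1 F \<mu> - 2 * F \<mu> + fls_param_shift (-1) F \<mu>) $$ k
     = (\<Sum>n\<le>N. (1 ^ n / fact n + (-1) ^ n / fact n) * ?h n) - 2 * F \<mu> $$ k"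
    using fls_param_shift_nth[of "-2" F, OF low, of 1 \<mu> k] fls_param_shift_nth[of "-2" F, OF low, of "-1" \<mu> k]
    by (simp add: N_def sum.distrib distrib_right)
  also have "(\<Sum>n\<le>N. (1 ^ n / fact n + (-1) ^ n / fact n) * ?h n) = (\<Sum>n\<le>N. if even n then 2 / fact n * ?h n else 0)"
    by (intro sum.cong refl) auto
  also have "\<dots> = 2 * F \<mu> $$ k + (\<Sum>n\<in>{1..N}. if even n then 2 / fact n * ?h n else 0)"
  proof -
    have "{..N} = insert 0 {1..N}" by auto
    then show ?thesis by simp
  qed
  also have "2 * F \<mu> $$ k + (\<Sum>n\<in>{1..N}. if even n then 2 / fact n * ?h n else 0) - 2 * F \<mu> $$ k
     = (\<Sum>n\<in>{1..N}. if even n then 2 / fact n * ?h n else 0)" by simp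
  finally have E: "(fls_param_shift 1 F \<mu> - 2 * F \<mu> + fls_param_shift (-1) F \<mu>) $$ k
     = (\<Sum>n\<in>{1..N}. if even n then 2 / fact n * ?h n else 0)" .
  show ?thesis
  proof (cases "k \<ge> 0 \<and> even k")
    case False
    have "(if even n then 2 / fact n * ?h n else 0) = 0" if "n \<in> {1..N}" for n
    proof (cases "even n \<and> even k")
      case True
      then have "k < 0" using False by simp
      moreover have "1 \<le> nat (k + 2)" using that by (simp add: N_def)
      then have "k \<ge> -1" by linarith
      ultimately have "k = -1" by linarith
      then show ?thesis using True by simp
    next
      case False
      then show ?thesis by (auto simp: odd higher_deriv_zero)
    qed
    then have "(\<Sum>n\<in>{1..N}. if even n then 2 / fact n * ?h n else 0) = 0" by (intro sum.neutral ballI)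
    then show ?thesis unfolding E using False by auto
  next
    case True
    define M where "M = nat (k div 2)"
    have "2 * (k div 2) = k" "k div 2 \<ge> 0" using True by simp_all
    then have k: "k = 2 * int M" by (simp add: M_def)
    have N: "N = 2 * (M + 1)" by (simp add: N_def k)
    have h: "?h (2 * j) = (deriv ^^ (2 * j)) (weber_F s l \<Phi> (M + 1 - j)) \<mu>" if "1 \<le> j" "j \<le> M + 1" for j
    proof -
      have "k - int (2 * j) \<ge> -2" "even (k - int (2 * j))" "nat ((k - int (2 * j) + 2) div 2) = M + 1 - j"
        using that by (auto simp: k)
      then show ?thesis by (simp add: F_def weber_free_energy_nth)
    qed
    have "(\<Sum>n\<in>{1..N}. if even n then 2 / fact n * ?h n else 0) = (\<Sum>n\<in>(\<lambda>j. 2 * j) ` {1..M+1}. if even n then 2 / fact n * ?h n else 0)"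
      by (rule sum.mono_neutral_right) (auto simp: N image_iff elim!: evenE)
    also have "\<dots> = (\<Sum>j=1..M+1. 2 / fact (2 * j) * ?h (2 * j))"
      by (subst sum.reindex) (auto simp: inj_on_def)
    also have "\<dots> = (\<Sum>j=1..M+1. 2 / fact (2 * j) * (deriv ^^ (2 * j)) (weber_F s l \<Phi> (M + 1 - j)) \<mu>)"
      by (intro sum.cong refl) (simp only: h atLeastAtMost_iff)
    also have "\<dots> = (if k = 0 then l \<mu> else 0)"
    proof (cases "M = 0")
      case True
      then show ?thesis using deriv2_F0[OF \<mu>] by (simp add: k)
    next
      case False
      then have M: "M \<ge> 1" by simp
      have "(\<Sum>j=1..M+1. 2 / fact (2 * j) * (deriv ^^ (2 * j)) (weber_F s l \<Phi> (M + 1 - j)) \<mu>)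
        = (\<Sum>j=1..M+1. - (2 * fact (2 * M - 1) / 4 ^ (M + 1) / \<mu> ^ (2 * M)) * (csch_square_series $ (2 * (M + 1 - j)) * 4 ^ j / fact (2 * j)))"
      proof (intro sum.cong refl)
        fix j assume "j \<in> {1..M+1}"
        then have j: "1 \<le> j" "j \<le> M + 1" by auto
        show "2 / fact (2 * j) * (deriv ^^ (2 * j)) (weber_F s l \<Phi> (M + 1 - j)) \<mu>
          = - (2 * fact (2 * M - 1) / 4 ^ (M + 1) / \<mu> ^ (2 * M)) * (csch_square_series $ (2 * (M + 1 - j)) * 4 ^ j / fact (2 * j))"
          unfolding deriv_F[OF M j \<mu>] by (simp add: mult_ac)
      qed
      also have "\<dots> = 0" unfolding sum_distrib_left[symmetric] csch_square_series_convolution using False by simp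
      finally show ?thesis using False by (simp add: k)
    qed
    finally show ?thesis unfolding E .
  qed
qed

end

theorem theorem4p7:
  fixes lam :: complex and U :: "complex set"
    and s l :: "complex \<Rightarrow> complex" and \<Phi> :: "complex \<Rightarrow> complex \<Rightarrow> complex"
  assumes "lam \<noteq> 0"
    and "open U" and "lam \<in> U"
    and "sqrt_branch U s" and "log_branch U l"
    and "\<And>\<mu>. \<mu> \<in> U \<Longrightarrow> weber_primitive (s \<mu>) (\<Phi> \<mu>)"
  shows "fls_param_shift 1 (weber_free_energy s l \<Phi>) lam
           - 2 * weber_free_energy s l \<Phi> lam
           + fls_param_shift (-1) (weber_free_energy s l \<Phi>) lam
         = fls_const ((deriv ^^ 2) (weber_F s l \<Phi> 0) lam)
       \<and> (deriv ^^ 2) (weber_F s l \<Phi> 0) lam = l lam"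
proof -
  interpret weber_branches U s l \<Phi>
    using assms by unfold_locales auto
  show ?thesis
    unfolding deriv2_F0[OF assms(3)]
    using second_difference_nth[OF assms(3)] by (auto intro!: fls_eqI)
qed

end
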